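(* Assume the standing setting described in the context. Let $J$ be an index set with $I^+\subseteq J\subseteq I$, and assume that $C(A_j)<\infty$ for all $j\in J$. Then the $(\boldsymbol A,\boldsymbol a,g,\chi,J)$-problem is solvable, i.e. there exists $\tilde{\boldsymbol\lambda}\in\mathcal E^+(\boldsymbol A,\boldsymbol a,g,J)$ with $G_\chi(\tilde{\boldsymbol\lambda})=G_\chi(\boldsymbol A,\boldsymbol a,g,J)$, and the class $\mathfrak S_\chi(\boldsymbol A,\boldsymbol a,g,J)$ of all its solutions is compact in the vague topology (componentwise vague topology on vector measures).
   Context: Standing setting. $\mathrm X$ is a noncompact locally compact Hausdorff space; $\mathfrak M$ is the space of real Radon measures on $\mathrm X$ with the vague topology (pointwise convergence on continuous compactly supported functions); $S(\nu)$ is the support of $\nu$; $\nu$ is bounded if $|\nu|(\mathrm X)<\infty$. The kernel $\kappa:\mathrm X\times\mathrm X\to[0,\infty]$ is lower semicontinuous and symmetric; $\kappa(\nu,\nu_1)=\int\kappa(x,y)\,d(\nu\otimes\nu_1)(x,y)$ is the mutual energy and $\kappa(x,\nu)=\int\kappa(x,y)\,d\nu(y)$ the potential; $\mathcal E$ is the set of $\nu\in\mathfrak M$ for which $\kappa(\nu,\nu)$ is well defined and finite. It is assumed that: (a) $\kappa$ is strictly positive definite: $\kappa(\nu,\nu)\ge0$ whenever defined, and $\|\nu\|:=\kappa(\nu,\nu)^{1/2}$ is a norm on the pre-Hilbert space $\mathcal E$ (inner product $\kappa(\nu,\nu_1)$); "strong" refers to this norm; (b) $\kappa$ is consistent: every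 strong Cauchy net in $\mathcal E^+:=\{\nu\in\mathcal E:\nu\ge0\}$ converges strongly to each of its vague cluster points; (c) $\kappa(x,y)$ is finite and continuous for $x\neq y$; (d) for every $\varepsilon>0$ and compact $K\subset\mathrm X$ there is a compact $K'$ with $\kappa(x,y)<\varepsilon$ for $x\in K$, $y\notin K'$; (e) generalized maximum principle with a constant $h\ge1$: for every compactly supported $\nu\ge0$ with $M:=\sup_{x\in S(\nu)}\kappa(x,\nu)<\infty$, one has $\kappa(x,\nu)\le hM$ for all $x\in\mathrm X$. A measure $\nu\ge0$ is concentrated on $E$ if $\mathrm X\setminus E$ is locally $\nu$-negligible; $\mathcal E^+_E$ is the set of elements of $\mathcal E^+$ concentrated on $E$. Interior capacity: $C(E)=1/\inf\{\kappa(\nu,\nu):\nu\in\mathcal E^+_E,\ \nu(E)=1\}$ (infimum over $\varnothing$ is $+\infty$); "n.e." means except on a set of interior capacity zero. Condenser: $I^+,I^-$ are disjoint countable index sets ($I^-$ may be empty), $I=I^+\cup I^-$; each $A_i$, $i\in I$, is a nonempty closed subset of $\mathrm X$; every compact set meets only finitely many $A_i$; $A_i\cap A_j=\varnothing$ for $i\in I^+$, $j\in I^-$. Put $\alpha_i=+1$ for $i\in I^+$, $\alpha_i=-1$ for $i\in I^-$, $A^\pm=\bigcup_{i\in I^\pm}A_i$, $A=\bigcup_{i\in I}A_i$. It is assumed that $\sup_{(x,y)\in A^+\times A^-}\kappa(x,y)<\infty$. A vector measure is $\boldsymbol\mu=(\mu^i)_{i\in I}$ with $\mu^i\ge0$ concentrated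 on $A_i$; $R\boldsymbol\mu:=\sum_{i\in I}\alpha_i\mu^i$ (a signed Radon measure); its energy is $\kappa(\boldsymbol\mu,\boldsymbol\mu)=\sum_{i,j\in I}\alpha_i\alpha_j\kappa(\mu^i,\mu^j)$; $\mathcal E^+(\boldsymbol A)$ is the set of vector measures with finite energy, with seminorm distance $\|\boldsymbol\mu_1-\boldsymbol\mu_2\|_{\mathcal E^+(\boldsymbol A)}:=\|R\boldsymbol\mu_1-R\boldsymbol\mu_2\|$. External field: a bounded signed measure $\chi\in\mathcal E$ with $S(\chi^+)\cap A^-=\varnothing$, $S(\chi^-)\cap A^+=\varnothing$; for $\boldsymbol\mu\in\mathcal E^+(\boldsymbol A)$, $G_\chi(\boldsymbol\mu):=\kappa(\boldsymbol\mu,\boldsymbol\mu)+2\sum_{i\in I}\alpha_i\int\kappa(x,\chi)\,d\mu^i(x)=\|R\boldsymbol\mu\|^2+2\kappa(\chi,R\boldsymbol\mu)$. Normalization: $g$ is continuous on $A$ with $g_{\inf}:=\inf_A g>0$, and for each $i\in I$ either $g|_{A_i}$ is bounded or there are $r_i>1$ and $\nu_i\in\mathcal E$ with $g(x)^{r_i}\le\kappa(x,\nu_i)$ for n.e. $x\in A_i$. $\boldsymbol a=(a_i)_{i\in I}$ with $a_i>0$ and $|\boldsymbol a|:=\sum_i a_i<\infty$. For $I^+\subseteq J\subseteq I$: $\mathcal E^+(\boldsymbol A,\boldsymbol a,g,J):=\{\boldsymbol\mu\in\mathcal E^+(\boldsymbol A):\int g\,d\mu^i=a_i\ \forall i\in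 J\}$, $G_\chi(\boldsymbol A,\boldsymbol a,g,J):=\inf$ of $G_\chi$ over this class; the $(\boldsymbol A,\boldsymbol a,g,\chi,J)$-problem asks for a minimizer in this class, and $\mathfrak S_\chi(\boldsymbol A,\boldsymbol a,g,J)$ denotes the set of minimizers. For $J=I$ the symbol $J$ is dropped. It is assumed that $G_\chi(\boldsymbol A,\boldsymbol a,g)<\infty$. *)

theory Defs
  imports "HOL-Analysis.Analysis" "HOL-Probability.Probability"
begin

text \<open>A (positive) Radon measure is represented by its Riesz measure on the Borel sets:
 finite on compact sets, inner regular (by compact sets) on open sets, outer regular
 (by open sets) on Borel sets.\<close>
definition radon :: "'a::topological_space measure \<Rightarrow> bool" where
  "radon M \<longleftrightarrow> sets M = sets borel
     \<and> (\<forall>K. compact K \<longrightarrow> emeasure M K < \<top>)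
     \<and> (\<forall>U. open U \<longrightarrow> emeasure M U = (SUP K\<in>{K. compact K \<and> K \<subseteq> U}. emeasure M K))
     \<and> (\<forall>B\<in>sets borel. emeasure M B = (INF U\<in>{U. open U \<and> B \<subseteq> U}. emeasure M U))"

definition Cc :: "('a::topological_space \<Rightarrow> real) set" where
  "Cc = {\<phi>. continuous_on UNIV \<phi> \<and> compact (closure {x. \<phi> x \<noteq> 0})}"

definition msupport :: "'a::topological_space measure \<Rightarrow> 'a set" where
  "msupport M = {x. \<forall>U. open U \<longrightarrow> x \<in> U \<longrightarrow> emeasure M U \<noteq> 0}"

definition concentrated_on :: "'a::topological_space measure \<Rightarrow> 'a set \<Rightarrow> bool" where
  "concentrated_on M E \<longleftrightarrow> (\<forall>K. compact K \<longrightarrow> (\<exists>N\<in>null_sets M. K - E \<subseteq> N))"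

definition vague :: "'a::topological_space measure topology" where
  "vague = topology_generated_by
     (insert UNIV {{M. integral\<^sup>L M \<phi> \<in> U} | \<phi> U. \<phi> \<in> Cc \<and> open (U::real set)})"

definition pot :: "('a \<Rightarrow> 'a \<Rightarrow> ennreal) \<Rightarrow> 'a \<Rightarrow> 'a measure \<Rightarrow> ennreal" where
  "pot \<kappa> x \<nu> = (\<integral>\<^sup>+ y. \<kappa> x y \<partial>\<nu>)"

definition menergy :: "('a \<Rightarrow> 'a \<Rightarrow> ennreal) \<Rightarrow> 'a measure \<Rightarrow> 'a measure \<Rightarrow> ennreal" where
  "menergy \<kappa> \<mu> \<nu> = (\<integral>\<^sup>+ x. pot \<kappa> x \<nu> \<partial>\<mu>)"

definition Eplus :: "('a::topological_space \<Rightarrow> 'a \<Rightarrow> ennreal) \<Rightarrow> 'a measure set" where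
  "Eplus \<kappa> = {\<mu>. radon \<mu> \<and> menergy \<kappa> \<mu> \<mu> < \<top>}"

definition sdist :: "('a \<Rightarrow> 'a \<Rightarrow> ennreal) \<Rightarrow> 'a measure \<Rightarrow> 'a measure \<Rightarrow> real" where
  "sdist \<kappa> \<mu> \<nu> = sqrt (enn2real (menergy \<kappa> \<mu> \<mu>) + enn2real (menergy \<kappa> \<nu> \<nu>)
                          - 2 * enn2real (menergy \<kappa> \<mu> \<nu>))"

text \<open>Signed Radon measures are represented by their Jordan decomposition (p, n):
  two positive Radon measures which are (locally) mutually singular.\<close>
definition signed_radon :: "'a::topological_space measure \<times> 'a measure \<Rightarrow> bool" where
  "signed_radon \<nu> \<longleftrightarrow> radon (fst \<nu>) \<and> radon (snd \<nu>) \<and>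
     (\<forall>K. compact K \<longrightarrow> (\<exists>P\<in>sets borel. emeasure (fst \<nu>) (K - P) = 0 \<and> emeasure (snd \<nu>) (K \<inter> P) = 0))"

text \<open>kappa(nu,nu) is well defined: the integrals of kappa w.r.t. (nu x nu)^+ = p x p + n x n and
  (nu x nu)^- = p x n + n x p are not both infinite.\<close>
definition energy_defined :: "('a \<Rightarrow> 'a \<Rightarrow> ennreal) \<Rightarrow> 'a measure \<times> 'a measure \<Rightarrow> bool" where
  "energy_defined \<kappa> \<nu> \<longleftrightarrow>
     menergy \<kappa> (fst \<nu>) (fst \<nu>) + menergy \<kappa> (snd \<nu>) (snd \<nu>) < \<top> \<or> menergy \<kappa> (fst \<nu>) (snd \<nu>) < \<top>"

definition senergy :: "('a \<Rightarrow> 'a \<Rightarrow> ennreal) \<Rightarrow> 'a measure \<times> 'a measure \<Rightarrow> ereal" where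
  "senergy \<kappa> \<nu> = enn2ereal (menergy \<kappa> (fst \<nu>) (fst \<nu>) + menergy \<kappa> (snd \<nu>) (snd \<nu>))
                   - 2 * enn2ereal (menergy \<kappa> (fst \<nu>) (snd \<nu>))"

definition Esigned :: "('a::topological_space \<Rightarrow> 'a \<Rightarrow> ennreal) \<Rightarrow> ('a measure \<times> 'a measure) set" where
  "Esigned \<kappa> = {\<nu>. signed_radon \<nu> \<and> menergy \<kappa> (fst \<nu>) (fst \<nu>) < \<top>
       \<and> menergy \<kappa> (snd \<nu>) (snd \<nu>) < \<top> \<and> menergy \<kappa> (fst \<nu>) (snd \<nu>) < \<top>}"

definition capacity :: "('a::topological_space \<Rightarrow> 'a \<Rightarrow> ennreal) \<Rightarrow> 'a set \<Rightarrow> ennreal" where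
  "capacity \<kappa> E = 1 / (INF \<nu>\<in>{\<nu>\<in>Eplus \<kappa>. concentrated_on \<nu> E \<and> emeasure \<nu> (space \<nu>) = 1}.
                         menergy \<kappa> \<nu> \<nu>)"

definition lsc_kernel :: "('a::topological_space \<Rightarrow> 'a \<Rightarrow> ennreal) \<Rightarrow> bool" where
  "lsc_kernel \<kappa> \<longleftrightarrow> (\<forall>t. open {z::'a\<times>'a. t < \<kappa> (fst z) (snd z)})"

definition strictly_pos_def :: "('a::topological_space \<Rightarrow> 'a \<Rightarrow> ennreal) \<Rightarrow> bool" where
  "strictly_pos_def \<kappa> \<longleftrightarrow>
     (\<forall>\<nu>. signed_radon \<nu> \<longrightarrow> energy_defined \<kappa> \<nu> \<longrightarrow> senergy \<kappa> \<nu> \<ge> 0) \<and>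
     (\<forall>\<nu>\<in>Esigned \<kappa>. senergy \<kappa> \<nu> = 0 \<longrightarrow>
        (\<forall>\<phi>\<in>Cc. integral\<^sup>L (fst \<nu>) \<phi> = integral\<^sup>L (snd \<nu>) \<phi>))"

text \<open>(b) consistency. Nets in E+ are represented by their image filters on measures.\<close>
definition consistent :: "('a::topological_space \<Rightarrow> 'a \<Rightarrow> ennreal) \<Rightarrow> bool" where
  "consistent \<kappa> \<longleftrightarrow>
     (\<forall>F::'a measure filter. F \<noteq> bot \<longrightarrow> eventually (\<lambda>\<mu>. \<mu> \<in> Eplus \<kappa>) F \<longrightarrow>
        (\<forall>\<epsilon>>0. eventually (\<lambda>(\<mu>,\<nu>). sdist \<kappa> \<mu> \<nu> < \<epsilon>) (F \<times>\<^sub>F F)) \<longrightarrow>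
        (\<forall>\<nu>. radon \<nu> \<longrightarrow>
           (\<forall>U. openin vague U \<longrightarrow> \<nu> \<in> U \<longrightarrow> frequently (\<lambda>\<mu>. \<mu> \<in> U) F) \<longrightarrow>
           \<nu> \<in> Eplus \<kappa> \<and> (\<forall>\<epsilon>>0. eventually (\<lambda>\<mu>. sdist \<kappa> \<mu> \<nu> < \<epsilon>) F)))"

definition gen_max_principle :: "('a::topological_space \<Rightarrow> 'a \<Rightarrow> ennreal) \<Rightarrow> real \<Rightarrow> bool" where
  "gen_max_principle \<kappa> h \<longleftrightarrow>
     (\<forall>\<nu>. radon \<nu> \<longrightarrow> compact (msupport \<nu>) \<longrightarrow>
        (SUP x\<in>msupport \<nu>. pot \<kappa> x \<nu>) < \<top> \<longrightarrow>
        (\<forall>x. pot \<kappa> x \<nu> \<le> ennreal h * (SUP y\<in>msupport \<nu>. pot \<kappa> y \<nu>)))"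

definition alpha :: "'i set \<Rightarrow> 'i \<Rightarrow> real" where
  "alpha Ipos i = (if i \<in> Ipos then 1 else -1)"

definition vec_measures :: "'i set \<Rightarrow> ('i \<Rightarrow> 'a::topological_space set) \<Rightarrow> ('i \<Rightarrow> 'a measure) set" where
  "vec_measures I A = {\<mu>. (\<forall>i\<in>I. radon (\<mu> i) \<and> concentrated_on (\<mu> i) (A i))
                          \<and> (\<forall>i. i \<notin> I \<longrightarrow> \<mu> i = null_measure borel)}"

definition vec_Eplus :: "('a::topological_space \<Rightarrow> 'a \<Rightarrow> ennreal) \<Rightarrow> 'i set \<Rightarrow> 'i set \<Rightarrow> ('i \<Rightarrow> 'a set)
     \<Rightarrow> ('i \<Rightarrow> 'a measure) set" where
  "vec_Eplus \<kappa> Ipos Ineg A = {\<mu>\<in>vec_measures (Ipos \<union> Ineg) A.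
      (SUP F\<in>{F. finite F \<and> F \<subseteq> (Ipos \<union> Ineg) \<times> (Ipos \<union> Ineg)}.
          \<Sum>(i,j)\<in>F. menergy \<kappa> (\<mu> i) (\<mu> j)) < \<top>}"

definition vec_energy :: "('a \<Rightarrow> 'a \<Rightarrow> ennreal) \<Rightarrow> 'i set \<Rightarrow> 'i set \<Rightarrow> ('i \<Rightarrow> 'a measure) \<Rightarrow> real" where
  "vec_energy \<kappa> Ipos Ineg \<mu> = infsum (\<lambda>(i,j). alpha Ipos i * alpha Ipos j * enn2real (menergy \<kappa> (\<mu> i) (\<mu> j)))
       ((Ipos \<union> Ineg) \<times> (Ipos \<union> Ineg))"

text \<open>Gauss functional G_chi; chi = (chi^+, chi^-), and the integral of the potential
  kappa(., chi) w.r.t. mu^i is kappa(mu^i, chi^+) - kappa(mu^i, chi^-).\<close>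
definition Gchi :: "('a \<Rightarrow> 'a \<Rightarrow> ennreal) \<Rightarrow> 'i set \<Rightarrow> 'i set \<Rightarrow> 'a measure \<times> 'a measure
     \<Rightarrow> ('i \<Rightarrow> 'a measure) \<Rightarrow> real" where
  "Gchi \<kappa> Ipos Ineg chi \<mu> = vec_energy \<kappa> Ipos Ineg \<mu>
     + 2 * infsum (\<lambda>i. alpha Ipos i * (enn2real (menergy \<kappa> (\<mu> i) (fst chi))
                                       - enn2real (menergy \<kappa> (\<mu> i) (snd chi)))) (Ipos \<union> Ineg)"

definition adm :: "('a::topological_space \<Rightarrow> 'a \<Rightarrow> ennreal) \<Rightarrow> 'i set \<Rightarrow> 'i set \<Rightarrow> ('i \<Rightarrow> 'a set)
     \<Rightarrow> ('i \<Rightarrow> real) \<Rightarrow> ('a \<Rightarrow> real) \<Rightarrow> 'i set \<Rightarrow> ('i \<Rightarrow> 'a measure) set" where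
  "adm \<kappa> Ipos Ineg A a g J = {\<mu>\<in>vec_Eplus \<kappa> Ipos Ineg A.
      \<forall>i\<in>J. (\<integral>\<^sup>+ x. ennreal (g x) * indicator (A i) x \<partial>(\<mu> i)) = ennreal (a i)}"

definition Ginf :: "('a::topological_space \<Rightarrow> 'a \<Rightarrow> ennreal) \<Rightarrow> 'i set \<Rightarrow> 'i set \<Rightarrow> ('i \<Rightarrow> 'a set)
     \<Rightarrow> ('i \<Rightarrow> real) \<Rightarrow> ('a \<Rightarrow> real) \<Rightarrow> 'a measure \<times> 'a measure \<Rightarrow> 'i set \<Rightarrow> ereal" where
  "Ginf \<kappa> Ipos Ineg A a g chi J = (INF \<mu>\<in>adm \<kappa> Ipos Ineg A a g J. ereal (Gchi \<kappa> Ipos Ineg chi \<mu>))"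

definition solutions :: "('a::topological_space \<Rightarrow> 'a \<Rightarrow> ennreal) \<Rightarrow> 'i set \<Rightarrow> 'i set \<Rightarrow> ('i \<Rightarrow> 'a set)
     \<Rightarrow> ('i \<Rightarrow> real) \<Rightarrow> ('a \<Rightarrow> real) \<Rightarrow> 'a measure \<times> 'a measure \<Rightarrow> 'i set \<Rightarrow> ('i \<Rightarrow> 'a measure) set" where
  "solutions \<kappa> Ipos Ineg A a g chi J =
     {lam\<in>adm \<kappa> Ipos Ineg A a g J. ereal (Gchi \<kappa> Ipos Ineg chi lam) = Ginf \<kappa> Ipos Ineg A a g chi J}"

definition vec_vague :: "'i set \<Rightarrow> ('i \<Rightarrow> 'a::topological_space measure) topology" where
  "vec_vague I = topology_generated_by
     (insert UNIV {{\<mu>. integral\<^sup>L (\<mu> i) \<phi> \<in> U} | i \<phi> U. i \<in> I \<and> \<phi> \<in> Cc \<and> open (U::real set)})"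

end

theory Submission
  imports Defs
begin

text \<open>
  The Gauss functional of a vector measure depends only on the positive part \<open>P\<close> and the negative part
  \<open>N\<close> of \<open>R\<mu>\<close>; up to a constant it is the square of the energy norm of \<open>P - N + \<chi>\<close>. The mass of \<open>P\<close>
  is bounded on the admissible class, so the generalized maximum principle bounds the mutual energy
  of \<open>P\<close> and \<open>N\<close> by a small multiple of the energy of \<open>N\<close> plus a constant; hence the energies of \<open>P\<close>
  and \<open>N\<close> are bounded along minimizing families, although the components outside \<open>J\<close> may have
  unbounded mass. Among the vector measures that are nearly minimal for the functional one chooses
  those for which the sum of the two energies is nearly minimal; the parallelogram law then makes
  \<open>P\<close> and \<open>N\<close> separately strong Cauchy. A vague limit along an ultrafilter exists because strongly
  bounded sets are bounded on compact sets, and by consistency it is a strong limit of both parts. The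
  normalization survives in the limit because a closed set of finite capacity carries uniformly little
  mass of bounded energy outside large compact sets. For the compactness of the set of solutions,
  note that all solutions have the same \<open>P\<close> and \<open>N\<close>, so the same limit argument applies to any
  ultrafilter of solutions.
\<close>

section \<open>Ultrafilters\<close>

text \<open>\<open>consistent\<close> gives strong limits only for Cauchy families of positive
  measures, whereas near-minimality of the Gauss functional controls only the norm of a signed
  measure. A family can be Cauchy in that norm without its parts \<open>P\<close> and
  \<open>N\<close> being known to be so; forcing this is the purpose of the second minimization, of
  \<open>Q\<close>. Since positivity of the kernel is the only source of norm estimates, signed
  differences are always written as distances between two sums lying in \<open>Eplus\<close>. No
  countable base and no sigma-finiteness are available. Limits are therefore taken along
  ultrafilters instead of subsequences, and Fubini's theorem and monotone convergence are recovered
  for lower semicontinuous integrands from compactness and the inner regularity of Radon measures on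
  open sets. Sums, differences, lattice infima and vague limits of measures all come from one
  source, the Riesz theorem applied to a functional on nonnegative test functions, which delivers
  regularity each time.\<close>

definition ultra :: "'x filter \<Rightarrow> bool" where
  "ultra U \<longleftrightarrow> U \<noteq> bot \<and> (\<forall>P. eventually P U \<or> eventually (\<lambda>x. \<not> P x) U)"

text \<open>Zorn's lemma is applied to the families of sets that contain those of \<open>F\<close>
  and have the finite intersection property; a maximal such family generates the
  ultrafilter.\<close>

lemma ultra_exists:
  fixes F :: "'x filter"
  assumes F: "F \<noteq> bot"
  shows "\<exists>U. ultra U \<and> U \<le> F"
proof -
  define S where "S = {\<A>::'x set set. {A. eventually (\<lambda>x. x \<in> A) F} \<subseteq> \<A> \<and>
      (\<forall>B. finite B \<and> B \<subseteq> \<A> \<longrightarrow> \<Inter>B \<noteq> {})}"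
  have F0: "{A. eventually (\<lambda>x. x \<in> A) F} \<in> S"
  proof -
    have "\<Inter>B \<noteq> {}" if "finite B" "B \<subseteq> {A. eventually (\<lambda>x. x \<in> A) F}" for B
    proof -
      have "eventually (\<lambda>x. \<forall>A\<in>B. x \<in> A) F"
        using that by (intro eventually_ball_finite) auto
      then obtain x where "\<forall>A\<in>B. x \<in> A" using eventually_happens[OF _ ] F by blast
      then show ?thesis by blast
    qed
    then show ?thesis by (auto simp: S_def)
  qed
  have chain: "\<Union>\<C> \<in> S" if ne: "\<C> \<noteq> {}" and ch: "subset.chain S \<C>" for \<C>
  proof -
    have sub: "\<C> \<subseteq> S" using ch by (auto simp: subset.chain_def)
    have "\<Inter>B \<noteq> {}" if B: "finite B" "B \<subseteq> \<Union>\<C>" for B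
    proof -
      obtain \<A> where "\<A> \<in> \<C>" "B \<subseteq> \<A>"
        using finite_subset_Union_chain[of B \<C> S] B ne ch by metis
      then show ?thesis using sub B by (auto simp: S_def)
    qed
    moreover have "{A. eventually (\<lambda>x. x \<in> A) F} \<subseteq> \<Union>\<C>"
      using ne sub by (force simp: S_def)
    ultimately show ?thesis by (auto simp: S_def)
  qed
  obtain \<A> where A: "\<A> \<in> S" "\<And>X. X \<in> S \<Longrightarrow> \<A> \<subseteq> X \<Longrightarrow> X = \<A>"
    using subset_Zorn_nonempty[of S] F0 chain by blast
  define U where "U = (INF A\<in>\<A>. principal A)"
  have ev: "eventually P U \<longleftrightarrow> (\<exists>B. finite B \<and> B \<subseteq> \<A> \<and> (\<forall>x\<in>\<Inter>B. P x))" for P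
  proof -
    have "(INF A\<in>B. principal A) = principal (\<Inter>B)" if "finite B" for B :: "'x set set"
      using INF_principal_finite[OF that, of "\<lambda>x. x"] by simp
    then have "(B \<subseteq> \<A> \<and> finite B \<and> eventually P (INF A\<in>B. principal A)) =
          (finite B \<and> B \<subseteq> \<A> \<and> (\<forall>x\<in>\<Inter>B. P x))" for B
      by (auto simp: eventually_principal)
    moreover have "eventually P U \<longleftrightarrow> (\<exists>B\<subseteq>\<A>. finite B \<and> eventually P (INF A\<in>B. principal A))"
      unfolding U_def by (rule eventually_INF)
    ultimately show ?thesis by presburger
  qed
  have "U \<noteq> bot"
  proof
    assume "U = bot"
    then have "eventually (\<lambda>x. False) U" by simp
    then obtain B where B: "finite B" "B \<subseteq> \<A>" "\<forall>x\<in>\<Inter>B. False" unfolding ev by blast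
    moreover have "\<Inter>B \<noteq> {}" using A(1) B(1,2) unfolding S_def by blast
    ultimately show False by blast
  qed
  moreover have "U \<le> F"
  proof (rule filter_leI)
    fix P assume "eventually P F"
    then have "{x. P x} \<in> \<A>" using A(1) by (auto simp: S_def)
    then show "eventually P U" unfolding ev by (intro exI[of _ "{{x. P x}}"]) auto
  qed
  moreover have "eventually P U \<or> eventually (\<lambda>x. \<not> P x) U" for P
  proof (rule ccontr)
    \<comment> \<open>If neither \<open>P\<close> nor its negation holds eventually, the set of
      \<open>P\<close> can be added without losing the finite intersection property, since an empty
      finite intersection would make the negation hold eventually. Maximality then puts this set
      into the family.\<close>
    assume neg: "\<not> ?thesis"
    have "insert {x. P x} \<A> \<in> S"
    proof -
      have "\<Inter>B \<noteq> {}" if B: "finite B" "B \<subseteq> insert {x. P x} \<A>" for B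
      proof
        assume e: "\<Inter>B = {}"
        have "\<forall>x\<in>\<Inter>(B - {{x. P x}}). \<not> P x" using e by blast
        then have "eventually (\<lambda>x. \<not> P x) U"
          unfolding ev using B by (intro exI[of _ "B - {{x. P x}}"]) auto
        then show False using neg by blast
      qed
      then show ?thesis using A(1) by (auto simp: S_def)
    qed
    then have "{x. P x} \<in> \<A>" using A(2) by blast
    then have "eventually P U" unfolding ev by (intro exI[of _ "{{x. P x}}"]) auto
    then show False using neg by blast
  qed
  ultimately show ?thesis by (auto simp: ultra_def)
qed

lemma ultra_not_bot: "ultra U \<Longrightarrow> U \<noteq> bot"
  by (simp add: ultra_def)

text \<open>The image filter lives on a compact interval and so has a cluster point; for an
  ultrafilter a cluster point is a limit, because membership in each neighbourhood is decided and
  cannot be decided negatively.\<close>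

lemma ultra_bounded_convergent:
  fixes f :: "'x \<Rightarrow> real"
  assumes U: "ultra U" and b: "eventually (\<lambda>x. \<bar>f x\<bar> \<le> C) U"
  shows "\<exists>l. (f \<longlongrightarrow> l) U"
proof -
  have "filtermap f U \<noteq> bot" using U by (simp add: ultra_def filtermap_bot_iff)
  moreover have "filtermap f U \<le> principal {-C..C}"
    using b by (auto simp: le_principal eventually_filtermap elim!: eventually_mono)
  ultimately obtain l where l: "inf (nhds l) (filtermap f U) \<noteq> bot"
    using compact_Icc[of "-C" C] unfolding compact_filter by (metis le_principal)
  have "(f \<longlongrightarrow> l) U"
  proof (rule topological_tendstoI)
    fix S assume S: "open S" "l \<in> S"
    have "eventually (\<lambda>x. f x \<in> S) U \<or> eventually (\<lambda>x. f x \<notin> S) U"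
      using U by (auto simp: ultra_def)
    moreover have "\<not> eventually (\<lambda>x. f x \<notin> S) U"
    proof
      assume e: "eventually (\<lambda>x. f x \<notin> S) U"
      have "eventually (\<lambda>y. False) (inf (nhds l) (filtermap f U))"
        unfolding eventually_inf
        by (rule exI[of _ "\<lambda>y. y \<in> S"], rule exI[of _ "\<lambda>y. y \<notin> S"])
           (use S e in \<open>auto simp: eventually_filtermap eventually_nhds\<close>)
      then show False using l by (simp add: trivial_limit_def)
    qed
    ultimately show "eventually (\<lambda>x. f x \<in> S) U" by blast
  qed
  then show ?thesis by blast
qed

section \<open>Continuous functions with compact support\<close>

lemma CcI:
  fixes \<phi> :: "'a::t2_space \<Rightarrow> real"
  assumes "continuous_on UNIV \<phi>" "compact K" "\<And>x. x \<notin> K \<Longrightarrow> \<phi> x = 0"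
  shows "\<phi> \<in> Cc"
proof -
  have "closure {x. \<phi> x \<noteq> 0} \<subseteq> K"
    using assms by (intro closure_minimal) (auto intro: compact_imp_closed)
  then have "compact (closure {x. \<phi> x \<noteq> 0})"
    using compact_Int_closed[OF assms(2), of "closure {x. \<phi> x \<noteq> 0}"] by (simp add: Int_absorb1)
  then show ?thesis using assms(1) by (simp add: Cc_def)
qed

lemma CcE:
  fixes \<phi> :: "'a::t2_space \<Rightarrow> real"
  assumes "\<phi> \<in> Cc"
  obtains K where "compact K" "\<And>x. x \<notin> K \<Longrightarrow> \<phi> x = 0" "continuous_on UNIV \<phi>"
proof (rule that)
  show "compact (closure {x. \<phi> x \<noteq> 0})" "continuous_on UNIV \<phi>"
    using assms by (auto simp: Cc_def)
  show "\<phi> x = 0" if "x \<notin> closure {x. \<phi> x \<noteq> 0}" for x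
    using that closure_subset[of "{x. \<phi> x \<noteq> 0}"] by auto
qed

text \<open>On this cone the Bochner integral and the extended nonnegative integral agree, and a
  functional has to be only additive and positively homogeneous in order to represent a
  measure.\<close>

definition Ccp :: "('a::topological_space \<Rightarrow> real) set" where
  "Ccp = {\<phi>\<in>Cc. \<forall>x. 0 \<le> \<phi> x}"

lemma CcpI:
  fixes \<phi> :: "'a::t2_space \<Rightarrow> real"
  assumes "continuous_on UNIV \<phi>" "compact K" "\<And>x. x \<notin> K \<Longrightarrow> \<phi> x = 0" "\<And>x. 0 \<le> \<phi> x"
  shows "\<phi> \<in> Ccp"
  using CcI[OF assms(1-3)] assms(4) by (simp add: Ccp_def)

lemma CcpE:
  fixes \<phi> :: "'a::t2_space \<Rightarrow> real"
  assumes "\<phi> \<in> Ccp"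
  obtains K where "compact K" "\<And>x. x \<notin> K \<Longrightarrow> \<phi> x = 0" "continuous_on UNIV \<phi>" "\<And>x. 0 \<le> \<phi> x"
proof -
  have "\<phi> \<in> Cc" "\<And>x. 0 \<le> \<phi> x" using assms by (auto simp: Ccp_def)
  then show ?thesis using CcE[of \<phi>] that by metis
qed

lemma Ccp_nonneg: "\<phi> \<in> Ccp \<Longrightarrow> 0 \<le> \<phi> x"
  by (simp add: Ccp_def)

lemma Ccp_cont: "\<phi> \<in> Ccp \<Longrightarrow> continuous_on UNIV \<phi>"
  by (simp add: Ccp_def Cc_def)

lemma Ccp_bounded:
  fixes \<phi> :: "'a::t2_space \<Rightarrow> real"
  assumes "\<phi> \<in> Ccp"
  obtains C where "C \<ge> 0" "\<And>x. \<phi> x \<le> C"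
proof -
  obtain K where K: "compact K" "\<And>x. x \<notin> K \<Longrightarrow> \<phi> x = 0" "continuous_on UNIV \<phi>"
    using CcpE[OF assms] by metis
  have "compact (\<phi> ` K)"
    using K by (intro compact_continuous_image) (auto intro: continuous_on_subset)
  then have "bounded (\<phi> ` K)" by (rule compact_imp_bounded)
  then obtain C where C: "\<And>x. x \<in> K \<Longrightarrow> \<bar>\<phi> x\<bar> \<le> C"
    unfolding bounded_iff by auto
  have "\<phi> x \<le> max C 0" for x
    using C[of x] K(2)[of x] by (cases "x \<in> K") auto
  then show ?thesis using that[of "max C 0"] by auto
qed

lemma Ccp_zero [simp]: "(\<lambda>x::'a::t2_space. 0) \<in> Ccp"
  by (rule CcpI[of _ "{}"]) auto

lemma Ccp_add:
  fixes \<phi> \<psi> :: "'a::t2_space \<Rightarrow> real"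
  assumes "\<phi> \<in> Ccp" "\<psi> \<in> Ccp" shows "(\<lambda>x. \<phi> x + \<psi> x) \<in> Ccp"
proof -
  obtain K where K: "compact K" "\<And>x. x \<notin> K \<Longrightarrow> \<phi> x = 0" "continuous_on UNIV \<phi>" "\<And>x. 0 \<le> \<phi> x"
    using CcpE[OF assms(1)] by metis
  obtain L where L: "compact L" "\<And>x. x \<notin> L \<Longrightarrow> \<psi> x = 0" "continuous_on UNIV \<psi>" "\<And>x. 0 \<le> \<psi> x"
    using CcpE[OF assms(2)] by metis
  show ?thesis
    using K L by (intro CcpI[of _ "K \<union> L"]) (auto intro!: continuous_intros)
qed

lemma Ccp_mult:
  fixes \<phi> u :: "'a::t2_space \<Rightarrow> real"
  assumes "\<phi> \<in> Ccp" "continuous_on UNIV u" "\<And>x. 0 \<le> u x" shows "(\<lambda>x. u x * \<phi> x) \<in> Ccp"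
proof -
  obtain K where K: "compact K" "\<And>x. x \<notin> K \<Longrightarrow> \<phi> x = 0" "continuous_on UNIV \<phi>" "\<And>x. 0 \<le> \<phi> x"
    using CcpE[OF assms(1)] by metis
  show ?thesis
    using K assms by (intro CcpI[of _ K]) (auto intro!: continuous_intros)
qed

lemma Ccp_scale:
  fixes \<phi> :: "'a::t2_space \<Rightarrow> real"
  assumes "\<phi> \<in> Ccp" "0 \<le> c" shows "(\<lambda>x. c * \<phi> x) \<in> Ccp"
  by (rule Ccp_mult) (use assms in auto)

lemma Ccp_diff:
  fixes \<phi> \<psi> :: "'a::t2_space \<Rightarrow> real"
  assumes "\<phi> \<in> Ccp" "\<psi> \<in> Ccp" "\<And>x. \<psi> x \<le> \<phi> x" shows "(\<lambda>x. \<phi> x - \<psi> x) \<in> Ccp"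
proof -
  obtain K where K: "compact K" "\<And>x. x \<notin> K \<Longrightarrow> \<phi> x = 0" "continuous_on UNIV \<phi>" "\<And>x. 0 \<le> \<phi> x"
    using CcpE[OF assms(1)] by metis
  have "\<psi> x = 0" if "x \<notin> K" for x
    using K(2)[OF that] assms(3)[of x] Ccp_nonneg[OF assms(2), of x] by linarith
  then show ?thesis
    using K assms Ccp_cont[OF assms(2)] by (intro CcpI[of _ K]) (auto intro!: continuous_intros)
qed

lemma Ccp_max:
  fixes \<phi> \<psi> :: "'a::t2_space \<Rightarrow> real"
  assumes "\<phi> \<in> Ccp" "\<psi> \<in> Ccp" shows "(\<lambda>x. max (\<phi> x) (\<psi> x)) \<in> Ccp"
proof -
  obtain K where K: "compact K" "\<And>x. x \<notin> K \<Longrightarrow> \<phi> x = 0" "continuous_on UNIV \<phi>" "\<And>x. 0 \<le> \<phi> x"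
    using CcpE[OF assms(1)] by metis
  obtain L where L: "compact L" "\<And>x. x \<notin> L \<Longrightarrow> \<psi> x = 0" "continuous_on UNIV \<psi>" "\<And>x. 0 \<le> \<psi> x"
    using CcpE[OF assms(2)] by metis
  show ?thesis
    using K L by (intro CcpI[of _ "K \<union> L"]) (auto intro!: continuous_intros simp: le_max_iff_disj)
qed

lemma Cc_decompose:
  fixes \<phi> :: "'a::t2_space \<Rightarrow> real"
  assumes "\<phi> \<in> Cc"
  shows "(\<lambda>x. max (\<phi> x) 0) \<in> Ccp" "(\<lambda>x. max (- \<phi> x) 0) \<in> Ccp"
    "\<phi> = (\<lambda>x. max (\<phi> x) 0 - max (- \<phi> x) 0)"
proof -
  obtain K where K: "compact K" "\<And>x. x \<notin> K \<Longrightarrow> \<phi> x = 0" "continuous_on UNIV \<phi>"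
    using CcE[OF assms] by metis
  show "(\<lambda>x. max (\<phi> x) 0) \<in> Ccp" "(\<lambda>x. max (- \<phi> x) 0) \<in> Ccp"
    using K by (auto intro!: CcpI[of _ K] continuous_intros)
  show "\<phi> = (\<lambda>x. max (\<phi> x) 0 - max (- \<phi> x) 0)" by (auto simp: max_def)
qed

lemma compact_nbhd:
  fixes K :: "'a::t2_space set"
  assumes lc: "locally_compact_space (euclidean :: 'a topology)" and K: "compact K"
  obtains V L where "open V" "compact L" "K \<subseteq> V" "V \<subseteq> L"
proof -
  have "Hausdorff_space (euclidean :: 'a topology)"
    by (meson Hausdorff_space_def disjnt_def hausdorff open_openin)
  then show ?thesis
    using lc K that locally_compact_space_compact_closed_compact[of "euclidean :: 'a topology"]
    by (metis compactin_euclidean_iff open_openin)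
qed

lemma Urysohn_Cc:
  fixes K :: "'a::t2_space set"
  assumes lc: "locally_compact_space (euclidean :: 'a topology)" and K: "compact K" "open U" "K \<subseteq> U"
  obtains \<phi> L where "\<phi> \<in> Ccp" "\<And>x. \<phi> x \<le> 1" "\<And>x. x \<in> K \<Longrightarrow> \<phi> x = 1"
    "compact L" "L \<subseteq> U" "\<And>x. x \<notin> L \<Longrightarrow> \<phi> x = 0"
proof -
  have H: "Hausdorff_space (euclidean :: 'a topology)"
    by (meson Hausdorff_space_def disjnt_def hausdorff open_openin)
  have cr: "completely_regular_space (euclidean :: 'a topology)"
    using lc H locally_compact_regular_imp_completely_regular_space by blast
  obtain V L where VL: "open V" "compact L" "K \<subseteq> V" "V \<subseteq> L"
    using compact_nbhd[OF lc K(1)] by blast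
  have "closed (-(U \<inter> V))" using K VL by auto
  then obtain f where f: "continuous_map euclidean (subtopology euclidean {0..1::real}) f"
      "f ` (-(U \<inter> V)) \<subseteq> {0}" "f ` K \<subseteq> {1}"
    using Urysohn_completely_regular_compact_closed[OF _ cr, of 0 1 K "-(U \<inter> V)"] K VL
    by (auto simp: disjnt_def)
  have f01: "0 \<le> f x" "f x \<le> 1" for x
    using f(1) by (auto simp: continuous_map_in_subtopology image_subset_iff)
  have fc: "continuous_on UNIV f"
    using f(1) by (auto simp: continuous_map_in_subtopology)
  \<comment> \<open>The set where \<open>f\<close> is nonzero need not have compact closure inside
    \<open>U\<close>. Cutting at height 1/2 confines it to \<open>M\<close>, which is closed, lies
    in \<open>U \<inter> V\<close>, and is compact because \<open>V\<close> is contained in the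
    compact \<open>L\<close>.\<close>
  define g where "g x = max 0 (2 * f x - 1)" for x
  have gc: "continuous_on UNIV g" unfolding g_def by (intro continuous_intros fc)
  define M where "M = {x. f x \<ge> 1/2}"
  have clM: "closed M" unfolding M_def using fc by (intro closed_Collect_le) (auto intro: continuous_intros)
  have MU: "M \<subseteq> U \<inter> V"
  proof
    fix x assume "x \<in> M"
    then have "f x \<noteq> 0" by (auto simp: M_def)
    then show "x \<in> U \<inter> V" using f(2) by blast
  qed
  have cM: "compact M"
    using compact_Int_closed[OF VL(2) clM] MU VL(4) by (metis Int_absorb1 inf.boundedE order_trans)
  have g0: "g x = 0" if "x \<notin> M" for x using that by (auto simp: g_def M_def)
  show ?thesis
  proof (rule that[of g M])
    show "g \<in> Ccp" using gc cM g0 by (intro CcpI[of _ M]) (auto simp: g_def)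
    show "g x \<le> 1" for x using f01[of x] by (auto simp: g_def)
    show "g x = 1" if "x \<in> K" for x using f(3) that by (auto simp: g_def)
  qed (use cM MU g0 in auto)
qed

section \<open>Lower semicontinuous functions\<close>

definition lsc :: "('a::topological_space \<Rightarrow> ennreal) \<Rightarrow> bool" where
  "lsc f \<longleftrightarrow> (\<forall>t. open {x. t < f x})"

lemma lsc_measurable [measurable_dest]:
  assumes "lsc f" shows "f \<in> borel_measurable borel"
  by (rule borel_measurableI_greater) (use assms in \<open>auto simp: lsc_def\<close>)

lemma lsc_indicator: "open U \<Longrightarrow> lsc (indicator U)"
proof (unfold lsc_def, intro allI)
  fix t :: ennreal assume "open U"
  have "{x. t < indicator U x} = (if t < 1 then U else {})"
    by (auto simp: indicator_def split: if_splits)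
  then show "open {x. t < indicator U x}" using \<open>open U\<close> by auto
qed

lemma lsc_SUP: "(\<And>j. j \<in> J \<Longrightarrow> lsc (f j)) \<Longrightarrow> lsc (\<lambda>x. SUP j\<in>J. f j x)"
proof (unfold lsc_def, intro allI)
  fix t assume *: "\<And>j. j \<in> J \<Longrightarrow> \<forall>t. open {x. t < f j x}"
  have "{x. t < (SUP j\<in>J. f j x)} = (\<Union>j\<in>J. {x. t < f j x})" by (auto simp: less_SUP_iff)
  then show "open {x. t < (SUP j\<in>J. f j x)}" using * by auto
qed

lemma lsc_continuous:
  assumes "continuous_on UNIV f" shows "lsc (\<lambda>x. ennreal (f x))"
  unfolding lsc_def
proof
  fix t :: ennreal
  show "open {x. t < ennreal (f x)}"
    using assms by (intro open_Collect_less continuous_on_const continuous_on_ennreal)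
qed

lemma SUP_sum_directed_ennreal:
  fixes f :: "'j \<Rightarrow> 'k \<Rightarrow> ennreal"
  assumes "finite N" "J \<noteq> {}"
    and dir: "\<And>i j. i \<in> J \<Longrightarrow> j \<in> J \<Longrightarrow> \<exists>k\<in>J. \<forall>n. f i n \<le> f k n \<and> f j n \<le> f k n"
  shows "(SUP j\<in>J. \<Sum>n\<in>N. f j n) = (\<Sum>n\<in>N. SUP j\<in>J. f j n)"
  using assms(1)
proof (induction N rule: finite_induct)
  case empty
  then show ?case using \<open>J \<noteq> {}\<close> by simp
next
  case (insert m N)
  have "(SUP j\<in>J. \<Sum>n\<in>insert m N. f j n) = (SUP j\<in>J. f j m + (\<Sum>n\<in>N. f j n))"
    using insert by simp
  also have "\<dots> = (SUP j\<in>J. f j m) + (SUP j\<in>J. \<Sum>n\<in>N. f j n)"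
  proof (rule SUP_add_directed_ennreal)
    fix i j assume "i \<in> J" "j \<in> J"
    then obtain k where "k \<in> J" "\<forall>n. f i n \<le> f k n \<and> f j n \<le> f k n" using dir by blast
    then show "\<exists>k\<in>J. f i m + (\<Sum>n\<in>N. f j n) \<le> f k m + (\<Sum>n\<in>N. f k n)"
      by (intro bexI[of _ k] add_mono sum_mono) auto
  qed
  finally show ?case using insert by simp
qed

section \<open>Monotone convergence for directed families of lower semicontinuous functions\<close>

lemma radon_sets: "radon M \<Longrightarrow> sets M = sets borel"
  by (simp add: radon_def)

lemma radon_space: "radon M \<Longrightarrow> space M = UNIV"
  using sets_eq_imp_space_eq[of M borel] by (simp add: radon_def)

lemma radon_compact: "radon M \<Longrightarrow> compact K \<Longrightarrow> emeasure M K < \<top>"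
  by (simp add: radon_def)

lemma radon_open: "radon M \<Longrightarrow> open U \<Longrightarrow>
    emeasure M U = (SUP K\<in>{K. compact K \<and> K \<subseteq> U}. emeasure M K)"
  by (simp add: radon_def)

lemma radon_borel: "radon M \<Longrightarrow> B \<in> sets borel \<Longrightarrow>
    emeasure M B = (INF U\<in>{U. open U \<and> B \<subseteq> U}. emeasure M U)"
  by (simp add: radon_def)

text \<open>A compact subset of the union is covered by finitely many members, hence by one of them;
  inner regularity on open sets does the rest. This replaces continuity from below, which covers
  only countable unions.\<close>

lemma radon_directed_Union:
  fixes U :: "'j \<Rightarrow> 'a::t2_space set"
  assumes M: "radon M" and ne: "J \<noteq> {}" and op: "\<And>j. j \<in> J \<Longrightarrow> open (U j)"
    and dir: "\<And>i j. i \<in> J \<Longrightarrow> j \<in> J \<Longrightarrow> \<exists>k\<in>J. U i \<subseteq> U k \<and> U j \<subseteq> U k"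
  shows "emeasure M (\<Union>j\<in>J. U j) = (SUP j\<in>J. emeasure M (U j))"
proof (rule antisym)
  have sM: "sets M = sets borel" using M by (rule radon_sets)
  have fin: "\<exists>k\<in>J. (\<Union>j\<in>F. U j) \<subseteq> U k" if "finite F" "F \<subseteq> J" for F
    using that
  proof (induction F rule: finite_induct)
    case empty
    then show ?case using ne by auto
  next
    case (insert j F)
    then obtain k where "k \<in> J" "(\<Union>j\<in>F. U j) \<subseteq> U k" by auto
    moreover obtain l where "l \<in> J" "U j \<subseteq> U l" "U k \<subseteq> U l" using dir[of j k] insert \<open>k \<in> J\<close> by auto
    ultimately show ?case by (intro bexI[of _ l]) auto
  qed
  show "emeasure M (\<Union>j\<in>J. U j) \<le> (SUP j\<in>J. emeasure M (U j))"
  proof (subst radon_open[OF M])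
    show "open (\<Union>j\<in>J. U j)" using op by auto
    show "(SUP K\<in>{K. compact K \<and> K \<subseteq> (\<Union>j\<in>J. U j)}. emeasure M K) \<le> (SUP j\<in>J. emeasure M (U j))"
    proof (rule SUP_least, clarify)
      fix K assume K: "compact K" "K \<subseteq> (\<Union>j\<in>J. U j)"
      then obtain F where F: "F \<subseteq> J" "finite F" "K \<subseteq> (\<Union>j\<in>F. U j)"
        using compactE_image[OF K(1), of J U] op by metis
      then obtain k where "k \<in> J" "K \<subseteq> U k" using fin[of F] by blast
      then show "emeasure M K \<le> (SUP j\<in>J. emeasure M (U j))"
        using op sM by (intro SUP_upper2[of k] emeasure_mono) auto
    qed
  qed
  show "(SUP j\<in>J. emeasure M (U j)) \<le> emeasure M (\<Union>j\<in>J. U j)"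
    using op sM by (intro SUP_least emeasure_mono) (auto intro!: borel_open open_UN)
qed

text \<open>A layer-cake sum with \<open>n * n\<close> layers of height \<open>1 / n\<close>,
  resolving values up to \<open>n\<close>. The strict inequality makes the level sets of a lower
  semicontinuous function open, so that its integral becomes a finite combination of measures of
  open sets.\<close>

definition level_step :: "nat \<Rightarrow> ennreal \<Rightarrow> ennreal" where
  "level_step n v = (\<Sum>k\<in>{1..n*n}. ennreal (1 / real n) * indicator {v. ennreal (real k / real n) < v} v)"

lemma card_less_nat:
  fixes w :: real assumes "w \<ge> 0"
  shows "real (card {k\<in>{1..N}. real k < w}) \<le> w" "real (card {k\<in>{1..N}. real k < w}) \<ge> min (real N) (w - 1)"
proof -
  have "{k\<in>{1..N}. real k < w} \<subseteq> {1..nat \<lfloor>w\<rfloor>}"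
  proof
    fix k assume "k \<in> {k\<in>{1..N}. real k < w}"
    then have "1 \<le> k" "real k < w" by auto
    then show "k \<in> {1..nat \<lfloor>w\<rfloor>}" by (auto simp: le_nat_iff le_floor_iff)
  qed
  then have "card {k\<in>{1..N}. real k < w} \<le> card {1..nat \<lfloor>w\<rfloor>}" by (intro card_mono) auto
  then have "real (card {k\<in>{1..N}. real k < w}) \<le> real (nat \<lfloor>w\<rfloor>)" by simp
  also have "\<dots> \<le> w" using assms by linarith
  finally show "real (card {k\<in>{1..N}. real k < w}) \<le> w" .
  have "{1..min N (nat (\<lceil>w\<rceil> - 1))} \<subseteq> {k\<in>{1..N}. real k < w}"
  proof
    fix k assume "k \<in> {1..min N (nat (\<lceil>w\<rceil> - 1))}"
    then have k: "1 \<le> k" "k \<le> N" "k \<le> nat (\<lceil>w\<rceil> - 1)" by auto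
    then have "int k \<le> \<lceil>w\<rceil> - 1" by linarith
    then have "real k < w" by linarith
    then show "k \<in> {k\<in>{1..N}. real k < w}" using k by auto
  qed
  then have "card {1..min N (nat (\<lceil>w\<rceil> - 1))} \<le> card {k\<in>{1..N}. real k < w}" by (intro card_mono) auto
  then have "real (min N (nat (\<lceil>w\<rceil> - 1))) \<le> real (card {k\<in>{1..N}. real k < w})" by simp
  moreover have "real (min N (nat (\<lceil>w\<rceil> - 1))) \<ge> min (real N) (w - 1)" by linarith
  ultimately show "real (card {k\<in>{1..N}. real k < w}) \<ge> min (real N) (w - 1)" by linarith
qed

lemma level_step_real:
  assumes "n > 0" "v \<ge> 0"
  shows "level_step n (ennreal v) = ennreal (real (card {k\<in>{1..n*n}. real k < v * n}) / n)"
proof -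
  have "level_step n (ennreal v) = (\<Sum>k\<in>{1..n*n}. ennreal (if real k < v * n then 1 / real n else 0))"
    unfolding level_step_def
    using assms by (intro sum.cong) (auto simp: indicator_def ennreal_less_iff divide_less_eq)
  also have "\<dots> = ennreal (\<Sum>k\<in>{1..n*n}. if real k < v * n then 1 / real n else 0)"
    by (intro sum_ennreal) auto
  also have "(\<Sum>k\<in>{1..n*n}. if real k < v * n then 1 / real n else 0) =
      (\<Sum>k\<in>{k\<in>{1..n*n}. real k < v * n}. 1 / real n)"
    by (rule sum.inter_filter[symmetric]) auto
  finally show ?thesis by simp
qed

lemma level_step_le: "level_step n v \<le> v"
proof (cases "n = 0")
  case True then show ?thesis by (simp add: level_step_def)
next
  case False
  show ?thesis
  proof (cases v)
    case (real r)
    then show ?thesis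
      using False card_less_nat(1)[of "r * n" "n*n"]
      by (simp add: level_step_real divide_le_eq)
  qed simp
qed

lemma level_step_tendsto: "(\<lambda>n. level_step n v) \<longlonglongrightarrow> v"
proof (cases v)
  case (real r)
  have "(\<lambda>n. real (card {k\<in>{1..n*n}. real k < r * n}) / n) \<longlonglongrightarrow> r"
  proof (rule tendsto_sandwich)
    show "eventually (\<lambda>n. min (real n) (r - 1 / n) \<le> real (card {k\<in>{1..n*n}. real k < r * n}) / n) sequentially"
      using eventually_gt_at_top[of 0]
    proof eventually_elim
      case (elim n)
      have "min (real (n*n)) (r * n - 1) \<le> real (card {k\<in>{1..n*n}. real k < r * n})"
        using card_less_nat(2)[of "r*n" "n*n"] real elim by simp
      moreover have "min (real n) (r - 1 / n) * n = min (real (n*n)) (r * n - 1)"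
        using elim by (auto simp: min_def field_simps)
      ultimately show ?case using elim by (simp add: le_divide_eq)
    qed
    show "eventually (\<lambda>n. real (card {k\<in>{1..n*n}. real k < r * n}) / n \<le> r) sequentially"
      using eventually_gt_at_top[of 0]
    proof eventually_elim
      case (elim n)
      then show ?case using card_less_nat(1)[of "r*n" "n*n"] real elim by (simp add: divide_le_eq)
    qed
    show "(\<lambda>n. min (real n) (r - 1 / n)) \<longlonglongrightarrow> r"
    proof -
      have "(\<lambda>n. r - 1 / real n) \<longlonglongrightarrow> r - 0" by (intro tendsto_intros lim_1_over_n)
      moreover have "eventually (\<lambda>n. r - 1 / real n = min (real n) (r - 1 / n)) sequentially"
        using eventually_ge_at_top[of "nat \<lceil>r\<rceil>"]
      proof eventually_elim
        case (elim n)
        have "r \<le> real n" using elim by linarith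
        moreover have "0 \<le> 1 / real n" by simp
        ultimately show ?case by linarith
      qed
      ultimately show ?thesis using Lim_transform_eventually by fastforce
    qed
  qed simp
  then have "(\<lambda>n. ennreal (real (card {k\<in>{1..n*n}. real k < r * n}) / n)) \<longlonglongrightarrow> v"
    using real by (auto intro: tendsto_ennrealI)
  moreover have "eventually (\<lambda>n. ennreal (real (card {k\<in>{1..n*n}. real k < r * n}) / n) = level_step n v) sequentially"
    using eventually_gt_at_top[of 0] by eventually_elim (use real in \<open>auto simp: level_step_real\<close>)
  ultimately show ?thesis by (rule Lim_transform_eventually)
next
  case top
  have "eventually (\<lambda>n. ennreal (real n) = level_step n v) sequentially"
    using eventually_gt_at_top[of 0]
  proof eventually_elim
    case (elim n)
    have "level_step n v = (\<Sum>k\<in>{1..n*n}. ennreal (1 / real n))"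
      unfolding level_step_def using top by (intro sum.cong) auto
    also have "\<dots> = ennreal (\<Sum>k\<in>{1..n*n}. 1 / real n)" by (intro sum_ennreal) auto
    finally show ?case using elim by simp
  qed
  moreover have "(\<lambda>n. ennreal (real n)) \<longlonglongrightarrow> \<top>"
    by (rule ennreal_tendsto_top_eq_at_top[THEN iffD2]) (rule filterlim_real_sequentially)
  ultimately show ?thesis using top Lim_transform_eventually by fastforce
qed

lemma nn_integral_level_step:
  assumes "sets M = sets borel" "lsc f"
  shows "(\<integral>\<^sup>+x. level_step n (f x) \<partial>M) =
     (\<Sum>k\<in>{1..n*n}. ennreal (1 / real n) * emeasure M {x. ennreal (real k / real n) < f x})"
proof -
  have ms: "{x. t < f x} \<in> sets M" for t
    using assms by (auto simp: lsc_def)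
  have eq: "indicator {v. t < v} (f x) = (indicator {x. t < f x} x :: ennreal)" for t x
    by (auto simp: indicator_def)
  show ?thesis
    unfolding level_step_def eq
    using ms by (subst nn_integral_sum) (auto simp: nn_integral_cmult_indicator intro!: borel_measurable_times borel_measurable_indicator)
qed

text \<open>The step sums are not monotone in \<open>n\<close>; Fatou's lemma applied to their
  pointwise limit takes the place of monotone convergence.\<close>

lemma nn_integral_level_step_SUP:
  assumes s: "sets M = sets borel" and f: "lsc f"
  shows "(\<integral>\<^sup>+x. f x \<partial>M) = (SUP n. \<integral>\<^sup>+x. level_step n (f x) \<partial>M)"
proof (rule antisym)
  have [measurable]: "f \<in> borel_measurable M" using lsc_measurable[OF f] s
    by (simp add: measurable_cong_sets[OF s refl])
  have [measurable]: "level_step n \<in> borel_measurable borel" for n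
    unfolding level_step_def by measurable
  have "(\<integral>\<^sup>+x. f x \<partial>M) = (\<integral>\<^sup>+x. liminf (\<lambda>n. level_step n (f x)) \<partial>M)"
    by (intro nn_integral_cong) (simp add: lim_imp_Liminf[OF trivial_limit_sequentially level_step_tendsto])
  also have "\<dots> \<le> liminf (\<lambda>n. \<integral>\<^sup>+x. level_step n (f x) \<partial>M)"
    by (rule nn_integral_liminf) measurable
  also have "\<dots> \<le> (SUP n. \<integral>\<^sup>+x. level_step n (f x) \<partial>M)"
    unfolding liminf_SUP_INF by (intro SUP_mono) (auto intro: INF_lower)
  finally show "(\<integral>\<^sup>+x. f x \<partial>M) \<le> (SUP n. \<integral>\<^sup>+x. level_step n (f x) \<partial>M)" .
  show "(SUP n. \<integral>\<^sup>+x. level_step n (f x) \<partial>M) \<le> (\<integral>\<^sup>+x. f x \<partial>M)"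
    by (intro SUP_least nn_integral_mono level_step_le)
qed

text \<open>For a directed family of lower semicontinuous functions, monotone convergence holds without
  any countability: it holds for open sets by compactness and inner regularity.\<close>
lemma radon_directed_SUP:
  fixes f :: "'j \<Rightarrow> 'a::t2_space \<Rightarrow> ennreal"
  assumes M: "radon M" and ne: "J \<noteq> {}" and lsc: "\<And>j. j \<in> J \<Longrightarrow> lsc (f j)"
    and dir: "\<And>i j. i \<in> J \<Longrightarrow> j \<in> J \<Longrightarrow> \<exists>k\<in>J. \<forall>x. f i x \<le> f k x \<and> f j x \<le> f k x"
  shows "(\<integral>\<^sup>+x. (SUP j\<in>J. f j x) \<partial>M) = (SUP j\<in>J. \<integral>\<^sup>+x. f j x \<partial>M)"
proof -
  have s: "sets M = sets borel" using M by (rule radon_sets)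
  have L: "lsc (\<lambda>x. SUP j\<in>J. f j x)" using lsc by (rule lsc_SUP)
  have em: "emeasure M {x. t < (SUP j\<in>J. f j x)} = (SUP j\<in>J. emeasure M {x. t < f j x})" for t
  proof -
    have "{x. t < (SUP j\<in>J. f j x)} = (\<Union>j\<in>J. {x. t < f j x})" by (auto simp: less_SUP_iff)
    also have "emeasure M \<dots> = (SUP j\<in>J. emeasure M {x. t < f j x})"
    proof (rule radon_directed_Union[OF M ne])
      show "open {x. t < f j x}" if "j \<in> J" for j using lsc[OF that] by (auto simp: lsc_def)
      fix i j assume "i \<in> J" "j \<in> J"
      then obtain k where "k \<in> J" "\<forall>x. f i x \<le> f k x \<and> f j x \<le> f k x" using dir by blast
      then show "\<exists>k\<in>J. {x. t < f i x} \<subseteq> {x. t < f k x} \<and> {x. t < f j x} \<subseteq> {x. t < f k x}"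
        by (intro bexI[of _ k]) (auto intro: less_le_trans)
    qed
    finally show ?thesis .
  qed
  have "(\<integral>\<^sup>+x. level_step n (SUP j\<in>J. f j x) \<partial>M) = (SUP j\<in>J. \<integral>\<^sup>+x. level_step n (f j x) \<partial>M)" for n
  proof -
    have "(\<integral>\<^sup>+x. level_step n (SUP j\<in>J. f j x) \<partial>M) =
        (\<Sum>k\<in>{1..n*n}. SUP j\<in>J. ennreal (1 / real n) * emeasure M {x. ennreal (real k / real n) < f j x})"
      by (simp add: nn_integral_level_step[OF s L] em SUP_mult_left_ennreal)
    also have "\<dots> = (SUP j\<in>J. \<Sum>k\<in>{1..n*n}. ennreal (1 / real n) * emeasure M {x. ennreal (real k / real n) < f j x})"
    proof (rule SUP_sum_directed_ennreal[symmetric])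
      fix i j assume "i \<in> J" "j \<in> J"
      then obtain k where k: "k \<in> J" "\<forall>x. f i x \<le> f k x \<and> f j x \<le> f k x" using dir by blast
      have "emeasure M {x. t < f i x} \<le> emeasure M {x. t < f k x}"
           "emeasure M {x. t < f j x} \<le> emeasure M {x. t < f k x}" for t
        using k lsc[OF k(1)] by (auto simp: s lsc_def intro!: emeasure_mono intro: less_le_trans)
      then show "\<exists>k\<in>J. \<forall>n'. ennreal (1 / real n) * emeasure M {x. ennreal (real n' / real n) < f i x}
               \<le> ennreal (1 / real n) * emeasure M {x. ennreal (real n' / real n) < f k x} \<and>
               ennreal (1 / real n) * emeasure M {x. ennreal (real n' / real n) < f j x}
               \<le> ennreal (1 / real n) * emeasure M {x. ennreal (real n' / real n) < f k x}"
        using k(1) by (intro bexI[of _ k]) (auto intro!: mult_left_mono)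
    qed (use ne in auto)
    also have "\<dots> = (SUP j\<in>J. \<integral>\<^sup>+x. level_step n (f j x) \<partial>M)"
      by (intro SUP_cong refl) (simp add: nn_integral_level_step[OF s lsc])
    finally show ?thesis .
  qed
  then have "(\<integral>\<^sup>+x. (SUP j\<in>J. f j x) \<partial>M) = (SUP n. SUP j\<in>J. \<integral>\<^sup>+x. level_step n (f j x) \<partial>M)"
    by (simp add: nn_integral_level_step_SUP[OF s L])
  also have "\<dots> = (SUP j\<in>J. SUP n. \<integral>\<^sup>+x. level_step n (f j x) \<partial>M)" by (rule SUP_commute)
  also have "\<dots> = (SUP j\<in>J. \<integral>\<^sup>+x. f j x \<partial>M)"
    by (intro SUP_cong refl) (simp add: nn_integral_level_step_SUP[OF s lsc])
  finally show ?thesis .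
qed

section \<open>The Riesz representation theorem\<close>

lemma Ccp_measurable: "\<phi> \<in> Ccp \<Longrightarrow> \<phi> \<in> borel_measurable borel"
  by (intro borel_measurable_continuous_onI Ccp_cont)

lemma Ccp_integrable:
  fixes M :: "'a::t2_space measure"
  assumes sM: "sets M = sets borel" and fin: "\<And>K. compact K \<Longrightarrow> emeasure M K < \<top>" and \<phi>: "\<phi> \<in> Ccp"
  shows "integrable M \<phi>"
proof -
  obtain K where K: "compact K" "\<And>x. x \<notin> K \<Longrightarrow> \<phi> x = 0" using CcpE[OF \<phi>] by metis
  obtain C where C: "C \<ge> 0" "\<And>x. \<phi> x \<le> C" using Ccp_bounded[OF \<phi>] by metis
  have m: "\<phi> \<in> borel_measurable M"
    using Ccp_measurable[OF \<phi>] by (simp add: measurable_cong_sets[OF sM refl])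
  have Ks: "K \<in> sets M" using K(1) sM by (simp add: compact_imp_closed)
  have "integrable M (\<lambda>x. C * indicator K x :: real)"
    using Ks fin[OF K(1)] by auto
  then show ?thesis
    using m by (rule Bochner_Integration.integrable_bound)
      (use C K Ccp_nonneg[OF \<phi>] in \<open>auto simp: indicator_def\<close>)
qed

lemma radon_integrable:
  fixes M :: "'a::t2_space measure"
  shows "radon M \<Longrightarrow> \<phi> \<in> Ccp \<Longrightarrow> integrable M \<phi>"
  by (intro Ccp_integrable) (auto simp: radon_def)

lemma radon_nn_integral:
  fixes M :: "'a::t2_space measure"
  shows "radon M \<Longrightarrow> \<phi> \<in> Ccp \<Longrightarrow> (\<integral>\<^sup>+x. ennreal (\<phi> x) \<partial>M) = ennreal (integral\<^sup>L M \<phi>)"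
  by (intro nn_integral_eq_integral radon_integrable) (auto simp: Ccp_nonneg)

locale pos_functional =
  fixes \<Lambda> :: "('a::t2_space \<Rightarrow> real) \<Rightarrow> real"
  assumes lc: "locally_compact_space (euclidean :: 'a topology)"
    and pos: "\<And>\<phi>. \<phi> \<in> Ccp \<Longrightarrow> 0 \<le> \<Lambda> \<phi>"
    and add: "\<And>\<phi> \<psi>. \<phi> \<in> Ccp \<Longrightarrow> \<psi> \<in> Ccp \<Longrightarrow> \<Lambda> (\<lambda>x. \<phi> x + \<psi> x) = \<Lambda> \<phi> + \<Lambda> \<psi>"
    and hom: "\<And>\<phi> c. \<phi> \<in> Ccp \<Longrightarrow> 0 \<le> c \<Longrightarrow> \<Lambda> (\<lambda>x. c * \<phi> x) = c * \<Lambda> \<phi>"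
begin

lemma mono: "\<phi> \<in> Ccp \<Longrightarrow> \<psi> \<in> Ccp \<Longrightarrow> (\<And>x. \<phi> x \<le> \<psi> x) \<Longrightarrow> \<Lambda> \<phi> \<le> \<Lambda> \<psi>"
proof -
  assume a: "\<phi> \<in> Ccp" "\<psi> \<in> Ccp" "\<And>x. \<phi> x \<le> \<psi> x"
  have d: "(\<lambda>x. \<psi> x - \<phi> x) \<in> Ccp" using a by (intro Ccp_diff)
  have "\<Lambda> \<psi> = \<Lambda> \<phi> + \<Lambda> (\<lambda>x. \<psi> x - \<phi> x)" using add[OF a(1) d] by simp
  then show ?thesis using pos[OF d] by simp
qed

lemma zero: "\<Lambda> (\<lambda>x. 0) = 0"
  using hom[of "\<lambda>x. 0" 0] by simp

definition below :: "'a set \<Rightarrow> ('a \<Rightarrow> real) set" where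
  "below U = {\<phi>\<in>Ccp. (\<forall>x. \<phi> x \<le> 1) \<and> (\<exists>K. compact K \<and> K \<subseteq> U \<and> (\<forall>x. x \<notin> K \<longrightarrow> \<phi> x = 0))}"

definition content :: "'a set \<Rightarrow> ennreal" where
  "content U = (SUP \<phi>\<in>below U. ennreal (\<Lambda> \<phi>))"

definition outer :: "'a set \<Rightarrow> ennreal" where
  "outer E = (INF U\<in>{U. open U \<and> E \<subseteq> U}. content U)"

lemma zero_below [simp]: "(\<lambda>x. 0) \<in> below U"
  by (auto simp: below_def intro: exI[of _ "{}"])

lemma below_mono: "U \<subseteq> V \<Longrightarrow> below U \<subseteq> below V"
  by (auto simp: below_def)

lemma content_mono: "U \<subseteq> V \<Longrightarrow> content U \<le> content V"
  unfolding content_def by (intro SUP_subset_mono below_mono) auto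

lemma content_empty: "content {} = 0"
proof -
  have "\<phi> = (\<lambda>x. 0)" if "\<phi> \<in> below {}" for \<phi> using that by (auto simp: below_def)
  then have "below {} = {\<lambda>x. 0}" by auto
  then show ?thesis by (simp add: content_def zero)
qed

lemma outer_open: "open U \<Longrightarrow> outer U = content U"
  unfolding outer_def by (intro antisym INF_lower INF_greatest content_mono) auto

lemma outer_mono: "E \<subseteq> F \<Longrightarrow> outer E \<le> outer F"
  unfolding outer_def by (intro INF_superset_mono) auto

text \<open>A test function below the union is split by a cutoff: \<open>w * \<phi>\<close> is
  supported in \<open>U\<close>, and the remaining part vanishes where \<open>u\<close> exceeds 1/2,
  hence off the compact set \<open>K - W\<close>, which lies in \<open>V\<close>.\<close>

lemma content_Un:
  assumes "open U" "open V"
  shows "content (U \<union> V) \<le> content U + content V"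
  unfolding content_def[of "U \<union> V"]
proof (rule SUP_least)
  fix \<phi> assume \<phi>: "\<phi> \<in> below (U \<union> V)"
  obtain K where K: "compact K" "K \<subseteq> U \<union> V" "\<And>x. x \<notin> K \<Longrightarrow> \<phi> x = 0"
    using \<phi> by (auto simp: below_def)
  have \<phi>C: "\<phi> \<in> Ccp" "\<And>x. 0 \<le> \<phi> x" "\<And>x. \<phi> x \<le> 1" using \<phi> by (auto simp: below_def Ccp_nonneg)
  have c1: "compact (K - V)" using K assms by (intro compact_diff)
  obtain u L where u: "u \<in> Ccp" "\<And>x. u x \<le> 1" "\<And>x. x \<in> K - V \<Longrightarrow> u x = 1"
    "compact L" "L \<subseteq> U" "\<And>x. x \<notin> L \<Longrightarrow> u x = 0"
    using Urysohn_Cc[OF lc c1 assms(1)] K by blast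
  \<comment> \<open>\<open>u\<close> need not be 1 on a neighbourhood of \<open>K - V\<close>, so it is doubled and truncated.\<close>
  define w where "w x = min 1 (2 * u x)" for x
  have uc: "continuous_on UNIV u" using u(1) by (rule Ccp_cont)
  have wc: "continuous_on UNIV w" unfolding w_def by (intro continuous_intros uc)
  have w01: "0 \<le> w x" "w x \<le> 1" for x using Ccp_nonneg[OF u(1), of x] by (auto simp: w_def)
  define W where "W = {x. u x > 1/2}"
  have oW: "open W" unfolding W_def using uc by (intro open_Collect_less) (auto intro: continuous_intros)
  have "compact (K - W)" using K oW by (intro compact_diff)
  define \<phi>1 where "\<phi>1 x = w x * \<phi> x" for x
  define \<phi>2 where "\<phi>2 x = (1 - w x) * \<phi> x" for x
  have C1: "\<phi>1 \<in> Ccp" "\<phi>2 \<in> Ccp"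
    unfolding \<phi>1_def \<phi>2_def using w01 by (auto intro!: Ccp_mult \<phi>C continuous_intros wc)
  have "\<phi>1 \<in> below U"
  proof -
    have "\<phi>1 x \<le> 1" for x unfolding \<phi>1_def using w01[of x] \<phi>C(2,3)[of x] by (simp add: mult_le_one)
    moreover have "\<phi>1 x = 0" if "x \<notin> L" for x using u(6)[OF that] by (simp add: \<phi>1_def w_def)
    ultimately show ?thesis using C1 u by (auto simp: below_def)
  qed
  moreover have "\<phi>2 \<in> below V"
  proof -
    have "\<phi>2 x \<le> 1" for x unfolding \<phi>2_def using w01[of x] \<phi>C(2,3)[of x] by (simp add: mult_le_one)
    moreover have "\<phi>2 x = 0" if "x \<notin> K - W" for x
      using that K(3)[of x] by (auto simp: \<phi>2_def w_def W_def)
    moreover have "K - W \<subseteq> V" using u(3) by (force simp: W_def)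
    ultimately show ?thesis using C1 \<open>compact (K - W)\<close> by (auto simp: below_def)
  qed
  moreover have "\<Lambda> \<phi> = \<Lambda> \<phi>1 + \<Lambda> \<phi>2"
    using add[OF C1] by (simp add: \<phi>1_def \<phi>2_def algebra_simps)
  ultimately have "ennreal (\<Lambda> \<phi>) = ennreal (\<Lambda> \<phi>1) + ennreal (\<Lambda> \<phi>2)"
    using C1 pos by (simp add: ennreal_plus)
  also have "\<dots> \<le> content U + content V"
    unfolding content_def using \<open>\<phi>1 \<in> below U\<close> \<open>\<phi>2 \<in> below V\<close> by (intro add_mono SUP_upper)
  finally show "ennreal (\<Lambda> \<phi>) \<le> content U + content V" .
qed

lemma content_finite_UN:
  "(\<And>i. open (U i)) \<Longrightarrow> content (\<Union>i<(n::nat). U i) \<le> (\<Sum>i<n. content (U i))"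
proof (induction n)
  case 0
  then show ?case by (simp add: content_empty)
next
  case (Suc n)
  have "(\<Union>i<Suc n. U i) = (\<Union>i<n. U i) \<union> U n" by (auto simp: lessThan_Suc)
  then have "content (\<Union>i<Suc n. U i) \<le> content (\<Union>i<n. U i) + content (U n)"
    using content_Un[of "\<Union>i<n. U i" "U n"] Suc.prems open_UN[of "{..<n}" U] by auto
  also have "\<dots> \<le> (\<Sum>i<n. content (U i)) + content (U n)" using Suc by (intro add_mono) auto
  finally show ?case by simp
qed

text \<open>The compact support of a test function meets the union already in finitely many of the
  sets.\<close>

lemma content_UN:
  assumes op: "\<And>i::nat. open (U i)"
  shows "content (\<Union>i. U i) \<le> (\<Sum>i. content (U i))"
  unfolding content_def[of "\<Union>i. U i"]
proof (rule SUP_least)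
  fix \<phi> assume \<phi>: "\<phi> \<in> below (\<Union>i. U i)"
  obtain K where K: "compact K" "K \<subseteq> (\<Union>i. U i)" "\<And>x. x \<notin> K \<Longrightarrow> \<phi> x = 0"
    using \<phi> by (auto simp: below_def)
  obtain F where F: "finite F" "K \<subseteq> (\<Union>i\<in>F. U i)"
    using compactE_image[OF K(1), of UNIV U] op K by metis
  obtain n where n: "F \<subseteq> {..<n}" using finite_nat_bounded[OF F(1)] by auto
  have "K \<subseteq> (\<Union>i<n. U i)" using F n by blast
  then have "\<phi> \<in> below (\<Union>i<n. U i)" using \<phi> K unfolding below_def by blast
  then have "ennreal (\<Lambda> \<phi>) \<le> content (\<Union>i<n. U i)" unfolding content_def by (rule SUP_upper)
  also have "\<dots> \<le> (\<Sum>i<n. content (U i))" by (rule content_finite_UN) (rule op)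
  also have "\<dots> \<le> (\<Sum>i. content (U i))" by (intro sum_le_suminf) auto
  finally show "ennreal (\<Lambda> \<phi>) \<le> (\<Sum>i. content (U i))" .
qed

lemma outer_subadditive: "outer (\<Union>i. E i) \<le> (\<Sum>i::nat. outer (E i))"
proof (rule ennreal_le_epsilon)
  fix e :: real assume fin: "(\<Sum>i. outer (E i)) < \<top>" and e: "0 < e"
  have "\<exists>U. open U \<and> E i \<subseteq> U \<and> content U \<le> outer (E i) + ennreal (e * (1/2)^Suc i)" for i
  proof -
    have "outer (E i) < \<top>" using fin ennreal_suminf_lessD by fastforce
    then have "outer (E i) < outer (E i) + ennreal (e * (1/2)^Suc i)"
      using e by (cases "outer (E i)") (auto simp flip: ennreal_plus simp: ennreal_less_iff)
    then show ?thesis unfolding outer_def[of "E i"] INF_less_iff by (auto intro: less_imp_le)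
  qed
  then obtain U where U: "\<And>i. open (U i)" "\<And>i. E i \<subseteq> U i"
      "\<And>i. content (U i) \<le> outer (E i) + ennreal (e * (1/2)^Suc i)" by metis
  have "outer (\<Union>i. E i) \<le> content (\<Union>i. U i)"
    unfolding outer_def using U by (intro INF_lower) auto
  also have "\<dots> \<le> (\<Sum>i. content (U i))" by (rule content_UN) (rule U)
  also have "\<dots> \<le> (\<Sum>i. outer (E i) + ennreal (e * (1/2)^Suc i))" by (intro suminf_le U) auto
  also have "\<dots> = (\<Sum>i. outer (E i)) + (\<Sum>i. ennreal (e * (1/2)^Suc i))" by (intro suminf_add[symmetric]) auto
  also have "(\<Sum>i. ennreal (e * (1/2)^Suc i)) = ennreal e"
  proof -
    have "(\<lambda>i. e * (1/2)^Suc i) sums e" using sums_mult[OF power_half_series, of e] by simp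
    then show ?thesis using e by (intro suminf_ennreal_eq) auto
  qed
  finally show "outer (\<Union>i. E i) \<le> (\<Sum>i. outer (E i)) + ennreal e" .
qed

lemma outer_measure_space: "outer_measure_space (Pow UNIV) outer"
  unfolding outer_measure_space_def positive_def increasing_def countably_subadditive_def
  using outer_open[of "{}"] content_empty outer_mono outer_subadditive by auto

text \<open>Take \<open>\<phi>\<close> below \<open>V \<inter> U\<close> with compact support
  \<open>K\<close>. The open set \<open>V - K\<close> still contains \<open>E - U\<close>, and for
  every \<open>\<psi>\<close> below \<open>V - K\<close> the sum \<open>\<phi> + \<psi>\<close> is
  below \<open>V\<close>, the supports being disjoint. Taking suprema over \<open>\<psi>\<close> and
  then over \<open>\<phi>\<close> gives the splitting.\<close>

lemma open_caratheodory:
  assumes U: "open U"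
  shows "outer (E \<inter> U) + outer (E - U) \<le> outer E"
  unfolding outer_def[of E]
proof (rule INF_greatest, clarify)
  fix V assume V: "open V" "E \<subseteq> V"
  have "ennreal (\<Lambda> \<phi>) + outer (E - U) \<le> content V" if \<phi>: "\<phi> \<in> below (V \<inter> U)" for \<phi>
  proof -
    obtain K where K: "compact K" "K \<subseteq> V \<inter> U" "\<And>x. x \<notin> K \<Longrightarrow> \<phi> x = 0"
      using \<phi> by (auto simp: below_def)
    have oVK: "open (V - K)" using V K by (intro open_Diff compact_imp_closed)
    have "outer (E - U) \<le> content (V - K)"
      unfolding outer_def using V K oVK by (intro INF_lower) auto
    then have "ennreal (\<Lambda> \<phi>) + outer (E - U) \<le> ennreal (\<Lambda> \<phi>) + content (V - K)" by (intro add_mono) auto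
    also have "\<dots> = (SUP \<psi>\<in>below (V - K). ennreal (\<Lambda> \<phi>) + ennreal (\<Lambda> \<psi>))"
      unfolding content_def using zero_below by (intro ennreal_SUP_add_right) blast
    also have "\<dots> \<le> content V"
    proof (rule SUP_least)
      fix \<psi> assume \<psi>: "\<psi> \<in> below (V - K)"
      obtain L where L: "compact L" "L \<subseteq> V - K" "\<And>x. x \<notin> L \<Longrightarrow> \<psi> x = 0"
        using \<psi> by (auto simp: below_def)
      have C: "\<phi> \<in> Ccp" "\<psi> \<in> Ccp" using \<phi> \<psi> by (auto simp: below_def)
      have "\<phi> x + \<psi> x \<le> 1" for x
        using \<phi> \<psi> K(3)[of x] L(2) L(3)[of x] by (cases "x \<in> K") (auto simp: below_def)
      moreover have "\<phi> x + \<psi> x = 0" if "x \<notin> K \<union> L" for x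
        using K(3)[of x] L(3)[of x] that by auto
      moreover have "compact (K \<union> L)" "K \<union> L \<subseteq> V" using K L by auto
      ultimately have "(\<lambda>x. \<phi> x + \<psi> x) \<in> below V"
        using Ccp_add[OF C] unfolding below_def by blast
      then have "ennreal (\<Lambda> (\<lambda>x. \<phi> x + \<psi> x)) \<le> content V"
        unfolding content_def by (rule SUP_upper)
      then show "ennreal (\<Lambda> \<phi>) + ennreal (\<Lambda> \<psi>) \<le> content V"
        using add[OF C] pos C by (simp add: ennreal_plus)
    qed
    finally show ?thesis .
  qed
  then have "(SUP \<phi>\<in>below (V \<inter> U). ennreal (\<Lambda> \<phi>) + outer (E - U)) \<le> content V"
    by (rule SUP_least)
  moreover have "(SUP \<phi>\<in>below (V \<inter> U). ennreal (\<Lambda> \<phi>) + outer (E - U)) = content (V \<inter> U) + outer (E - U)"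
    unfolding content_def using zero_below by (intro ennreal_SUP_add_left) blast
  moreover have "outer (E \<inter> U) \<le> content (V \<inter> U)"
    using V outer_open[OF open_Int[OF V(1) U]] outer_mono[of "E \<inter> U" "V \<inter> U"] by auto
  ultimately show "outer (E \<inter> U) + outer (E - U) \<le> content V"
    by (metis add_right_mono order_trans)
qed

definition RM :: "'a measure" where
  "RM = measure_of UNIV (sets borel) outer"

lemma sets_RM [simp, measurable_cong]: "sets RM = sets borel"
  unfolding RM_def by (metis sets.sigma_sets_eq sets_measure_of space_borel subset_Pow_Union Pow_UNIV subset_UNIV)

text \<open>\<open>outer\<close> is a measure on the sets satisfying the Caratheodory condition, and
  these contain the open sets, hence all Borel sets.\<close>

lemma emeasure_RM: "B \<in> sets borel \<Longrightarrow> emeasure RM B = outer B"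
proof -
  assume B: "B \<in> sets borel"
  define L where "L = lambda_system UNIV (Pow UNIV) outer"
  have ms: "measure_space UNIV L outer"
    unfolding L_def using sigma_algebra.caratheodory_lemma[OF sigma_algebra_Pow outer_measure_space] .
  have "open U \<Longrightarrow> U \<in> L" for U
  proof -
    assume U: "open U"
    have "outer (E \<inter> U) + outer (E - U) = outer E" for E
    proof (rule antisym[OF open_caratheodory[OF U]])
      have "outer E \<le> outer (\<Union>i::nat. if i = 0 then E \<inter> U else if i = 1 then E - U else {})"
        by (rule outer_mono) (auto split: if_splits)
      also have "\<dots> \<le> (\<Sum>i. outer (if i = 0 then E \<inter> U else if i = 1 then E - U else {}))"
        by (rule outer_subadditive)
      also have "\<dots> = (\<Sum>i\<in>{0,1::nat}. outer (if i = 0 then E \<inter> U else if i = 1 then E - U else {}))"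
        using outer_open[of "{}"] content_empty by (intro suminf_finite) auto
      finally show "outer E \<le> outer (E \<inter> U) + outer (E - U)" by simp
    qed
    then show "U \<in> L" unfolding L_def lambda_system_def
      by (auto simp: Int_commute Diff_eq)
  qed
  moreover have "sigma_algebra UNIV L" using ms by (simp add: measure_space_def)
  ultimately have "sigma_sets UNIV {S. open S} \<subseteq> L"
    by (intro sigma_algebra.sigma_sets_subset) auto
  moreover have "sets (borel::'a measure) = sigma_sets UNIV {S. open S}"
    unfolding borel_def by (rule sets_measure_of) simp
  ultimately have sub: "sets borel \<subseteq> L" by simp
  show ?thesis
  proof (rule emeasure_measure_of[OF RM_def])
    show "sets borel \<subseteq> Pow UNIV" by auto
    show "B \<in> sets RM" using B by simp
    show "positive (sets RM) outer" using ms by (auto simp: measure_space_def positive_def)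
    show "countably_additive (sets RM) outer"
    proof -
      have "countably_additive L outer" using ms by (simp add: measure_space_def)
      then show ?thesis using sub unfolding countably_additive_def by (metis order_trans sets_RM subsetD)
    qed
  qed
qed

text \<open>For \<open>a < 1\<close> the open set where \<open>\<phi> > a\<close> contains
  \<open>B\<close>, and every test function below it is at most \<open>\<phi> / a\<close>. Then
  \<open>a\<close> tends to 1.\<close>

lemma RM_le:
  assumes B: "B \<in> sets borel" and \<phi>: "\<phi> \<in> Ccp" and ge: "\<And>x. x \<in> B \<Longrightarrow> 1 \<le> \<phi> x"
  shows "emeasure RM B \<le> ennreal (\<Lambda> \<phi>)"
proof -
  have *: "emeasure RM B \<le> ennreal (\<Lambda> \<phi> / a)" if a: "0 < a" "a < 1" for a
  proof -
    have "open {x. a < \<phi> x}" using Ccp_cont[OF \<phi>] by (intro open_Collect_less) (auto intro: continuous_intros)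
    moreover have "B \<subseteq> {x. a < \<phi> x}" using ge a by force
    ultimately have "emeasure RM B \<le> content {x. a < \<phi> x}"
      unfolding emeasure_RM[OF B] outer_def by (intro INF_lower) auto
    also have "\<dots> \<le> ennreal (\<Lambda> \<phi> / a)"
      unfolding content_def
    proof (rule SUP_least)
      fix \<psi> assume \<psi>: "\<psi> \<in> below {x. a < \<phi> x}"
      have "\<psi> x \<le> 1 / a * \<phi> x" for x
      proof (cases "a < \<phi> x")
        case True
        then have "1 \<le> 1 / a * \<phi> x" using a by (simp add: field_simps)
        moreover have "\<psi> x \<le> 1" using \<psi> by (simp add: below_def)
        ultimately show ?thesis by linarith
      next
        case False
        then have "\<psi> x = 0" using \<psi> by (auto simp: below_def)
        then show ?thesis using a Ccp_nonneg[OF \<phi>, of x] by simp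
      qed
      then have "\<Lambda> \<psi> \<le> \<Lambda> (\<lambda>x. 1 / a * \<phi> x)"
        using \<psi> \<phi> a by (intro mono Ccp_scale) (auto simp: below_def)
      also have "\<dots> = \<Lambda> \<phi> / a" using hom[OF \<phi>, of "1 / a"] a by simp
      finally show "ennreal (\<Lambda> \<psi>) \<le> ennreal (\<Lambda> \<phi> / a)" by (rule ennreal_leI)
    qed
    finally show ?thesis .
  qed
  have "((\<lambda>a. ennreal (\<Lambda> \<phi> / a)) \<longlongrightarrow> ennreal (\<Lambda> \<phi> / 1)) (at_left 1)"
    by (intro tendsto_intros tendsto_ennrealI) auto
  moreover have "eventually (\<lambda>a. emeasure RM B \<le> ennreal (\<Lambda> \<phi> / a)) (at_left 1)"
    using eventually_at_left_real[of 0 1] by (auto elim!: eventually_mono intro: *)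
  ultimately have "emeasure RM B \<le> ennreal (\<Lambda> \<phi> / 1)"
    by (intro tendsto_lowerbound[of _ _ "at_left (1::real)"]) auto
  then show ?thesis by simp
qed

lemma RM_ge:
  assumes K: "compact K" and \<phi>: "\<phi> \<in> Ccp" and le: "\<And>x. \<phi> x \<le> 1" and z: "\<And>x. x \<notin> K \<Longrightarrow> \<phi> x = 0"
  shows "ennreal (\<Lambda> \<phi>) \<le> emeasure RM K"
proof -
  have "K \<in> sets borel" using K by (simp add: compact_imp_closed)
  moreover have "ennreal (\<Lambda> \<phi>) \<le> content U" if "open U" "K \<subseteq> U" for U
    unfolding content_def using assms that by (intro SUP_upper) (auto simp: below_def)
  ultimately show ?thesis unfolding emeasure_RM[OF \<open>K \<in> sets borel\<close>] outer_def by (auto intro!: INF_greatest)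
qed

lemma RM_finite: "compact K \<Longrightarrow> emeasure RM K < \<top>"
proof -
  assume K: "compact K"
  obtain \<phi> where "\<phi> \<in> Ccp" "\<And>x. x \<in> K \<Longrightarrow> \<phi> x = 1"
    using Urysohn_Cc[OF lc K open_UNIV subset_UNIV] by metis
  then have "emeasure RM K \<le> ennreal (\<Lambda> \<phi>)" using K by (intro RM_le) (auto simp: compact_imp_closed)
  then show ?thesis by (simp add: le_less_trans)
qed

lemma radon_RM: "radon RM"
  unfolding radon_def
proof (intro conjI allI impI ballI)
  show "sets RM = sets borel" by simp
  show "compact K \<Longrightarrow> emeasure RM K < \<top>" for K by (rule RM_finite)
  show "emeasure RM U = (SUP K\<in>{K. compact K \<and> K \<subseteq> U}. emeasure RM K)" if U: "open U" for U
  proof (rule antisym)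
    have "emeasure RM U = content U" using U by (simp add: emeasure_RM outer_open)
    also have "\<dots> \<le> (SUP K\<in>{K. compact K \<and> K \<subseteq> U}. emeasure RM K)"
      unfolding content_def
    proof (rule SUP_least)
      fix \<phi> assume "\<phi> \<in> below U"
      then obtain K where K: "compact K" "K \<subseteq> U" "\<And>x. x \<notin> K \<Longrightarrow> \<phi> x = 0" "\<phi> \<in> Ccp" "\<And>x. \<phi> x \<le> 1"
        by (auto simp: below_def)
      then have "ennreal (\<Lambda> \<phi>) \<le> emeasure RM K" by (intro RM_ge)
      then show "ennreal (\<Lambda> \<phi>) \<le> (SUP K\<in>{K. compact K \<and> K \<subseteq> U}. emeasure RM K)"
        using K by (intro SUP_upper2[of K]) auto
    qed
    finally show "emeasure RM U \<le> (SUP K\<in>{K. compact K \<and> K \<subseteq> U}. emeasure RM K)" .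
    show "(SUP K\<in>{K. compact K \<and> K \<subseteq> U}. emeasure RM K) \<le> emeasure RM U"
      using U by (intro SUP_least emeasure_mono) auto
  qed
  show "emeasure RM B = (INF U\<in>{U. open U \<and> B \<subseteq> U}. emeasure RM U)" if "B \<in> sets borel" for B
    unfolding emeasure_RM[OF that] outer_def
    by (intro INF_cong) (auto simp: emeasure_RM outer_open[unfolded outer_def] outer_open)
qed

text \<open>\<open>\<phi>\<close> is cut into horizontal slices \<open>s k\<close> of thickness
  \<open>e\<close>. Each slice lies between \<open>e\<close> times the indicators of
  \<open>B (Suc k)\<close> and \<open>B k\<close>, so \<open>\<Lambda> \<phi>\<close> and the
  integral lie between the same two sums; the difference of these sums telescopes.\<close>

lemma RM_slices:
  assumes \<phi>: "\<phi> \<in> Ccp" and S: "compact S" "\<And>x. x \<notin> S \<Longrightarrow> \<phi> x = 0" and e: "e > 0"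
  shows "\<bar>\<Lambda> \<phi> - integral\<^sup>L RM \<phi>\<bar> \<le> e * measure RM S"
proof -
  obtain C where C: "C \<ge> 0" "\<And>x. \<phi> x \<le> C" using Ccp_bounded[OF \<phi>] by metis
  have \<phi>c: "continuous_on UNIV \<phi>" and \<phi>0: "\<And>x. 0 \<le> \<phi> x" using \<phi> by (auto simp: Ccp_cont Ccp_nonneg)
  define s where "s k x = min (max (\<phi> x - real k * e) 0) e" for k x
  \<comment> \<open>For \<open>k = 0\<close> the level set would be the whole space, possibly of
    infinite measure; it is replaced by the compact set \<open>S\<close>.\<close>
  define B where "B k = (if k = 0 then S else {x. real k * e \<le> \<phi> x})" for k
  have cB: "compact (B k)" for k
  proof (cases "k = 0")
    case False
    have "closed {x. real k * e \<le> \<phi> x}" by (intro closed_Collect_le continuous_intros \<phi>c)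
    moreover have "{x. real k * e \<le> \<phi> x} \<subseteq> S"
    proof
      fix x assume "x \<in> {x. real k * e \<le> \<phi> x}"
      then have "\<phi> x > 0" using False e by (auto intro: less_le_trans[of 0 "real k * e"])
      then show "x \<in> S" using S(2)[of x] by auto
    qed
    ultimately show ?thesis using False S(1) compact_Int_closed[OF S(1), of "{x. real k * e \<le> \<phi> x}"]
      by (simp add: B_def Int_absorb1)
  qed (simp add: B_def S)
  have bB: "B k \<in> sets borel" for k using cB[of k] by (simp add: compact_imp_closed)
  have fB: "emeasure RM (B k) \<noteq> \<top>" for k using RM_finite[OF cB[of k]] by auto
  have s0: "0 \<le> s k x" "s k x \<le> e" for k x using e by (auto simp: s_def)
  have sz: "s k x = 0" if "x \<notin> B k" for k x
    using that e S(2)[of x] by (cases "k = 0") (auto simp: s_def B_def)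
  have sfull: "s k x = e" if "x \<in> B (Suc k)" for k x
    using that e by (auto simp: s_def B_def algebra_simps)
  have sC: "s k \<in> Ccp" for k
    using cB[of k] sz s0 by (intro CcpI[of _ "B k"]) (auto simp: s_def intro!: continuous_intros \<phi>c)
  have ssum: "(\<Sum>k<n. s k x) = min (\<phi> x) (real n * e)" for n x
  proof (induction n)
    case 0 then show ?case using \<phi>0[of x] by simp
  next
    case (Suc n)
    have "(\<Sum>k<Suc n. s k x) = min (\<phi> x) (real n * e) + s n x" using Suc by simp
    also have "\<dots> = min (\<phi> x) (real (Suc n) * e)" using e by (auto simp: s_def min_def max_def algebra_simps)
    finally show ?case .
  qed
  have \<Lambda>sum: "(\<lambda>x. \<Sum>k<n. s k x) \<in> Ccp \<and> \<Lambda> (\<lambda>x. \<Sum>k<n. s k x) = (\<Sum>k<n. \<Lambda> (s k))" for n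
  proof (induction n)
    case 0 then show ?case using zero by simp
  next
    case (Suc n)
    then show ?case using Ccp_add[of "\<lambda>x. \<Sum>k<n. s k x" "s n"] sC[of n] add[of "\<lambda>x. \<Sum>k<n. s k x" "s n"] by simp
  qed
  obtain n where n: "C \<le> real n * e" using reals_Archimedean3[OF e] by (metis less_imp_le)
  have \<phi>eq: "\<phi> = (\<lambda>x. \<Sum>k<n. s k x)"
  proof
    fix x
    have "\<phi> x \<le> real n * e" using C(2)[of x] n by linarith
    then show "\<phi> x = (\<Sum>k<n. s k x)" using ssum[where n=n and x=x] by simp
  qed
  have intg: "integrable RM (s k)" for k using radon_integrable[OF radon_RM sC] .
  have I: "integral\<^sup>L RM \<phi> = (\<Sum>k<n. integral\<^sup>L RM (s k))"
    by (subst \<phi>eq, rule Bochner_Integration.integral_sum) (rule intg)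
  have L: "\<Lambda> \<phi> = (\<Sum>k<n. \<Lambda> (s k))" by (subst \<phi>eq) (use \<Lambda>sum in auto)
  have L1: "e * measure RM (B (Suc k)) \<le> \<Lambda> (s k)" for k
  proof -
    have "emeasure RM (B (Suc k)) \<le> ennreal (\<Lambda> (\<lambda>x. 1 / e * s k x))"
      using sC[of k] e sfull[of _ k] bB by (intro RM_le Ccp_scale) auto
    also have "\<Lambda> (\<lambda>x. 1 / e * s k x) = \<Lambda> (s k) / e" using hom[OF sC[of k], of "1/e"] e by simp
    finally have "measure RM (B (Suc k)) \<le> \<Lambda> (s k) / e"
      using fB[of "Suc k"] pos[OF sC[of k]] e by (simp add: emeasure_eq_ennreal_measure)
    then show ?thesis using e by (simp add: field_simps)
  qed
  have L2: "\<Lambda> (s k) \<le> e * measure RM (B k)" for k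
  proof -
    have "ennreal (\<Lambda> (\<lambda>x. 1 / e * s k x)) \<le> emeasure RM (B k)"
      using sC[of k] e s0[of k] sz[of _ k] cB by (intro RM_ge Ccp_scale) (auto simp: field_simps)
    also have "\<Lambda> (\<lambda>x. 1 / e * s k x) = \<Lambda> (s k) / e" using hom[OF sC[of k], of "1/e"] e by simp
    finally have "\<Lambda> (s k) / e \<le> measure RM (B k)"
      using fB[of k] by (simp add: emeasure_eq_ennreal_measure)
    then show ?thesis using e by (simp add: field_simps)
  qed
  have ii: "integral\<^sup>L RM (\<lambda>x. e * indicator (B k) x) = e * measure RM (B k)" for k
    using bB[of k] by simp
  have ib: "integrable RM (\<lambda>x. e * indicator (B k) x)" for k
    using bB[of k] fB[of k] by (auto simp: top.not_eq_extremum)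
  have I1: "e * measure RM (B (Suc k)) \<le> integral\<^sup>L RM (s k)" for k
    unfolding ii[symmetric] using s0 sfull by (intro integral_mono intg ib) (auto simp: indicator_def)
  have I2: "integral\<^sup>L RM (s k) \<le> e * measure RM (B k)" for k
    unfolding ii[symmetric] using s0 sz by (intro integral_mono intg ib) (auto simp: indicator_def)
  have tel: "(\<Sum>k<n. e * measure RM (B k)) - (\<Sum>k<n. e * measure RM (B (Suc k))) \<le> e * measure RM (B 0)"
  proof -
    have "(\<Sum>k<n. e * measure RM (B k)) - (\<Sum>k<n. e * measure RM (B (Suc k)))
        = (\<Sum>k<n. e * measure RM (B k) - e * measure RM (B (Suc k)))" by (simp add: sum_subtractf)
    also have "\<dots> = e * measure RM (B 0) - e * measure RM (B n)"
      by (rule sum_lessThan_telescope')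
    finally show ?thesis using e by simp
  qed
  have "(\<Sum>k<n. e * measure RM (B (Suc k))) \<le> \<Lambda> \<phi>" "\<Lambda> \<phi> \<le> (\<Sum>k<n. e * measure RM (B k))"
    "(\<Sum>k<n. e * measure RM (B (Suc k))) \<le> integral\<^sup>L RM \<phi>" "integral\<^sup>L RM \<phi> \<le> (\<Sum>k<n. e * measure RM (B k))"
    unfolding L I by (intro sum_mono L1 L2 I1 I2)+
  then show ?thesis using tel by (simp add: B_def abs_le_iff)
qed

lemma RM_integral:
  assumes \<phi>: "\<phi> \<in> Ccp" shows "integral\<^sup>L RM \<phi> = \<Lambda> \<phi>"
proof -
  obtain S where S: "compact S" "\<And>x. x \<notin> S \<Longrightarrow> \<phi> x = 0" using CcpE[OF \<phi>] by metis
  have "\<bar>\<Lambda> \<phi> - integral\<^sup>L RM \<phi>\<bar> \<le> 0"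
  proof (rule field_le_epsilon)
    fix e :: real assume e: "e > 0"
    define d where "d = e / (measure RM S + 1)"
    have p: "measure RM S + 1 > 0" using measure_nonneg[of RM S] by linarith
    then have "d > 0" using e by (simp add: d_def)
    then have "\<bar>\<Lambda> \<phi> - integral\<^sup>L RM \<phi>\<bar> \<le> d * measure RM S" using RM_slices[OF \<phi> S] by blast
    also have "\<dots> \<le> d * (measure RM S + 1)" using \<open>d > 0\<close> by simp
    also have "\<dots> = e" using p by (simp add: d_def)
    finally show "\<bar>\<Lambda> \<phi> - integral\<^sup>L RM \<phi>\<bar> \<le> 0 + e" by simp
  qed
  then show ?thesis by simp
qed

end

theorem Riesz_representation:
  fixes \<Lambda> :: "('a::t2_space \<Rightarrow> real) \<Rightarrow> real"
  assumes "locally_compact_space (euclidean :: 'a topology)"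
    and "\<And>\<phi>. \<phi> \<in> Ccp \<Longrightarrow> 0 \<le> \<Lambda> \<phi>"
    and "\<And>\<phi> \<psi>. \<phi> \<in> Ccp \<Longrightarrow> \<psi> \<in> Ccp \<Longrightarrow> \<Lambda> (\<lambda>x. \<phi> x + \<psi> x) = \<Lambda> \<phi> + \<Lambda> \<psi>"
    and "\<And>\<phi> c. \<phi> \<in> Ccp \<Longrightarrow> 0 \<le> c \<Longrightarrow> \<Lambda> (\<lambda>x. c * \<phi> x) = c * \<Lambda> \<phi>"
  obtains M where "radon M" "\<And>\<phi>. \<phi> \<in> Ccp \<Longrightarrow> integral\<^sup>L M \<phi> = \<Lambda> \<phi>"
proof -
  interpret pos_functional \<Lambda> using assms by unfold_locales
  show ?thesis using that[OF radon_RM RM_integral] .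
qed

section \<open>Operations on Radon measures\<close>

definition Ccp_le :: "('a::topological_space \<Rightarrow> ennreal) \<Rightarrow> ('a \<Rightarrow> real) set" where
  "Ccp_le f = {\<phi>\<in>Ccp. \<forall>x. ennreal (\<phi> x) \<le> f x}"

lemma zero_Ccp_le: "(\<lambda>x::'a::t2_space. 0) \<in> Ccp_le f"
  by (simp add: Ccp_le_def)

lemma Ccp_le_directed:
  fixes f :: "'a::t2_space \<Rightarrow> ennreal"
  assumes "\<phi> \<in> Ccp_le f" "\<psi> \<in> Ccp_le f"
  shows "\<exists>\<eta>\<in>Ccp_le f. (\<forall>x. \<phi> x \<le> \<eta> x) \<and> (\<forall>x. \<psi> x \<le> \<eta> x)"
proof (intro bexI conjI allI)
  show "(\<lambda>x. max (\<phi> x) (\<psi> x)) \<in> Ccp_le f"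
    using assms Ccp_max[of \<phi> \<psi>] by (simp add: Ccp_le_def) (simp add: max_def)
qed auto

lemma lsc_eq_SUP_Ccp:
  fixes f :: "'a::t2_space \<Rightarrow> ennreal"
  assumes lc: "locally_compact_space (euclidean :: 'a topology)" and f: "lsc f"
  shows "f x = (SUP \<phi>\<in>Ccp_le f. ennreal (\<phi> x))"
proof (rule antisym)
  show "f x \<le> (SUP \<phi>\<in>Ccp_le f. ennreal (\<phi> x))"
  proof (rule dense_le)
    fix t assume t: "t < f x"
    then obtain r where r: "t = ennreal r" "r \<ge> 0" by (cases t) auto
    have op: "open {y. t < f y}" using f by (auto simp: lsc_def)
    obtain \<phi> L where \<phi>: "\<phi> \<in> Ccp" "\<And>y. \<phi> y \<le> 1" "\<phi> x = 1" "L \<subseteq> {y. t < f y}" "\<And>y. y \<notin> L \<Longrightarrow> \<phi> y = 0"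
      using Urysohn_Cc[OF lc finite_imp_compact[of "{x}"] op] t by (metis empty_subsetI finite.emptyI finite_insert insert_subset mem_Collect_eq singletonI)
    have "ennreal (r * \<phi> y) \<le> f y" for y
    proof (cases "y \<in> L")
      case True
      have "r * \<phi> y \<le> r" using \<phi>(2)[of y] r by (simp add: mult_left_le)
      then have "ennreal (r * \<phi> y) \<le> t" using r by (simp add: ennreal_leI)
      also have "t \<le> f y" using True \<phi>(4) by auto
      finally show ?thesis .
    qed (simp add: \<phi>)
    then have "(\<lambda>y. r * \<phi> y) \<in> Ccp_le f" using \<phi> r by (simp add: Ccp_le_def Ccp_scale)
    then have "ennreal (r * \<phi> x) \<le> (SUP \<phi>\<in>Ccp_le f. ennreal (\<phi> x))" by (rule SUP_upper)
    then show "t \<le> (SUP \<phi>\<in>Ccp_le f. ennreal (\<phi> x))" using \<phi> r by simp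
  qed
  show "(SUP \<phi>\<in>Ccp_le f. ennreal (\<phi> x)) \<le> f x"
    by (rule SUP_least) (auto simp: Ccp_le_def)
qed

text \<open>Integrals of lower semicontinuous functions are thereby determined by test functions.
  Monotonicity in the measure, additivity of sums of measures and semicontinuity under vague limits
  all reduce to this.\<close>

lemma radon_lsc_integral:
  fixes f :: "'a::t2_space \<Rightarrow> ennreal"
  assumes lc: "locally_compact_space (euclidean :: 'a topology)" and M: "radon M" and f: "lsc f"
  shows "(\<integral>\<^sup>+x. f x \<partial>M) = (SUP \<phi>\<in>Ccp_le f. ennreal (integral\<^sup>L M \<phi>))"
proof -
  have "(\<integral>\<^sup>+x. f x \<partial>M) = (\<integral>\<^sup>+x. (SUP \<phi>\<in>Ccp_le f. ennreal (\<phi> x)) \<partial>M)"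
    by (subst lsc_eq_SUP_Ccp[OF lc f]) simp
  also have "\<dots> = (SUP \<phi>\<in>Ccp_le f. \<integral>\<^sup>+x. ennreal (\<phi> x) \<partial>M)"
  proof (rule radon_directed_SUP[OF M])
    show "Ccp_le f \<noteq> {}" using zero_Ccp_le by blast
    show "lsc (\<lambda>x. ennreal (\<phi> x))" if "\<phi> \<in> Ccp_le f" for \<phi>
      using that by (intro lsc_continuous) (auto simp: Ccp_le_def Ccp_cont)
    show "\<exists>k\<in>Ccp_le f. \<forall>x. ennreal (\<phi> x) \<le> ennreal (k x) \<and> ennreal (\<psi> x) \<le> ennreal (k x)"
      if "\<phi> \<in> Ccp_le f" "\<psi> \<in> Ccp_le f" for \<phi> \<psi>
      using Ccp_le_directed[OF that] by (meson ennreal_leI)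
  qed
  also have "\<dots> = (SUP \<phi>\<in>Ccp_le f. ennreal (integral\<^sup>L M \<phi>))"
    by (intro SUP_cong refl radon_nn_integral M) (auto simp: Ccp_le_def)
  finally show ?thesis .
qed

lemma radon_lsc_mono:
  fixes f :: "'a::t2_space \<Rightarrow> ennreal"
  assumes lc: "locally_compact_space (euclidean :: 'a topology)" and MN: "radon M" "radon N"
    and le: "\<And>\<phi>. \<phi> \<in> Ccp \<Longrightarrow> integral\<^sup>L M \<phi> \<le> integral\<^sup>L N \<phi>" and f: "lsc f"
  shows "(\<integral>\<^sup>+x. f x \<partial>M) \<le> (\<integral>\<^sup>+x. f x \<partial>N)"
  unfolding radon_lsc_integral[OF lc MN(1) f] radon_lsc_integral[OF lc MN(2) f]
  by (rule SUP_mono) (auto simp: Ccp_le_def intro!: ennreal_leI le)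

lemma radon_emeasure_mono:
  fixes M :: "'a::t2_space measure"
  assumes lc: "locally_compact_space (euclidean :: 'a topology)" and MN: "radon M" "radon N"
    and le: "\<And>\<phi>. \<phi> \<in> Ccp \<Longrightarrow> integral\<^sup>L M \<phi> \<le> integral\<^sup>L N \<phi>" and B: "B \<in> sets borel"
  shows "emeasure M B \<le> emeasure N B"
proof -
  have "emeasure M U \<le> emeasure N U" if U: "open U" for U
    using radon_lsc_mono[OF lc MN le lsc_indicator[OF U]] U MN by (simp add: radon_sets)
  then show ?thesis unfolding radon_borel[OF MN(1) B] radon_borel[OF MN(2) B]
    by (intro INF_mono) auto
qed

lemma radon_eqI:
  fixes M :: "'a::t2_space measure"
  assumes lc: "locally_compact_space (euclidean :: 'a topology)" and MN: "radon M" "radon N"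
    and eq: "\<And>\<phi>. \<phi> \<in> Ccp \<Longrightarrow> integral\<^sup>L M \<phi> = integral\<^sup>L N \<phi>"
  shows "M = N"
  using MN by (intro measure_eqI antisym radon_emeasure_mono[OF lc]) (auto simp: eq radon_sets)

lemma radon_eq_openI:
  fixes M :: "'a::t2_space measure"
  assumes MN: "radon M" "radon N" and eq: "\<And>U. open U \<Longrightarrow> emeasure M U = emeasure N U"
  shows "M = N"
proof (rule measure_eqI)
  show "sets M = sets N" using MN by (simp add: radon_sets)
  fix B assume "B \<in> sets M"
  then have B: "B \<in> sets borel" using MN by (simp add: radon_sets)
  show "emeasure M B = emeasure N B"
    unfolding radon_borel[OF MN(1) B] radon_borel[OF MN(2) B] using eq by (intro INF_cong) auto
qed

section \<open>Sums of families of Radon measures\<close>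

lemma nn_integral_count_space_SUP:
  fixes g :: "'i \<Rightarrow> ennreal"
  shows "(\<integral>\<^sup>+i. g i \<partial>count_space I) = (SUP F\<in>{F. finite F \<and> F \<subseteq> I}. sum g F)"
proof (rule antisym)
  let ?c = "SUP F\<in>{F. finite F \<and> F \<subseteq> I}. sum g F"
  have fin: "sum g F \<le> ?c" if "finite F" "F \<subseteq> I" for F using that by (intro SUP_upper) auto
  show "(\<integral>\<^sup>+i. g i \<partial>count_space I) \<le> ?c"
    unfolding nn_integral_def
  proof (rule SUP_least, clarify)
    fix s assume s: "simple_function (count_space I) s" "s \<le> g"
    show "integral\<^sup>S (count_space I) s \<le> ?c"
    proof (cases "finite {i\<in>I. 0 < s i}")
      case True
      have "integral\<^sup>S (count_space I) s = (\<integral>\<^sup>+i. s i \<partial>count_space I)"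
        by (rule nn_integral_eq_simple_integral[symmetric, OF s(1)])
      also have "\<dots> = (\<Sum>i\<in>{i\<in>I. 0 < s i}. s i)" by (rule nn_integral_count_space[OF True])
      also have "\<dots> \<le> (\<Sum>i\<in>{i\<in>I. 0 < s i}. g i)" using s(2) by (intro sum_mono) (auto simp: le_fun_def)
      also have "\<dots> \<le> ?c" using True by (intro fin) auto
      finally show ?thesis .
    next
      case False
      \<comment> \<open>A simple function has finitely many values, so some positive value
        \<open>s i0\<close> is attained infinitely often, and arbitrarily large finite subsums force
        the right-hand side to be infinite.\<close>
      have "finite (s ` I)" using s(1) by (simp add: simple_function_def)
      then have "finite (s ` {i\<in>I. 0 < s i})" by (rule finite_subset[rotated]) auto
      then obtain i0 where i0: "i0 \<in> {i\<in>I. 0 < s i}" "infinite {i \<in> {i\<in>I. 0 < s i}. s i = s i0}"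
        using pigeonhole_infinite[OF False] by blast
      have "of_nat n * s i0 \<le> ?c" for n :: nat
      proof -
        obtain F where F: "F \<subseteq> {i \<in> {i\<in>I. 0 < s i}. s i = s i0}" "finite F" "card F = n"
          using infinite_arbitrarily_large[OF i0(2)] by metis
        have "of_nat n * s i0 = (\<Sum>i\<in>F. s i)" using F by (simp add: subset_iff)
        also have "\<dots> \<le> sum g F" using s(2) by (intro sum_mono) (auto simp: le_fun_def)
        also have "\<dots> \<le> ?c" using F by (intro fin) auto
        finally show ?thesis .
      qed
      then have "(SUP n::nat. of_nat n * s i0) \<le> ?c" by (intro SUP_least)
      moreover have "(SUP n::nat. of_nat n * s i0) = \<top>"
        using less_imp_neq[of 0 "s i0"] i0(1) by (simp add: SUP_mult_right_ennreal[symmetric] ennreal_SUP_of_nat_eq_top ennreal_top_mult)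
      ultimately have "?c = \<top>" by (simp only: top_unique)
      then show ?thesis by (simp only: top_greatest)
    qed
  qed
  show "?c \<le> (\<integral>\<^sup>+i. g i \<partial>count_space I)"
  proof (rule SUP_least, clarify)
    fix F assume F: "finite F" "F \<subseteq> I"
    have "sum g F = (\<integral>\<^sup>+i. g i * indicator F i \<partial>count_space I)"
      using F by (subst nn_integral_count_space'[of F]) (auto simp: indicator_def)
    also have "\<dots> \<le> (\<integral>\<^sup>+i. g i \<partial>count_space I)" by (intro nn_integral_mono) (auto simp: indicator_def)
    finally show "sum g F \<le> (\<integral>\<^sup>+i. g i \<partial>count_space I)" .
  qed
qed

text \<open>The sum is characterized through test functions, so that its regularity comes from the
  Riesz theorem instead of having to be checked for a setwise sum.\<close>

definition is_rsum :: "'i set \<Rightarrow> ('i \<Rightarrow> 'a::topological_space measure) \<Rightarrow> 'a measure \<Rightarrow> bool" where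
  "is_rsum I \<mu> M \<longleftrightarrow> radon M \<and>
    (\<forall>\<phi>\<in>Ccp. ennreal (integral\<^sup>L M \<phi>) = (\<integral>\<^sup>+i. ennreal (integral\<^sup>L (\<mu> i) \<phi>) \<partial>count_space I))"

definition rsum :: "'i set \<Rightarrow> ('i \<Rightarrow> 'a::topological_space measure) \<Rightarrow> 'a measure" where
  "rsum I \<mu> = (SOME M. is_rsum I \<mu> M)"

lemma is_rsum_exists:
  fixes \<mu> :: "'i \<Rightarrow> 'a::t2_space measure"
  assumes lc: "locally_compact_space (euclidean :: 'a topology)" and r: "\<And>i. i \<in> I \<Longrightarrow> radon (\<mu> i)"
    and lf: "\<And>K. compact K \<Longrightarrow> finite {i\<in>I. emeasure (\<mu> i) K \<noteq> 0}"
  shows "\<exists>M. is_rsum I \<mu> M"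
proof -
  define S where "S \<phi> = (\<integral>\<^sup>+i. ennreal (integral\<^sup>L (\<mu> i) \<phi>) \<partial>count_space I)" for \<phi>
  have nonneg: "0 \<le> integral\<^sup>L (\<mu> i) \<phi>" if "\<phi> \<in> Ccp" for \<phi> i
    using that by (intro Bochner_Integration.integral_nonneg) (auto simp: Ccp_nonneg)
  have fin: "S \<phi> < \<top>" if \<phi>: "\<phi> \<in> Ccp" for \<phi>
  proof -
    obtain K where K: "compact K" "\<And>x. x \<notin> K \<Longrightarrow> \<phi> x = 0" using CcpE[OF \<phi>] by metis
    have "integral\<^sup>L (\<mu> i) \<phi> = 0" if "i \<in> I" "emeasure (\<mu> i) K = 0" for i
    proof (rule integral_eq_zero_AE)
      have "K \<in> null_sets (\<mu> i)" using that K r[OF that(1)] by (auto simp: null_sets_def radon_sets compact_imp_closed)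
      then show "AE x in \<mu> i. \<phi> x = 0" by (rule AE_I') (use K in auto)
    qed
    then have "{i\<in>I. 0 < ennreal (integral\<^sup>L (\<mu> i) \<phi>)} \<subseteq> {i\<in>I. emeasure (\<mu> i) K \<noteq> 0}" by force
    then have f: "finite {i\<in>I. 0 < ennreal (integral\<^sup>L (\<mu> i) \<phi>)}" using lf[OF K(1)] by (rule finite_subset)
    show ?thesis unfolding S_def nn_integral_count_space[OF f] by (subst sum_ennreal) (auto simp: nonneg \<phi>)
  qed
  obtain M where M: "radon M" "\<And>\<phi>. \<phi> \<in> Ccp \<Longrightarrow> integral\<^sup>L M \<phi> = enn2real (S \<phi>)"
  proof (rule Riesz_representation[OF lc, of "\<lambda>\<phi>. enn2real (S \<phi>)"])
    fix \<phi> \<psi> :: "'a \<Rightarrow> real" assume a: "\<phi> \<in> Ccp" "\<psi> \<in> Ccp"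
    have "S (\<lambda>x. \<phi> x + \<psi> x) = (\<integral>\<^sup>+i. ennreal (integral\<^sup>L (\<mu> i) \<phi>) + ennreal (integral\<^sup>L (\<mu> i) \<psi>) \<partial>count_space I)"
      unfolding S_def using r a nonneg
      by (intro nn_integral_cong) (simp add: radon_integrable ennreal_plus)
    also have "\<dots> = S \<phi> + S \<psi>" unfolding S_def by (rule nn_integral_add) auto
    finally show "enn2real (S (\<lambda>x. \<phi> x + \<psi> x)) = enn2real (S \<phi>) + enn2real (S \<psi>)"
      using fin a by (simp add: enn2real_plus)
  next
    fix \<phi> :: "'a \<Rightarrow> real" and c :: real assume a: "\<phi> \<in> Ccp" "0 \<le> c"
    have "S (\<lambda>x. c * \<phi> x) = (\<integral>\<^sup>+i. ennreal c * ennreal (integral\<^sup>L (\<mu> i) \<phi>) \<partial>count_space I)"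
      unfolding S_def using a by (intro nn_integral_cong) (simp add: ennreal_mult')
    also have "\<dots> = ennreal c * S \<phi>" unfolding S_def by (rule nn_integral_cmult) auto
    finally show "enn2real (S (\<lambda>x. c * \<phi> x)) = c * enn2real (S \<phi>)"
      using a by (simp add: enn2real_mult)
  qed auto
  then have "is_rsum I \<mu> M"
    using fin unfolding is_rsum_def S_def by (auto simp: ennreal_enn2real)
  then show ?thesis by blast
qed

lemma is_rsum_lsc:
  fixes \<mu> :: "'i \<Rightarrow> 'a::t2_space measure"
  assumes lc: "locally_compact_space (euclidean :: 'a topology)" and r: "\<And>i. i \<in> I \<Longrightarrow> radon (\<mu> i)"
    and M: "is_rsum I \<mu> M" and f: "lsc f"
  shows "(\<integral>\<^sup>+x. f x \<partial>M) = (\<integral>\<^sup>+i. (\<integral>\<^sup>+x. f x \<partial>\<mu> i) \<partial>count_space I)"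
proof (rule antisym)
  have rM: "radon M" and eq: "\<And>\<phi>. \<phi> \<in> Ccp \<Longrightarrow> ennreal (integral\<^sup>L M \<phi>) = (\<integral>\<^sup>+i. ennreal (integral\<^sup>L (\<mu> i) \<phi>) \<partial>count_space I)"
    using M by (auto simp: is_rsum_def)
  have up: "ennreal (integral\<^sup>L (\<mu> i) \<phi>) \<le> (\<integral>\<^sup>+x. f x \<partial>\<mu> i)" if "i \<in> I" "\<phi> \<in> Ccp_le f" for i \<phi>
    unfolding radon_lsc_integral[OF lc r[OF that(1)] f] using that by (intro SUP_upper)
  show "(\<integral>\<^sup>+x. f x \<partial>M) \<le> (\<integral>\<^sup>+i. (\<integral>\<^sup>+x. f x \<partial>\<mu> i) \<partial>count_space I)"
    unfolding radon_lsc_integral[OF lc rM f]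
  proof (rule SUP_least)
    fix \<phi> assume \<phi>: "\<phi> \<in> Ccp_le f"
    then have "ennreal (integral\<^sup>L M \<phi>) = (\<integral>\<^sup>+i. ennreal (integral\<^sup>L (\<mu> i) \<phi>) \<partial>count_space I)"
      by (intro eq) (auto simp: Ccp_le_def)
    also have "\<dots> \<le> (\<integral>\<^sup>+i. (\<integral>\<^sup>+x. f x \<partial>\<mu> i) \<partial>count_space I)"
      by (intro nn_integral_mono up \<phi>) simp
    finally show "ennreal (integral\<^sup>L M \<phi>) \<le> (\<integral>\<^sup>+i. (\<integral>\<^sup>+x. f x \<partial>\<mu> i) \<partial>count_space I)" .
  qed
  show "(\<integral>\<^sup>+i. (\<integral>\<^sup>+x. f x \<partial>\<mu> i) \<partial>count_space I) \<le> (\<integral>\<^sup>+x. f x \<partial>M)"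
    unfolding nn_integral_count_space_SUP
  proof (rule SUP_least, clarify)
    fix F assume F: "finite F" "F \<subseteq> I"
    \<comment> \<open>The value 0 off \<open>F\<close> makes the directedness condition, which is
      asked for all indices, hold trivially there; only the finitely many measures indexed by
      \<open>F\<close> have to be compared.\<close>
    define h where "h \<phi> i = (if i \<in> F then ennreal (integral\<^sup>L (\<mu> i) \<phi>) else 0)" for \<phi> i
    have "(\<Sum>i\<in>F. \<integral>\<^sup>+x. f x \<partial>\<mu> i) = (\<Sum>i\<in>F. SUP \<phi>\<in>Ccp_le f. h \<phi> i)"
      using F by (intro sum.cong refl) (auto simp: h_def radon_lsc_integral[OF lc r f])
    also have "\<dots> = (SUP \<phi>\<in>Ccp_le f. \<Sum>i\<in>F. h \<phi> i)"
    proof (rule SUP_sum_directed_ennreal[symmetric, OF F(1)])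
      show "Ccp_le f \<noteq> {}" using zero_Ccp_le by blast
      fix \<phi> \<psi> assume a: "\<phi> \<in> Ccp_le f" "\<psi> \<in> Ccp_le f"
      then obtain \<eta> where \<eta>: "\<eta> \<in> Ccp_le f" "\<forall>x. \<phi> x \<le> \<eta> x" "\<forall>x. \<psi> x \<le> \<eta> x" using Ccp_le_directed by blast
      have "integral\<^sup>L (\<mu> i) \<phi> \<le> integral\<^sup>L (\<mu> i) \<eta>" "integral\<^sup>L (\<mu> i) \<psi> \<le> integral\<^sup>L (\<mu> i) \<eta>" if "i \<in> F" for i
        using a \<eta> r F that by (auto intro!: integral_mono radon_integrable simp: Ccp_le_def)
      then show "\<exists>k\<in>Ccp_le f. \<forall>n. h \<phi> n \<le> h k n \<and> h \<psi> n \<le> h k n"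
        using \<eta>(1) by (intro bexI[of _ \<eta>]) (auto simp: h_def ennreal_leI)
    qed
    also have "\<dots> \<le> (\<integral>\<^sup>+x. f x \<partial>M)"
      unfolding radon_lsc_integral[OF lc rM f]
    proof (rule SUP_mono)
      fix \<phi> assume \<phi>: "\<phi> \<in> Ccp_le f"
      have "(\<Sum>i\<in>F. h \<phi> i) = (\<Sum>i\<in>F. ennreal (integral\<^sup>L (\<mu> i) \<phi>))" by (simp add: h_def)
      also have "\<dots> \<le> (\<integral>\<^sup>+i. ennreal (integral\<^sup>L (\<mu> i) \<phi>) \<partial>count_space I)"
        unfolding nn_integral_count_space_SUP using F by (intro SUP_upper) auto
      also have "\<dots> = ennreal (integral\<^sup>L M \<phi>)" using \<phi> by (intro eq[symmetric]) (auto simp: Ccp_le_def)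
      finally show "\<exists>m\<in>Ccp_le f. (\<Sum>i\<in>F. h \<phi> i) \<le> ennreal (integral\<^sup>L M m)" using \<phi> by blast
    qed
    finally show "(\<Sum>i\<in>F. \<integral>\<^sup>+x. f x \<partial>\<mu> i) \<le> (\<integral>\<^sup>+x. f x \<partial>M)" .
  qed
qed

lemma rsum_props:
  fixes \<mu> :: "'i \<Rightarrow> 'a::t2_space measure"
  assumes lc: "locally_compact_space (euclidean :: 'a topology)" and r: "\<And>i. i \<in> I \<Longrightarrow> radon (\<mu> i)"
    and lf: "\<And>K. compact K \<Longrightarrow> finite {i\<in>I. emeasure (\<mu> i) K \<noteq> 0}"
  shows "radon (rsum I \<mu>)"
    "lsc f \<Longrightarrow> (\<integral>\<^sup>+x. f x \<partial>rsum I \<mu>) = (\<integral>\<^sup>+i. (\<integral>\<^sup>+x. f x \<partial>\<mu> i) \<partial>count_space I)"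
proof -
  have *: "is_rsum I \<mu> (rsum I \<mu>)"
    unfolding rsum_def using is_rsum_exists[OF lc r lf] by (rule someI_ex)
  then show "radon (rsum I \<mu>)" by (simp add: is_rsum_def)
  show "lsc f \<Longrightarrow> (\<integral>\<^sup>+x. f x \<partial>rsum I \<mu>) = (\<integral>\<^sup>+i. (\<integral>\<^sup>+x. f x \<partial>\<mu> i) \<partial>count_space I)"
    by (rule is_rsum_lsc[OF lc r *])
qed

definition radd :: "'a::topological_space measure \<Rightarrow> 'a measure \<Rightarrow> 'a measure" where
  "radd M N = rsum UNIV (\<lambda>b. if b then M else N)"

lemma radd_props:
  fixes M N :: "'a::t2_space measure"
  assumes lc: "locally_compact_space (euclidean :: 'a topology)" and r: "radon M" "radon N"
  shows "radon (radd M N)"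
    "lsc f \<Longrightarrow> (\<integral>\<^sup>+x. f x \<partial>radd M N) = (\<integral>\<^sup>+x. f x \<partial>M) + (\<integral>\<^sup>+x. f x \<partial>N)"
proof -
  have r': "\<And>b. b \<in> UNIV \<Longrightarrow> radon (if b then M else N)" using r by auto
  show "radon (radd M N)" unfolding radd_def using r' by (intro rsum_props[OF lc]) auto
  assume f: "lsc f"
  have "(\<integral>\<^sup>+x. f x \<partial>radd M N) = (\<integral>\<^sup>+b. (\<integral>\<^sup>+x. f x \<partial>(if b then M else N)) \<partial>count_space UNIV)"
    unfolding radd_def by (rule rsum_props(2)[OF lc r' _ f]) auto
  then show "(\<integral>\<^sup>+x. f x \<partial>radd M N) = (\<integral>\<^sup>+x. f x \<partial>M) + (\<integral>\<^sup>+x. f x \<partial>N)"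
    by (simp add: nn_integral_count_space_finite UNIV_bool add.commute)
qed

lemma Ccp_lsc: "\<phi> \<in> Ccp \<Longrightarrow> lsc (\<lambda>x. ennreal (\<phi> x))"
  by (intro lsc_continuous Ccp_cont)

lemma integral_nonneg_Ccp: "\<phi> \<in> Ccp \<Longrightarrow> 0 \<le> integral\<^sup>L M \<phi>"
  by (intro Bochner_Integration.integral_nonneg) (auto simp: Ccp_nonneg)

lemma radd_integral:
  fixes M N :: "'a::t2_space measure"
  assumes lc: "locally_compact_space (euclidean :: 'a topology)" and r: "radon M" "radon N" and \<phi>: "\<phi> \<in> Ccp"
  shows "integral\<^sup>L (radd M N) \<phi> = integral\<^sup>L M \<phi> + integral\<^sup>L N \<phi>"
proof -
  have "ennreal (integral\<^sup>L (radd M N) \<phi>) = ennreal (integral\<^sup>L M \<phi> + integral\<^sup>L N \<phi>)"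
    using radd_props(2)[OF lc r Ccp_lsc[OF \<phi>]] radon_nn_integral[OF radd_props(1)[OF lc r] \<phi>]
      radon_nn_integral[OF r(1) \<phi>] radon_nn_integral[OF r(2) \<phi>] \<phi>
    by (simp add: ennreal_plus integral_nonneg_Ccp)
  then show ?thesis using \<phi> by (subst (asm) ennreal_inj) (auto intro!: add_nonneg_nonneg integral_nonneg_Ccp)
qed

lemma radon_null: "radon (null_measure borel)"
  unfolding radon_def
proof (intro conjI allI impI ballI)
  fix U :: "'a set" 
  have "{K. compact K \<and> K \<subseteq> U} \<noteq> {}" by (auto intro: exI[of _ "{}"])
  then show "emeasure (null_measure borel) U = (SUP K\<in>{K. compact K \<and> K \<subseteq> U}. emeasure (null_measure borel) K)"
    by simp
next
  fix B :: "'a set" 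
  have "{U. open U \<and> B \<subseteq> U} \<noteq> {}" by (auto intro: exI[of _ "UNIV"])
  then show "emeasure (null_measure borel) B = (INF U\<in>{U. open U \<and> B \<subseteq> U}. emeasure (null_measure borel) U)"
    by simp
qed auto

section \<open>Scaling, regularity of finite measures, and restriction\<close>

lemma radon_scale:
  fixes M :: "'a::topological_space measure"
  assumes M: "radon M" shows "radon (scale_measure (ennreal r) M)"
proof (cases "r > 0")
  case False
  then have "scale_measure (ennreal r) M = null_measure M" by (simp add: ennreal_neg)
  also have "\<dots> = null_measure borel" using radon_sets[OF M] by (intro measure_eqI) auto
  finally show ?thesis by (simp add: radon_null)
next
  case r: True
  show ?thesis
    unfolding radon_def
  proof (intro conjI allI impI ballI)
    show "sets (scale_measure (ennreal r) M) = sets borel" using M by (simp add: radon_sets)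
    show "emeasure (scale_measure (ennreal r) M) K < \<top>" if "compact K" for K
      using radon_compact[OF M that] by (simp add: ennreal_mult_less_top)
    show "emeasure (scale_measure (ennreal r) M) U = (SUP K\<in>{K. compact K \<and> K \<subseteq> U}. emeasure (scale_measure (ennreal r) M) K)"
      if "open U" for U
      by (simp add: radon_open[OF M that] SUP_mult_left_ennreal)
    show "emeasure (scale_measure (ennreal r) M) B = (INF U\<in>{U. open U \<and> B \<subseteq> U}. emeasure (scale_measure (ennreal r) M) U)"
      if B: "B \<in> sets borel" for B
    proof (rule antisym)
      show "emeasure (scale_measure (ennreal r) M) B \<le> (INF U\<in>{U. open U \<and> B \<subseteq> U}. emeasure (scale_measure (ennreal r) M) U)"
        using M by (intro INF_greatest emeasure_mono) (auto simp: radon_sets)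
      let ?x = "INF U\<in>{U. open U \<and> B \<subseteq> U}. emeasure (scale_measure (ennreal r) M) U"
      \<comment> \<open>Scaling by \<open>r\<close> is undone by scaling by \<open>1 / r\<close>;
        this moves the positive factor through the infimum over open supersets.\<close>
      have rr: "ennreal r * (ennreal (1/r) * y) = y" for y
        using r by (simp add: mult.assoc[symmetric] ennreal_mult'[symmetric])
      have "ennreal (1/r) * ?x \<le> emeasure M U" if "open U" "B \<subseteq> U" for U
      proof -
        have "?x \<le> ennreal r * emeasure M U" using that by (intro INF_lower2[of U]) auto
        then have "ennreal (1/r) * ?x \<le> ennreal (1/r) * (ennreal r * emeasure M U)" by (intro mult_left_mono) auto
        also have "\<dots> = emeasure M U" using rr[of "emeasure M U"] by (simp add: mult.left_commute)
        finally show ?thesis .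
      qed
      then have "ennreal (1/r) * ?x \<le> emeasure M B" unfolding radon_borel[OF M B] by (intro INF_greatest) auto
      then have "ennreal r * (ennreal (1/r) * ?x) \<le> ennreal r * emeasure M B" by (intro mult_left_mono) auto
      then show "?x \<le> emeasure (scale_measure (ennreal r) M) B" by (simp add: rr)
    qed
  qed
qed

lemma scale_lsc_integral:
  assumes "radon M" "lsc f"
  shows "(\<integral>\<^sup>+x. f x \<partial>scale_measure r M) = r * (\<integral>\<^sup>+x. f x \<partial>M)"
  using assms lsc_measurable[OF assms(2)]
  by (intro nn_integral_scale_measure) (simp add: measurable_cong_sets[OF radon_sets refl])

lemma radon_finite_outer:
  fixes M :: "'a::t2_space measure"
  assumes M: "radon M" and B: "B \<in> sets borel" "emeasure M B < \<top>" and e: "e > (0::real)"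
  obtains U where "open U" "B \<subseteq> U" "emeasure M (U - B) \<le> ennreal e"
proof -
  have "emeasure M B < emeasure M B + ennreal e"
    using B e by (cases "emeasure M B") (auto simp flip: ennreal_plus simp: ennreal_less_iff)
  then have "(INF U\<in>{U. open U \<and> B \<subseteq> U}. emeasure M U) < emeasure M B + ennreal e"
    using radon_borel[OF M B(1)] by simp
  then obtain U where U: "open U" "B \<subseteq> U" "emeasure M U < emeasure M B + ennreal e"
    unfolding INF_less_iff by auto
  have "emeasure M (U - B) = emeasure M U - emeasure M B"
    using U B radon_sets[OF M] by (intro emeasure_Diff) (auto simp: less_top)
  also have "\<dots> \<le> ennreal e" using U(3) B by (auto intro!: ennreal_minus_le_iff[THEN iffD2])
  finally show ?thesis using that U by blast
qed

text \<open>\<open>radon\<close> asks for inner regularity on open sets only. For finite measures it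
  extends to Borel sets: a compact \<open>K0\<close> carries almost all the mass, an open
  \<open>U\<close> is slightly larger than the complement of \<open>B\<close>, and
  \<open>K0 - U\<close> is the compact set wanted.\<close>

lemma radon_finite_inner:
  fixes M :: "'a::t2_space measure"
  assumes M: "radon M" and fin: "emeasure M UNIV < \<top>" and B: "B \<in> sets borel" and e: "e > (0::real)"
  obtains K where "compact K" "K \<subseteq> B" "emeasure M (B - K) \<le> ennreal e"
proof -
  have s: "sets M = sets borel" using M by (rule radon_sets)
  have sub: "emeasure M C < \<top>" for C
    using emeasure_space[of M C] fin radon_space[OF M] by (auto intro: le_less_trans)
  obtain K0 where K0: "compact K0" "emeasure M (- K0) \<le> ennreal (e/2)"
  proof (cases "emeasure M UNIV = 0")
    case True
    then have "emeasure M (- {}) \<le> ennreal (e/2)" by simp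
    then show ?thesis using that[of "{}"] by simp
  next
    case False
    then obtain u where u: "emeasure M UNIV = ennreal u" "u > 0"
      using fin by (cases "emeasure M UNIV") (auto simp: less_top)
    have "ennreal (u - e/2) < emeasure M UNIV" unfolding u(1) using u e by (intro ennreal_lessI) auto
    also have "emeasure M UNIV = (SUP K\<in>{K. compact K \<and> K \<subseteq> UNIV}. emeasure M K)"
      by (rule radon_open[OF M]) simp
    finally obtain K where K: "compact K" "ennreal (u - e/2) < emeasure M K" unfolding less_SUP_iff by auto
    have Ks: "K \<in> sets M" using K s by (simp add: compact_imp_closed)
    obtain k where k: "emeasure M K = ennreal k" "k \<ge> 0" using sub[of K] by (cases "emeasure M K") (auto simp: less_top)
    have "emeasure M (UNIV - K) = emeasure M UNIV - emeasure M K"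
      using Ks sub[of K] s by (intro emeasure_Diff) (auto simp: less_top)
    also have "\<dots> = ennreal (u - k)" using u k by (simp add: ennreal_minus)
    also have "\<dots> \<le> ennreal (e/2)"
    proof -
      have "\<not> k \<le> u - e/2" using K(2) ennreal_leI[of k "u - e/2"] unfolding k(1) by (metis leD)
      then show ?thesis by (intro ennreal_leI) simp
    qed
    finally show ?thesis using that[of K] K by (simp add: Compl_eq_Diff_UNIV)
  qed
  obtain U where U: "open U" "-B \<subseteq> U" "emeasure M (U - -B) \<le> ennreal (e/2)"
    using radon_finite_outer[OF M, of "-B" "e/2"] B e sub by auto
  show ?thesis
  proof (rule that[of "K0 - U"])
    show "compact (K0 - U)" using K0 U by (intro compact_diff)
    show "K0 - U \<subseteq> B" using U by auto
    have m: "-K0 \<in> sets M" "U - -B \<in> sets M" using K0 U B s by (auto simp: compact_imp_closed)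
    have "emeasure M (B - (K0 - U)) \<le> emeasure M (-K0 \<union> (U - -B))"
      using m by (intro emeasure_mono) auto
    also have "\<dots> \<le> emeasure M (-K0) + emeasure M (U - -B)" using m by (intro emeasure_subadditive)
    also have "\<dots> \<le> ennreal (e/2) + ennreal (e/2)" by (intro add_mono K0 U)
    also have "\<dots> = ennreal e" using e by (simp flip: ennreal_plus)
    finally show "emeasure M (B - (K0 - U)) \<le> ennreal e" .
  qed
qed

text \<open>Compact and open approximants for the finite measure \<open>M\<close> have small error
  for \<open>M\<close>, hence also for \<open>N\<close>.\<close>

lemma radon_dominated:
  fixes M N :: "'a::t2_space measure"
  assumes M: "radon M" and fin: "emeasure M UNIV < \<top>" and sN: "sets N = sets borel"
    and le: "\<And>B. B \<in> sets borel \<Longrightarrow> emeasure N B \<le> emeasure M B"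
  shows "radon N"
  unfolding radon_def
proof (intro conjI allI impI ballI sN)
  have sub: "emeasure M C < \<top>" for C
    using emeasure_space[of M C] fin radon_space[OF M] by (auto intro: le_less_trans)
  show "emeasure N K < \<top>" if "compact K" for K
    using le[of K] sub[of K] that by (auto simp: compact_imp_closed)
  show "emeasure N U = (SUP K\<in>{K. compact K \<and> K \<subseteq> U}. emeasure N K)" if U: "open U" for U
  proof (rule antisym)
    show "emeasure N U \<le> (SUP K\<in>{K. compact K \<and> K \<subseteq> U}. emeasure N K)"
    proof (rule ennreal_le_epsilon)
      fix e :: real assume "0 < e"
      then obtain K where K: "compact K" "K \<subseteq> U" "emeasure M (U - K) \<le> ennreal e"
        using radon_finite_inner[OF M fin borel_open[OF U]] by metis
      have m: "K \<in> sets N" "U - K \<in> sets N" "U - K \<in> sets borel" using K U sN by (auto simp: compact_imp_closed)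
      have "emeasure N U \<le> emeasure N K + emeasure N (U - K)"
        using emeasure_subadditive[OF m(1,2)] K by (simp add: Un_absorb1)
      also have "\<dots> \<le> (SUP K\<in>{K. compact K \<and> K \<subseteq> U}. emeasure N K) + ennreal e"
        using K le[OF m(3)] by (intro add_mono SUP_upper) auto
      finally show "emeasure N U \<le> (SUP K\<in>{K. compact K \<and> K \<subseteq> U}. emeasure N K) + ennreal e" .
    qed
    show "(SUP K\<in>{K. compact K \<and> K \<subseteq> U}. emeasure N K) \<le> emeasure N U"
      using U sN by (intro SUP_least emeasure_mono) auto
  qed
  show "emeasure N B = (INF U\<in>{U. open U \<and> B \<subseteq> U}. emeasure N U)" if B: "B \<in> sets borel" for B
  proof (rule antisym)
    show "emeasure N B \<le> (INF U\<in>{U. open U \<and> B \<subseteq> U}. emeasure N U)"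
      using sN by (intro INF_greatest emeasure_mono) auto
    show "(INF U\<in>{U. open U \<and> B \<subseteq> U}. emeasure N U) \<le> emeasure N B"
    proof (rule ennreal_le_epsilon)
      fix e :: real assume "0 < e"
      then obtain U where U: "open U" "B \<subseteq> U" "emeasure M (U - B) \<le> ennreal e"
        using radon_finite_outer[OF M B sub] by metis
      have m: "B \<in> sets N" "U - B \<in> sets N" "U - B \<in> sets borel" using B U sN by auto
      have "(INF U\<in>{U. open U \<and> B \<subseteq> U}. emeasure N U) \<le> emeasure N U" using U by (intro INF_lower) auto
      also have "\<dots> \<le> emeasure N B + emeasure N (U - B)"
        using emeasure_subadditive[OF m(1,2)] U by (simp add: Un_absorb1)
      also have "\<dots> \<le> emeasure N B + ennreal e"
        using U(3) le[OF m(3)] by (intro add_mono) auto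
      finally show "(INF U\<in>{U. open U \<and> B \<subseteq> U}. emeasure N U) \<le> emeasure N B + ennreal e" .
    qed
  qed
qed

definition mrestr :: "'a measure \<Rightarrow> 'a set \<Rightarrow> 'a measure" where
  "mrestr M B = density M (indicator B)"

lemma sets_mrestr [simp]: "sets (mrestr M B) = sets M"
  by (simp add: mrestr_def)

lemma emeasure_mrestr: "radon M \<Longrightarrow> B \<in> sets borel \<Longrightarrow> C \<in> sets borel \<Longrightarrow> emeasure (mrestr M B) C = emeasure M (B \<inter> C)"
  unfolding mrestr_def by (subst emeasure_restricted) (auto simp: radon_sets)

lemma nn_integral_mrestr:
  assumes "radon M" "B \<in> sets borel" "f \<in> borel_measurable borel"
  shows "(\<integral>\<^sup>+x. f x \<partial>mrestr M B) = (\<integral>\<^sup>+x. f x * indicator B x \<partial>M)"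
  unfolding mrestr_def using assms
  by (subst nn_integral_density) (auto simp: measurable_cong_sets[OF radon_sets refl] mult.commute)

lemma radon_mrestr_finite:
  fixes M :: "'a::t2_space measure"
  assumes M: "radon M" and fin: "emeasure M UNIV < \<top>" and B: "B \<in> sets borel"
  shows "radon (mrestr M B)"
proof (rule radon_dominated[OF M fin])
  show "sets (mrestr M B) = sets borel" using M by (simp add: radon_sets)
  show "emeasure (mrestr M B) C \<le> emeasure M C" if "C \<in> sets borel" for C
    unfolding emeasure_mrestr[OF M B that] using that M by (intro emeasure_mono) (auto simp: radon_sets)
qed

lemma radon_mrestr_compact:
  fixes M :: "'a::t2_space measure"
  assumes M: "radon M" and K: "compact K"
  shows "radon (mrestr M K)"
  unfolding radon_def
proof (intro conjI allI impI ballI)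
  have Kb: "K \<in> sets borel" using K by (simp add: compact_imp_closed)
  have s: "sets M = sets borel" using M by (rule radon_sets)
  note em = emeasure_mrestr[OF M Kb]
  have fin: "emeasure M C < \<top>" if "C \<subseteq> K" for C
    using emeasure_mono[OF that, of M] Kb s radon_compact[OF M K] by auto
  show sr: "sets (mrestr M K) = sets borel" using s by simp
  show "emeasure (mrestr M K) C < \<top>" if "compact C" for C
    using that fin[of "K \<inter> C"] by (subst em) (auto simp: compact_imp_closed)
  show "emeasure (mrestr M K) U = (SUP C\<in>{C. compact C \<and> C \<subseteq> U}. emeasure (mrestr M K) C)" if U: "open U" for U
  proof (rule antisym)
    show "emeasure (mrestr M K) U \<le> (SUP C\<in>{C. compact C \<and> C \<subseteq> U}. emeasure (mrestr M K) C)"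
    proof (rule ennreal_le_epsilon)
      fix e :: real assume e: "0 < e"
      have KU: "K - U \<in> sets borel" using Kb U by auto
      have KUf: "emeasure M (K - U) < \<top>" by (intro fin) auto
      obtain V where V: "open V" "K - U \<subseteq> V" "emeasure M (V - (K - U)) \<le> ennreal e"
        using radon_finite_outer[OF M KU KUf e] by metis
      have c: "compact (K - V)" using K V by (intro compact_diff)
      have "emeasure (mrestr M K) U = emeasure M (K \<inter> U)" using U by (simp add: em)
      also have "\<dots> \<le> emeasure M ((K - V) \<union> (V - (K - U)))"
        using Kb V U s by (intro emeasure_mono) auto
      also have "\<dots> \<le> emeasure M (K - V) + emeasure M (V - (K - U))"
        using Kb V U s by (intro emeasure_subadditive) auto
      also have "\<dots> \<le> (SUP C\<in>{C. compact C \<and> C \<subseteq> U}. emeasure (mrestr M K) C) + ennreal e"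
      proof (intro add_mono V)
        have "emeasure M (K - V) = emeasure (mrestr M K) (K - V)"
          using c by (subst em) (auto simp: compact_imp_closed Int_absorb1)
        also have "\<dots> \<le> (SUP C\<in>{C. compact C \<and> C \<subseteq> U}. emeasure (mrestr M K) C)"
          using c V by (intro SUP_upper) auto
        finally show "emeasure M (K - V) \<le> (SUP C\<in>{C. compact C \<and> C \<subseteq> U}. emeasure (mrestr M K) C)" .
      qed
      finally show "emeasure (mrestr M K) U \<le> (SUP C\<in>{C. compact C \<and> C \<subseteq> U}. emeasure (mrestr M K) C) + ennreal e" .
    qed
    show "(SUP C\<in>{C. compact C \<and> C \<subseteq> U}. emeasure (mrestr M K) C) \<le> emeasure (mrestr M K) U"
      using U sr by (intro SUP_least emeasure_mono) auto
  qed
  show "emeasure (mrestr M K) B = (INF U\<in>{U. open U \<and> B \<subseteq> U}. emeasure (mrestr M K) U)" if B: "B \<in> sets borel" for B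
  proof (rule antisym)
    show "emeasure (mrestr M K) B \<le> (INF U\<in>{U. open U \<and> B \<subseteq> U}. emeasure (mrestr M K) U)"
      using sr by (intro INF_greatest emeasure_mono) auto
    have "(INF U\<in>{U. open U \<and> B \<subseteq> U}. emeasure (mrestr M K) U) \<le> (INF U\<in>{U. open U \<and> K \<inter> B \<subseteq> U}. emeasure M U)"
    proof (rule INF_mono, clarify)
      fix V assume V: "open V" "K \<inter> B \<subseteq> V"
      \<comment> \<open>Adding the complement of \<open>K\<close> turns an open neighbourhood of
        \<open>K \<inter> B\<close> into one of \<open>B\<close> without changing its trace on
        \<open>K\<close>.\<close>
      have o: "open (V \<union> -K)" using V K by (auto simp: compact_imp_closed open_closed)
      have "emeasure (mrestr M K) (V \<union> -K) = emeasure M (K \<inter> (V \<union> -K))" using o by (intro em) auto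
      also have "\<dots> \<le> emeasure M V" using V s by (intro emeasure_mono) auto
      finally show "\<exists>U\<in>{U. open U \<and> B \<subseteq> U}. emeasure (mrestr M K) U \<le> emeasure M V"
        using o V by (intro bexI[of _ "V \<union> -K"]) auto
    qed
    also have "\<dots> = emeasure M (K \<inter> B)" using Kb B by (intro radon_borel[OF M, symmetric]) auto
    also have "\<dots> = emeasure (mrestr M K) B" using B by (simp add: em)
    finally show "(INF U\<in>{U. open U \<and> B \<subseteq> U}. emeasure (mrestr M K) U) \<le> emeasure (mrestr M K) B" .
  qed
qed

text \<open>Each test function below \<open>f\<close> lives on a compact set, so a bound uniform
  over compact sets suffices, even if the space is not a countable union of compact sets.\<close>

lemma radon_integral_compact_SUP:
  fixes f :: "'a::t2_space \<Rightarrow> ennreal"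
  assumes lc: "locally_compact_space (euclidean :: 'a topology)" and M: "radon M" and f: "lsc f"
    and c: "\<And>K. compact K \<Longrightarrow> (\<integral>\<^sup>+x. f x * indicator K x \<partial>M) \<le> c"
  shows "(\<integral>\<^sup>+x. f x \<partial>M) \<le> c"
  unfolding radon_lsc_integral[OF lc M f]
proof (rule SUP_least)
  fix \<phi> assume \<phi>: "\<phi> \<in> Ccp_le f"
  then have \<phi>C: "\<phi> \<in> Ccp" by (simp add: Ccp_le_def)
  obtain K where K: "compact K" "\<And>x. x \<notin> K \<Longrightarrow> \<phi> x = 0" using CcpE[OF \<phi>C] by metis
  have "ennreal (integral\<^sup>L M \<phi>) = (\<integral>\<^sup>+x. ennreal (\<phi> x) \<partial>M)" using radon_nn_integral[OF M \<phi>C] by simp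
  also have "\<dots> \<le> (\<integral>\<^sup>+x. f x * indicator K x \<partial>M)"
    using \<phi> K by (intro nn_integral_mono) (auto simp: Ccp_le_def indicator_def)
  also have "\<dots> \<le> c" using c K by auto
  finally show "ennreal (integral\<^sup>L M \<phi>) \<le> c" .
qed

lemma concentrated_closed:
  fixes M :: "'a::t2_space measure"
  assumes M: "radon M" and E: "closed E"
  shows "concentrated_on M E \<longleftrightarrow> emeasure M (- E) = 0"
proof
  have s: "sets M = sets borel" using M by (rule radon_sets)
  assume c: "concentrated_on M E"
  have "emeasure M K = 0" if "compact K" "K \<subseteq> -E" for K
  proof -
    have "\<exists>N\<in>null_sets M. K - E \<subseteq> N" using c that(1) by (simp add: concentrated_on_def)
    then obtain N where "N \<in> null_sets M" "K - E \<subseteq> N" ..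
    moreover have "K - E = K" using that by auto
    moreover have "K \<in> sets M" using that s by (simp add: compact_imp_closed)
    ultimately show ?thesis by (metis null_sets_subset null_setsD1)
  qed
  then have "(SUP K\<in>{K. compact K \<and> K \<subseteq> -E}. emeasure M K) = (SUP K\<in>{K. compact K \<and> K \<subseteq> -E}. 0)"
    by (intro SUP_cong) auto
  also have "\<dots> = 0" by (rule SUP_const) (auto intro: exI[of _ "{}"])
  finally show "emeasure M (- E) = 0" using E by (subst radon_open[OF M]) auto
next
  assume z: "emeasure M (- E) = 0"
  have "-E \<in> null_sets M" using z E radon_sets[OF M] by (auto simp: null_sets_def)
  then show "concentrated_on M E" unfolding concentrated_on_def by blast
qed

section \<open>Vague convergence\<close>

definition vlim :: "'b filter \<Rightarrow> ('b \<Rightarrow> 'a::topological_space measure) \<Rightarrow> 'a measure \<Rightarrow> bool" where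
  "vlim F M \<nu> \<longleftrightarrow> (\<forall>\<phi>\<in>Cc. ((\<lambda>b. integral\<^sup>L (M b) \<phi>) \<longlongrightarrow> integral\<^sup>L \<nu> \<phi>) F)"

lemma vlimI:
  fixes M :: "'b \<Rightarrow> 'a::t2_space measure"
  assumes ev: "eventually (\<lambda>b. radon (M b)) F" and \<nu>: "radon \<nu>"
    and t: "\<And>\<phi>. \<phi> \<in> Ccp \<Longrightarrow> ((\<lambda>b. integral\<^sup>L (M b) \<phi>) \<longlongrightarrow> integral\<^sup>L \<nu> \<phi>) F"
  shows "vlim F M \<nu>"
  unfolding vlim_def
proof
  fix \<phi> :: "'a \<Rightarrow> real" assume "\<phi> \<in> Cc"
  define p where "p x = max (\<phi> x) 0" for x
  define n where "n x = max (- \<phi> x) 0" for x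
  have pn: "p \<in> Ccp" "n \<in> Ccp" "\<phi> = (\<lambda>x. p x - n x)"
    using Cc_decompose[OF \<open>\<phi> \<in> Cc\<close>] unfolding p_def[abs_def] n_def[abs_def] by simp_all
  have dec: "integral\<^sup>L N \<phi> = integral\<^sup>L N p - integral\<^sup>L N n" if "radon N" for N
    unfolding pn(3) using that pn(1,2) by (intro Bochner_Integration.integral_diff radon_integrable)
  have "((\<lambda>b. integral\<^sup>L (M b) p - integral\<^sup>L (M b) n) \<longlongrightarrow> integral\<^sup>L \<nu> p - integral\<^sup>L \<nu> n) F"
    by (intro tendsto_diff t pn)
  then have "((\<lambda>b. integral\<^sup>L (M b) p - integral\<^sup>L (M b) n) \<longlongrightarrow> integral\<^sup>L \<nu> \<phi>) F" by (simp add: dec[OF \<nu>])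
  moreover have "eventually (\<lambda>b. integral\<^sup>L (M b) p - integral\<^sup>L (M b) n = integral\<^sup>L (M b) \<phi>) F"
    using ev by eventually_elim (simp add: dec)
  ultimately show "((\<lambda>b. integral\<^sup>L (M b) \<phi>) \<longlongrightarrow> integral\<^sup>L \<nu> \<phi>) F" by (rule Lim_transform_eventually)
qed

lemma vlimD: "vlim F M \<nu> \<Longrightarrow> \<phi> \<in> Ccp \<Longrightarrow> ((\<lambda>b. integral\<^sup>L (M b) \<phi>) \<longlongrightarrow> integral\<^sup>L \<nu> \<phi>) F"
  by (simp add: vlim_def Ccp_def)

text \<open>Connects convergence of integrals with the generated topology used in
  \<open>consistent\<close>, by induction on how an open set is generated from the subbasis.\<close>

lemma vlim_eventually_openin:
  assumes v: "vlim F M \<nu>" and U: "openin vague U" "\<nu> \<in> U"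
  shows "eventually (\<lambda>b. M b \<in> U) F"
proof -
  have "generate_topology_on (insert UNIV {{M. integral\<^sup>L M \<phi> \<in> U} | \<phi> U. \<phi> \<in> Cc \<and> open (U::real set)}) U"
    using U(1) unfolding vague_def by (rule openin_topology_generated_by)
  then show ?thesis using U(2)
  proof (induction rule: generate_topology_on.induct)
    case (Int a b)
    then show ?case by (auto intro: eventually_conj)
  next
    case (UN K)
    then obtain k where "k \<in> K" "\<nu> \<in> k" by blast
    then have "eventually (\<lambda>b. M b \<in> k) F" using UN by blast
    then show ?case by (rule eventually_mono) (use \<open>k \<in> K\<close> in blast)
  next
    case (Basis s)
    then consider "s = UNIV" | \<phi> V where "s = {M. integral\<^sup>L M \<phi> \<in> V}" "\<phi> \<in> Cc" "open V" by auto
    then show ?case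
    proof cases
      case (2 \<phi> V)
      then have "((\<lambda>b. integral\<^sup>L (M b) \<phi>) \<longlongrightarrow> integral\<^sup>L \<nu> \<phi>) F" using v by (simp add: vlim_def)
      from topological_tendstoD[OF this 2(3)] show ?thesis using Basis 2(1) by simp
    qed auto
  qed auto
qed

lemma integral_le_compact:
  fixes M :: "'a::t2_space measure"
  assumes M: "radon M" and \<phi>: "\<phi> \<in> Ccp" and K: "compact K" "\<And>x. x \<notin> K \<Longrightarrow> \<phi> x = 0" and C: "\<And>x. \<phi> x \<le> C"
  shows "integral\<^sup>L M \<phi> \<le> C * measure M K"
proof -
  have Ks: "K \<in> sets M" using K radon_sets[OF M] by (simp add: compact_imp_closed)
  have "integrable M (\<lambda>x. C * indicator K x :: real)" using Ks radon_compact[OF M K(1)] by auto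
  then have "integral\<^sup>L M \<phi> \<le> integral\<^sup>L M (\<lambda>x. C * indicator K x)"
    using C K(2) by (intro integral_mono radon_integrable[OF M \<phi>]) (auto simp: indicator_def)
  then show ?thesis using Ks by simp
qed

text \<open>A bound on each compact set makes every test integral bounded, hence convergent along
  the ultrafilter; the limits form a positive functional, which is represented by a Radon
  measure.\<close>

lemma vlim_exists:
  fixes M :: "'b \<Rightarrow> 'a::t2_space measure"
  assumes lc: "locally_compact_space (euclidean :: 'a topology)" and U: "ultra U"
    and ev: "eventually (\<lambda>b. radon (M b)) U"
    and bd: "\<And>K. compact K \<Longrightarrow> \<exists>C. eventually (\<lambda>b. measure (M b) K \<le> C) U"
  obtains \<nu> where "radon \<nu>" "vlim U M \<nu>"
proof -
  have Unb: "U \<noteq> bot" using U by (rule ultra_not_bot)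
  have ex: "\<exists>l. ((\<lambda>b. integral\<^sup>L (M b) \<phi>) \<longlongrightarrow> l) U" if \<phi>: "\<phi> \<in> Ccp" for \<phi>
  proof -
    obtain K where K: "compact K" "\<And>x. x \<notin> K \<Longrightarrow> \<phi> x = 0" using CcpE[OF \<phi>] by metis
    obtain C where C: "C \<ge> 0" "\<And>x. \<phi> x \<le> C" using Ccp_bounded[OF \<phi>] by metis
    obtain D where D: "eventually (\<lambda>b. measure (M b) K \<le> D) U" using bd[OF K(1)] by blast
    have "eventually (\<lambda>b. \<bar>integral\<^sup>L (M b) \<phi>\<bar> \<le> C * D) U"
      using ev D
    proof eventually_elim
      case (elim b)
      have "integral\<^sup>L (M b) \<phi> \<le> C * measure (M b) K" using elim \<phi> K C by (intro integral_le_compact)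
      also have "\<dots> \<le> C * D" using elim C by (intro mult_left_mono)
      finally show ?case using integral_nonneg_Ccp[OF \<phi>, of "M b"] by simp
    qed
    then show ?thesis by (rule ultra_bounded_convergent[OF U])
  qed
  define L where "L \<phi> = Lim U (\<lambda>b. integral\<^sup>L (M b) \<phi>)" for \<phi> :: "'a \<Rightarrow> real"
  have L: "((\<lambda>b. integral\<^sup>L (M b) \<phi>) \<longlongrightarrow> L \<phi>) U" if "\<phi> \<in> Ccp" for \<phi>
    using ex[OF that] tendsto_Lim[OF Unb] unfolding L_def by metis
  have uniq: "L \<phi> = l" if "((\<lambda>b. integral\<^sup>L (M b) \<phi>) \<longlongrightarrow> l) U" "\<phi> \<in> Ccp" for \<phi> l
    using tendsto_unique[OF Unb L[OF that(2)] that(1)] .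
  obtain \<nu> where \<nu>: "radon \<nu>" "\<And>\<phi>. \<phi> \<in> Ccp \<Longrightarrow> integral\<^sup>L \<nu> \<phi> = L \<phi>"
  proof (rule Riesz_representation[OF lc, of L])
    show "0 \<le> L \<phi>" if "\<phi> \<in> Ccp" for \<phi>
      using L[OF that] by (rule tendsto_lowerbound[OF _ _ Unb]) (auto simp: integral_nonneg_Ccp that)
    fix \<phi> \<psi> :: "'a \<Rightarrow> real" assume a: "\<phi> \<in> Ccp" "\<psi> \<in> Ccp"
    have "((\<lambda>b. integral\<^sup>L (M b) \<phi> + integral\<^sup>L (M b) \<psi>) \<longlongrightarrow> L \<phi> + L \<psi>) U"
      by (intro tendsto_add L a)
    moreover have "eventually (\<lambda>b. integral\<^sup>L (M b) \<phi> + integral\<^sup>L (M b) \<psi> = integral\<^sup>L (M b) (\<lambda>x. \<phi> x + \<psi> x)) U"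
      using ev by eventually_elim (use a in \<open>simp add: radon_integrable\<close>)
    ultimately show "L (\<lambda>x. \<phi> x + \<psi> x) = L \<phi> + L \<psi>"
      by (intro uniq Ccp_add a) (rule Lim_transform_eventually)
  next
    fix \<phi> :: "'a \<Rightarrow> real" and c :: real assume a: "\<phi> \<in> Ccp" "0 \<le> c"
    have "((\<lambda>b. c * integral\<^sup>L (M b) \<phi>) \<longlongrightarrow> c * L \<phi>) U" by (intro tendsto_mult tendsto_const L a)
    then show "L (\<lambda>x. c * \<phi> x) = c * L \<phi>" using a by (intro uniq Ccp_scale) auto
  qed auto
  have "vlim U M \<nu>" using ev \<nu> L by (intro vlimI) auto
  then show ?thesis using that \<nu> by blast
qed

lemma vlim_lsc_le:
  fixes M :: "'b \<Rightarrow> 'a::t2_space measure"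
  assumes lc: "locally_compact_space (euclidean :: 'a topology)" and F: "F \<noteq> bot"
    and v: "vlim F M \<nu>" and \<nu>: "radon \<nu>" and ev: "eventually (\<lambda>b. radon (M b)) F" and f: "lsc f"
    and c: "eventually (\<lambda>b. (\<integral>\<^sup>+x. f x \<partial>M b) \<le> c) F"
  shows "(\<integral>\<^sup>+x. f x \<partial>\<nu>) \<le> c"
  unfolding radon_lsc_integral[OF lc \<nu> f]
proof (rule SUP_least)
  fix \<phi> assume \<phi>: "\<phi> \<in> Ccp_le f"
  then have \<phi>C: "\<phi> \<in> Ccp" by (simp add: Ccp_le_def)
  have "((\<lambda>b. ennreal (integral\<^sup>L (M b) \<phi>)) \<longlongrightarrow> ennreal (integral\<^sup>L \<nu> \<phi>)) F"
    by (intro tendsto_ennrealI vlimD[OF v] \<phi>C)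
  moreover have "eventually (\<lambda>b. ennreal (integral\<^sup>L (M b) \<phi>) \<le> c) F"
    using ev c
  proof eventually_elim
    case (elim b)
    have "ennreal (integral\<^sup>L (M b) \<phi>) \<le> (\<integral>\<^sup>+x. f x \<partial>M b)"
      unfolding radon_lsc_integral[OF lc elim(1) f] using \<phi> by (intro SUP_upper)
    then show ?case using elim(2) by (rule order_trans)
  qed
  ultimately show "ennreal (integral\<^sup>L \<nu> \<phi>) \<le> c" using F by (intro tendsto_upperbound)
qed

section \<open>Potentials and mutual energies\<close>

lemma lsc_cmult_indicator: "open V \<Longrightarrow> lsc (\<lambda>x. c * indicator V x)"
proof (unfold lsc_def, intro allI)
  fix t assume "open V"
  have "{x. t < c * indicator V x} = (if t < c then V else {})"
    by (auto simp: indicator_def split: if_splits)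
  then show "open {x. t < c * indicator V x}" using \<open>open V\<close> by auto
qed

locale lsc_sym_kernel =
  fixes \<kappa> :: "'a::t2_space \<Rightarrow> 'a \<Rightarrow> ennreal"
  assumes lc: "locally_compact_space (euclidean :: 'a topology)"
    and k_lsc: "lsc_kernel \<kappa>"
    and k_sym: "\<And>x y. \<kappa> x y = \<kappa> y x"
begin

text \<open>The kernel is the supremum of the directed family of finite maxima of multiples of open
  rectangles below it; for these Fubini's theorem is a finite computation.\<close>

definition rects :: "(ennreal \<times> 'a set \<times> 'a set) set" where
  "rects = {(c,U,V). open U \<and> open V \<and> (\<forall>x\<in>U. \<forall>y\<in>V. c \<le> \<kappa> x y)}"

definition frects :: "(ennreal \<times> 'a set \<times> 'a set) set set" where
  "frects = {T. finite T \<and> T \<subseteq> rects}"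

definition step :: "(ennreal \<times> 'a set \<times> 'a set) set \<Rightarrow> 'a \<Rightarrow> 'a \<Rightarrow> ennreal" where
  "step T x y = (SUP (c,U,V)\<in>T. c * indicator U x * indicator V y)"

lemma step_mono: "T \<subseteq> T' \<Longrightarrow> step T x y \<le> step T' x y"
  unfolding step_def by (intro SUP_subset_mono) auto

lemma frects_Un: "T \<in> frects \<Longrightarrow> T' \<in> frects \<Longrightarrow> T \<union> T' \<in> frects"
  by (auto simp: frects_def)

lemma empty_frects: "{} \<in> frects"
  by (simp add: frects_def)

lemma kernel_eq_SUP: "\<kappa> x y = (SUP T\<in>frects. step T x y)"
proof (rule antisym)
  show "\<kappa> x y \<le> (SUP T\<in>frects. step T x y)"
  proof (rule dense_le)
    fix t assume t: "t < \<kappa> x y"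
    have "open {z::'a\<times>'a. t < \<kappa> (fst z) (snd z)}" using k_lsc by (simp add: lsc_kernel_def)
    then obtain U V where UV: "open U" "open V" "(x,y) \<in> U \<times> V" "U \<times> V \<subseteq> {z. t < \<kappa> (fst z) (snd z)}"
      using t by (elim open_prod_elim[where x="(x,y)"]) auto
    then have "{(t,U,V)} \<in> frects" by (auto simp: frects_def rects_def intro!: less_imp_le)
    moreover have "step {(t,U,V)} x y = t" using UV by (simp add: step_def)
    ultimately show "t \<le> (SUP T\<in>frects. step T x y)" by (metis SUP_upper)
  qed
  show "(SUP T\<in>frects. step T x y) \<le> \<kappa> x y"
  proof (rule SUP_least)
    fix T assume "T \<in> frects"
    then have "c * indicator U x * indicator V y \<le> \<kappa> x y" if "(c,U,V) \<in> T" for c U V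
      using that by (auto simp: frects_def rects_def indicator_def)
    then show "step T x y \<le> \<kappa> x y" unfolding step_def by (auto intro!: SUP_least)
  qed
qed

lemma lsc_step: "T \<in> frects \<Longrightarrow> lsc (step T x)"
proof -
  assume T: "T \<in> frects"
  have "lsc (\<lambda>y. SUP r\<in>T. (fst r * indicator (fst (snd r)) x) * indicator (snd (snd r)) y)"
    using T by (intro lsc_SUP lsc_cmult_indicator) (auto simp: frects_def rects_def)
  then show ?thesis by (simp add: step_def[abs_def] case_prod_beta)
qed

text \<open>Finitely many rectangles are involved. On the open set \<open>W\<close> of points lying
  in every first side that contains \<open>x0\<close>, the step kernel is at least its value at
  \<open>x0\<close>, whatever \<open>y\<close> is.\<close>

lemma lsc_integral_step:
  assumes T: "T \<in> frects"
  shows "lsc (\<lambda>x. \<integral>\<^sup>+y. step T x y \<partial>\<nu>)"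
  unfolding lsc_def
proof (intro allI, subst open_subopen, clarify)
  fix t x0 assume t: "t < (\<integral>\<^sup>+y. step T x0 y \<partial>\<nu>)"
  define W where "W = (\<Inter>r\<in>{r\<in>T. x0 \<in> fst (snd r)}. fst (snd r))"
  have oW: "open W" unfolding W_def using T by (intro open_INT) (auto simp: frects_def rects_def)
  have "step T x0 y \<le> step T x y" if "x \<in> W" for x y
    unfolding step_def
  proof (rule SUP_mono)
    fix r assume "r \<in> T"
    then show "\<exists>m\<in>T. (case r of (c, U, V) \<Rightarrow> c * indicator U x0 * indicator V y) \<le>
        (case m of (c, U, V) \<Rightarrow> c * indicator U x * indicator V y)"
      using that by (intro bexI[of _ r]) (auto simp: W_def indicator_def split: prod.splits)
  qed
  then have "t < (\<integral>\<^sup>+y. step T x y \<partial>\<nu>)" if "x \<in> W" for x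
    using t that by (auto intro: less_le_trans nn_integral_mono)
  moreover have "x0 \<in> W" by (auto simp: W_def)
  ultimately show "\<exists>W. open W \<and> x0 \<in> W \<and> W \<subseteq> {x. t < (\<integral>\<^sup>+y. step T x y \<partial>\<nu>)}" using oW by blast
qed

lemma pot_eq_SUP:
  assumes \<nu>: "radon \<nu>"
  shows "pot \<kappa> x \<nu> = (SUP T\<in>frects. \<integral>\<^sup>+y. step T x y \<partial>\<nu>)"
proof -
  have "pot \<kappa> x \<nu> = (\<integral>\<^sup>+y. (SUP T\<in>frects. step T x y) \<partial>\<nu>)"
    unfolding pot_def by (intro nn_integral_cong kernel_eq_SUP)
  also have "\<dots> = (SUP T\<in>frects. \<integral>\<^sup>+y. step T x y \<partial>\<nu>)"
  proof (rule radon_directed_SUP[OF \<nu>])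
    fix i j assume "i \<in> frects" "j \<in> frects"
    then show "\<exists>k\<in>frects. \<forall>y. step i x y \<le> step k x y \<and> step j x y \<le> step k x y"
      by (intro bexI[of _ "i \<union> j"] frects_Un) (auto intro: step_mono)
  qed (use empty_frects lsc_step in auto)
  finally show ?thesis .
qed

lemma lsc_pot: "radon \<nu> \<Longrightarrow> lsc (\<lambda>x. pot \<kappa> x \<nu>)"
  unfolding pot_eq_SUP by (intro lsc_SUP lsc_integral_step)

lemma lsc_kernel_section: "lsc (\<kappa> x)"
proof -
  have "lsc (\<lambda>y. SUP T\<in>frects. step T x y)" by (intro lsc_SUP lsc_step)
  then show ?thesis by (simp add: kernel_eq_SUP[symmetric])
qed

lemma menergy_eq_SUP:
  assumes \<mu>: "radon \<mu>" and \<nu>: "radon \<nu>"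
  shows "menergy \<kappa> \<mu> \<nu> = (SUP T\<in>frects. \<integral>\<^sup>+x. \<integral>\<^sup>+y. step T x y \<partial>\<nu> \<partial>\<mu>)"
  unfolding menergy_def pot_eq_SUP[OF \<nu>]
proof (rule radon_directed_SUP[OF \<mu>])
  fix i j assume "i \<in> frects" "j \<in> frects"
  then show "\<exists>k\<in>frects. \<forall>x. (\<integral>\<^sup>+y. step i x y \<partial>\<nu>) \<le> (\<integral>\<^sup>+y. step k x y \<partial>\<nu>) \<and>
     (\<integral>\<^sup>+y. step j x y \<partial>\<nu>) \<le> (\<integral>\<^sup>+y. step k x y \<partial>\<nu>)"
    by (intro bexI[of _ "i \<union> j"] frects_Un) (auto intro!: step_mono nn_integral_mono)
qed (use empty_frects lsc_integral_step in auto)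

text \<open>The space is cut into the finitely many cells on which the set of rectangles with first
  side containing \<open>x\<close> is constant. This turns the step kernel into a finite sum of
  products of a function of \<open>x\<close> and a function of \<open>y\<close>, for which the order
  of integration is immaterial without any finiteness of the measures.\<close>

lemma step_Fubini:
  assumes T: "T \<in> frects" and \<mu>: "radon \<mu>" and \<nu>: "radon \<nu>"
  shows "(\<integral>\<^sup>+x. \<integral>\<^sup>+y. step T x y \<partial>\<nu> \<partial>\<mu>) = (\<integral>\<^sup>+y. \<integral>\<^sup>+x. step T x y \<partial>\<mu> \<partial>\<nu>)"
proof -
  have fin: "finite T" using T by (simp add: frects_def)
  define cell where "cell S = {x. {r\<in>T. x \<in> fst (snd r)} = S}" for S
  define col where "col S y = (SUP r\<in>S. fst r * indicator (snd (snd r)) y)" for S :: "(ennreal \<times> 'a set \<times> 'a set) set" and y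
  have cellm: "cell S \<in> sets borel" if "S \<in> Pow T" for S
  proof (cases "T = {}")
    case False
    have "cell S = (\<Inter>r\<in>T. if r \<in> S then fst (snd r) else - fst (snd r))"
      using that by (auto simp: cell_def split: if_splits)
    also have "\<dots> \<in> sets borel"
      using fin False T by (intro sets.finite_INT) (auto simp: frects_def rects_def)
    finally show ?thesis .
  qed (auto simp: cell_def)
  have colm: "col S \<in> borel_measurable borel" if "S \<in> Pow T" for S
  proof -
    have "lsc (col S)" unfolding col_def[abs_def] using that T
      by (intro lsc_SUP lsc_cmult_indicator) (auto simp: frects_def rects_def)
    then show ?thesis by (rule lsc_measurable)
  qed
  have eq: "step T x y = (\<Sum>S\<in>Pow T. indicator (cell S) x * col S y)" for x y
  proof -
    define S0 where "S0 = {r\<in>T. x \<in> fst (snd r)}"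
    have "(\<Sum>S\<in>Pow T. indicator (cell S) x * col S y) = (\<Sum>S\<in>{S0}. indicator (cell S) x * col S y)"
      using fin by (intro sum.mono_neutral_right) (auto simp: S0_def cell_def indicator_def)
    also have "\<dots> = col S0 y" by (simp add: cell_def S0_def)
    also have "\<dots> = step T x y"
    proof (rule antisym)
      show "col S0 y \<le> step T x y" unfolding col_def step_def
      proof (rule SUP_mono)
        fix r assume "r \<in> S0"
        then show "\<exists>m\<in>T. fst r * indicator (snd (snd r)) y \<le> (case m of (c, U, V) \<Rightarrow> c * indicator U x * indicator V y)"
          by (intro bexI[of _ r]) (auto simp: S0_def split: prod.splits)
      qed
      show "step T x y \<le> col S0 y" unfolding step_def
      proof (rule SUP_least, clarify)
        fix c U V assume r: "(c,U,V) \<in> T"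
        show "c * indicator U x * indicator V y \<le> col S0 y"
        proof (cases "x \<in> U")
          case True
          then have "(c,U,V) \<in> S0" using r by (auto simp: S0_def)
          then show ?thesis unfolding col_def using True by (intro SUP_upper2) auto
        qed auto
      qed
    qed
    finally show ?thesis by simp
  qed
  have s: "sets \<mu> = sets borel" "sets \<nu> = sets borel" using \<mu> \<nu> by (auto simp: radon_sets)
  have m1: "col S \<in> borel_measurable \<nu>" if "S \<in> Pow T" for S
    using colm[OF that] by (simp add: measurable_cong_sets[OF s(2) refl])
  have m2: "cell S \<in> sets \<mu>" if "S \<in> Pow T" for S using cellm[OF that] s by simp
  have "(\<integral>\<^sup>+y. step T x y \<partial>\<nu>) = (\<Sum>S\<in>Pow T. indicator (cell S) x * (\<integral>\<^sup>+y. col S y \<partial>\<nu>))" for x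
    unfolding eq using m1 by (subst nn_integral_sum) (auto simp: nn_integral_cmult)
  then have "(\<integral>\<^sup>+x. \<integral>\<^sup>+y. step T x y \<partial>\<nu> \<partial>\<mu>) = (\<Sum>S\<in>Pow T. emeasure \<mu> (cell S) * (\<integral>\<^sup>+y. col S y \<partial>\<nu>))"
    using m2 by (simp, subst nn_integral_sum) (auto simp: nn_integral_multc)
  moreover have "(\<integral>\<^sup>+x. step T x y \<partial>\<mu>) = (\<Sum>S\<in>Pow T. emeasure \<mu> (cell S) * col S y)" for y
    unfolding eq using m2 by (subst nn_integral_sum) (auto simp: nn_integral_multc)
  then have "(\<integral>\<^sup>+y. \<integral>\<^sup>+x. step T x y \<partial>\<mu> \<partial>\<nu>) = (\<Sum>S\<in>Pow T. emeasure \<mu> (cell S) * (\<integral>\<^sup>+y. col S y \<partial>\<nu>))"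
    using m1 by (simp, subst nn_integral_sum) (auto simp: nn_integral_cmult)
  ultimately show ?thesis by simp
qed

lemma menergy_sym:
  assumes \<mu>: "radon \<mu>" and \<nu>: "radon \<nu>"
  shows "menergy \<kappa> \<mu> \<nu> = menergy \<kappa> \<nu> \<mu>"
proof -
  have *: "menergy \<kappa> \<mu> \<nu> \<le> menergy \<kappa> \<nu> \<mu>" if r: "radon \<mu>" "radon \<nu>" for \<mu> \<nu>
    unfolding menergy_eq_SUP[OF r]
  proof (rule SUP_least)
    fix T assume T: "T \<in> frects"
    \<comment> \<open>Transposing the rectangles keeps them below the kernel because the kernel is
      symmetric.\<close>
    define T' where "T' = (\<lambda>(c,U,V). (c,V,U)) ` T"
    have "c \<le> \<kappa> x y" if "(c,U,V) \<in> T" "x \<in> V" "y \<in> U" for c U V x y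
      using T that by (subst k_sym) (auto simp: frects_def rects_def)
    then have T': "T' \<in> frects" using T by (auto simp: T'_def frects_def rects_def)
    have st: "step T x y = step T' y x" for x y
      unfolding step_def T'_def by (auto simp: image_image case_prod_beta mult_ac intro!: SUP_cong)
    have "(\<integral>\<^sup>+x. \<integral>\<^sup>+y. step T x y \<partial>\<nu> \<partial>\<mu>) = (\<integral>\<^sup>+y. \<integral>\<^sup>+x. step T' y x \<partial>\<mu> \<partial>\<nu>)"
      unfolding st[symmetric] by (rule step_Fubini[OF T r])
    also have "\<dots> \<le> menergy \<kappa> \<nu> \<mu>"
      unfolding menergy_eq_SUP[OF r(2,1)] using T' by (rule SUP_upper)
    finally show "(\<integral>\<^sup>+x. \<integral>\<^sup>+y. step T x y \<partial>\<nu> \<partial>\<mu>) \<le> menergy \<kappa> \<nu> \<mu>" .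
  qed
  show ?thesis using *[OF \<mu> \<nu>] *[OF \<nu> \<mu>] by (rule antisym)
qed

lemma menergy_mono_left:
  assumes "radon \<mu>" "radon \<mu>'" "radon \<nu>" and le: "\<And>\<phi>. \<phi> \<in> Ccp \<Longrightarrow> integral\<^sup>L \<mu> \<phi> \<le> integral\<^sup>L \<mu>' \<phi>"
  shows "menergy \<kappa> \<mu> \<nu> \<le> menergy \<kappa> \<mu>' \<nu>"
  unfolding menergy_def by (rule radon_lsc_mono[OF lc assms(1,2) le lsc_pot[OF assms(3)]])

lemma menergy_radd:
  assumes "radon \<mu>" "radon \<nu>" "radon \<omega>"
  shows "menergy \<kappa> (radd \<mu> \<nu>) \<omega> = menergy \<kappa> \<mu> \<omega> + menergy \<kappa> \<nu> \<omega>"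
    "menergy \<kappa> \<omega> (radd \<mu> \<nu>) = menergy \<kappa> \<omega> \<mu> + menergy \<kappa> \<omega> \<nu>"
proof -
  show *: "menergy \<kappa> (radd \<mu> \<nu>) \<omega> = menergy \<kappa> \<mu> \<omega> + menergy \<kappa> \<nu> \<omega>"
    unfolding menergy_def by (rule radd_props(2)[OF lc assms(1,2) lsc_pot[OF assms(3)]])
  show "menergy \<kappa> \<omega> (radd \<mu> \<nu>) = menergy \<kappa> \<omega> \<mu> + menergy \<kappa> \<omega> \<nu>"
    using * assms radd_props(1)[OF lc assms(1,2)] by (metis menergy_sym)
qed

lemma menergy_scale:
  assumes "radon \<mu>" "radon \<omega>"
  shows "menergy \<kappa> (scale_measure (ennreal r) \<mu>) \<omega> = ennreal r * menergy \<kappa> \<mu> \<omega>"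
    "menergy \<kappa> \<omega> (scale_measure (ennreal r) \<mu>) = ennreal r * menergy \<kappa> \<omega> \<mu>"
proof -
  show *: "menergy \<kappa> (scale_measure (ennreal r) \<mu>) \<omega> = ennreal r * menergy \<kappa> \<mu> \<omega>"
    unfolding menergy_def by (rule scale_lsc_integral[OF assms(1) lsc_pot[OF assms(2)]])
  show "menergy \<kappa> \<omega> (scale_measure (ennreal r) \<mu>) = ennreal r * menergy \<kappa> \<omega> \<mu>"
    using * assms radon_scale[OF assms(1)] by (metis menergy_sym)
qed

lemma menergy_rsum:
  assumes "\<And>i. i \<in> I \<Longrightarrow> radon (\<mu> i)" "\<And>K. compact K \<Longrightarrow> finite {i\<in>I. emeasure (\<mu> i) K \<noteq> 0}" "radon \<omega>"
  shows "menergy \<kappa> (rsum I \<mu>) \<omega> = (\<integral>\<^sup>+i. menergy \<kappa> (\<mu> i) \<omega> \<partial>count_space I)"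
  unfolding menergy_def by (rule rsum_props(2)[OF lc assms(1,2) lsc_pot[OF assms(3)]])

lemma menergy_mrestr_le:
  assumes "radon \<mu>" "B \<in> sets borel" "radon (mrestr \<mu> B)" "radon \<omega>"
  shows "menergy \<kappa> (mrestr \<mu> B) \<omega> \<le> menergy \<kappa> \<mu> \<omega>" "menergy \<kappa> \<omega> (mrestr \<mu> B) \<le> menergy \<kappa> \<omega> \<mu>"
proof -
  show *: "menergy \<kappa> (mrestr \<mu> B) \<omega> \<le> menergy \<kappa> \<mu> \<omega>"
    unfolding menergy_def using lsc_pot[OF assms(4)] assms
    by (subst nn_integral_mrestr) (auto intro!: nn_integral_mono simp: indicator_def lsc_measurable)
  show "menergy \<kappa> \<omega> (mrestr \<mu> B) \<le> menergy \<kappa> \<omega> \<mu>"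
    using * menergy_sym[OF assms(3,4)] menergy_sym[OF assms(1,4)] by simp
qed

lemma menergy_mrestr_self_le:
  assumes "radon \<mu>" "B \<in> sets borel" "radon (mrestr \<mu> B)"
  shows "menergy \<kappa> (mrestr \<mu> B) (mrestr \<mu> B) \<le> menergy \<kappa> \<mu> \<mu>"
  using menergy_mrestr_le(1)[OF assms assms(3)] menergy_mrestr_le(2)[OF assms assms(1)] by (rule order_trans)

end

section \<open>The energy norm\<close>

lemma nn_integral_set_mono_measure:
  assumes r: "radon \<mu>" "radon \<nu>" and S: "S \<in> sets borel" and f: "f \<in> borel_measurable borel"
    and le: "\<And>X. X \<in> sets borel \<Longrightarrow> X \<subseteq> S \<Longrightarrow> emeasure \<nu> X \<le> emeasure \<mu> X"
  shows "(\<integral>\<^sup>+x. f x * indicator S x \<partial>\<nu>) \<le> (\<integral>\<^sup>+x. f x * indicator S x \<partial>\<mu>)"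
proof -
  have s: "sets (mrestr \<nu> S) = sets (mrestr \<mu> S)" using r by (simp add: radon_sets)
  have "emeasure (mrestr \<nu> S) X \<le> emeasure (mrestr \<mu> S) X" for X
  proof (cases "X \<in> sets borel")
    case True
    then show ?thesis using r S by (simp add: emeasure_mrestr le)
  next
    case False
    then show ?thesis using r by (simp add: emeasure_notin_sets radon_sets)
  qed
  then have "mrestr \<nu> S \<le> mrestr \<mu> S"
    using s sets_eq_imp_space_eq[OF s] by (auto simp: le_measure_iff le_fun_def)
  then have "(\<integral>\<^sup>+x. f x \<partial>mrestr \<nu> S) \<le> (\<integral>\<^sup>+x. f x \<partial>mrestr \<mu> S)" using s by (intro nn_integral_mono_measure)
  then show ?thesis using r S f by (simp add: nn_integral_mrestr)
qed

text \<open>Restricting to \<open>K\<close> gives a finite measure, for which Borel sets are inner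
  regular; \<open>M\<close> itself offers this for open sets only.\<close>

lemma radon_null_of_compacts:
  fixes M :: "'a::t2_space measure"
  assumes M: "radon M" and K: "compact K" and B: "B \<in> sets borel" "B \<subseteq> K"
    and z: "\<And>Q. compact Q \<Longrightarrow> Q \<subseteq> B \<Longrightarrow> emeasure M Q = 0"
  shows "emeasure M B = 0"
proof -
  have Kb: "K \<in> sets borel" using K by (simp add: compact_imp_closed)
  have s: "sets M = sets borel" using M by (rule radon_sets)
  have rK: "radon (mrestr M K)" using radon_mrestr_compact[OF M K] .
  have fin: "emeasure (mrestr M K) UNIV < \<top>" using radon_compact[OF M K] by (simp add: emeasure_mrestr[OF M Kb])
  have "emeasure M B \<le> 0"
  proof (rule ennreal_le_epsilon)
    fix e :: real assume "e > 0"
    then obtain Q where Q: "compact Q" "Q \<subseteq> B" "emeasure (mrestr M K) (B - Q) \<le> ennreal e"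
      using radon_finite_inner[OF rK fin B(1)] by metis
    have Qb: "Q \<in> sets borel" using Q by (simp add: compact_imp_closed)
    have "emeasure M (B - Q) \<le> ennreal e"
      using Q(3) B Qb by (subst (asm) emeasure_mrestr[OF M Kb]) (auto simp: Int_absorb1 subset_iff)
    moreover have "emeasure M B \<le> emeasure M Q + emeasure M (B - Q)"
      using emeasure_subadditive[of Q M "B - Q"] Qb B s Q by (simp add: Un_absorb1)
    ultimately show "emeasure M B \<le> 0 + ennreal e" using z[OF Q(1,2)] by (metis add_left_mono order_trans)
  qed
  then show ?thesis by simp
qed

lemma radd_emeasure_le:
  fixes M N :: "'a::t2_space measure"
  assumes lc: "locally_compact_space (euclidean :: 'a topology)" and r: "radon M" "radon N" and B: "B \<in> sets borel"
  shows "emeasure M B + emeasure N B \<le> emeasure (radd M N) B"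
  unfolding radon_borel[OF radd_props(1)[OF lc r] B]
proof (rule INF_greatest, clarify)
  fix U assume U: "open U" "B \<subseteq> U"
  have "emeasure (radd M N) U = emeasure M U + emeasure N U"
    using radd_props(2)[OF lc r lsc_indicator[OF U(1)]] U r radd_props(1)[OF lc r] by (simp add: radon_sets)
  moreover have "emeasure M B + emeasure N B \<le> emeasure M U + emeasure N U"
    using U r by (intro add_mono emeasure_mono) (auto simp: radon_sets)
  ultimately show "emeasure M B + emeasure N B \<le> emeasure (radd M N) U" by simp
qed

lemma Riesz_difference:
  fixes M N :: "'a::t2_space measure"
  assumes lc: "locally_compact_space (euclidean :: 'a topology)" and r: "radon M" "radon N"
    and le: "\<And>\<phi>. \<phi> \<in> Ccp \<Longrightarrow> integral\<^sup>L N \<phi> \<le> integral\<^sup>L M \<phi>"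
  obtains D where "radon D" "M = radd D N"
proof -
  obtain D where D: "radon D" "\<And>\<phi>. \<phi> \<in> Ccp \<Longrightarrow> integral\<^sup>L D \<phi> = integral\<^sup>L M \<phi> - integral\<^sup>L N \<phi>"
    by (rule Riesz_representation[OF lc, of "\<lambda>\<phi>. integral\<^sup>L M \<phi> - integral\<^sup>L N \<phi>"])
       (auto simp: le radon_integrable r algebra_simps)
  have "M = radd D N"
    using r D radd_props(1)[OF lc D(1) r(2)] by (intro radon_eqI[OF lc]) (auto simp: radd_integral[OF lc])
  then show ?thesis using that D by blast
qed

text \<open>\<open>strictly_pos_def\<close> speaks only about mutually singular pairs. To apply it
  to a difference of two arbitrary measures, their common part \<open>c\<close> has to be split off;
  singularity is local, so Hahn sets are needed only inside compact sets.\<close>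

lemma radon_Jordan:
  fixes \<mu> \<nu> :: "'a::t2_space measure"
  assumes lc: "locally_compact_space (euclidean :: 'a topology)" and r: "radon \<mu>" "radon \<nu>"
  obtains p n c where "radon p" "radon n" "radon c" "signed_radon (p,n)" "\<mu> = radd p c" "\<nu> = radd n c"
proof -
  define V where "V f S = (\<integral>\<^sup>+x. f x * indicator S x \<partial>\<mu>) + (\<integral>\<^sup>+x. f x * indicator (-S) x \<partial>\<nu>)"
    for f :: "'a \<Rightarrow> ennreal" and S
  \<comment> \<open>\<open>W\<close> is the integral against the lattice infimum of \<open>\<mu>\<close> and \<open>\<nu>\<close>.\<close>
  define W where "W f = (INF S\<in>sets borel. V f S)" for f :: "'a \<Rightarrow> ennreal"
  have s: "sets \<mu> = sets borel" "sets \<nu> = sets borel" using r by (auto simp: radon_sets)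
  have meas: "f \<in> borel_measurable \<mu>" "f \<in> borel_measurable \<nu>" if "f \<in> borel_measurable borel" for f :: "'a \<Rightarrow> ennreal"
    using that by (simp_all add: measurable_cong_sets[OF s(1) refl] measurable_cong_sets[OF s(2) refl])
  have Wmu: "W f \<le> (\<integral>\<^sup>+x. f x \<partial>\<mu>)" and Wnu: "W f \<le> (\<integral>\<^sup>+x. f x \<partial>\<nu>)" for f
  proof -
    have "W f \<le> V f UNIV" "W f \<le> V f {}" unfolding W_def by (auto intro!: INF_lower)
    then show "W f \<le> (\<integral>\<^sup>+x. f x \<partial>\<mu>)" "W f \<le> (\<integral>\<^sup>+x. f x \<partial>\<nu>)" by (auto simp: V_def)
  qed
  have hahn: "\<exists>Y\<in>sets borel. Y \<subseteq> K \<and> (\<forall>X\<in>sets borel. X \<subseteq> Y \<longrightarrow> emeasure \<nu> X \<le> emeasure \<mu> X) \<and>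
      (\<forall>X\<in>sets borel. X \<subseteq> K \<longrightarrow> X \<inter> Y = {} \<longrightarrow> emeasure \<mu> X \<le> emeasure \<nu> X)" if "compact K" for K
  proof -
    have "K \<in> sets \<mu>" "emeasure \<mu> K \<noteq> \<top>" "emeasure \<nu> K \<noteq> \<top>" "sets \<nu> = sets \<mu>"
      using radon_compact[OF r(1) that] radon_compact[OF r(2) that] borel_closed[OF compact_imp_closed[OF that]]
      by (simp_all add: s)
    from unsigned_Hahn_decomposition[OF this(4,1,2,3)] show ?thesis unfolding s(1) .
  qed
  have split: "(\<integral>\<^sup>+x. f x * indicator B x \<partial>M) = (\<integral>\<^sup>+x. f x * indicator (B \<inter> S) x \<partial>M) + (\<integral>\<^sup>+x. f x * indicator (B - S) x \<partial>M)"
    if "f \<in> borel_measurable M" "B \<in> sets M" "S \<in> sets M" for f B S and M :: "'a measure"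
    using that by (subst nn_integral_add[symmetric]) (auto intro!: nn_integral_cong simp: indicator_def)
  \<comment> \<open>The infimum defining \<open>W\<close> is attained by taking the smaller of the
    two measures on each side of the Hahn set. One set \<open>Y\<close> serves every
    \<open>f\<close> vanishing off \<open>K\<close>, and this common minimizer makes
    \<open>W\<close> additive.\<close>
  have attained: "W f = V f (- Y)"
    if Y: "Y \<in> sets borel" "Y \<subseteq> K" "\<forall>X\<in>sets borel. X \<subseteq> Y \<longrightarrow> emeasure \<nu> X \<le> emeasure \<mu> X"
      "\<forall>X\<in>sets borel. X \<subseteq> K \<longrightarrow> X \<inter> Y = {} \<longrightarrow> emeasure \<mu> X \<le> emeasure \<nu> X"
      and K: "compact K" and f: "f \<in> borel_measurable borel" "\<And>x. x \<notin> K \<Longrightarrow> f x = 0" for K Y f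
  proof (rule antisym)
    have Kb: "K \<in> sets borel" using K by (simp add: compact_imp_closed)
    show "W f \<le> V f (- Y)" unfolding W_def using Y by (intro INF_lower) auto
    show "V f (- Y) \<le> W f" unfolding W_def
    proof (rule INF_greatest)
      fix S :: "'a set" assume S: "S \<in> sets borel"
      have K1: "(\<integral>\<^sup>+x. f x * indicator (- Y) x \<partial>\<mu>) = (\<integral>\<^sup>+x. f x * indicator (K - Y) x \<partial>\<mu>)"
        using f(2) by (intro nn_integral_cong) (auto simp: indicator_def)
      have a1: "(\<integral>\<^sup>+x. f x * indicator (K - Y - S) x \<partial>\<mu>) \<le> (\<integral>\<^sup>+x. f x * indicator (K - Y - S) x \<partial>\<nu>)"
        using r S Y Kb f by (intro nn_integral_set_mono_measure) (auto simp: Y(4) subset_iff disjoint_iff)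
      have a2: "(\<integral>\<^sup>+x. f x * indicator (Y \<inter> S) x \<partial>\<nu>) \<le> (\<integral>\<^sup>+x. f x * indicator (Y \<inter> S) x \<partial>\<mu>)"
        using r S Y Kb f by (intro nn_integral_set_mono_measure) (auto simp: Y(3))
      have "V f (- Y) = ((\<integral>\<^sup>+x. f x * indicator ((K - Y) \<inter> S) x \<partial>\<mu>) + (\<integral>\<^sup>+x. f x * indicator (K - Y - S) x \<partial>\<mu>))
          + ((\<integral>\<^sup>+x. f x * indicator (Y \<inter> S) x \<partial>\<nu>) + (\<integral>\<^sup>+x. f x * indicator (Y - S) x \<partial>\<nu>))"
      proof -
        have "K - Y \<in> sets \<mu>" "S \<in> sets \<mu>" "Y \<in> sets \<nu>" "S \<in> sets \<nu>" using Y(1) Kb S s by auto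
        then show ?thesis
          unfolding V_def K1 double_complement
          using split[OF meas(1)[OF f(1)], of "K - Y" S] split[OF meas(2)[OF f(1)], of Y S] by simp
      qed
      also have "\<dots> \<le> ((\<integral>\<^sup>+x. f x * indicator ((K - Y) \<inter> S) x \<partial>\<mu>) + (\<integral>\<^sup>+x. f x * indicator (K - Y - S) x \<partial>\<nu>))
          + ((\<integral>\<^sup>+x. f x * indicator (Y \<inter> S) x \<partial>\<mu>) + (\<integral>\<^sup>+x. f x * indicator (Y - S) x \<partial>\<nu>))"
        by (intro add_mono a1 a2 order_refl)
      also have "\<dots> = ((\<integral>\<^sup>+x. f x * indicator ((K - Y) \<inter> S) x \<partial>\<mu>) + (\<integral>\<^sup>+x. f x * indicator (Y \<inter> S) x \<partial>\<mu>))
          + ((\<integral>\<^sup>+x. f x * indicator (K - Y - S) x \<partial>\<nu>) + (\<integral>\<^sup>+x. f x * indicator (Y - S) x \<partial>\<nu>))"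
        by (simp add: ac_simps)
      also have "\<dots> = (\<integral>\<^sup>+x. f x * indicator ((K - Y) \<inter> S) x + f x * indicator (Y \<inter> S) x \<partial>\<mu>)
          + (\<integral>\<^sup>+x. f x * indicator (K - Y - S) x + f x * indicator (Y - S) x \<partial>\<nu>)"
        using meas[OF f(1)] Y Kb S s by (subst (1 2) nn_integral_add) auto
      also have "\<dots> \<le> V f S" unfolding V_def
        by (intro add_mono nn_integral_mono) (auto simp: indicator_def)
      finally show "V f (- Y) \<le> V f S" .
    qed
  qed
  have Ccp_m: "(\<lambda>x. ennreal (\<phi> x)) \<in> borel_measurable borel" if "\<phi> \<in> Ccp" for \<phi> :: "'a \<Rightarrow> real"
    using lsc_measurable[OF Ccp_lsc[OF that]] .
  have Wfin: "W (\<lambda>x. ennreal (\<phi> x)) < \<top>" if "\<phi> \<in> Ccp" for \<phi>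
    using Wmu[of "\<lambda>x. ennreal (\<phi> x)"] radon_nn_integral[OF r(1) that] by (auto intro: le_less_trans)
  obtain c where c: "radon c" "\<And>\<phi>. \<phi> \<in> Ccp \<Longrightarrow> integral\<^sup>L c \<phi> = enn2real (W (\<lambda>x. ennreal (\<phi> x)))"
  proof (rule Riesz_representation[OF lc, of "\<lambda>\<phi>. enn2real (W (\<lambda>x. ennreal (\<phi> x)))"])
    fix \<phi> \<psi> :: "'a \<Rightarrow> real" assume a: "\<phi> \<in> Ccp" "\<psi> \<in> Ccp"
    obtain K where K: "compact K" "\<And>x. x \<notin> K \<Longrightarrow> \<phi> x = 0" using CcpE[OF a(1)] by metis
    obtain L where L: "compact L" "\<And>x. x \<notin> L \<Longrightarrow> \<psi> x = 0" using CcpE[OF a(2)] by metis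
    have cKL: "compact (K \<union> L)" using K L by auto
    obtain Y where Y: "Y \<in> sets borel" "Y \<subseteq> K \<union> L" "\<forall>X\<in>sets borel. X \<subseteq> Y \<longrightarrow> emeasure \<nu> X \<le> emeasure \<mu> X"
      "\<forall>X\<in>sets borel. X \<subseteq> K \<union> L \<longrightarrow> X \<inter> Y = {} \<longrightarrow> emeasure \<mu> X \<le> emeasure \<nu> X" using hahn[OF cKL] by blast
    have e: "W (\<lambda>x. ennreal (\<eta> x)) = V (\<lambda>x. ennreal (\<eta> x)) (-Y)" if "\<eta> \<in> Ccp" "\<And>x. x \<notin> K \<union> L \<Longrightarrow> \<eta> x = 0" for \<eta>
      using that by (intro attained[OF Y cKL] Ccp_m) auto
    have add: "V (\<lambda>x. ennreal (\<phi> x + \<psi> x)) (-Y) = V (\<lambda>x. ennreal (\<phi> x)) (-Y) + V (\<lambda>x. ennreal (\<psi> x)) (-Y)"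
    proof -
      have m: "(\<lambda>x. ennreal (\<phi> x) * indicator B x) \<in> borel_measurable M"
        "(\<lambda>x. ennreal (\<psi> x) * indicator B x) \<in> borel_measurable M" if "B \<in> sets borel" "sets M = sets borel" for B M
        using Ccp_m[OF a(1)] Ccp_m[OF a(2)] that by (auto simp: measurable_cong_sets[OF that(2) refl])
      have "(\<integral>\<^sup>+x. ennreal (\<phi> x + \<psi> x) * indicator B x \<partial>M) =
         (\<integral>\<^sup>+x. ennreal (\<phi> x) * indicator B x \<partial>M) + (\<integral>\<^sup>+x. ennreal (\<psi> x) * indicator B x \<partial>M)"
        if "B \<in> sets borel" "sets M = sets borel" for B M
        using m[OF that] a by (subst nn_integral_add[symmetric]) (auto simp: ennreal_plus Ccp_nonneg distrib_right)
      then show ?thesis unfolding V_def using Y(1) s by (simp add: ac_simps)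
    qed
    show "enn2real (W (\<lambda>x. ennreal (\<phi> x + \<psi> x))) = enn2real (W (\<lambda>x. ennreal (\<phi> x))) + enn2real (W (\<lambda>x. ennreal (\<psi> x)))"
      using e[OF Ccp_add[OF a]] e[OF a(1)] e[OF a(2)] add Wfin[OF a(1)] Wfin[OF a(2)] K L
      by (simp add: enn2real_plus)
  next
    fix \<phi> :: "'a \<Rightarrow> real" and t :: real assume a: "\<phi> \<in> Ccp" "0 \<le> t"
    obtain K where K: "compact K" "\<And>x. x \<notin> K \<Longrightarrow> \<phi> x = 0" using CcpE[OF a(1)] by metis
    obtain Y where Y: "Y \<in> sets borel" "Y \<subseteq> K" "\<forall>X\<in>sets borel. X \<subseteq> Y \<longrightarrow> emeasure \<nu> X \<le> emeasure \<mu> X"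
      "\<forall>X\<in>sets borel. X \<subseteq> K \<longrightarrow> X \<inter> Y = {} \<longrightarrow> emeasure \<mu> X \<le> emeasure \<nu> X" using hahn[OF K(1)] by blast
    have e: "W (\<lambda>x. ennreal (\<eta> x)) = V (\<lambda>x. ennreal (\<eta> x)) (-Y)" if "\<eta> \<in> Ccp" "\<And>x. x \<notin> K \<Longrightarrow> \<eta> x = 0" for \<eta>
      using that by (intro attained[OF Y K(1)] Ccp_m) auto
    have "(\<integral>\<^sup>+x. ennreal (t * \<phi> x) * indicator B x \<partial>M) = ennreal t * (\<integral>\<^sup>+x. ennreal (\<phi> x) * indicator B x \<partial>M)"
      if "B \<in> sets borel" "sets M = sets borel" for B M
      using Ccp_m[OF a(1)] that a(2)
      by (subst nn_integral_cmult[symmetric]) (auto simp: measurable_cong_sets[OF that(2) refl] ennreal_mult' mult.assoc)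
    then have "V (\<lambda>x. ennreal (t * \<phi> x)) (-Y) = ennreal t * V (\<lambda>x. ennreal (\<phi> x)) (-Y)"
      unfolding V_def using Y(1) s by (simp add: distrib_left)
    then show "enn2real (W (\<lambda>x. ennreal (t * \<phi> x))) = t * enn2real (W (\<lambda>x. ennreal (\<phi> x)))"
      using e[OF Ccp_scale[OF a]] e[OF a(1)] K a(2) by (simp add: enn2real_mult)
  qed auto
  have cW: "ennreal (integral\<^sup>L c \<phi>) = W (\<lambda>x. ennreal (\<phi> x))" if "\<phi> \<in> Ccp" for \<phi>
    using c(2)[OF that] Wfin[OF that] by simp
  have cmu: "integral\<^sup>L c \<phi> \<le> integral\<^sup>L \<mu> \<phi>" and cnu: "integral\<^sup>L c \<phi> \<le> integral\<^sup>L \<nu> \<phi>" if "\<phi> \<in> Ccp" for \<phi>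
  proof -
    have "ennreal (integral\<^sup>L c \<phi>) \<le> ennreal (integral\<^sup>L \<mu> \<phi>)" "ennreal (integral\<^sup>L c \<phi>) \<le> ennreal (integral\<^sup>L \<nu> \<phi>)"
      unfolding cW[OF that] using Wmu Wnu radon_nn_integral[OF r(1) that] radon_nn_integral[OF r(2) that] by metis+
    then show "integral\<^sup>L c \<phi> \<le> integral\<^sup>L \<mu> \<phi>" "integral\<^sup>L c \<phi> \<le> integral\<^sup>L \<nu> \<phi>"
      using integral_nonneg_Ccp[OF that] by (auto simp: ennreal_le_iff)
  qed
  obtain p where p: "radon p" "\<mu> = radd p c" using Riesz_difference[OF lc r(1) c(1) cmu] by blast
  obtain n where n: "radon n" "\<nu> = radd n c" using Riesz_difference[OF lc r(2) c(1) cnu] by blast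
  \<comment> \<open>A lower bound for \<open>c\<close> on compact sets: a test function equal to 1
    on \<open>Q\<close> and supported in a given neighbourhood \<open>U\<close> turns the assumption
    on all splittings of \<open>Q\<close> into a lower bound for \<open>W\<close>.\<close>
  have cge: "m \<le> emeasure c Q" if Q: "compact Q" and
      m: "\<And>S. S \<in> sets borel \<Longrightarrow> m \<le> emeasure \<mu> (Q \<inter> S) + emeasure \<nu> (Q - S)" for Q m
  proof -
    have Qb: "Q \<in> sets borel" using Q by (simp add: compact_imp_closed)
    show ?thesis unfolding radon_borel[OF c(1) Qb]
    proof (rule INF_greatest, clarify)
      fix U assume U: "open U" "Q \<subseteq> U"
      obtain \<phi> L where \<phi>: "\<phi> \<in> Ccp" "\<And>x. \<phi> x \<le> 1" "\<And>x. x \<in> Q \<Longrightarrow> \<phi> x = 1" "L \<subseteq> U" "\<And>x. x \<notin> L \<Longrightarrow> \<phi> x = 0"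
        using Urysohn_Cc[OF lc Q U] by metis
      have "m \<le> V (\<lambda>x. ennreal (\<phi> x)) S" if S: "S \<in> sets borel" for S
      proof -
        have "m \<le> emeasure \<mu> (Q \<inter> S) + emeasure \<nu> (Q - S)" using m S by blast
        also have "\<dots> = (\<integral>\<^sup>+x. indicator (Q \<inter> S) x \<partial>\<mu>) + (\<integral>\<^sup>+x. indicator (Q - S) x \<partial>\<nu>)"
          using Qb S s by simp
        also have "\<dots> \<le> V (\<lambda>x. ennreal (\<phi> x)) S" unfolding V_def
          using \<phi>(3) by (intro add_mono nn_integral_mono) (auto simp: indicator_def)
        finally show ?thesis .
      qed
      then have "m \<le> W (\<lambda>x. ennreal (\<phi> x))" unfolding W_def by (intro INF_greatest)
      also have "\<dots> = (\<integral>\<^sup>+x. ennreal (\<phi> x) \<partial>c)" using cW[OF \<phi>(1)] radon_nn_integral[OF c(1) \<phi>(1)] by simp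
      also have "\<dots> \<le> (\<integral>\<^sup>+x. indicator U x \<partial>c)"
        using \<phi>(2,4,5) by (intro nn_integral_mono) (force simp: indicator_def)
      also have "\<dots> = emeasure c U" using U radon_sets[OF c(1)] by simp
      finally show "m \<le> emeasure c U" .
    qed
  qed
  have "signed_radon (p,n)"
    unfolding signed_radon_def
  proof (intro conjI allI impI)
    fix K :: "'a set" assume K: "compact K"
    obtain Y where Y: "Y \<in> sets borel" "Y \<subseteq> K" "\<forall>X\<in>sets borel. X \<subseteq> Y \<longrightarrow> emeasure \<nu> X \<le> emeasure \<mu> X"
      "\<forall>X\<in>sets borel. X \<subseteq> K \<longrightarrow> X \<inter> Y = {} \<longrightarrow> emeasure \<mu> X \<le> emeasure \<nu> X" using hahn[OF K] by blast
    have Kb: "K \<in> sets borel" using K by (simp add: compact_imp_closed)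
    \<comment> \<open>Cancellation of \<open>emeasure c Q\<close>, legitimate because this value is
      finite on compact sets.\<close>
    have zero: "emeasure d Q = 0" if "emeasure d Q + emeasure c Q \<le> x" "x \<le> emeasure c Q" "compact Q" for d Q and x :: ennreal
    proof -
      have "emeasure c Q + emeasure d Q \<le> emeasure c Q" using that(1,2) by (metis add.commute order_trans)
      then show ?thesis using radon_compact[OF c(1) that(3)]
        by (cases "emeasure c Q"; cases "emeasure d Q") (auto simp flip: ennreal_plus simp: top_unique)
    qed
    \<comment> \<open>On the Hahn set \<open>\<nu>\<close> is the smaller measure, so
      \<open>c\<close> already has all the mass of \<open>\<nu>\<close> there and nothing is left
      for \<open>n\<close>.\<close>
    have nY: "emeasure n Y = 0"
    proof (rule radon_null_of_compacts[OF n(1) K Y(1,2)])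
      fix Q assume Q: "compact Q" "Q \<subseteq> Y"
      have Qb: "Q \<in> sets borel" using Q by (simp add: compact_imp_closed)
      have "emeasure \<nu> Q \<le> emeasure c Q"
      proof (rule cge[OF Q(1)])
        fix S :: "'a set" assume S: "S \<in> sets borel"
        have "emeasure \<nu> Q \<le> emeasure \<nu> (Q \<inter> S) + emeasure \<nu> (Q - S)"
          using Qb S s emeasure_subadditive[of "Q \<inter> S" \<nu> "Q - S"] by (simp add: Int_Diff_Un)
        also have "\<dots> \<le> emeasure \<mu> (Q \<inter> S) + emeasure \<nu> (Q - S)"
          using Y(3)[rule_format, of "Q \<inter> S"] Q Qb S by (intro add_mono) auto
        finally show "emeasure \<nu> Q \<le> emeasure \<mu> (Q \<inter> S) + emeasure \<nu> (Q - S)" .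
      qed
      moreover have "emeasure n Q + emeasure c Q \<le> emeasure \<nu> Q"
        unfolding n(2) by (rule radd_emeasure_le[OF lc n(1) c(1) Qb])
      ultimately show "emeasure n Q = 0" using zero Q(1) by blast
    qed
    have pY: "emeasure p (K - Y) = 0"
    proof (rule radon_null_of_compacts[OF p(1) K])
      show "K - Y \<in> sets borel" using Kb Y by auto
      fix Q assume Q: "compact Q" "Q \<subseteq> K - Y"
      have Qb: "Q \<in> sets borel" using Q by (simp add: compact_imp_closed)
      have "emeasure \<mu> Q \<le> emeasure c Q"
      proof (rule cge[OF Q(1)])
        fix S :: "'a set" assume S: "S \<in> sets borel"
        have "emeasure \<mu> Q \<le> emeasure \<mu> (Q \<inter> S) + emeasure \<mu> (Q - S)"
          using Qb S s emeasure_subadditive[of "Q \<inter> S" \<mu> "Q - S"] by (simp add: Int_Diff_Un)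
        also have "\<dots> \<le> emeasure \<mu> (Q \<inter> S) + emeasure \<nu> (Q - S)"
          using Y(4)[rule_format, of "Q - S"] Q Qb S by (intro add_mono) auto
        finally show "emeasure \<mu> Q \<le> emeasure \<mu> (Q \<inter> S) + emeasure \<nu> (Q - S)" .
      qed
      moreover have "emeasure p Q + emeasure c Q \<le> emeasure \<mu> Q"
        unfolding p(2) by (rule radd_emeasure_le[OF lc p(1) c(1) Qb])
      ultimately show "emeasure p Q = 0" using zero Q(1) by blast
    qed auto
    have "K \<inter> Y = Y" using Y(2) by auto
    then show "\<exists>P\<in>sets borel. emeasure (fst (p, n)) (K - P) = 0 \<and> emeasure (snd (p, n)) (K \<inter> P) = 0"
      using Y(1) nY pY by (intro bexI[of _ Y]) auto
  qed (use p n in auto)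
  then show ?thesis using that p n c by blast
qed

section \<open>The pre-Hilbert structure on measures of finite energy\<close>

locale pd_kernel = lsc_sym_kernel \<kappa> for \<kappa> :: "'a::t2_space \<Rightarrow> 'a \<Rightarrow> ennreal" +
  assumes k_a: "strictly_pos_def \<kappa>"
begin

text \<open>An infinite mutual energy would be read as 0, so this real form is faithful only when
  finiteness is known; within \<open>Eplus\<close> that is the first claim of
  \<open>Eplus_pos_def\<close>.\<close>

definition bil :: "'a measure \<Rightarrow> 'a measure \<Rightarrow> real" where
  "bil \<mu> \<nu> = enn2real (menergy \<kappa> \<mu> \<nu>)"

lemma Eplus_radon: "\<mu> \<in> Eplus \<kappa> \<Longrightarrow> radon \<mu>"
  by (simp add: Eplus_def)

text \<open>After the decomposition into \<open>p\<close>, \<open>n\<close> and the common part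
  \<open>c\<close>, all terms containing \<open>c\<close> cancel in the squared distance, which
  leaves the positivity of the energy of the Jordan pair \<open>(p,n)\<close>.\<close>

lemma Eplus_pos_def:
  assumes \<mu>: "\<mu> \<in> Eplus \<kappa>" and \<nu>: "\<nu> \<in> Eplus \<kappa>"
  shows "menergy \<kappa> \<mu> \<nu> < \<top>" "2 * bil \<mu> \<nu> \<le> bil \<mu> \<mu> + bil \<nu> \<nu>"
    "2 * bil \<mu> \<nu> = bil \<mu> \<mu> + bil \<nu> \<nu> \<Longrightarrow> \<mu> = \<nu>"
proof -
  obtain p n c where pnc: "radon p" "radon n" "radon c" "signed_radon (p,n)" "\<mu> = radd p c" "\<nu> = radd n c"
    using radon_Jordan[OF lc Eplus_radon[OF \<mu>] Eplus_radon[OF \<nu>]] by metis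
  let ?e = "menergy \<kappa>"
  note rs = radd_props(1)[OF lc pnc(1,3)] radd_props(1)[OF lc pnc(2,3)]
  have mm: "?e \<mu> \<mu> = ?e p p + ?e p c + (?e c p + ?e c c)"
    unfolding pnc(5) using pnc rs by (simp add: menergy_radd)
  have nn: "?e \<nu> \<nu> = ?e n n + ?e n c + (?e c n + ?e c c)"
    unfolding pnc(6) using pnc rs by (simp add: menergy_radd)
  have mn: "?e \<mu> \<nu> = ?e p n + ?e p c + (?e c n + ?e c c)"
    unfolding pnc(5,6) using pnc rs by (simp add: menergy_radd)
  have "?e \<mu> \<mu> < \<top>" "?e \<nu> \<nu> < \<top>" using \<mu> \<nu> by (auto simp: Eplus_def)
  then have fin: "?e p p < \<top>" "?e p c < \<top>" "?e c p < \<top>" "?e c c < \<top>" "?e n n < \<top>" "?e n c < \<top>" "?e c n < \<top>"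
    unfolding mm nn by auto
  have sE: "senergy \<kappa> (p,n) \<ge> 0"
    using k_a pnc(4) fin by (auto simp: strictly_pos_def_def energy_defined_def)
  \<comment> \<open>The self-energies of \<open>p\<close> and \<open>n\<close> are finite, so the
    energy of the pair is defined even before the mixed term is known to be finite; were that term
    infinite, the energy would be minus infinity, against positivity.\<close>
  have pnfin: "?e p n < \<top>"
  proof (rule ccontr)
    assume "\<not> ?e p n < \<top>"
    then have "?e p n = \<top>" using top.not_eq_extremum by blast
    moreover obtain x where "?e p p + ?e n n = ennreal x" "x \<ge> 0"
      using fin by (cases "?e p p + ?e n n") auto
    ultimately have "senergy \<kappa> (p,n) = ereal x - 2 * \<infinity>"
      by (simp add: senergy_def enn2ereal_ennreal top_ennreal.rep_eq)
    then show False using sE by simp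
  qed
  have reals: "?e p p = ennreal (bil p p)" "?e n n = ennreal (bil n n)" "?e p n = ennreal (bil p n)"
    "?e p c = ennreal (bil p c)" "?e c p = ennreal (bil c p)" "?e c c = ennreal (bil c c)"
    "?e n c = ennreal (bil n c)" "?e c n = ennreal (bil c n)"
    using fin pnfin by (auto simp: bil_def)
  have nonneg: "0 \<le> bil x y" for x y by (simp add: bil_def)
  show "menergy \<kappa> \<mu> \<nu> < \<top>" unfolding mn using fin pnfin by simp
  have sEr: "senergy \<kappa> (p,n) = ereal (bil p p + bil n n - 2 * bil p n)"
    unfolding senergy_def by (simp add: reals nonneg enn2ereal_ennreal flip: ennreal_plus)
  have key: "2 * bil p n \<le> bil p p + bil n n" using sE unfolding sEr by simp
  have sym: "bil p c = bil c p" "bil n c = bil c n" using pnc menergy_sym by (simp_all add: bil_def)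
  have b1: "bil \<mu> \<mu> = bil p p + bil p c + (bil c p + bil c c)"
    unfolding bil_def[of \<mu> \<mu>] mm by (simp add: reals nonneg flip: ennreal_plus)
  have b2: "bil \<nu> \<nu> = bil n n + bil n c + (bil c n + bil c c)"
    unfolding bil_def[of \<nu> \<nu>] nn by (simp add: reals nonneg flip: ennreal_plus)
  have b3: "bil \<mu> \<nu> = bil p n + bil p c + (bil c n + bil c c)"
    unfolding bil_def[of \<mu> \<nu>] mn by (simp add: reals nonneg flip: ennreal_plus)
  show "2 * bil \<mu> \<nu> \<le> bil \<mu> \<mu> + bil \<nu> \<nu>" unfolding b1 b2 b3 using key sym by simp
  assume "2 * bil \<mu> \<nu> = bil \<mu> \<mu> + bil \<nu> \<nu>"
  then have "2 * bil p n = bil p p + bil n n" unfolding b1 b2 b3 using sym by simp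
  then have "senergy \<kappa> (p,n) = 0" unfolding sEr by simp
  moreover have "(p,n) \<in> Esigned \<kappa>" using pnc(4) fin pnfin by (simp add: Esigned_def)
  ultimately have eqpn: "integral\<^sup>L p \<phi> = integral\<^sup>L n \<phi>" if "\<phi> \<in> Ccp" for \<phi>
  proof -
    have "\<forall>\<nu>\<in>Esigned \<kappa>. senergy \<kappa> \<nu> = 0 \<longrightarrow> (\<forall>\<phi>\<in>Cc. integral\<^sup>L (fst \<nu>) \<phi> = integral\<^sup>L (snd \<nu>) \<phi>)"
      using k_a by (simp add: strictly_pos_def_def)
    from bspec[OF this \<open>(p,n) \<in> Esigned \<kappa>\<close>] show ?thesis
      using \<open>senergy \<kappa> (p,n) = 0\<close> that by (simp add: Ccp_def)
  qed
  have "p = n" using pnc eqpn by (intro radon_eqI[OF lc]) auto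
  then show "\<mu> = \<nu>" using pnc by simp
qed

lemma menergy_bil: "\<mu> \<in> Eplus \<kappa> \<Longrightarrow> \<nu> \<in> Eplus \<kappa> \<Longrightarrow> menergy \<kappa> \<mu> \<nu> = ennreal (bil \<mu> \<nu>)"
  using Eplus_pos_def(1) by (simp add: bil_def)

lemma bil_nonneg [simp]: "0 \<le> bil \<mu> \<nu>"
  by (simp add: bil_def)

lemma bil_sym: "\<mu> \<in> Eplus \<kappa> \<Longrightarrow> \<nu> \<in> Eplus \<kappa> \<Longrightarrow> bil \<mu> \<nu> = bil \<nu> \<mu>"
  by (simp add: bil_def menergy_sym Eplus_radon)

lemma radd_Eplus: "\<mu> \<in> Eplus \<kappa> \<Longrightarrow> \<nu> \<in> Eplus \<kappa> \<Longrightarrow> radd \<mu> \<nu> \<in> Eplus \<kappa>"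
  using Eplus_pos_def(1)[of \<mu> \<nu>] Eplus_pos_def(1)[of \<nu> \<mu>] by (simp add: Eplus_def radd_props(1)[OF lc] menergy_radd)

lemma scale_Eplus: "\<mu> \<in> Eplus \<kappa> \<Longrightarrow> scale_measure (ennreal r) \<mu> \<in> Eplus \<kappa>"
  by (auto simp: Eplus_def radon_scale menergy_scale ennreal_mult_less_top)

lemma bil_radd:
  assumes "\<mu> \<in> Eplus \<kappa>" "\<nu> \<in> Eplus \<kappa>" "\<omega> \<in> Eplus \<kappa>"
  shows "bil (radd \<mu> \<nu>) \<omega> = bil \<mu> \<omega> + bil \<nu> \<omega>" "bil \<omega> (radd \<mu> \<nu>) = bil \<omega> \<mu> + bil \<omega> \<nu>"
  using assms Eplus_pos_def(1)[of \<mu> \<omega>] Eplus_pos_def(1)[of \<nu> \<omega>] Eplus_pos_def(1)[of \<omega> \<mu>] Eplus_pos_def(1)[of \<omega> \<nu>]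
  by (simp_all add: bil_def menergy_radd Eplus_radon enn2real_plus)

lemma bil_scale:
  assumes "\<mu> \<in> Eplus \<kappa>" "\<omega> \<in> Eplus \<kappa>" "0 \<le> r"
  shows "bil (scale_measure (ennreal r) \<mu>) \<omega> = r * bil \<mu> \<omega>" "bil \<omega> (scale_measure (ennreal r) \<mu>) = r * bil \<omega> \<mu>"
  using assms by (auto simp: bil_def menergy_scale Eplus_radon enn2real_mult)

lemma null_Eplus: "null_measure borel \<in> Eplus \<kappa>"
  by (simp add: Eplus_def radon_null menergy_def)

lemma bil_null [simp]: "bil (null_measure borel) \<mu> = 0" "\<mu> \<in> Eplus \<kappa> \<Longrightarrow> bil \<mu> (null_measure borel) = 0"
  using bil_sym[OF null_Eplus, of \<mu>] by (auto simp: bil_def menergy_def)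

lemma sdist_sq:
  assumes "\<mu> \<in> Eplus \<kappa>" "\<nu> \<in> Eplus \<kappa>"
  shows "(sdist \<kappa> \<mu> \<nu>)\<^sup>2 = bil \<mu> \<mu> + bil \<nu> \<nu> - 2 * bil \<mu> \<nu>"
  using Eplus_pos_def(2)[OF assms] by (simp add: sdist_def bil_def)

lemma sdist_nonneg: "\<mu> \<in> Eplus \<kappa> \<Longrightarrow> \<nu> \<in> Eplus \<kappa> \<Longrightarrow> 0 \<le> sdist \<kappa> \<mu> \<nu>"
  using Eplus_pos_def(2)[of \<mu> \<nu>] by (simp add: sdist_def bil_def)

lemma sdist_eq_0: "\<mu> \<in> Eplus \<kappa> \<Longrightarrow> \<nu> \<in> Eplus \<kappa> \<Longrightarrow> sdist \<kappa> \<mu> \<nu> = 0 \<Longrightarrow> \<mu> = \<nu>"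
  using sdist_sq[of \<mu> \<nu>] Eplus_pos_def(3)[of \<mu> \<nu>] by simp

lemma quadratic_discriminant:
  fixes a b c :: real
  assumes "\<And>t. 0 \<le> a * t\<^sup>2 + 2 * b * t + c" "0 \<le> a" "0 \<le> c"
  shows "b\<^sup>2 \<le> a * c"
proof (cases "a = 0")
  case True
  have "b = 0"
  proof (rule ccontr)
    assume "b \<noteq> 0"
    \<comment> \<open>For \<open>a = 0\<close> this argument makes the affine function equal to
      -1.\<close>
    then show False using assms(1)[of "- (c + 1) / (2 * b)"] True by (simp add: field_simps)
  qed
  then show ?thesis using True by simp
next
  case False
  then have a: "a > 0" using assms by simp
  have "0 \<le> a * (a * (- b / a)\<^sup>2 + 2 * b * (- b / a) + c)"
    using assms(1)[of "- b / a"] a by (intro mult_nonneg_nonneg) linarith+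
  also have "\<dots> = a * c - b\<^sup>2" using a by (simp add: field_simps power2_eq_square)
  finally show ?thesis by simp
qed

text \<open>The discriminant of the squared norm of \<open>\<mu> - \<nu> + t\<omega>\<close>. Only
  positive measures are available: for \<open>t \<ge> 0\<close> the norm is the distance from
  \<open>\<mu> + t\<omega>\<close> to \<open>\<nu>\<close>, and for negative \<open>t\<close> the
  roles of \<open>\<mu>\<close> and \<open>\<nu>\<close> are exchanged.\<close>

lemma bil_diff_Cauchy_Schwarz:
  assumes \<mu>: "\<mu> \<in> Eplus \<kappa>" and \<nu>: "\<nu> \<in> Eplus \<kappa>" and \<omega>: "\<omega> \<in> Eplus \<kappa>"
  shows "\<bar>bil \<mu> \<omega> - bil \<nu> \<omega>\<bar> \<le> sdist \<kappa> \<mu> \<nu> * sqrt (bil \<omega> \<omega>)"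
proof -
  have *: "0 \<le> bil \<omega> \<omega> * t\<^sup>2 + 2 * (bil \<mu> \<omega> - bil \<nu> \<omega>) * t + (sdist \<kappa> \<mu> \<nu>)\<^sup>2"
    if m: "\<mu> \<in> Eplus \<kappa>" and n: "\<nu> \<in> Eplus \<kappa>" and t: "t \<ge> 0" for t \<mu> \<nu>
  proof -
    define s where "s = scale_measure (ennreal t) \<omega>"
    have sE: "s \<in> Eplus \<kappa>" unfolding s_def using \<omega> by (rule scale_Eplus)
    have "2 * bil (radd \<mu> s) \<nu> \<le> bil (radd \<mu> s) (radd \<mu> s) + bil \<nu> \<nu>"
      by (intro Eplus_pos_def radd_Eplus m n sE)
    moreover have "bil (radd \<mu> s) \<nu> = bil \<mu> \<nu> + t * bil \<omega> \<nu>"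
      using m n sE \<omega> t by (simp add: bil_radd s_def bil_scale)
    moreover have "bil (radd \<mu> s) (radd \<mu> s) = bil \<mu> \<mu> + t * bil \<mu> \<omega> + (t * bil \<omega> \<mu> + t * (t * bil \<omega> \<omega>))"
      using m n sE \<omega> t radd_Eplus[OF m sE] by (simp add: bil_radd) (simp add: s_def bil_scale scale_Eplus)
    ultimately show ?thesis
      using sdist_sq[OF m n] bil_sym[OF m \<omega>] bil_sym[OF n \<omega>] by (simp add: algebra_simps power2_eq_square)
  qed
  have "(bil \<mu> \<omega> - bil \<nu> \<omega>)\<^sup>2 \<le> bil \<omega> \<omega> * (sdist \<kappa> \<mu> \<nu>)\<^sup>2"
  proof (rule quadratic_discriminant)
    fix t :: real
    show "0 \<le> bil \<omega> \<omega> * t\<^sup>2 + 2 * (bil \<mu> \<omega> - bil \<nu> \<omega>) * t + (sdist \<kappa> \<mu> \<nu>)\<^sup>2"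
    proof (cases "t \<ge> 0")
      case False
      then show ?thesis using *[OF \<nu> \<mu>, of "-t"] sdist_sq[OF \<mu> \<nu>] sdist_sq[OF \<nu> \<mu>] bil_sym[OF \<mu> \<nu>]
        by (simp add: algebra_simps)
    qed (use *[OF \<mu> \<nu>] in auto)
  qed auto
  also have "\<dots> = (sdist \<kappa> \<mu> \<nu> * sqrt (bil \<omega> \<omega>))\<^sup>2" by (simp add: power_mult_distrib)
  finally have "\<bar>bil \<mu> \<omega> - bil \<nu> \<omega>\<bar> \<le> \<bar>sdist \<kappa> \<mu> \<nu> * sqrt (bil \<omega> \<omega>)\<bar>" by (simp only: abs_le_square_iff)
  then show ?thesis using sdist_nonneg[OF \<mu> \<nu>] by (simp add: abs_mult)
qed

lemma sdist_null: "\<mu> \<in> Eplus \<kappa> \<Longrightarrow> sdist \<kappa> \<mu> (null_measure borel) = sqrt (bil \<mu> \<mu>)"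
  using sdist_sq[OF _ null_Eplus, of \<mu>] sdist_nonneg[OF _ null_Eplus, of \<mu>]
  by (simp add: real_sqrt_unique)

lemma bil_Cauchy_Schwarz:
  assumes \<mu>: "\<mu> \<in> Eplus \<kappa>" and \<omega>: "\<omega> \<in> Eplus \<kappa>"
  shows "bil \<mu> \<omega> \<le> sqrt (bil \<mu> \<mu>) * sqrt (bil \<omega> \<omega>)"
  using bil_diff_Cauchy_Schwarz[OF \<mu> null_Eplus \<omega>] \<mu> by (simp add: sdist_null)

lemma bil_tendsto:
  assumes ev: "eventually (\<lambda>b. P b \<in> Eplus \<kappa>) F" and P: "P0 \<in> Eplus \<kappa>" and \<omega>: "\<omega> \<in> Eplus \<kappa>"
    and t: "((\<lambda>b. sdist \<kappa> (P b) P0) \<longlongrightarrow> 0) F"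
  shows "((\<lambda>b. bil (P b) \<omega>) \<longlongrightarrow> bil P0 \<omega>) F"
proof -
  have "((\<lambda>b. bil (P b) \<omega> - bil P0 \<omega>) \<longlongrightarrow> 0) F"
  proof (rule Lim_null_comparison)
    show "eventually (\<lambda>b. norm (bil (P b) \<omega> - bil P0 \<omega>) \<le> sdist \<kappa> (P b) P0 * sqrt (bil \<omega> \<omega>)) F"
      using ev by eventually_elim (use bil_diff_Cauchy_Schwarz[OF _ P \<omega>] in auto)
    show "((\<lambda>b. sdist \<kappa> (P b) P0 * sqrt (bil \<omega> \<omega>)) \<longlongrightarrow> 0) F"
      by (rule tendsto_mult_left_zero[OF t])
  qed
  then show ?thesis by (simp add: Lim_null[symmetric])
qed

lemma energy_tendsto:
  assumes ev: "eventually (\<lambda>b. P b \<in> Eplus \<kappa>) F" and P: "P0 \<in> Eplus \<kappa>"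
    and t: "((\<lambda>b. sdist \<kappa> (P b) P0) \<longlongrightarrow> 0) F"
  shows "((\<lambda>b. bil (P b) (P b)) \<longlongrightarrow> bil P0 P0) F"
proof -
  have "((\<lambda>b. (sdist \<kappa> (P b) P0)\<^sup>2 + 2 * bil (P b) P0 - bil P0 P0) \<longlongrightarrow> 0\<^sup>2 + 2 * bil P0 P0 - bil P0 P0) F"
    by (intro tendsto_intros t bil_tendsto[OF ev P P])
  then have "((\<lambda>b. (sdist \<kappa> (P b) P0)\<^sup>2 + 2 * bil (P b) P0 - bil P0 P0) \<longlongrightarrow> bil P0 P0) F" by simp
  moreover have "eventually (\<lambda>b. (sdist \<kappa> (P b) P0)\<^sup>2 + 2 * bil (P b) P0 - bil P0 P0 = bil (P b) (P b)) F"
    using ev by eventually_elim (simp add: sdist_sq P)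
  ultimately show ?thesis by (rule Lim_transform_eventually)
qed

text \<open>One factor is exchanged at a time; the energies of \<open>N b\<close> converge, so they
  stay bounded in the error term.\<close>

lemma bil_tendsto2:
  assumes evP: "eventually (\<lambda>b. P b \<in> Eplus \<kappa>) F" and P: "P0 \<in> Eplus \<kappa>"
    and tP: "((\<lambda>b. sdist \<kappa> (P b) P0) \<longlongrightarrow> 0) F"
    and evN: "eventually (\<lambda>b. N b \<in> Eplus \<kappa>) F" and N: "N0 \<in> Eplus \<kappa>"
    and tN: "((\<lambda>b. sdist \<kappa> (N b) N0) \<longlongrightarrow> 0) F"
  shows "((\<lambda>b. bil (P b) (N b)) \<longlongrightarrow> bil P0 N0) F"
proof -
  have "((\<lambda>b. bil (P b) (N b) - bil P0 (N b)) \<longlongrightarrow> 0) F"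
  proof (rule Lim_null_comparison)
    show "eventually (\<lambda>b. norm (bil (P b) (N b) - bil P0 (N b)) \<le> sdist \<kappa> (P b) P0 * sqrt (bil (N b) (N b))) F"
      using evP evN by eventually_elim (use bil_diff_Cauchy_Schwarz[OF _ P] in auto)
    have "((\<lambda>b. sdist \<kappa> (P b) P0 * sqrt (bil (N b) (N b))) \<longlongrightarrow> 0 * sqrt (bil N0 N0)) F"
      by (intro tendsto_intros tP energy_tendsto[OF evN N tN])
    then show "((\<lambda>b. sdist \<kappa> (P b) P0 * sqrt (bil (N b) (N b))) \<longlongrightarrow> 0) F" by simp
  qed
  moreover have "((\<lambda>b. bil P0 (N b)) \<longlongrightarrow> bil P0 N0) F"
  proof -
    have "((\<lambda>b. bil (N b) P0) \<longlongrightarrow> bil P0 N0) F"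
      using bil_tendsto[OF evN N P tN] by (simp add: bil_sym[OF P N])
    moreover have "eventually (\<lambda>b. bil (N b) P0 = bil P0 (N b)) F"
      using evN by eventually_elim (simp add: bil_sym P)
    ultimately show ?thesis by (rule Lim_transform_eventually)
  qed
  ultimately have "((\<lambda>b. (bil (P b) (N b) - bil P0 (N b)) + bil P0 (N b)) \<longlongrightarrow> 0 + bil P0 N0) F"
    by (rule tendsto_add)
  then show ?thesis by simp
qed

end

section \<open>Consequences of consistency and of the maximum principle\<close>

lemma radd_emeasure:
  fixes M N :: "'a::t2_space measure"
  assumes lc: "locally_compact_space (euclidean :: 'a topology)" and r: "radon M" "radon N" and B: "B \<in> sets borel"
  shows "emeasure (radd M N) B = emeasure M B + emeasure N B"
proof (rule antisym)
  show "emeasure (radd M N) B \<le> emeasure M B + emeasure N B"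
  proof (cases "emeasure M B < \<top> \<and> emeasure N B < \<top>")
    case True
    show ?thesis
    proof (rule ennreal_le_epsilon)
      fix e :: real assume "e > 0"
      then have e2: "e/2 > 0" by simp
      obtain U where U: "open U" "B \<subseteq> U" "emeasure M (U - B) \<le> ennreal (e/2)"
        using radon_finite_outer[OF r(1) B _ e2] True by metis
      obtain V where V: "open V" "B \<subseteq> V" "emeasure N (V - B) \<le> ennreal (e/2)"
        using radon_finite_outer[OF r(2) B _ e2] True by metis
      have o: "open (U \<inter> V)" using U V by auto
      have "emeasure (radd M N) B \<le> emeasure (radd M N) (U \<inter> V)"
        using U V o radd_props(1)[OF lc r] by (intro emeasure_mono) (auto simp: radon_sets)
      also have "\<dots> = emeasure M (U \<inter> V) + emeasure N (U \<inter> V)"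
        using radd_props(2)[OF lc r lsc_indicator[OF o]] o r radd_props(1)[OF lc r] by (simp add: radon_sets)
      also have "\<dots> \<le> (emeasure M B + emeasure M (U - B)) + (emeasure N B + emeasure N (V - B))"
      proof (rule add_mono)
        have "emeasure M (U \<inter> V) \<le> emeasure M (B \<union> (U - B))" using U B r by (intro emeasure_mono) (auto simp: radon_sets)
        also have "\<dots> \<le> emeasure M B + emeasure M (U - B)" using U B r by (intro emeasure_subadditive) (auto simp: radon_sets)
        finally show "emeasure M (U \<inter> V) \<le> emeasure M B + emeasure M (U - B)" .
        have "emeasure N (U \<inter> V) \<le> emeasure N (B \<union> (V - B))" using V B r by (intro emeasure_mono) (auto simp: radon_sets)
        also have "\<dots> \<le> emeasure N B + emeasure N (V - B)" using V B r by (intro emeasure_subadditive) (auto simp: radon_sets)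
        finally show "emeasure N (U \<inter> V) \<le> emeasure N B + emeasure N (V - B)" .
      qed
      also have "\<dots> \<le> (emeasure M B + ennreal (e/2)) + (emeasure N B + ennreal (e/2))"
        by (intro add_mono U V order_refl)
      also have "\<dots> = emeasure M B + emeasure N B + (ennreal (e/2) + ennreal (e/2))" by (simp add: ac_simps)
      also have "ennreal (e/2) + ennreal (e/2) = ennreal e" using \<open>e > 0\<close> by (simp flip: ennreal_plus)
      finally show "emeasure (radd M N) B \<le> emeasure M B + emeasure N B + ennreal e" .
    qed
  next
    case False
    then have "emeasure M B + emeasure N B = \<top>" using top.not_eq_extremum by force
    then show ?thesis by (metis top_greatest)
  qed
qed (rule radd_emeasure_le[OF lc r B])

text \<open>The classical argument that a minimizing sequence in a convex set is Cauchy, carried out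
  for a whole directed family of midpoint-closed sets. It serves twice: with unit measures escaping
  to infinity, and with nearly minimal vector measures.\<close>

lemma minimizing_filter:
  fixes S :: "'k \<Rightarrow> 'x set" and Q :: "'x \<Rightarrow> real"
  assumes dir: "\<And>k l. \<exists>m. S m \<subseteq> S k \<inter> S l"
    and mid: "\<And>k x y. x \<in> S k \<Longrightarrow> y \<in> S k \<Longrightarrow> mid x y \<in> S k"
    and par: "\<And>k x y. x \<in> S k \<Longrightarrow> y \<in> S k \<Longrightarrow> D x y \<le> 2 * Q x + 2 * Q y - 4 * Q (mid x y)"
    and bd: "\<And>k. \<exists>x\<in>S k. Q x \<le> C"
    and nonneg: "\<And>k x. x \<in> S k \<Longrightarrow> 0 \<le> Q x"
  obtains F where "F \<noteq> bot" "\<And>k. eventually (\<lambda>x. x \<in> S k) F"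
    "\<And>e. e > 0 \<Longrightarrow> \<exists>T. eventually T F \<and> (\<forall>x y. T x \<longrightarrow> T y \<longrightarrow> D x y < e)"
proof -
  define d where "d k = Inf (Q ` S k)" for k
  have bb: "bdd_below (Q ` S k)" for k using nonneg by (intro bdd_belowI[of _ 0]) auto
  have dle: "d k \<le> Q x" if "x \<in> S k" for k x unfolding d_def using that bb by (intro cInf_lower) auto
  have dC: "d k \<le> C" for k using bd[of k] dle by (meson order_trans)
  \<comment> \<open>The infima \<open>d k\<close> have the common bound \<open>C\<close>. Their
    supremum is the level approached by \<open>Q\<close> along the filter, and every
    \<open>S k\<close> contains points with values below \<open>s + \<delta>\<close>.\<close>
  define s where "s = (SUP k. d k)"
  have ba: "bdd_above (range d)" using dC by (intro bdd_aboveI[of _ C]) auto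
  have ds: "d k \<le> s" for k unfolding s_def using ba by (intro cSUP_upper) auto
  define B where "B = (\<lambda>(k, n::nat). {x \<in> S k. Q x \<le> s + 1 / real (Suc n)})"
  have Bne: "B p \<noteq> {}" for p
  proof -
    obtain k n where p: "p = (k, n)" by (cases p)
    have "Q ` S k \<noteq> {}" using bd[of k] by auto
    moreover have "d k < s + 1 / real (Suc n)" using ds[of k] by (smt (verit) divide_pos_pos of_nat_0_less_iff zero_less_Suc)
    ultimately obtain x where "x \<in> S k" "Q x < s + 1 / real (Suc n)"
      unfolding d_def using cInf_less_iff[OF _ bb] by blast
    then show ?thesis unfolding p B_def by (auto intro!: exI[of _ x])
  qed
  define F where "F = (INF p. principal (B p))"
  have ev: "eventually P F \<longleftrightarrow> (\<exists>p. eventually P (principal (B p)))" for P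
  proof -
    have "\<exists>r. principal (B r) \<le> inf (principal (B p)) (principal (B q))" for p q
    proof -
      obtain k n l j where pq: "p = (k, n)" "q = (l, j)" by (cases p, cases q)
      obtain m where m: "S m \<subseteq> S k \<inter> S l" using dir by blast
      have "1 / real (Suc (max n j)) \<le> 1 / real (Suc n)" "1 / real (Suc (max n j)) \<le> 1 / real (Suc j)"
        by (auto intro!: divide_left_mono)
      then have "B (m, max n j) \<subseteq> B p \<inter> B q" using m unfolding pq B_def by force
      then show ?thesis by (intro exI[of _ "(m, max n j)"]) auto
    qed
    then show ?thesis unfolding F_def by (subst eventually_INF_base) auto
  qed
  show ?thesis
  proof (rule that)
    show "F \<noteq> bot" unfolding trivial_limit_def ev using Bne by (auto simp: eventually_principal)
    show "eventually (\<lambda>x. x \<in> S k) F" for k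
      unfolding ev eventually_principal by (intro exI[of _ "(k, 0)"]) (auto simp: B_def)
    fix e :: real assume e: "e > 0"
    \<comment> \<open>Both values of \<open>Q\<close> are at most \<open>s + \<delta>\<close> and
      the midpoint, lying in \<open>S k\<close>, has value above \<open>s - \<delta>\<close>; the
      parallelogram estimate therefore gives \<open>8 * \<delta>\<close>.\<close>
    obtain n where n: "1 / real (Suc n) < e / 8" using e nat_approx_posE[of "e/8"] by auto
    define \<delta> where "\<delta> = 1 / real (Suc n)"
    have \<delta>: "\<delta> > 0" "8 * \<delta> < e" using n by (auto simp: \<delta>_def)
    obtain k where k: "s - \<delta> < d k" using less_cSUP_iff[OF _ ba, of "s - \<delta>"] \<delta> unfolding s_def by auto
    show "\<exists>T. eventually T F \<and> (\<forall>x y. T x \<longrightarrow> T y \<longrightarrow> D x y < e)"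
    proof (intro exI[of _ "\<lambda>x. x \<in> B (k, n)"] conjI allI impI)
      show "eventually (\<lambda>x. x \<in> B (k, n)) F" unfolding ev eventually_principal by blast
      fix x y assume "x \<in> B (k, n)" "y \<in> B (k, n)"
      then have xy: "x \<in> S k" "y \<in> S k" "Q x \<le> s + \<delta>" "Q y \<le> s + \<delta>" by (auto simp: B_def \<delta>_def)
      have "D x y \<le> 2 * Q x + 2 * Q y - 4 * Q (mid x y)" using par xy by blast
      also have "\<dots> \<le> 4 * (s + \<delta>) - 4 * d k" using xy dle[OF mid[OF xy(1,2)]] by simp
      also have "\<dots> < e" using k \<delta> by simp
      finally show "D x y < e" .
    qed
  qed
qed

definition rmid :: "'a::topological_space measure \<Rightarrow> 'a measure \<Rightarrow> 'a measure" where
  "rmid \<mu> \<nu> = scale_measure (ennreal (1/2)) (radd \<mu> \<nu>)"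

lemma rmid_props:
  fixes M N :: "'a::t2_space measure"
  assumes lc: "locally_compact_space (euclidean :: 'a topology)" and r: "radon M" "radon N"
  shows "radon (rmid M N)"
    "lsc f \<Longrightarrow> (\<integral>\<^sup>+x. f x \<partial>rmid M N) = ennreal (1/2) * ((\<integral>\<^sup>+x. f x \<partial>M) + (\<integral>\<^sup>+x. f x \<partial>N))"
    "B \<in> sets borel \<Longrightarrow> emeasure (rmid M N) B = ennreal (1/2) * (emeasure M B + emeasure N B)"
  unfolding rmid_def
  by (rule radon_scale[OF radd_props(1)[OF lc r]])
     (simp_all add: scale_lsc_integral[OF radd_props(1)[OF lc r]] radd_props(2)[OF lc r] radd_emeasure[OF lc r])

text \<open>Normalized to total mass 1; in the degenerate case of measure zero the factor is 0 and
  the result is the zero measure, so positivity of the mass is assumed wherever it is used.\<close>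

definition nrestr :: "'a measure \<Rightarrow> 'a set \<Rightarrow> 'a measure" where
  "nrestr \<nu> B = scale_measure (ennreal (1 / measure \<nu> B)) (mrestr \<nu> B)"

context pd_kernel
begin

lemma rmid_Eplus: "\<mu> \<in> Eplus \<kappa> \<Longrightarrow> \<nu> \<in> Eplus \<kappa> \<Longrightarrow> rmid \<mu> \<nu> \<in> Eplus \<kappa>"
  unfolding rmid_def by (intro scale_Eplus radd_Eplus)

lemma bil_rmid:
  assumes "\<mu> \<in> Eplus \<kappa>" "\<nu> \<in> Eplus \<kappa>" "\<omega> \<in> Eplus \<kappa>"
  shows "bil (rmid \<mu> \<nu>) \<omega> = (bil \<mu> \<omega> + bil \<nu> \<omega>) / 2" "bil \<omega> (rmid \<mu> \<nu>) = (bil \<omega> \<mu> + bil \<omega> \<nu>) / 2"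
proof -
  have "radd \<mu> \<nu> \<in> Eplus \<kappa>" using assms by (intro radd_Eplus)
  then show "bil (rmid \<mu> \<nu>) \<omega> = (bil \<mu> \<omega> + bil \<nu> \<omega>) / 2" "bil \<omega> (rmid \<mu> \<nu>) = (bil \<omega> \<mu> + bil \<omega> \<nu>) / 2"
    unfolding rmid_def using assms bil_scale[of "radd \<mu> \<nu>" \<omega> "1/2"] bil_radd[of \<mu> \<nu> \<omega>] by auto
qed

lemma sdist_sq_rmid:
  assumes "\<mu> \<in> Eplus \<kappa>" "\<nu> \<in> Eplus \<kappa>"
  shows "(sdist \<kappa> \<mu> \<nu>)\<^sup>2 = 2 * bil \<mu> \<mu> + 2 * bil \<nu> \<nu> - 4 * bil (rmid \<mu> \<nu>) (rmid \<mu> \<nu>)"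
  using assms rmid_Eplus[OF assms] bil_sym[OF assms] by (simp add: sdist_sq bil_rmid field_simps)

lemma nrestr_props:
  assumes \<nu>: "\<nu> \<in> Eplus \<kappa>" and B: "B \<in> sets borel" and r: "radon (mrestr \<nu> B)"
    and fin: "emeasure \<nu> B < \<top>" and pos: "measure \<nu> B > 0"
  shows "nrestr \<nu> B \<in> Eplus \<kappa>" "bil (nrestr \<nu> B) (nrestr \<nu> B) \<le> bil \<nu> \<nu> / (measure \<nu> B)\<^sup>2"
    "C \<in> sets borel \<Longrightarrow> emeasure (nrestr \<nu> B) C = ennreal (1 / measure \<nu> B) * emeasure \<nu> (B \<inter> C)"
    "emeasure (nrestr \<nu> B) UNIV = 1"
proof -
  have rn: "radon \<nu>" using \<nu> by (rule Eplus_radon)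
  have le: "menergy \<kappa> (mrestr \<nu> B) (mrestr \<nu> B) \<le> menergy \<kappa> \<nu> \<nu>" by (rule menergy_mrestr_self_le[OF rn B r])
  then have mE: "mrestr \<nu> B \<in> Eplus \<kappa>" using r \<nu> by (auto simp: Eplus_def intro: le_less_trans)
  then show "nrestr \<nu> B \<in> Eplus \<kappa>" unfolding nrestr_def by (rule scale_Eplus)
  have ble: "bil (mrestr \<nu> B) (mrestr \<nu> B) \<le> bil \<nu> \<nu>"
    using le \<nu> unfolding bil_def by (intro enn2real_mono) (auto simp: Eplus_def)
  have "bil (nrestr \<nu> B) (nrestr \<nu> B) = (1 / measure \<nu> B) * ((1 / measure \<nu> B) * bil (mrestr \<nu> B) (mrestr \<nu> B))"
    unfolding nrestr_def using mE scale_Eplus[OF mE] by (simp add: bil_scale)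
  also have "\<dots> = bil (mrestr \<nu> B) (mrestr \<nu> B) / (measure \<nu> B)\<^sup>2" by (simp add: power2_eq_square)
  also have "\<dots> \<le> bil \<nu> \<nu> / (measure \<nu> B)\<^sup>2" using ble by (intro divide_right_mono) auto
  finally show "bil (nrestr \<nu> B) (nrestr \<nu> B) \<le> bil \<nu> \<nu> / (measure \<nu> B)\<^sup>2" .
  show em: "emeasure (nrestr \<nu> B) C = ennreal (1 / measure \<nu> B) * emeasure \<nu> (B \<inter> C)" if "C \<in> sets borel" for C
    unfolding nrestr_def using emeasure_mrestr[OF rn B that] by simp
  show "emeasure (nrestr \<nu> B) UNIV = 1"
    using em[of UNIV] pos fin by (simp add: emeasure_eq_ennreal_measure top.not_eq_extremum ennreal_mult[symmetric])
qed

text \<open>If \<open>B\<close> carried mass, the normalized restriction to it would compete in the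
  definition of the capacity of \<open>N\<close> with finite energy. The Borel set \<open>B\<close>
  is needed because \<open>N\<close> itself may fail to be measurable.\<close>

lemma capacity_zero_null:
  assumes c: "capacity \<kappa> N = 0" and \<nu>: "\<nu> \<in> Eplus \<kappa>" "emeasure \<nu> UNIV < \<top>" and B: "B \<in> sets borel" "B \<subseteq> N"
  shows "emeasure \<nu> B = 0"
proof (rule ccontr)
  assume nz: "emeasure \<nu> B \<noteq> 0"
  have rn: "radon \<nu>" using \<nu> by (simp add: Eplus_radon)
  have fin: "emeasure \<nu> B < \<top>"
    using emeasure_space[of \<nu> B] \<nu>(2) radon_space[OF rn] by (auto intro: le_less_trans)
  then have pos: "measure \<nu> B > 0" using nz by (simp add: measure_def enn2real_positive_iff zero_less_iff_neq_zero)
  have r: "radon (mrestr \<nu> B)" by (rule radon_mrestr_finite[OF rn \<nu>(2) B(1)])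
  note n = nrestr_props[OF \<nu>(1) B(1) r fin pos]
  let ?t = "nrestr \<nu> B"
  have "emeasure ?t (-B) = 0" using n(3)[of "-B"] B by simp
  then have null: "-B \<in> null_sets ?t" using B Eplus_radon[OF n(1)] by (auto simp: null_sets_def radon_sets)
  have "concentrated_on ?t N" unfolding concentrated_on_def using null B by blast
  moreover have "space ?t = UNIV" using Eplus_radon[OF n(1)] by (rule radon_space)
  ultimately have "(INF \<nu>\<in>{\<nu>\<in>Eplus \<kappa>. concentrated_on \<nu> N \<and> emeasure \<nu> (space \<nu>) = 1}. menergy \<kappa> \<nu> \<nu>) \<le> menergy \<kappa> ?t ?t"
    using n by (intro INF_lower) auto
  also have "\<dots> < \<top>" using n(1) by (simp add: Eplus_def)
  finally show False using c by (auto simp: capacity_def ennreal_divide_eq_0_iff)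
qed

end

section \<open>Mass bounds from consistency\<close>

locale consistent_kernel = pd_kernel +
  assumes k_b: "consistent \<kappa>"
begin

text \<open>\<open>consistent\<close> is formulated for filters of measures, and is applied here to
  the image filter; a vague limit along it is in particular a vague cluster point.\<close>

lemma consistentD:
  assumes F: "F \<noteq> bot" and ev: "eventually (\<lambda>b. P b \<in> Eplus \<kappa>) F"
    and Cauchy: "\<And>e. e > 0 \<Longrightarrow> \<exists>T. eventually T F \<and> (\<forall>b b'. T b \<longrightarrow> T b' \<longrightarrow> sdist \<kappa> (P b) (P b') < e)"
    and \<nu>: "radon \<nu>" and v: "vlim F P \<nu>"
  shows "\<nu> \<in> Eplus \<kappa>" "((\<lambda>b. sdist \<kappa> (P b) \<nu>) \<longlongrightarrow> 0) F"
proof -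
  let ?G = "filtermap P F"
  have "?G \<noteq> bot" using F by (simp add: filtermap_bot_iff)
  moreover have "eventually (\<lambda>\<mu>. \<mu> \<in> Eplus \<kappa>) ?G" using ev by (simp add: eventually_filtermap)
  moreover have "eventually (\<lambda>(\<mu>,\<nu>). sdist \<kappa> \<mu> \<nu> < e) (?G \<times>\<^sub>F ?G)" if e: "e > 0" for e
  proof -
    obtain T where T: "eventually T F" "\<forall>b b'. T b \<longrightarrow> T b' \<longrightarrow> sdist \<kappa> (P b) (P b') < e" using Cauchy[OF e] by blast
    have "eventually (\<lambda>m. \<exists>b. T b \<and> m = P b) ?G"
      unfolding eventually_filtermap using T(1) by (rule eventually_mono) auto
    then show ?thesis unfolding eventually_prod_filter
      using T(2) by (intro exI[of _ "\<lambda>m. \<exists>b. T b \<and> m = P b"]) auto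
  qed
  moreover have "frequently (\<lambda>\<mu>. \<mu> \<in> U) ?G" if "openin vague U" "\<nu> \<in> U" for U
    using vlim_eventually_openin[OF v that] \<open>?G \<noteq> bot\<close>
    by (intro eventually_frequently) (auto simp: eventually_filtermap)
  ultimately have *: "\<nu> \<in> Eplus \<kappa> \<and> (\<forall>e>0. eventually (\<lambda>\<mu>. sdist \<kappa> \<mu> \<nu> < e) ?G)"
    using k_b \<nu> unfolding consistent_def by blast
  then show nE: "\<nu> \<in> Eplus \<kappa>" by blast
  show "((\<lambda>b. sdist \<kappa> (P b) \<nu>) \<longlongrightarrow> 0) F"
  proof (rule tendstoI)
    fix e :: real assume "e > 0"
    then have "eventually (\<lambda>b. sdist \<kappa> (P b) \<nu> < e) F" using * by (auto simp: eventually_filtermap)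
    then show "eventually (\<lambda>b. dist (sdist \<kappa> (P b) \<nu>) 0 < e) F"
      using ev by eventually_elim (use sdist_nonneg[OF _ nE] in auto)
  qed
qed

text \<open>Otherwise there are unit measures on \<open>K\<close> whose energies tend to 0. They are
  strong Cauchy, so a vague limit along an ultrafilter is a strong limit and has energy 0, hence
  vanishes; but a test function equal to 1 on \<open>K\<close> keeps its integrals at least
  1.\<close>

lemma compact_mass_bound:
  assumes K: "compact K"
  shows "\<exists>C. \<forall>\<nu>\<in>Eplus \<kappa>. measure \<nu> K \<le> C * sqrt (bil \<nu> \<nu>)"
proof (rule ccontr)
  assume "\<not> ?thesis"
  then have "\<exists>\<nu>\<in>Eplus \<kappa>. measure \<nu> K > real n * sqrt (bil \<nu> \<nu>)" for n by (meson not_le)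
  then obtain \<nu> where \<nu>: "\<And>n. \<nu> n \<in> Eplus \<kappa>" "\<And>n. measure (\<nu> n) K > real n * sqrt (bil (\<nu> n) (\<nu> n))" by metis
  have Kb: "K \<in> sets borel" using K by (simp add: compact_imp_closed)
  have pos: "measure (\<nu> n) K > 0" for n using \<nu>(2)[of n] by (smt (verit) bil_nonneg mult_nonneg_nonneg of_nat_0_le_iff real_sqrt_ge_zero)
  have rr: "radon (mrestr (\<nu> n) K)" for n by (intro radon_mrestr_compact K Eplus_radon \<nu>)
  have fin: "emeasure (\<nu> n) K < \<top>" for n using radon_compact[OF Eplus_radon[OF \<nu>(1)] K] .
  define \<tau> where "\<tau> n = nrestr (\<nu> n) K" for n
  note np = nrestr_props[OF \<nu>(1) Kb rr fin pos, folded \<tau>_def]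
  have small: "bil (\<tau> n) (\<tau> n) \<le> inverse ((real n)\<^sup>2)" if "n > 0" for n
  proof -
    have "bil (\<tau> n) (\<tau> n) \<le> bil (\<nu> n) (\<nu> n) / (measure (\<nu> n) K)\<^sup>2" by (rule np)
    also have "(real n * sqrt (bil (\<nu> n) (\<nu> n)))\<^sup>2 \<le> (measure (\<nu> n) K)\<^sup>2"
      using \<nu>(2)[of n] by (intro power_mono) auto
    then have "bil (\<nu> n) (\<nu> n) / (measure (\<nu> n) K)\<^sup>2 \<le> inverse ((real n)\<^sup>2)"
      using pos[of n] that by (simp add: power_mult_distrib field_simps)
    finally show ?thesis .
  qed
  have lim0: "(\<lambda>n. bil (\<tau> n) (\<tau> n)) \<longlonglongrightarrow> 0"
  proof (rule Lim_null_comparison)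
    show "eventually (\<lambda>n. norm (bil (\<tau> n) (\<tau> n)) \<le> inverse ((real n)\<^sup>2)) sequentially"
      using eventually_gt_at_top[of 0] by eventually_elim (use small in auto)
    show "(\<lambda>n. inverse ((real n)\<^sup>2)) \<longlonglongrightarrow> 0"
      using tendsto_power[OF lim_inverse_n[where 'a=real], of 2] by (simp add: power_inverse)
  qed
  obtain U where U: "ultra U" "U \<le> sequentially" using ultra_exists[of sequentially] by auto
  have Unb: "U \<noteq> bot" using U by (simp add: ultra_def)
  have lim0U: "((\<lambda>n. bil (\<tau> n) (\<tau> n)) \<longlongrightarrow> 0) U" using lim0 U(2) by (rule tendsto_mono[rotated])
  have mass: "measure (\<tau> n) C \<le> 1" for n C
    using emeasure_space[of "\<tau> n" C] radon_space[OF Eplus_radon[OF np(1)[of n]]] np(4)[of n]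
    by (auto simp: measure_def intro!: enn2real_leI)
  obtain t where t: "radon t" "vlim U \<tau> t"
    using vlim_exists[OF lc U(1), of \<tau>] np(1) mass Eplus_radon by (metis (no_types, lifting) eventuallyI)
  have Cauchy: "\<exists>T. eventually T U \<and> (\<forall>b b'. T b \<longrightarrow> T b' \<longrightarrow> sdist \<kappa> (\<tau> b) (\<tau> b') < e)" if e: "e > 0" for e
  proof (intro exI conjI allI impI)
    show "eventually (\<lambda>n. bil (\<tau> n) (\<tau> n) < e\<^sup>2 / 2) U"
      using order_tendstoD(2)[OF lim0U, of "e\<^sup>2 / 2"] e by simp
    fix b b' assume "bil (\<tau> b) (\<tau> b) < e\<^sup>2 / 2" "bil (\<tau> b') (\<tau> b') < e\<^sup>2 / 2"
    then have "(sdist \<kappa> (\<tau> b) (\<tau> b'))\<^sup>2 < e\<^sup>2" using sdist_sq[OF np(1) np(1), of b b'] bil_nonneg[of "\<tau> b" "\<tau> b'"] by linarith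
    then show "sdist \<kappa> (\<tau> b) (\<tau> b') < e" by (rule power_less_imp_less_base) (use e in simp)
  qed
  note cons = consistentD[OF Unb _ Cauchy t, OF eventuallyI[OF np(1)]]
  have "((\<lambda>n. bil (\<tau> n) (\<tau> n)) \<longlongrightarrow> bil t t) U"
    by (rule energy_tendsto[OF eventuallyI[OF np(1)] cons])
  then have "bil t t = 0" using tendsto_unique[OF Unb _ lim0U] by blast
  then have tn: "t = null_measure borel"
    using Eplus_pos_def(3)[OF cons(1) null_Eplus] cons(1) by simp
  obtain \<phi> where \<phi>: "\<phi> \<in> Ccp" "\<And>x. x \<in> K \<Longrightarrow> \<phi> x = 1"
    using Urysohn_Cc[OF lc K open_UNIV subset_UNIV] by metis
  have one: "integral\<^sup>L (\<tau> n) \<phi> \<ge> 1" for n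
  proof -
    have rt: "radon (\<tau> n)" using np(1) by (rule Eplus_radon)
    have "1 = emeasure (\<tau> n) K" using np(3)[OF Kb, of n] np(3)[of UNIV n] np(4)[of n] by simp
    also have "\<dots> = (\<integral>\<^sup>+x. indicator K x \<partial>\<tau> n)" using Kb rt by (simp add: radon_sets)
    also have "\<dots> \<le> (\<integral>\<^sup>+x. ennreal (\<phi> x) \<partial>\<tau> n)" using \<phi>(2) by (intro nn_integral_mono) (auto simp: indicator_def)
    also have "\<dots> = ennreal (integral\<^sup>L (\<tau> n) \<phi>)" by (rule radon_nn_integral[OF rt \<phi>(1)])
    finally show ?thesis by simp
  qed
  have "((\<lambda>n. integral\<^sup>L (\<tau> n) \<phi>) \<longlongrightarrow> integral\<^sup>L t \<phi>) U" by (rule vlimD[OF t(2) \<phi>(1)])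
  then have "1 \<le> integral\<^sup>L t \<phi>" by (rule tendsto_lowerbound) (use one Unb in auto)
  moreover have "integral\<^sup>L t \<phi> = 0" unfolding tn by (rule integral_null_measure)
  ultimately show False by simp
qed

text \<open>If the mass at infinity were not controlled, near-minimal unit measures on \<open>E - K\<close>, for \<open>K\<close>
  running through the compact sets, would form a strong Cauchy filter converging vaguely, hence
  strongly, to zero, contradicting the finiteness of the capacity of \<open>E\<close>.\<close>
lemma tail_mass_bound:
  assumes E: "closed E" and cap: "capacity \<kappa> E < \<top>" and e: "e > 0"
  shows "\<exists>K. compact K \<and> (\<forall>\<nu>\<in>Eplus \<kappa>. emeasure \<nu> UNIV < \<top> \<longrightarrow> emeasure \<nu> (-E) = 0 \<longrightarrow>
      measure \<nu> (-K) \<le> e * sqrt (bil \<nu> \<nu>))"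
proof (rule ccontr)
  assume neg: "\<not> ?thesis"
  \<comment> \<open>The index ranges over all sets, the condition on \<open>K\<close> being void
    when \<open>K\<close> is not compact; this provides the family with a total index type.\<close>
  define S where "S K = {\<tau>\<in>Eplus \<kappa>. emeasure \<tau> UNIV = 1 \<and> emeasure \<tau> (-E) = 0 \<and> (compact K \<longrightarrow> emeasure \<tau> K = 0)}" for K
  have Eb: "-E \<in> sets borel" using E by auto
  have mid: "rmid x y \<in> S k" if "x \<in> S k" "y \<in> S k" for k x y
  proof -
    have xy: "x \<in> Eplus \<kappa>" "y \<in> Eplus \<kappa>" using that by (auto simp: S_def)
    note rm = rmid_props(3)[OF lc Eplus_radon[OF xy(1)] Eplus_radon[OF xy(2)]]
    have "emeasure (rmid x y) UNIV = 1"
    proof -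
      have two: "(1::ennreal) + 1 = ennreal 2" by simp
      have "emeasure (rmid x y) UNIV = ennreal (1/2) * (1 + 1)" using rm[of UNIV] that unfolding S_def by simp
      also have "\<dots> = ennreal (1/2 * 2)" unfolding two by (rule ennreal_mult[symmetric]) auto
      finally show ?thesis by simp
    qed
    moreover have "emeasure (rmid x y) (-E) = 0" using rm[OF Eb] that by (simp add: S_def)
    moreover have "emeasure (rmid x y) k = 0" if "compact k" using rm[of k] \<open>x \<in> S k\<close> \<open>y \<in> S k\<close> that
      by (simp add: S_def compact_imp_closed)
    ultimately show ?thesis using rmid_Eplus[OF xy] by (simp add: S_def)
  qed
  obtain F where F: "F \<noteq> bot" "\<And>k. eventually (\<lambda>x. x \<in> S k) F"
    "\<And>e. e > 0 \<Longrightarrow> \<exists>T. eventually T F \<and> (\<forall>x y. T x \<longrightarrow> T y \<longrightarrow> (sdist \<kappa> x y)\<^sup>2 < e)"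
  \<comment> \<open>A measure violating the claim has more than
    \<open>e * sqrt (bil \<nu> \<nu>)\<close> of mass off \<open>K\<close>; normalizing its
    restriction to the complement of \<open>K\<close> leaves energy at most
    \<open>1 / e\<^sup>2\<close>, the uniform bound required here.\<close>
  proof (rule minimizing_filter[of S rmid "\<lambda>x y. (sdist \<kappa> x y)\<^sup>2" "\<lambda>x. bil x x" "1 / e\<^sup>2"])
    show "\<exists>m. S m \<subseteq> S k \<inter> S l" for k l
    proof -
      have *: "\<exists>m. S m \<subseteq> S k \<inter> S l" if "\<not> compact l" for k l
        using that by (intro exI[of _ k]) (auto simp: S_def)
      have "S (k \<union> l) \<subseteq> S k \<inter> S l" if c: "compact k" "compact l"
      proof
        fix \<tau> assume "\<tau> \<in> S (k \<union> l)"
        then have t: "\<tau> \<in> Eplus \<kappa>" "emeasure \<tau> (k \<union> l) = 0" "emeasure \<tau> UNIV = 1" "emeasure \<tau> (-E) = 0" using c by (auto simp: S_def)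
        have "emeasure \<tau> k \<le> emeasure \<tau> (k \<union> l)" "emeasure \<tau> l \<le> emeasure \<tau> (k \<union> l)"
          using c Eplus_radon[OF t(1)] by (auto intro!: emeasure_mono simp: radon_sets compact_imp_closed)
        then show "\<tau> \<in> S k \<inter> S l" using t by (simp add: S_def)
      qed
      then show ?thesis using *[of l k] *[of k l] by (metis inf_commute)
    qed
    show "rmid x y \<in> S k" if "x \<in> S k" "y \<in> S k" for k x y using mid that .
    show "(sdist \<kappa> x y)\<^sup>2 \<le> 2 * bil x x + 2 * bil y y - 4 * bil (rmid x y) (rmid x y)" if "x \<in> S k" "y \<in> S k" for k x y
      using that sdist_sq_rmid[of x y] by (simp add: S_def)
    show "\<exists>x\<in>S k. bil x x \<le> 1 / e\<^sup>2" for k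
    proof -
      define K where "K = (if compact k then k else {})"
      have K: "compact K" by (simp add: K_def)
      then obtain \<nu> where \<nu>: "\<nu> \<in> Eplus \<kappa>" "emeasure \<nu> UNIV < \<top>" "emeasure \<nu> (-E) = 0" "measure \<nu> (-K) > e * sqrt (bil \<nu> \<nu>)"
        using neg by (meson not_le)
      have rn: "radon \<nu>" using \<nu> by (simp add: Eplus_radon)
      have Kb: "-K \<in> sets borel" using K by (simp add: compact_imp_closed)
      have pos: "measure \<nu> (-K) > 0" using \<nu>(4) e by (smt (verit) bil_nonneg mult_nonneg_nonneg real_sqrt_ge_zero)
      have fin: "emeasure \<nu> (-K) < \<top>" using emeasure_space[of \<nu> "-K"] \<nu>(2) radon_space[OF rn] by (auto intro: le_less_trans)
      note np = nrestr_props[OF \<nu>(1) Kb radon_mrestr_finite[OF rn \<nu>(2) Kb] fin pos]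
      have "emeasure (nrestr \<nu> (-K)) (-E) = 0"
      proof -
        have "emeasure \<nu> (-K \<inter> -E) \<le> emeasure \<nu> (-E)" using Eb rn by (intro emeasure_mono) (auto simp: radon_sets)
        then show ?thesis using np(3)[OF Eb] \<nu>(3) by simp
      qed
      moreover have "emeasure (nrestr \<nu> (-K)) k = 0" if "compact k"
        using np(3)[of k] that by (simp add: K_def compact_imp_closed)
      ultimately have "nrestr \<nu> (-K) \<in> S k" using np(1,4) by (simp add: S_def)
      moreover have "bil (nrestr \<nu> (-K)) (nrestr \<nu> (-K)) \<le> 1 / e\<^sup>2"
      proof -
        have "bil (nrestr \<nu> (-K)) (nrestr \<nu> (-K)) \<le> bil \<nu> \<nu> / (measure \<nu> (-K))\<^sup>2" by (rule np)
        also have "(e * sqrt (bil \<nu> \<nu>))\<^sup>2 \<le> (measure \<nu> (-K))\<^sup>2"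
          using \<nu>(4) e by (intro power_mono) auto
        then have "bil \<nu> \<nu> / (measure \<nu> (-K))\<^sup>2 \<le> 1 / e\<^sup>2"
          using pos e by (simp add: power_mult_distrib field_simps)
        finally show ?thesis .
      qed
      ultimately show ?thesis by blast
    qed
  qed auto
  have evE: "eventually (\<lambda>x. x \<in> Eplus \<kappa>) F" using F(2)[of "{}"] by (rule eventually_mono) (auto simp: S_def)
  \<comment> \<open>Each test function lives on a compact set which the measures of the filter
    eventually do not charge.\<close>
  have "vlim F (\<lambda>x. x) (null_measure borel)"
  proof (rule vlimI)
    show "eventually (\<lambda>b. radon b) F" using evE by (rule eventually_mono) (auto simp: Eplus_radon)
    fix \<phi> :: "'a \<Rightarrow> real" assume \<phi>: "\<phi> \<in> Ccp"
    obtain K where K: "compact K" "\<And>x. x \<notin> K \<Longrightarrow> \<phi> x = 0" using CcpE[OF \<phi>] by metis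
    have "eventually (\<lambda>b. integral\<^sup>L b \<phi> = 0) F"
      using F(2)[of K]
    proof eventually_elim
      case (elim b)
      then have b: "b \<in> Eplus \<kappa>" "emeasure b K = 0" using K by (auto simp: S_def)
      have "K \<in> null_sets b" using b K Eplus_radon[OF b(1)] by (auto simp: null_sets_def radon_sets compact_imp_closed)
      then have "AE x in b. \<phi> x = 0" by (rule AE_I') (use K in auto)
      then show ?case by (rule integral_eq_zero_AE)
    qed
    moreover have "integral\<^sup>L (null_measure borel) \<phi> = 0" by (rule integral_null_measure)
    ultimately show "((\<lambda>b. integral\<^sup>L b \<phi>) \<longlongrightarrow> integral\<^sup>L (null_measure borel) \<phi>) F"
      by (simp add: tendsto_eventually)
  qed (rule radon_null)
  moreover have "\<exists>T. eventually T F \<and> (\<forall>b b'. T b \<longrightarrow> T b' \<longrightarrow> sdist \<kappa> b b' < \<epsilon>)" if \<epsilon>: "\<epsilon> > 0" for \<epsilon>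
  proof -
    obtain T where T: "eventually T F" "\<forall>x y. T x \<longrightarrow> T y \<longrightarrow> (sdist \<kappa> x y)\<^sup>2 < \<epsilon>\<^sup>2" using F(3)[of "\<epsilon>\<^sup>2"] \<epsilon> by auto
    have "sdist \<kappa> x y < \<epsilon>" if "T x" "T y" for x y
      using T(2) that \<epsilon> by (intro power_less_imp_less_base[of "sdist \<kappa> x y" 2 \<epsilon>]) auto
    then show ?thesis using T(1) by blast
  qed
  ultimately have "((\<lambda>b. sdist \<kappa> b (null_measure borel)) \<longlongrightarrow> 0) F"
    using consistentD(2)[OF F(1) evE _ radon_null] by blast
  then have "((\<lambda>b. (sdist \<kappa> b (null_measure borel))\<^sup>2) \<longlongrightarrow> 0\<^sup>2) F" by (rule tendsto_power)
  moreover have "eventually (\<lambda>b. (sdist \<kappa> b (null_measure borel))\<^sup>2 = bil b b) F"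
    using evE by eventually_elim (simp add: sdist_null)
  ultimately have lim: "((\<lambda>b. bil b b) \<longlongrightarrow> 0) F" using Lim_transform_eventually by fastforce
  \<comment> \<open>Finite capacity means that \<open>w\<close>, the least energy of a unit measure
    on \<open>E\<close>, is nonzero, whereas the members of the filter are such measures with
    energies tending to 0.\<close>
  define w where "w = (INF \<nu>\<in>{\<nu>\<in>Eplus \<kappa>. concentrated_on \<nu> E \<and> emeasure \<nu> (space \<nu>) = 1}. menergy \<kappa> \<nu> \<nu>)"
  have w0: "w \<noteq> 0" using cap unfolding capacity_def w_def[symmetric] by auto
  have ge: "eventually (\<lambda>b. w \<le> ennreal (bil b b)) F"
    using F(2)[of "{}"]
  proof eventually_elim
    case (elim b)
    then have b: "b \<in> Eplus \<kappa>" "emeasure b UNIV = 1" "emeasure b (-E) = 0" by (auto simp: S_def)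
    have "concentrated_on b E" using concentrated_closed[OF Eplus_radon[OF b(1)] E] b by simp
    then have "w \<le> menergy \<kappa> b b" unfolding w_def using b radon_space[OF Eplus_radon[OF b(1)]] by (intro INF_lower) auto
    then show ?case using menergy_bil[OF b(1) b(1)] by simp
  qed
  have "((\<lambda>b. ennreal (bil b b)) \<longlongrightarrow> ennreal 0) F" using lim by (rule tendsto_ennrealI)
  then have "w \<le> ennreal 0" by (rule tendsto_lowerbound) (use ge F(1) in auto)
  then show False using w0 by simp
qed

end

section \<open>The maximum principle and mutual energies\<close>

lemma closed_msupport: "closed (msupport M)"
proof -
  have "- msupport M = \<Union>{U. open U \<and> emeasure M U = 0}" by (auto simp: msupport_def)
  then have "open (- msupport M)" by auto
  then show ?thesis by (simp add: open_closed)
qed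

context pd_kernel
begin

lemma pot_mrestr_le:
  assumes "radon \<nu>" "B \<in> sets borel"
  shows "pot \<kappa> x (mrestr \<nu> B) \<le> pot \<kappa> x \<nu>"
  unfolding pot_def using assms lsc_measurable[OF lsc_kernel_section]
  by (subst nn_integral_mrestr) (auto intro!: nn_integral_mono simp: indicator_def)

text \<open>The mutual energy is split along the set \<open>B\<close> where the potential of \<open>\<nu>\<close> is at most four times
  that of \<open>\<omega>\<close>: off \<open>B\<close> it is absorbed by the energy of \<open>\<nu>\<close>, and on \<open>B\<close> the maximum
  principle bounds the potential of \<open>\<nu>\<close>.\<close>
lemma max_principle_bound:
  assumes gmp: "gen_max_principle \<kappa> h" and h: "h \<ge> 0"
    and \<omega>: "\<omega> \<in> Eplus \<kappa>" "emeasure \<omega> UNIV \<le> ennreal m" "emeasure \<omega> (-P) = 0" "closed P"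
    and \<nu>: "\<nu> \<in> Eplus \<kappa>" "emeasure \<nu> (-Q) = 0" "closed Q"
    and C: "\<And>x y. x \<in> P \<Longrightarrow> y \<in> Q \<Longrightarrow> \<kappa> x y \<le> ennreal C" "C \<ge> 0" and m: "m \<ge> 0"
  shows "4 * bil \<omega> \<nu> \<le> bil \<nu> \<nu> + 16 * h * C * m\<^sup>2"
proof -
  have ro: "radon \<omega>" and rn: "radon \<nu>" using \<omega> \<nu> by (auto simp: Eplus_radon)
  have AEo: "AE y in \<omega>. y \<in> P"
  proof (rule AE_I')
    show "-P \<in> null_sets \<omega>" using \<omega> ro by (auto simp: null_sets_def radon_sets)
  qed auto
  have AEn: "AE y in \<nu>. y \<in> Q"
  proof (rule AE_I')
    show "-Q \<in> null_sets \<nu>" using \<nu> rn by (auto simp: null_sets_def radon_sets)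
  qed auto
  have po: "pot \<kappa> x \<omega> \<le> ennreal (C * m)" if "x \<in> Q" for x
  proof -
    have "pot \<kappa> x \<omega> \<le> (\<integral>\<^sup>+y. ennreal C \<partial>\<omega>)"
      unfolding pot_def
    proof (rule nn_integral_mono_AE)
      show "AE y in \<omega>. \<kappa> x y \<le> ennreal C" using AEo by eventually_elim (use C(1) that in \<open>simp add: k_sym[of x]\<close>)
    qed
    also have "\<dots> = ennreal C * emeasure \<omega> UNIV" using radon_space[OF ro] by simp
    also have "\<dots> \<le> ennreal C * ennreal m" by (intro mult_left_mono \<omega>) auto
    finally show ?thesis using C m by (simp add: ennreal_mult)
  qed
  have lpo: "lsc (\<lambda>x. pot \<kappa> x \<omega>)" and lpn: "lsc (\<lambda>x. pot \<kappa> x \<nu>)" using ro rn by (auto intro: lsc_pot)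
  note [measurable] = lsc_measurable[OF lpo] lsc_measurable[OF lpn]
  have sn: "sets \<nu> = sets borel" using rn by (rule radon_sets)
  define B where "B = {x. pot \<kappa> x \<nu> \<le> 4 * pot \<kappa> x \<omega>}"
  have Bb: "B \<in> sets borel" unfolding B_def by measurable
  have Qb: "Q \<in> sets borel" using \<nu> by auto
  \<comment> \<open>\<open>gen_max_principle\<close> needs compact support, so \<open>\<nu>\<close>
    is first restricted to a compact \<open>L\<close>. On \<open>L\<close> its potential is at most
    four times that of \<open>\<omega>\<close>, that is \<open>4 * C * m\<close>; the principle
    extends this to the whole space with factor \<open>h\<close>. Interchanging the measures by
    symmetry and integrating against the mass \<open>m\<close> of \<open>\<omega>\<close> yields
    \<open>4 * h * C * m\<^sup>2\<close>.\<close>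
  have bound: "(\<integral>\<^sup>+x. pot \<kappa> x \<omega> * indicator L x \<partial>\<nu>) \<le> ennreal (4 * h * C * m\<^sup>2)"
    if L: "compact L" "L \<subseteq> B \<inter> Q" for L
  proof -
    have Lb: "L \<in> sets borel" using L by (simp add: compact_imp_closed)
    have rL: "radon (mrestr \<nu> L)" by (rule radon_mrestr_compact[OF rn L(1)])
    have sub: "msupport (mrestr \<nu> L) \<subseteq> L"
    proof
      fix x assume x: "x \<in> msupport (mrestr \<nu> L)"
      show "x \<in> L"
      proof (rule ccontr)
        assume "x \<notin> L"
        moreover have "open (-L)" using L by (simp add: compact_imp_closed open_Compl)
        moreover have "emeasure (mrestr \<nu> L) (-L) = 0" using Lb by (subst emeasure_mrestr[OF rn]) auto
        ultimately show False using x by (auto simp: msupport_def)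
      qed
    qed
    have cs: "compact (msupport (mrestr \<nu> L))"
      using compact_Int_closed[OF L(1) closed_msupport] sub by (metis Int_absorb1)
    have supp: "(SUP y\<in>msupport (mrestr \<nu> L). pot \<kappa> y (mrestr \<nu> L)) \<le> ennreal (4 * (C * m))"
    proof (rule SUP_least)
      fix y assume "y \<in> msupport (mrestr \<nu> L)"
      then have y: "y \<in> B" "y \<in> Q" using sub L by auto
      have "pot \<kappa> y (mrestr \<nu> L) \<le> pot \<kappa> y \<nu>" by (rule pot_mrestr_le[OF rn Lb])
      also have "\<dots> \<le> 4 * pot \<kappa> y \<omega>" using y by (simp add: B_def)
      also have "\<dots> \<le> 4 * ennreal (C * m)" using po[OF y(2)] by (intro mult_left_mono) auto
      finally show "pot \<kappa> y (mrestr \<nu> L) \<le> ennreal (4 * (C * m))" using C m by (simp add: ennreal_mult)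
    qed
    have ub: "pot \<kappa> x (mrestr \<nu> L) \<le> ennreal (h * (4 * (C * m)))" for x
    proof -
      have "pot \<kappa> x (mrestr \<nu> L) \<le> ennreal h * (SUP y\<in>msupport (mrestr \<nu> L). pot \<kappa> y (mrestr \<nu> L))"
        using gmp rL cs supp unfolding gen_max_principle_def by (metis ennreal_less_top le_less_trans)
      also have "\<dots> \<le> ennreal h * ennreal (4 * (C * m))" by (intro mult_left_mono supp) auto
      finally show ?thesis using h C m by (simp add: ennreal_mult)
    qed
    have "(\<integral>\<^sup>+x. pot \<kappa> x \<omega> * indicator L x \<partial>\<nu>) = menergy \<kappa> (mrestr \<nu> L) \<omega>"
      unfolding menergy_def using Lb lsc_measurable[OF lpo] by (intro nn_integral_mrestr[OF rn, symmetric])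
    also have "\<dots> = menergy \<kappa> \<omega> (mrestr \<nu> L)" by (rule menergy_sym[OF rL ro])
    also have "\<dots> \<le> (\<integral>\<^sup>+x. ennreal (h * (4 * (C * m))) \<partial>\<omega>)" unfolding menergy_def by (intro nn_integral_mono ub)
    also have "\<dots> = ennreal (h * (4 * (C * m))) * emeasure \<omega> UNIV" using radon_space[OF ro] by simp
    also have "\<dots> \<le> ennreal (h * (4 * (C * m))) * ennreal m" by (intro mult_left_mono \<omega>) auto
    also have "\<dots> = ennreal (4 * h * C * m\<^sup>2)" using h C m by (simp add: ennreal_mult[symmetric] power2_eq_square mult_ac)
    finally show ?thesis .
  qed
  \<comment> \<open>The set \<open>B\<close> is only Borel. Inside \<open>K\<close> it is
    approximated by compact subsets, and the remainder is harmless since the potential of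
    \<open>\<omega>\<close> is bounded by \<open>C * m\<close> on \<open>Q\<close>.\<close>
  have boundD: "(\<integral>\<^sup>+x. pot \<kappa> x \<omega> * indicator (K \<inter> B \<inter> Q) x \<partial>\<nu>) \<le> ennreal (4 * h * C * m\<^sup>2)"
    if K: "compact K" for K
  proof (rule ennreal_le_epsilon)
    fix e :: real assume e: "e > 0"
    have Kb: "K \<in> sets borel" using K by (simp add: compact_imp_closed)
    define D where "D = K \<inter> B \<inter> Q"
    have Db: "D \<in> sets borel" unfolding D_def using Kb Bb Qb by auto
    have fin: "emeasure (mrestr \<nu> K) UNIV < \<top>" using radon_compact[OF rn K] by (simp add: emeasure_mrestr[OF rn Kb])
    \<comment> \<open>The summand 1 avoids a division by zero when \<open>C * m = 0\<close>.\<close>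
    define d where "d = e / (C * m + 1)"
    have Cm: "C * m \<ge> 0" using C m by simp
    then have d: "d > 0" using e by (simp add: d_def)
    obtain L where L: "compact L" "L \<subseteq> D" "emeasure (mrestr \<nu> K) (D - L) \<le> ennreal d"
      using radon_finite_inner[OF radon_mrestr_compact[OF rn K] fin Db d] by metis
    have Lb: "L \<in> sets borel" using L by (simp add: compact_imp_closed)
    have "K \<inter> (D - L) = D - L" by (auto simp: D_def)
    then have DL: "emeasure \<nu> (D - L) \<le> ennreal d"
      using L(3) Db Lb by (subst (asm) emeasure_mrestr[OF rn Kb]) auto
    have "(\<integral>\<^sup>+x. pot \<kappa> x \<omega> * indicator D x \<partial>\<nu>) \<le> (\<integral>\<^sup>+x. pot \<kappa> x \<omega> * indicator L x + ennreal (C * m) * indicator (D - L) x \<partial>\<nu>)"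
      using po by (intro nn_integral_mono) (auto simp: indicator_def D_def)
    also have "\<dots> = (\<integral>\<^sup>+x. pot \<kappa> x \<omega> * indicator L x \<partial>\<nu>) + ennreal (C * m) * emeasure \<nu> (D - L)"
      using Lb Db lsc_measurable[OF lpo] sn
      by (subst nn_integral_add) (auto simp: nn_integral_cmult_indicator measurable_cong_sets[OF sn refl])
    also have "\<dots> \<le> ennreal (4 * h * C * m\<^sup>2) + ennreal (C * m) * ennreal d"
      using L by (intro add_mono bound mult_left_mono DL) (auto simp: D_def)
    also have "ennreal (C * m) * ennreal d \<le> ennreal e"
    proof -
      have "C * m * d \<le> e" using Cm e by (simp add: d_def field_simps)
      then show ?thesis using Cm d by (simp add: ennreal_mult[symmetric] ennreal_leI)
    qed
    finally show "(\<integral>\<^sup>+x. pot \<kappa> x \<omega> * indicator (K \<inter> B \<inter> Q) x \<partial>\<nu>) \<le> ennreal (4 * h * C * m\<^sup>2) + ennreal e"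
      by (simp add: D_def add_left_mono)
  qed
  have "(\<integral>\<^sup>+x. pot \<kappa> x \<omega> \<partial>\<nu>) \<le> ennreal ((bil \<nu> \<nu> + 16 * h * C * m\<^sup>2) / 4)"
  proof (rule radon_integral_compact_SUP[OF lc rn lpo])
    fix K :: "'a set" assume K: "compact K"
    have Kb: "K \<in> sets borel" using K by (simp add: compact_imp_closed)
    have "4 * (\<integral>\<^sup>+x. pot \<kappa> x \<omega> * indicator K x \<partial>\<nu>) = (\<integral>\<^sup>+x. 4 * (pot \<kappa> x \<omega> * indicator K x) \<partial>\<nu>)"
      using Kb sn lsc_measurable[OF lpo] by (intro nn_integral_cmult[symmetric]) (auto simp: measurable_cong_sets[OF sn refl])
    \<comment> \<open>Off \<open>B\<close> four times the potential of \<open>\<omega>\<close> is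
      below that of \<open>\<nu>\<close>, whose integral is the energy of \<open>\<nu>\<close>. This
      explains the coefficient 4 on the left of the claim, and 16 as four times the 4 from
      \<open>bound\<close>.\<close>
    also have "\<dots> \<le> (\<integral>\<^sup>+x. 4 * (pot \<kappa> x \<omega> * indicator (K \<inter> B \<inter> Q) x) + pot \<kappa> x \<nu> \<partial>\<nu>)"
    proof (rule nn_integral_mono_AE)
      show "AE x in \<nu>. 4 * (pot \<kappa> x \<omega> * indicator K x) \<le> 4 * (pot \<kappa> x \<omega> * indicator (K \<inter> B \<inter> Q) x) + pot \<kappa> x \<nu>"
        using AEn
      proof eventually_elim
        case (elim x)
        show ?case
        proof (cases "x \<in> B")
          case True
          then show ?thesis using elim by (auto simp: indicator_def)
        next
          case False
          then have "4 * pot \<kappa> x \<omega> \<le> pot \<kappa> x \<nu>" by (simp add: B_def)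
          then show ?thesis using False by (auto simp: indicator_def)
        qed
      qed
    qed
    also have "\<dots> = 4 * (\<integral>\<^sup>+x. pot \<kappa> x \<omega> * indicator (K \<inter> B \<inter> Q) x \<partial>\<nu>) + menergy \<kappa> \<nu> \<nu>"
      unfolding menergy_def using Kb Bb Qb sn lsc_measurable[OF lpo] lsc_measurable[OF lpn]
      by (subst nn_integral_add) (auto simp: measurable_cong_sets[OF sn refl] nn_integral_cmult)
    also have "\<dots> \<le> 4 * ennreal (4 * h * C * m\<^sup>2) + ennreal (bil \<nu> \<nu>)"
      using boundD[OF K] menergy_bil[OF \<nu>(1) \<nu>(1)] by (intro add_mono mult_left_mono) auto
    also have "\<dots> = ennreal (4 * ((bil \<nu> \<nu> + 16 * h * C * m\<^sup>2) / 4))"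
      using h C by (simp add: ennreal_mult[symmetric] flip: ennreal_plus ennreal_numeral)
    finally have le4: "4 * (\<integral>\<^sup>+x. pot \<kappa> x \<omega> * indicator K x \<partial>\<nu>) \<le> ennreal (4 * ((bil \<nu> \<nu> + 16 * h * C * m\<^sup>2) / 4))" .
    show "(\<integral>\<^sup>+x. pot \<kappa> x \<omega> * indicator K x \<partial>\<nu>) \<le> ennreal ((bil \<nu> \<nu> + 16 * h * C * m\<^sup>2) / 4)"
    proof -
      have q: "(bil \<nu> \<nu> + 16 * h * C * m\<^sup>2) / 4 \<ge> 0" using h C by simp
      have "ennreal (4 * ((bil \<nu> \<nu> + 16 * h * C * m\<^sup>2) / 4)) = ennreal 4 * ennreal ((bil \<nu> \<nu> + 16 * h * C * m\<^sup>2) / 4)"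
        using q by (intro ennreal_mult) auto
      then have "4 * (\<integral>\<^sup>+x. pot \<kappa> x \<omega> * indicator K x \<partial>\<nu>) \<le> 4 * ennreal ((bil \<nu> \<nu> + 16 * h * C * m\<^sup>2) / 4)"
        using le4 by (simp only: ennreal_numeral)
      then show ?thesis by (subst (asm) ennreal_mult_le_mult_iff) auto
    qed
  qed
  then have "menergy \<kappa> \<nu> \<omega> \<le> ennreal ((bil \<nu> \<nu> + 16 * h * C * m\<^sup>2) / 4)" by (simp add: menergy_def)
  then have "bil \<nu> \<omega> \<le> (bil \<nu> \<nu> + 16 * h * C * m\<^sup>2) / 4"
    using menergy_bil[OF \<nu>(1) \<omega>(1)] h C by (simp add: ennreal_le_iff)
  then show ?thesis using bil_sym[OF \<nu>(1) \<omega>(1)] by simp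
qed

end

section \<open>Vector measures on a condenser\<close>

lemma nn_integral_count_space_Un:
  assumes "A \<inter> B = {}"
  shows "(\<integral>\<^sup>+x. f x \<partial>count_space (A \<union> B)) = (\<integral>\<^sup>+x. f x \<partial>count_space A) + (\<integral>\<^sup>+x. f x \<partial>count_space B)"
proof -
  have "(\<integral>\<^sup>+x. f x * indicator (A \<union> B) x \<partial>count_space UNIV) =
      (\<integral>\<^sup>+x. f x * indicator A x + f x * indicator B x \<partial>count_space UNIV)"
    using assms by (intro nn_integral_cong) (auto simp: indicator_def)
  also have "\<dots> = (\<integral>\<^sup>+x. f x * indicator A x \<partial>count_space UNIV) + (\<integral>\<^sup>+x. f x * indicator B x \<partial>count_space UNIV)"
    by (intro nn_integral_add) auto
  finally show ?thesis
    by (simp add: nn_integral_restrict_space[symmetric] restrict_count_space)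
qed

lemma nn_integral_count_space_Times:
  "(\<integral>\<^sup>+z. f z \<partial>count_space (A \<times> B)) = (\<integral>\<^sup>+x. (\<integral>\<^sup>+y. f (x,y) \<partial>count_space B) \<partial>count_space A)"
proof -
  have "(\<integral>\<^sup>+z. f z \<partial>count_space (A \<times> B)) = (\<integral>\<^sup>+z. f z * indicator (A \<times> B) z \<partial>count_space UNIV)"
    by (simp add: nn_integral_restrict_space[symmetric] restrict_count_space)
  also have "\<dots> = (\<integral>\<^sup>+x. (\<integral>\<^sup>+y. f (x,y) * indicator (A \<times> B) (x,y) \<partial>count_space UNIV) \<partial>count_space UNIV)"
    using nn_integral_fst_count_space[of "\<lambda>z. f z * indicator (A \<times> B) z"] by simp
  also have "\<dots> = (\<integral>\<^sup>+x. (\<integral>\<^sup>+y. f (x,y) * indicator B y \<partial>count_space UNIV) * indicator A x \<partial>count_space UNIV)"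
    by (intro nn_integral_cong) (auto simp: indicator_def)
  finally show ?thesis
    by (simp add: nn_integral_restrict_space[symmetric] restrict_count_space)
qed

text \<open>\<open>vec_energy\<close> and \<open>Gchi\<close> are unordered real sums; this passes
  to them from extended nonnegative sums, in which all rearrangements are free.\<close>

lemma count_space_has_sum:
  fixes f :: "'x \<Rightarrow> ennreal"
  assumes fin: "(\<integral>\<^sup>+x. f x \<partial>count_space S) < \<top>"
  shows "((\<lambda>x. enn2real (f x)) has_sum enn2real (\<integral>\<^sup>+x. f x \<partial>count_space S)) S"
proof -
  let ?T = "\<integral>\<^sup>+x. f x \<partial>count_space S"
  have le: "sum f F \<le> ?T" if "finite F" "F \<subseteq> S" for F
    unfolding nn_integral_count_space_SUP using that by (intro SUP_upper) auto
  have ft: "f x < \<top>" if "x \<in> S" for x using le[of "{x}"] that fin by (auto intro: le_less_trans)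
  have eq: "ennreal (sum (\<lambda>x. enn2real (f x)) F) = sum f F" if "finite F" "F \<subseteq> S" for F
  proof -
    have "ennreal (sum (\<lambda>x. enn2real (f x)) F) = (\<Sum>x\<in>F. ennreal (enn2real (f x)))" by (rule sum_ennreal[symmetric]) auto
    also have "\<dots> = sum f F" using that ft by (intro sum.cong) (auto simp: subset_iff)
    finally show ?thesis .
  qed
  have "(\<lambda>x. enn2real (f x)) summable_on S"
  proof (rule nonneg_bdd_above_summable_on)
    show "bdd_above (sum (\<lambda>x. enn2real (f x)) ` {F. F \<subseteq> S \<and> finite F})"
    proof (rule bdd_aboveI, clarify)
      fix F assume F: "F \<subseteq> S" "finite F"
      have "ennreal (sum (\<lambda>x. enn2real (f x)) F) \<le> ennreal (enn2real ?T)"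
        using eq[OF F(2,1)] le[OF F(2,1)] fin by simp
      then show "sum (\<lambda>x. enn2real (f x)) F \<le> enn2real ?T" by (simp add: ennreal_le_iff)
    qed
  qed auto
  moreover from this have "ennreal (infsum (\<lambda>x. enn2real (f x)) S) = (SUP F\<in>{F. finite F \<and> F \<subseteq> S}. ennreal (sum (\<lambda>x. enn2real (f x)) F))"
    by (intro infsum_nonneg_is_SUPREMUM_ennreal) auto
  then have "ennreal (infsum (\<lambda>x. enn2real (f x)) S) = ?T"
    unfolding nn_integral_count_space_SUP using eq by (auto intro!: SUP_cong)
  then have "infsum (\<lambda>x. enn2real (f x)) S = enn2real ?T"
    by (metis enn2real_ennreal infsum_nonneg enn2real_nonneg)
  ultimately show ?thesis by (metis has_sum_infsum)
qed

lemma has_sum_neg: "(u has_sum b) S \<Longrightarrow> ((\<lambda>x. - u x) has_sum - b) S" for b :: real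
  by (simp add: has_sum_uminus)

text \<open>A relatively compact neighbourhood of a point outside the union meets finitely many of
  the sets, whose union can be removed.\<close>

lemma closed_locally_finite_Union:
  fixes A :: "'i \<Rightarrow> 'a::t2_space set"
  assumes lc: "locally_compact_space (euclidean :: 'a topology)"
    and cl: "\<And>i. i \<in> S \<Longrightarrow> closed (A i)" and lf: "\<And>K. compact K \<Longrightarrow> finite {i\<in>S. A i \<inter> K \<noteq> {}}"
  shows "closed (\<Union>i\<in>S. A i)"
  unfolding closed_def
proof (subst open_subopen, clarify)
  fix x assume x: "x \<notin> (\<Union>i\<in>S. A i)"
  obtain V L where VL: "open V" "compact L" "{x} \<subseteq> V" "V \<subseteq> L" using compact_nbhd[OF lc, of "{x}"] by auto
  let ?F = "{i\<in>S. A i \<inter> L \<noteq> {}}"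
  have "open (V - (\<Union>i\<in>?F. A i))" using VL cl lf[OF VL(2)] by (intro open_Diff closed_UN) auto
  moreover have "x \<in> V - (\<Union>i\<in>?F. A i)" using x VL by auto
  moreover have "V - (\<Union>i\<in>?F. A i) \<subseteq> - (\<Union>i\<in>S. A i)" using VL by auto
  ultimately show "\<exists>T. open T \<and> x \<in> T \<and> T \<subseteq> - (\<Union>i\<in>S. A i)" by blast
qed

section \<open>The positive and negative parts of a vector measure\<close>

locale condenser = consistent_kernel \<kappa> for \<kappa> :: "'a::t2_space \<Rightarrow> 'a \<Rightarrow> ennreal" +
  fixes h :: real
    and Ipos Ineg J :: "'i set"
    and A :: "'i \<Rightarrow> 'a set"
    and chi :: "'a measure \<times> 'a measure"
    and g :: "'a \<Rightarrow> real"
    and a :: "'i \<Rightarrow> real"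
  assumes h_ge: "h \<ge> 1"
    and k_e: "gen_max_principle \<kappa> h"
    and I_disj: "Ipos \<inter> Ineg = {}"
    and A_closed: "\<And>i. i \<in> Ipos \<union> Ineg \<Longrightarrow> closed (A i)"
    and A_locfin: "\<And>K. compact K \<Longrightarrow> finite {i \<in> Ipos \<union> Ineg. A i \<inter> K \<noteq> {}}"
    and A_sep: "\<And>i j. i \<in> Ipos \<Longrightarrow> j \<in> Ineg \<Longrightarrow> A i \<inter> A j = {}"
    and A_kbd: "(SUP z\<in>(\<Union>i\<in>Ipos. A i) \<times> (\<Union>j\<in>Ineg. A j). \<kappa> (fst z) (snd z)) < \<top>"
    and chi_E: "chi \<in> Esigned \<kappa>"
    and g_cont: "continuous_on (\<Union>i\<in>Ipos \<union> Ineg. A i) g"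
    and g_inf: "\<exists>c>0. \<forall>x\<in>(\<Union>i\<in>Ipos \<union> Ineg. A i). c \<le> g x"
    and g_growth: "\<And>i. i \<in> Ipos \<union> Ineg \<Longrightarrow>
        bounded (g ` A i) \<or>
        (\<exists>r \<nu>. r > 1 \<and> \<nu> \<in> Esigned \<kappa> \<and>
           (\<exists>N. capacity \<kappa> N = 0 \<and>
              (\<forall>x\<in>A i - N. pot \<kappa> x (snd \<nu>) < \<top> \<and>
                   ennreal (g x powr r) + pot \<kappa> x (snd \<nu>) \<le> pot \<kappa> x (fst \<nu>))))"
    and a_pos: "\<And>i. i \<in> Ipos \<union> Ineg \<Longrightarrow> a i > 0"
    and a_sum: "a summable_on (Ipos \<union> Ineg)"
    and J_sub: "Ipos \<subseteq> J" "J \<subseteq> Ipos \<union> Ineg"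
    and cap_fin: "\<And>j. j \<in> J \<Longrightarrow> capacity \<kappa> (A j) < \<top>"
begin

abbreviation "I \<equiv> Ipos \<union> Ineg"
abbreviation "VM \<equiv> vec_measures I A"
abbreviation "VE \<equiv> vec_Eplus \<kappa> Ipos Ineg A"
abbreviation "ADM \<equiv> adm \<kappa> Ipos Ineg A a g J"
abbreviation "G \<equiv> Gchi \<kappa> Ipos Ineg chi"
abbreviation "Apos \<equiv> (\<Union>i\<in>Ipos. A i)"
abbreviation "Aneg \<equiv> (\<Union>i\<in>Ineg. A i)"

definition Rp :: "('i \<Rightarrow> 'a measure) \<Rightarrow> 'a measure" where "Rp \<mu> = rsum Ipos \<mu>"
definition Rn :: "('i \<Rightarrow> 'a measure) \<Rightarrow> 'a measure" where "Rn \<mu> = rsum Ineg \<mu>"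

lemma VM_radon: "\<mu> \<in> VM \<Longrightarrow> i \<in> I \<Longrightarrow> radon (\<mu> i)"
  by (simp add: vec_measures_def)

lemma VM_null: "\<mu> \<in> VM \<Longrightarrow> i \<in> I \<Longrightarrow> emeasure (\<mu> i) (- A i) = 0"
proof -
  assume a: "\<mu> \<in> VM" "i \<in> I"
  then have "concentrated_on (\<mu> i) (A i)" by (simp add: vec_measures_def)
  then show ?thesis using concentrated_closed[OF VM_radon[OF a] A_closed[OF a(2)]] by blast
qed

lemma VM_I:
  assumes "\<And>i. i \<in> I \<Longrightarrow> radon (\<mu> i)" "\<And>i. i \<in> I \<Longrightarrow> emeasure (\<mu> i) (- A i) = 0"
    "\<And>i. i \<notin> I \<Longrightarrow> \<mu> i = null_measure borel"
  shows "\<mu> \<in> VM"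
proof -
  have "concentrated_on (\<mu> i) (A i)" if "i \<in> I" for i
    using concentrated_closed[OF assms(1)[OF that] A_closed[OF that]] assms(2)[OF that] by blast
  then show ?thesis unfolding vec_measures_def using assms(1,3) by blast
qed

lemma VM_zero_off: "\<mu> \<in> VM \<Longrightarrow> i \<in> I \<Longrightarrow> A i \<inter> K = {} \<Longrightarrow> emeasure (\<mu> i) K = 0"
proof -
  assume a: "\<mu> \<in> VM" "i \<in> I" "A i \<inter> K = {}"
  have "emeasure (\<mu> i) K \<le> emeasure (\<mu> i) (- A i)"
    using a A_closed[OF a(2)] VM_radon[OF a(1,2)] by (intro emeasure_mono) (auto simp: radon_sets)
  then show ?thesis using VM_null[OF a(1,2)] by simp
qed

text \<open>Only finitely many plates meet a compact set; this is the local finiteness that makes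
  sums over arbitrary sets of indices Radon measures.\<close>

lemma VM_locfin:
  assumes \<mu>: "\<mu> \<in> VM" and S: "S \<subseteq> I" and K: "compact K"
  shows "finite {i\<in>S. emeasure (\<mu> i) K \<noteq> 0}"
proof (rule finite_subset[OF _ A_locfin[OF K]])
  show "{i \<in> S. emeasure (\<mu> i) K \<noteq> 0} \<subseteq> {i \<in> I. A i \<inter> K \<noteq> {}}"
    using VM_zero_off[OF \<mu>] S by blast
qed

lemma rsum_VM:
  assumes \<mu>: "\<mu> \<in> VM" and S: "S \<subseteq> I"
  shows "radon (rsum S \<mu>)"
    "lsc f \<Longrightarrow> (\<integral>\<^sup>+x. f x \<partial>rsum S \<mu>) = (\<integral>\<^sup>+i. (\<integral>\<^sup>+x. f x \<partial>\<mu> i) \<partial>count_space S)"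
    "open U \<Longrightarrow> emeasure (rsum S \<mu>) U = (\<integral>\<^sup>+i. emeasure (\<mu> i) U \<partial>count_space S)"
proof -
  have r: "\<And>i. i \<in> S \<Longrightarrow> radon (\<mu> i)" using VM_radon[OF \<mu>] S by auto
  show rr: "radon (rsum S \<mu>)" by (rule rsum_props[OF lc r VM_locfin[OF \<mu> S]])
  show i: "(\<integral>\<^sup>+x. f x \<partial>rsum S \<mu>) = (\<integral>\<^sup>+i. (\<integral>\<^sup>+x. f x \<partial>\<mu> i) \<partial>count_space S)" if "lsc f" for f
    by (rule rsum_props(2)[OF lc r VM_locfin[OF \<mu> S] that])
  assume U: "open U"
  have "emeasure (rsum S \<mu>) U = (\<integral>\<^sup>+i. (\<integral>\<^sup>+x. indicator U x \<partial>\<mu> i) \<partial>count_space S)"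
    using i[OF lsc_indicator[OF U]] U rr by (simp add: radon_sets)
  also have "\<dots> = (\<integral>\<^sup>+i. emeasure (\<mu> i) U \<partial>count_space S)"
    using U r by (intro nn_integral_cong nn_integral_indicator) (auto simp: radon_sets)
  finally show "emeasure (rsum S \<mu>) U = (\<integral>\<^sup>+i. emeasure (\<mu> i) U \<partial>count_space S)" .
qed

lemma rsum_ge:
  assumes \<mu>: "\<mu> \<in> VM" and S: "S \<subseteq> I" and i: "i \<in> S" and f: "lsc f"
  shows "(\<integral>\<^sup>+x. f x \<partial>\<mu> i) \<le> (\<integral>\<^sup>+x. f x \<partial>rsum S \<mu>)"
proof -
  have "sum (\<lambda>i. \<integral>\<^sup>+x. f x \<partial>\<mu> i) {i} \<le> (\<integral>\<^sup>+i. (\<integral>\<^sup>+x. f x \<partial>\<mu> i) \<partial>count_space S)"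
    unfolding nn_integral_count_space_SUP using i by (intro SUP_upper) auto
  then show ?thesis using rsum_VM(2)[OF \<mu> S f] by simp
qed

lemma rsum_integral_ge:
  assumes \<mu>: "\<mu> \<in> VM" and S: "S \<subseteq> I" and i: "i \<in> S" and \<phi>: "\<phi> \<in> Ccp"
  shows "integral\<^sup>L (\<mu> i) \<phi> \<le> integral\<^sup>L (rsum S \<mu>) \<phi>"
proof -
  have ri: "radon (\<mu> i)" using VM_radon[OF \<mu>] i S by auto
  show ?thesis
    using rsum_ge[OF \<mu> S i Ccp_lsc[OF \<phi>]] radon_nn_integral[OF ri \<phi>] radon_nn_integral[OF rsum_VM(1)[OF \<mu> S] \<phi>]
      integral_nonneg_Ccp[OF \<phi>] by (simp add: ennreal_le_iff)
qed

lemma rsum_menergy: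
  assumes \<mu>: "\<mu> \<in> VM" and S: "S \<subseteq> I" and \<omega>: "radon \<omega>"
  shows "menergy \<kappa> (rsum S \<mu>) \<omega> = (\<integral>\<^sup>+i. menergy \<kappa> (\<mu> i) \<omega> \<partial>count_space S)"
  using VM_radon[OF \<mu>] S by (intro menergy_rsum VM_locfin[OF \<mu> S] \<omega>) auto

lemma rsum_menergy2:
  assumes \<mu>: "\<mu> \<in> VM" and S: "S \<subseteq> I" "S' \<subseteq> I"
  shows "menergy \<kappa> (rsum S \<mu>) (rsum S' \<mu>) = (\<integral>\<^sup>+z. menergy \<kappa> (\<mu> (fst z)) (\<mu> (snd z)) \<partial>count_space (S \<times> S'))"
proof -
  have "menergy \<kappa> (rsum S \<mu>) (rsum S' \<mu>) = (\<integral>\<^sup>+i. menergy \<kappa> (\<mu> i) (rsum S' \<mu>) \<partial>count_space S)"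
    by (rule rsum_menergy[OF \<mu> S(1) rsum_VM(1)[OF \<mu> S(2)]])
  also have "\<dots> = (\<integral>\<^sup>+i. (\<integral>\<^sup>+j. menergy \<kappa> (\<mu> i) (\<mu> j) \<partial>count_space S') \<partial>count_space S)"
  proof (rule nn_integral_cong)
    fix i assume "i \<in> space (count_space S)"
    then have ri: "radon (\<mu> i)" using VM_radon[OF \<mu>] S by auto
    have "menergy \<kappa> (\<mu> i) (rsum S' \<mu>) = menergy \<kappa> (rsum S' \<mu>) (\<mu> i)"
      by (rule menergy_sym[OF ri rsum_VM(1)[OF \<mu> S(2)]])
    also have "\<dots> = (\<integral>\<^sup>+j. menergy \<kappa> (\<mu> j) (\<mu> i) \<partial>count_space S')" by (rule rsum_menergy[OF \<mu> S(2) ri])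
    also have "\<dots> = (\<integral>\<^sup>+j. menergy \<kappa> (\<mu> i) (\<mu> j) \<partial>count_space S')"
      using VM_radon[OF \<mu>] S ri by (intro nn_integral_cong menergy_sym) auto
    finally show "menergy \<kappa> (\<mu> i) (rsum S' \<mu>) = (\<integral>\<^sup>+j. menergy \<kappa> (\<mu> i) (\<mu> j) \<partial>count_space S')" .
  qed
  finally show ?thesis by (simp add: nn_integral_count_space_Times)
qed

lemma Rp_radon: "\<mu> \<in> VM \<Longrightarrow> radon (Rp \<mu>)" and Rn_radon: "\<mu> \<in> VM \<Longrightarrow> radon (Rn \<mu>)"
  unfolding Rp_def Rn_def by (auto intro: rsum_VM)

lemma total_energy:
  assumes \<mu>: "\<mu> \<in> VM"
  shows "(SUP F\<in>{F. finite F \<and> F \<subseteq> I \<times> I}. \<Sum>(i,j)\<in>F. menergy \<kappa> (\<mu> i) (\<mu> j)) =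
    menergy \<kappa> (Rp \<mu>) (Rp \<mu>) + menergy \<kappa> (Rp \<mu>) (Rn \<mu>) + (menergy \<kappa> (Rn \<mu>) (Rp \<mu>) + menergy \<kappa> (Rn \<mu>) (Rn \<mu>))"
proof -
  let ?f = "\<lambda>z. menergy \<kappa> (\<mu> (fst z)) (\<mu> (snd z))"
  have 1: "(SUP F\<in>{F. finite F \<and> F \<subseteq> I \<times> I}. \<Sum>(i,j)\<in>F. menergy \<kappa> (\<mu> i) (\<mu> j)) = (\<integral>\<^sup>+z. ?f z \<partial>count_space (I \<times> I))"
    unfolding nn_integral_count_space_SUP by (simp add: case_prod_beta)
  have "I \<times> I = ((Ipos \<times> Ipos) \<union> (Ipos \<times> Ineg)) \<union> ((Ineg \<times> Ipos) \<union> (Ineg \<times> Ineg))" by auto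
  then have "(\<integral>\<^sup>+z. ?f z \<partial>count_space (I \<times> I)) = (\<integral>\<^sup>+z. ?f z \<partial>count_space (((Ipos \<times> Ipos) \<union> (Ipos \<times> Ineg)) \<union> ((Ineg \<times> Ipos) \<union> (Ineg \<times> Ineg))))"
    by (rule arg_cong)
  also have "\<dots> = ((\<integral>\<^sup>+z. ?f z \<partial>count_space (Ipos \<times> Ipos)) + (\<integral>\<^sup>+z. ?f z \<partial>count_space (Ipos \<times> Ineg)))
     + ((\<integral>\<^sup>+z. ?f z \<partial>count_space (Ineg \<times> Ipos)) + (\<integral>\<^sup>+z. ?f z \<partial>count_space (Ineg \<times> Ineg)))"
    using I_disj by (subst nn_integral_count_space_Un, force)+ simp
  finally show ?thesis unfolding 1 Rp_def Rn_def by (simp add: rsum_menergy2[OF \<mu>])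
qed

text \<open>The total energy splits into four blocks according to signs. Once the two diagonal
  blocks are finite, the mixed ones are finite too, by the positivity of the kernel.\<close>

lemma VE_iff: "\<mu> \<in> VE \<longleftrightarrow> \<mu> \<in> VM \<and> Rp \<mu> \<in> Eplus \<kappa> \<and> Rn \<mu> \<in> Eplus \<kappa>"
proof (cases "\<mu> \<in> VM")
  case True
  have "\<mu> \<in> VE \<longleftrightarrow> menergy \<kappa> (Rp \<mu>) (Rp \<mu>) + menergy \<kappa> (Rp \<mu>) (Rn \<mu>) + (menergy \<kappa> (Rn \<mu>) (Rp \<mu>) + menergy \<kappa> (Rn \<mu>) (Rn \<mu>)) < \<top>"
    using True total_energy[OF True] by (simp add: vec_Eplus_def)
  moreover have "\<dots> \<longleftrightarrow> Rp \<mu> \<in> Eplus \<kappa> \<and> Rn \<mu> \<in> Eplus \<kappa>"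
    using Eplus_pos_def(1)[of "Rp \<mu>" "Rn \<mu>"] Eplus_pos_def(1)[of "Rn \<mu>" "Rp \<mu>"] Rp_radon[OF True] Rn_radon[OF True]
    by (auto simp: Eplus_def)
  ultimately show ?thesis using True by simp
qed (simp add: vec_Eplus_def)

lemma VE_energy_has_sum:
  assumes \<mu>: "\<mu> \<in> VM" and S: "S \<subseteq> I" "S' \<subseteq> I" and E: "rsum S \<mu> \<in> Eplus \<kappa>" "rsum S' \<mu> \<in> Eplus \<kappa>"
  shows "((\<lambda>z. enn2real (menergy \<kappa> (\<mu> (fst z)) (\<mu> (snd z)))) has_sum bil (rsum S \<mu>) (rsum S' \<mu>)) (S \<times> S')"
  using count_space_has_sum[where f="\<lambda>z. menergy \<kappa> (\<mu> (fst z)) (\<mu> (snd z))" and S="S \<times> S'"]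
    Eplus_pos_def(1)[OF E] unfolding rsum_menergy2[OF \<mu> S] bil_def by simp

lemma VE_pot_has_sum:
  assumes \<mu>: "\<mu> \<in> VM" and S: "S \<subseteq> I" and E: "rsum S \<mu> \<in> Eplus \<kappa>" "\<omega> \<in> Eplus \<kappa>"
  shows "((\<lambda>i. enn2real (menergy \<kappa> (\<mu> i) \<omega>)) has_sum bil (rsum S \<mu>) \<omega>) S"
  using count_space_has_sum[where f="\<lambda>i. menergy \<kappa> (\<mu> i) \<omega>" and S=S]
    Eplus_pos_def(1)[OF E] unfolding rsum_menergy[OF \<mu> S Eplus_radon[OF E(2)]] bil_def by simp

abbreviation "chip \<equiv> fst chi"
abbreviation "chin \<equiv> snd chi"

lemma chi_Eplus: "chip \<in> Eplus \<kappa>" "chin \<in> Eplus \<kappa>"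
  using chi_E by (auto simp: Esigned_def Eplus_def signed_radon_def)

definition Gform :: "'a measure \<Rightarrow> 'a measure \<Rightarrow> real" where
  "Gform P N = bil P P + bil N N - 2 * bil P N + 2 * (bil P chip - bil P chin - bil N chip + bil N chin)"

text \<open>On each sign block the factor from \<open>alpha\<close> is constant, and the unsigned
  double sum is the mutual energy of two summed measures; finiteness of each block permits adding
  them.\<close>

lemma Gchi_eq:
  assumes \<mu>: "\<mu> \<in> VE"
  shows "G \<mu> = Gform (Rp \<mu>) (Rn \<mu>)"
proof -
  have VM: "\<mu> \<in> VM" and P: "rsum Ipos \<mu> \<in> Eplus \<kappa>" and N: "rsum Ineg \<mu> \<in> Eplus \<kappa>"
    using \<mu> by (auto simp: VE_iff Rp_def Rn_def)
  let ?P = "rsum Ipos \<mu>" and ?N = "rsum Ineg \<mu>"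
  let ?e = "\<lambda>z. enn2real (menergy \<kappa> (\<mu> (fst z)) (\<mu> (snd z)))"
  define f where "f = (\<lambda>(i,j). alpha Ipos i * alpha Ipos j * enn2real (menergy \<kappa> (\<mu> i) (\<mu> j)))"
  have al: "alpha Ipos i = 1" if "i \<in> Ipos" for i using that by (simp add: alpha_def)
  have al': "alpha Ipos i = -1" if "i \<in> Ineg" for i using that I_disj by (auto simp: alpha_def)
  have pp: "(f has_sum bil ?P ?P) (Ipos \<times> Ipos)"
    by (rule has_sum_cong[THEN iffD1, OF _ VE_energy_has_sum[OF VM _ _ P P]]) (auto simp: f_def al)
  have nn: "(f has_sum bil ?N ?N) (Ineg \<times> Ineg)"
    by (rule has_sum_cong[THEN iffD1, OF _ VE_energy_has_sum[OF VM _ _ N N]]) (auto simp: f_def al')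
  have pn: "(f has_sum - bil ?P ?N) (Ipos \<times> Ineg)"
    by (rule has_sum_cong[THEN iffD1, OF _ has_sum_neg[OF VE_energy_has_sum[OF VM _ _ P N]]]) (auto simp: f_def al al')
  have np: "(f has_sum - bil ?N ?P) (Ineg \<times> Ipos)"
    by (rule has_sum_cong[THEN iffD1, OF _ has_sum_neg[OF VE_energy_has_sum[OF VM _ _ N P]]]) (auto simp: f_def al al')
  have "(f has_sum (bil ?P ?P + - bil ?P ?N) + (- bil ?N ?P + bil ?N ?N))
      (((Ipos \<times> Ipos) \<union> (Ipos \<times> Ineg)) \<union> ((Ineg \<times> Ipos) \<union> (Ineg \<times> Ineg)))"
    using I_disj by (intro has_sum_Un_disjoint pp nn pn np) auto
  moreover have "((Ipos \<times> Ipos) \<union> (Ipos \<times> Ineg)) \<union> ((Ineg \<times> Ipos) \<union> (Ineg \<times> Ineg)) = I \<times> I" by auto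
  ultimately have "infsum f (I \<times> I) = (bil ?P ?P + - bil ?P ?N) + (- bil ?N ?P + bil ?N ?N)"
    using infsumI by metis
  then have en: "vec_energy \<kappa> Ipos Ineg \<mu> = bil ?P ?P + bil ?N ?N - 2 * bil ?P ?N"
    unfolding vec_energy_def f_def[symmetric] using bil_sym[OF P N] by simp
  define l where "l = (\<lambda>i. alpha Ipos i * (enn2real (menergy \<kappa> (\<mu> i) chip) - enn2real (menergy \<kappa> (\<mu> i) chin)))"
  have diff: "((\<lambda>i. enn2real (menergy \<kappa> (\<mu> i) chip) - enn2real (menergy \<kappa> (\<mu> i) chin)) has_sum
       bil (rsum S \<mu>) chip - bil (rsum S \<mu>) chin) S" if "S \<subseteq> I" "rsum S \<mu> \<in> Eplus \<kappa>" for S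
    using has_sum_add[OF VE_pot_has_sum[OF VM that chi_Eplus(1)] has_sum_neg[OF VE_pot_has_sum[OF VM that chi_Eplus(2)]]] by simp
  have lp: "(l has_sum bil ?P chip - bil ?P chin) Ipos"
    by (rule has_sum_cong[THEN iffD1, OF _ diff[OF _ P]]) (auto simp: l_def al)
  have ln: "(l has_sum - (bil ?N chip - bil ?N chin)) Ineg"
    by (rule has_sum_cong[THEN iffD1, OF _ has_sum_neg[OF diff[OF _ N]]]) (auto simp: l_def al')
  have "infsum l I = (bil ?P chip - bil ?P chin) + - (bil ?N chip - bil ?N chin)"
    using I_disj by (intro infsumI has_sum_Un_disjoint lp ln)
  then show ?thesis unfolding Gchi_def en l_def[symmetric] Gform_def Rp_def Rn_def by simp
qed

text \<open>The value infinity off the closed set \<open>A i\<close> makes this extension of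
  \<open>g\<close> lower semicontinuous on the whole space and leaves integrals unchanged, since the
  \<open>i\<close>-th component does not charge the complement of \<open>A i\<close>.\<close>

definition gl :: "'i \<Rightarrow> 'a \<Rightarrow> ennreal" where
  "gl i x = (if x \<in> A i then ennreal (g x) else \<top>)"

lemma g_cont_A: "i \<in> I \<Longrightarrow> continuous_on (A i) g"
  using g_cont by (rule continuous_on_subset) auto

lemma gl_lsc: "i \<in> I \<Longrightarrow> lsc (gl i)"
  unfolding lsc_def
proof
  fix t assume i: "i \<in> I"
  show "open {x. t < gl i x}"
  proof (cases "t = \<top>")
    case False
    have "closed {y::real. ennreal y \<le> t}" by (intro closed_Collect_le continuous_on_ennreal continuous_intros)
    then have "closed (g -` {y. ennreal y \<le> t} \<inter> A i)"
      using g_cont_A[OF i] continuous_on_closed_vimage[OF A_closed[OF i]] by blast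
    moreover have "g -` {y. ennreal y \<le> t} \<inter> A i = {x \<in> A i. ennreal (g x) \<le> t}" by auto
    ultimately have "closed {x \<in> A i. ennreal (g x) \<le> t}" by simp
    moreover have "{x. t < gl i x} = - {x \<in> A i. ennreal (g x) \<le> t}"
      using False by (auto simp: gl_def top.not_eq_extremum not_le)
    ultimately show ?thesis by (simp add: open_Compl)
  qed auto
qed

lemma gl_integral:
  assumes i: "i \<in> I" and M: "radon M" "emeasure M (- A i) = 0"
  shows "(\<integral>\<^sup>+x. ennreal (g x) * indicator (A i) x \<partial>M) = (\<integral>\<^sup>+x. gl i x \<partial>M)"
proof (rule nn_integral_cong_AE)
  have "- A i \<in> null_sets M" using M A_closed[OF i] by (auto simp: null_sets_def radon_sets)
  then show "AE x in M. ennreal (g x) * indicator (A i) x = gl i x"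
    by (rule AE_I') (auto simp: gl_def)
qed

lemma adm_iff: "\<mu> \<in> ADM \<longleftrightarrow> \<mu> \<in> VE \<and> (\<forall>i\<in>J. (\<integral>\<^sup>+x. gl i x \<partial>\<mu> i) = ennreal (a i))"
proof -
  have "(\<integral>\<^sup>+x. ennreal (g x) * indicator (A i) x \<partial>\<mu> i) = (\<integral>\<^sup>+x. gl i x \<partial>\<mu> i)" if "\<mu> \<in> VE" "i \<in> J" for i
    using that J_sub VM_radon VM_null by (intro gl_integral) (auto simp: VE_iff)
  then show ?thesis by (auto simp: adm_def)
qed

section \<open>Midpoints and convexity of the Gauss functional\<close>

definition vmid :: "('i \<Rightarrow> 'a measure) \<Rightarrow> ('i \<Rightarrow> 'a measure) \<Rightarrow> ('i \<Rightarrow> 'a measure)" where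
  "vmid \<mu> \<nu> i = (if i \<in> I then rmid (\<mu> i) (\<nu> i) else null_measure borel)"

lemma vmid_VM:
  assumes "\<mu> \<in> VM" "\<nu> \<in> VM" shows "vmid \<mu> \<nu> \<in> VM"
proof (rule VM_I)
  fix i assume i: "i \<in> I"
  note r = VM_radon[OF assms(1) i] VM_radon[OF assms(2) i]
  show "radon (vmid \<mu> \<nu> i)" using rmid_props(1)[OF lc r] i by (simp add: vmid_def)
  show "emeasure (vmid \<mu> \<nu> i) (- A i) = 0"
    using rmid_props(3)[OF lc r, of "- A i"] A_closed[OF i] VM_null[OF assms(1) i] VM_null[OF assms(2) i] i
    by (simp add: vmid_def)
qed (simp add: vmid_def)

lemma rsum_vmid:
  assumes \<mu>: "\<mu> \<in> VM" and \<nu>: "\<nu> \<in> VM" and S: "S \<subseteq> I"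
  shows "rsum S (vmid \<mu> \<nu>) = rmid (rsum S \<mu>) (rsum S \<nu>)"
proof (rule radon_eq_openI)
  note r = rsum_VM(1)[OF \<mu> S] rsum_VM(1)[OF \<nu> S]
  show "radon (rsum S (vmid \<mu> \<nu>))" by (rule rsum_VM[OF vmid_VM[OF \<mu> \<nu>] S])
  show "radon (rmid (rsum S \<mu>) (rsum S \<nu>))" by (rule rmid_props(1)[OF lc r])
  fix U :: "'a set" assume U: "open U"
  have "emeasure (rsum S (vmid \<mu> \<nu>)) U = (\<integral>\<^sup>+i. emeasure (vmid \<mu> \<nu> i) U \<partial>count_space S)"
    by (rule rsum_VM(3)[OF vmid_VM[OF \<mu> \<nu>] S U])
  also have "\<dots> = (\<integral>\<^sup>+i. ennreal (1/2) * (emeasure (\<mu> i) U + emeasure (\<nu> i) U) \<partial>count_space S)"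
    using S U VM_radon[OF \<mu>] VM_radon[OF \<nu>]
    by (intro nn_integral_cong) (auto simp: vmid_def rmid_props(3)[OF lc] subset_iff)
  also have "\<dots> = ennreal (1/2) * (emeasure (rsum S \<mu>) U + emeasure (rsum S \<nu>) U)"
    unfolding rsum_VM(3)[OF \<mu> S U] rsum_VM(3)[OF \<nu> S U]
    by (subst nn_integral_cmult, simp, subst nn_integral_add) auto
  also have "\<dots> = emeasure (rmid (rsum S \<mu>) (rsum S \<nu>)) U"
    using U by (intro rmid_props(3)[OF lc r, symmetric]) auto
  finally show "emeasure (rsum S (vmid \<mu> \<nu>)) U = emeasure (rmid (rsum S \<mu>) (rsum S \<nu>)) U" .
qed

lemma Rp_vmid: "\<mu> \<in> VM \<Longrightarrow> \<nu> \<in> VM \<Longrightarrow> Rp (vmid \<mu> \<nu>) = rmid (Rp \<mu>) (Rp \<nu>)"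
  and Rn_vmid: "\<mu> \<in> VM \<Longrightarrow> \<nu> \<in> VM \<Longrightarrow> Rn (vmid \<mu> \<nu>) = rmid (Rn \<mu>) (Rn \<nu>)"
  unfolding Rp_def Rn_def by (auto intro!: rsum_vmid)

lemma vmid_VE: "\<mu> \<in> VE \<Longrightarrow> \<nu> \<in> VE \<Longrightarrow> vmid \<mu> \<nu> \<in> VE"
  using VE_iff vmid_VM Rp_vmid Rn_vmid rmid_Eplus by metis

lemma vmid_ADM:
  assumes "\<mu> \<in> ADM" "\<nu> \<in> ADM" shows "vmid \<mu> \<nu> \<in> ADM"
proof -
  have VE: "\<mu> \<in> VE" "\<nu> \<in> VE" using assms by (auto simp: adm_iff)
  have "(\<integral>\<^sup>+x. gl i x \<partial>vmid \<mu> \<nu> i) = ennreal (a i)" if i: "i \<in> J" for i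
  proof -
    have iI: "i \<in> I" using i J_sub by auto
    note r = VM_radon[OF _ iI, of \<mu>] VM_radon[OF _ iI, of \<nu>]
    have "(\<integral>\<^sup>+x. gl i x \<partial>vmid \<mu> \<nu> i) = ennreal (1/2) * ((\<integral>\<^sup>+x. gl i x \<partial>\<mu> i) + (\<integral>\<^sup>+x. gl i x \<partial>\<nu> i))"
      using VE r gl_lsc[OF iI] iI by (simp only: vmid_def if_True VE_iff) (intro rmid_props(2)[OF lc], auto)
    also have "\<dots> = ennreal (1/2) * (ennreal (a i) + ennreal (a i))" using assms i by (auto simp: adm_iff)
    also have "ennreal (a i) + ennreal (a i) = ennreal (a i + a i)" by (rule ennreal_plus[symmetric]) (use a_pos[OF iI] in auto)
    also have "ennreal (1/2) * ennreal (a i + a i) = ennreal (1/2 * (a i + a i))" by (rule ennreal_mult[symmetric]) (use a_pos[OF iI] in auto)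
    finally show ?thesis by simp
  qed
  then show ?thesis using vmid_VE[OF VE] by (simp add: adm_iff)
qed

text \<open>The parallelogram law for \<open>R\<mu>\<close> and \<open>R\<nu>\<close>. Their
  distance is written as that between \<open>Rp \<mu> + Rn \<nu>\<close> and
  \<open>Rp \<nu> + Rn \<mu>\<close>, both of which are positive measures.\<close>

lemma G_vmid:
  assumes "\<mu> \<in> VE" "\<nu> \<in> VE"
  shows "G (vmid \<mu> \<nu>) = (G \<mu> + G \<nu>) / 2 - (sdist \<kappa> (radd (Rp \<mu>) (Rn \<nu>)) (radd (Rp \<nu>) (Rn \<mu>)))\<^sup>2 / 4"
proof -
  have VM: "\<mu> \<in> VM" "\<nu> \<in> VM" and E: "Rp \<mu> \<in> Eplus \<kappa>" "Rn \<mu> \<in> Eplus \<kappa>" "Rp \<nu> \<in> Eplus \<kappa>" "Rn \<nu> \<in> Eplus \<kappa>"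
    using assms by (auto simp: VE_iff)
  note E' = rmid_Eplus[OF E(1) E(3)] rmid_Eplus[OF E(2) E(4)] radd_Eplus[OF E(1) E(4)] radd_Eplus[OF E(3) E(2)]
  note sy = bil_sym[OF E(1) E(2)] bil_sym[OF E(1) E(3)] bil_sym[OF E(1) E(4)] bil_sym[OF E(2) E(3)] bil_sym[OF E(2) E(4)] bil_sym[OF E(3) E(4)]
  show ?thesis
    unfolding Gchi_eq[OF vmid_VE[OF assms]] Gchi_eq[OF assms(1)] Gchi_eq[OF assms(2)]
      Rp_vmid[OF VM] Rn_vmid[OF VM] Gform_def sdist_sq[OF E'(3,4)]
    by (simp add: bil_rmid bil_radd E E' chi_Eplus) (simp add: sy field_simps)
qed

section \<open>Bounds on mass and energy over the admissible class\<close>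

lemma component_mass:
  assumes \<mu>: "\<mu> \<in> ADM" and i: "i \<in> J" and c: "c > 0" "\<forall>x\<in>(\<Union>i\<in>I. A i). c \<le> g x"
  shows "emeasure (\<mu> i) UNIV \<le> ennreal (a i / c)"
proof -
  have iI: "i \<in> I" using i J_sub by auto
  have r: "radon (\<mu> i)" using \<mu> VM_radon[OF _ iI] by (auto simp: adm_iff VE_iff)
  have "ennreal c * emeasure (\<mu> i) UNIV = (\<integral>\<^sup>+x. ennreal c \<partial>\<mu> i)" using radon_space[OF r] by simp
  also have "\<dots> \<le> (\<integral>\<^sup>+x. gl i x \<partial>\<mu> i)"
    using c iI by (intro nn_integral_mono) (auto simp: gl_def intro!: ennreal_leI)
  also have "\<dots> = ennreal (a i)" using \<mu> i by (auto simp: adm_iff)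
  finally have le: "ennreal c * emeasure (\<mu> i) UNIV \<le> ennreal (a i)" .
  then have "ennreal (1/c) * (ennreal c * emeasure (\<mu> i) UNIV) \<le> ennreal (1/c) * ennreal (a i)" by (intro mult_left_mono) auto
  moreover have "ennreal (1/c) * (ennreal c * emeasure (\<mu> i) UNIV) = emeasure (\<mu> i) UNIV"
    using c by (simp add: mult.assoc[symmetric] ennreal_mult[symmetric])
  moreover have "ennreal (1/c) * ennreal (a i) = ennreal (a i / c)"
    using c a_pos[OF iI] by (simp add: ennreal_mult[symmetric])
  ultimately show ?thesis by simp
qed

text \<open>All positive indices belong to \<open>J\<close>, so each of their components has mass at
  most \<open>a i / c\<close>, with \<open>c\<close> a positive lower bound of \<open>g\<close>, and
  the \<open>a i\<close> are summable. Nothing of the kind is available for the negative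
  part.\<close>

lemma Rp_mass: "\<exists>m\<ge>0. \<forall>\<mu>\<in>ADM. emeasure (Rp \<mu>) UNIV \<le> ennreal m"
proof -
  obtain c where c: "c > 0" "\<forall>x\<in>(\<Union>i\<in>I. A i). c \<le> g x" using g_inf by blast
  have nn: "infsum a I \<ge> 0" using a_pos by (intro infsum_nonneg) (auto intro: less_imp_le)
  show ?thesis
  proof (intro exI[of _ "infsum a I / c"] conjI ballI)
    show "0 \<le> infsum a I / c" using nn c by simp
    fix \<mu> assume \<mu>: "\<mu> \<in> ADM"
    then have VM: "\<mu> \<in> VM" by (auto simp: adm_iff VE_iff)
    have "emeasure (Rp \<mu>) UNIV = (\<integral>\<^sup>+i. emeasure (\<mu> i) UNIV \<partial>count_space Ipos)"
      unfolding Rp_def by (rule rsum_VM(3)[OF VM]) auto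
    also have "\<dots> \<le> ennreal (infsum a I / c)"
      unfolding nn_integral_count_space_SUP
    proof (rule SUP_least, clarify)
      fix F assume F: "finite F" "F \<subseteq> Ipos"
      have "(\<Sum>i\<in>F. emeasure (\<mu> i) UNIV) \<le> (\<Sum>i\<in>F. ennreal (a i / c))"
        using F J_sub by (intro sum_mono component_mass[OF \<mu> _ c]) auto
      also have "\<dots> = ennreal (\<Sum>i\<in>F. a i / c)" using F a_pos c by (intro sum_ennreal) (auto intro!: divide_nonneg_pos less_imp_le)
      also have "(\<Sum>i\<in>F. a i / c) = sum a F / c" by (simp add: sum_divide_distrib)
      also have "ennreal \<dots> \<le> ennreal (infsum a I / c)"
        using F a_pos c by (intro ennreal_leI divide_right_mono finite_sum_le_infsum a_sum) (auto intro: less_imp_le)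
      finally show "(\<Sum>i\<in>F. emeasure (\<mu> i) UNIV) \<le> ennreal (infsum a I / c)" .
    qed
    finally show "emeasure (Rp \<mu>) UNIV \<le> ennreal (infsum a I / c)" .
  qed
qed

lemma closed_Apos: "closed Apos" and closed_Aneg: "closed Aneg"
proof -
  have "finite {i\<in>Ipos. A i \<inter> K \<noteq> {}}" "finite {i\<in>Ineg. A i \<inter> K \<noteq> {}}" if "compact K" for K
    by (rule finite_subset[OF _ A_locfin[OF that]], auto)+
  then show "closed Apos" "closed Aneg" using A_closed by (auto intro!: closed_locally_finite_Union[OF lc])
qed

lemma Rp_null: "\<mu> \<in> VM \<Longrightarrow> emeasure (Rp \<mu>) (- Apos) = 0" and Rn_null: "\<mu> \<in> VM \<Longrightarrow> emeasure (Rn \<mu>) (- Aneg) = 0"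
proof -
  assume \<mu>: "\<mu> \<in> VM"
  have "emeasure (\<mu> i) (- Apos) = 0" if "i \<in> Ipos" for i using VM_zero_off[OF \<mu>, of i "- Apos"] that by auto
  then have "(\<integral>\<^sup>+i. emeasure (\<mu> i) (- Apos) \<partial>count_space Ipos) = (\<integral>\<^sup>+i. 0 \<partial>count_space Ipos)" by (intro nn_integral_cong) auto
  then show "emeasure (Rp \<mu>) (- Apos) = 0" unfolding Rp_def
    by (subst rsum_VM(3)[OF \<mu> _ open_Compl[OF closed_Apos]]) auto
  have "emeasure (\<mu> i) (- Aneg) = 0" if "i \<in> Ineg" for i using VM_zero_off[OF \<mu>, of i "- Aneg"] that by auto
  then have "(\<integral>\<^sup>+i. emeasure (\<mu> i) (- Aneg) \<partial>count_space Ineg) = (\<integral>\<^sup>+i. 0 \<partial>count_space Ineg)" by (intro nn_integral_cong) auto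
  then show "emeasure (Rn \<mu>) (- Aneg) = 0" unfolding Rn_def
    by (subst rsum_VM(3)[OF \<mu> _ open_Compl[OF closed_Aneg]]) auto
qed

definition Q :: "('i \<Rightarrow> 'a measure) \<Rightarrow> real" where
  "Q \<mu> = bil (Rp \<mu>) (Rp \<mu>) + bil (Rn \<mu>) (Rn \<mu>)"

text \<open>With \<open>u\<close>, \<open>v\<close> the norms of the two parts, the maximum
  principle gives \<open>2 * bil (Rp \<mu>) (Rn \<mu>) \<le> v\<^sup>2 / 2 + 8 * h * C *
  m\<^sup>2\<close>. The linear terms cost \<open>u\<^sup>2 / 2\<close> and
  \<open>v\<^sup>2 / 4\<close> more, which leaves \<open>u\<^sup>2 / 2 + v\<^sup>2 / 4\<close> in
  the lower bound for \<open>G \<mu>\<close>; this is the origin of the factor 4.\<close>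

lemma Q_bound: "\<exists>D. \<forall>\<mu>\<in>ADM. Q \<mu> \<le> 4 * G \<mu> + D"
proof -
  obtain m where m: "m \<ge> 0" "\<And>\<mu>. \<mu> \<in> ADM \<Longrightarrow> emeasure (Rp \<mu>) UNIV \<le> ennreal m" using Rp_mass by blast
  define C where "C = enn2real (SUP z\<in>Apos \<times> Aneg. \<kappa> (fst z) (snd z))"
  have C: "\<kappa> x y \<le> ennreal C" if "x \<in> Apos" "y \<in> Aneg" for x y
  proof -
    have "\<kappa> (fst (x,y)) (snd (x,y)) \<le> (SUP z\<in>Apos \<times> Aneg. \<kappa> (fst z) (snd z))" using that by (intro SUP_upper) auto
    also have "\<dots> = ennreal C" using A_kbd by (simp add: C_def)
    finally show ?thesis by simp
  qed
  have C0: "C \<ge> 0" by (simp add: C_def)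
  define X where "X = sqrt (bil chip chip) + sqrt (bil chin chin)"
  have X0: "X \<ge> 0" by (simp add: X_def)
  show ?thesis
  proof (intro exI[of _ "32 * h * C * m\<^sup>2 + 24 * X\<^sup>2"] ballI)
    fix \<mu> assume \<mu>: "\<mu> \<in> ADM"
    then have VE: "\<mu> \<in> VE" and VM: "\<mu> \<in> VM" and E: "Rp \<mu> \<in> Eplus \<kappa>" "Rn \<mu> \<in> Eplus \<kappa>" by (auto simp: adm_iff VE_iff)
    have mp: "4 * bil (Rp \<mu>) (Rn \<mu>) \<le> bil (Rn \<mu>) (Rn \<mu>) + 16 * h * C * m\<^sup>2"
      by (rule max_principle_bound[OF k_e _ E(1) m(2)[OF \<mu>] Rp_null[OF VM] closed_Apos E(2) Rn_null[OF VM] closed_Aneg C C0 m(1)])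
         (use h_ge in auto)
    define u where "u = sqrt (bil (Rp \<mu>) (Rp \<mu>))"
    define v where "v = sqrt (bil (Rn \<mu>) (Rn \<mu>))"
    have uv: "u \<ge> 0" "v \<ge> 0" "bil (Rp \<mu>) (Rp \<mu>) = u\<^sup>2" "bil (Rn \<mu>) (Rn \<mu>) = v\<^sup>2" by (auto simp: u_def v_def)
    have c1: "bil (Rp \<mu>) chin \<le> u * X" "bil (Rn \<mu>) chip \<le> v * X"
    proof -
      have "bil (Rp \<mu>) chin \<le> u * sqrt (bil chin chin)" unfolding u_def by (rule bil_Cauchy_Schwarz[OF E(1) chi_Eplus(2)])
      also have "\<dots> \<le> u * X" using uv by (intro mult_left_mono) (auto simp: X_def)
      finally show "bil (Rp \<mu>) chin \<le> u * X" .
      have "bil (Rn \<mu>) chip \<le> v * sqrt (bil chip chip)" unfolding v_def by (rule bil_Cauchy_Schwarz[OF E(2) chi_Eplus(1)])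
      also have "\<dots> \<le> v * X" using uv by (intro mult_left_mono) (auto simp: X_def)
      finally show "bil (Rn \<mu>) chip \<le> v * X" .
    qed
    have G: "G \<mu> \<ge> u\<^sup>2 + v\<^sup>2 - 2 * bil (Rp \<mu>) (Rn \<mu>) - 2 * (u * X) - 2 * (v * X)"
      unfolding Gchi_eq[OF VE] Gform_def uv(3,4) 
    proof -
      have "- (u * X) - v * X \<le> bil (Rp \<mu>) chip - bil (Rp \<mu>) chin - bil (Rn \<mu>) chip + bil (Rn \<mu>) chin"
        using c1 bil_nonneg[of "Rp \<mu>" chip] bil_nonneg[of "Rn \<mu>" chin] by linarith
      then show "u\<^sup>2 + v\<^sup>2 - 2 * bil (Rp \<mu>) (Rn \<mu>) - 2 * (u * X) - 2 * (v * X) \<le> u\<^sup>2 + v\<^sup>2 - 2 * bil (Rp \<mu>) (Rn \<mu>) +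
         2 * (bil (Rp \<mu>) chip - bil (Rp \<mu>) chin - bil (Rn \<mu>) chip + bil (Rn \<mu>) chin)" by simp
    qed
    \<comment> \<open>Young's inequality, with weights chosen so that part of
      \<open>u\<^sup>2\<close> and of \<open>v\<^sup>2\<close> survives; the resulting
      \<open>6 * X\<^sup>2\<close> becomes \<open>24 * X\<^sup>2\<close> after multiplication by
      4.\<close>
    have q1: "2 * (u * X) \<le> u\<^sup>2 / 2 + 2 * X\<^sup>2" using zero_le_power2[of "u - 2 * X"] by (simp add: power2_diff field_simps)
    have q2: "2 * (v * X) \<le> v\<^sup>2 / 4 + 4 * X\<^sup>2" using zero_le_power2[of "v / 2 - 2 * X"] by (simp add: power2_diff field_simps)
    show "Q \<mu> \<le> 4 * G \<mu> + (32 * h * C * m\<^sup>2 + 24 * X\<^sup>2)"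
      unfolding Q_def uv(3,4) using G q1 q2 mp[unfolded uv(4)] zero_le_power2[of u] by linarith
  qed
qed

text \<open>\<open>G \<mu>\<close> plus the energy of \<open>\<chi>\<close> is the squared norm of
  \<open>R\<mu> + \<chi>\<close>, computed here as the squared distance between two positive
  measures.\<close>

lemma G_lower: "\<mu> \<in> VE \<Longrightarrow> G \<mu> \<ge> - (sdist \<kappa> chip chin)\<^sup>2"
proof -
  assume \<mu>: "\<mu> \<in> VE"
  then have E: "Rp \<mu> \<in> Eplus \<kappa>" "Rn \<mu> \<in> Eplus \<kappa>" by (auto simp: VE_iff)
  note c = chi_Eplus
  note E' = radd_Eplus[OF E(1) c(1)] radd_Eplus[OF E(2) c(2)]
  note sy = bil_sym[OF E(1) c(1)] bil_sym[OF E(1) c(2)] bil_sym[OF E(2) c(1)] bil_sym[OF E(2) c(2)]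
  have "2 * bil (radd (Rp \<mu>) chip) (radd (Rn \<mu>) chin) \<le> bil (radd (Rp \<mu>) chip) (radd (Rp \<mu>) chip) + bil (radd (Rn \<mu>) chin) (radd (Rn \<mu>) chin)"
    by (rule Eplus_pos_def(2)[OF E'])
  then show ?thesis
    unfolding Gchi_eq[OF \<mu>] Gform_def sdist_sq[OF c] by (simp add: bil_radd E E' c sy)
qed

end

context condenser
begin

section \<open>Vague limits of admissible vector measures\<close>

lemma rsum_integral:
  assumes \<mu>: "\<mu> \<in> VM" and S: "S \<subseteq> I" and \<phi>: "\<phi> \<in> Ccp" and K: "compact K" "\<And>x. x \<notin> K \<Longrightarrow> \<phi> x = 0"
  shows "integral\<^sup>L (rsum S \<mu>) \<phi> = (\<Sum>i\<in>{i\<in>S. A i \<inter> K \<noteq> {}}. integral\<^sup>L (\<mu> i) \<phi>)"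
proof -
  let ?T = "{i\<in>S. A i \<inter> K \<noteq> {}}"
  have fin: "finite ?T" using S by (intro finite_subset[OF _ A_locfin[OF K(1)]]) auto
  have z: "integral\<^sup>L (\<mu> i) \<phi> = 0" if "i \<in> S" "i \<notin> ?T" for i
  proof (rule integral_eq_zero_AE)
    have iI: "i \<in> I" and e: "A i \<inter> K = {}" using that S by auto
    have "K \<in> null_sets (\<mu> i)"
      using VM_zero_off[OF \<mu> iI e] K VM_radon[OF \<mu> iI] by (auto simp: null_sets_def radon_sets compact_imp_closed)
    then show "AE x in \<mu> i. \<phi> x = 0" by (rule AE_I') (use K in auto)
  qed
  have "ennreal (integral\<^sup>L (rsum S \<mu>) \<phi>) = (\<integral>\<^sup>+i. (\<integral>\<^sup>+x. ennreal (\<phi> x) \<partial>\<mu> i) \<partial>count_space S)"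
    using rsum_VM(2)[OF \<mu> S Ccp_lsc[OF \<phi>]] radon_nn_integral[OF rsum_VM(1)[OF \<mu> S] \<phi>] by simp
  also have "\<dots> = (\<integral>\<^sup>+i. ennreal (integral\<^sup>L (\<mu> i) \<phi>) \<partial>count_space S)"
    using VM_radon[OF \<mu>] S \<phi> by (intro nn_integral_cong radon_nn_integral) auto
  also have "\<dots> = (\<Sum>i\<in>?T. ennreal (integral\<^sup>L (\<mu> i) \<phi>))"
    by (rule nn_integral_count_space'[OF fin]) (auto simp: z)
  also have "\<dots> = ennreal (\<Sum>i\<in>?T. integral\<^sup>L (\<mu> i) \<phi>)"
    by (intro sum_ennreal integral_nonneg_Ccp \<phi>)
  finally show ?thesis
    by (subst (asm) ennreal_inj) (auto intro!: sum_nonneg integral_nonneg_Ccp \<phi>)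
qed

text \<open>A test function sees only the finitely many plates meeting its support, so componentwise
  vague convergence passes to the sums even for infinite index sets.\<close>

lemma vlim_rsum:
  assumes ev: "eventually (\<lambda>\<mu>. \<mu> \<in> VM) F" and lam: "lam \<in> VM" and S: "S \<subseteq> I"
    and v: "\<And>i. i \<in> I \<Longrightarrow> vlim F (\<lambda>\<mu>. \<mu> i) (lam i)"
  shows "vlim F (\<lambda>\<mu>. rsum S \<mu>) (rsum S lam)"
proof (rule vlimI)
  show "eventually (\<lambda>\<mu>. radon (rsum S \<mu>)) F" using ev by eventually_elim (rule rsum_VM(1)[OF _ S])
  show "radon (rsum S lam)" by (rule rsum_VM(1)[OF lam S])
  fix \<phi> :: "'a \<Rightarrow> real" assume \<phi>: "\<phi> \<in> Ccp"
  obtain K where K: "compact K" "\<And>x. x \<notin> K \<Longrightarrow> \<phi> x = 0" using CcpE[OF \<phi>] by metis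
  let ?T = "{i\<in>S. A i \<inter> K \<noteq> {}}"
  have "((\<lambda>\<mu>. \<Sum>i\<in>?T. integral\<^sup>L (\<mu> i) \<phi>) \<longlongrightarrow> (\<Sum>i\<in>?T. integral\<^sup>L (lam i) \<phi>)) F"
    using S by (intro tendsto_sum vlimD[OF v] \<phi>) auto
  then have "((\<lambda>\<mu>. \<Sum>i\<in>?T. integral\<^sup>L (\<mu> i) \<phi>) \<longlongrightarrow> integral\<^sup>L (rsum S lam) \<phi>) F"
    using rsum_integral[OF lam S \<phi> K] by simp
  moreover have "eventually (\<lambda>\<mu>. (\<Sum>i\<in>?T. integral\<^sup>L (\<mu> i) \<phi>) = integral\<^sup>L (rsum S \<mu>) \<phi>) F"
    using ev by eventually_elim (rule rsum_integral[OF _ S \<phi> K, symmetric])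
  ultimately show "((\<lambda>\<mu>. integral\<^sup>L (rsum S \<mu>) \<phi>) \<longlongrightarrow> integral\<^sup>L (rsum S lam) \<phi>) F"
    by (rule Lim_transform_eventually)
qed

text \<open>The kernel is nonnegative and \<open>\<mu> i\<close> is dominated by the part of
  \<open>R\<mu>\<close> containing it, so its energy is dominated as well. This transfers the bound
  on \<open>Q\<close> to every component.\<close>

lemma component_Eplus:
  assumes \<mu>: "\<mu> \<in> VE" and i: "i \<in> I"
  shows "\<mu> i \<in> Eplus \<kappa>" "bil (\<mu> i) (\<mu> i) \<le> Q \<mu>"
proof -
  have VM: "\<mu> \<in> VM" and E: "Rp \<mu> \<in> Eplus \<kappa>" "Rn \<mu> \<in> Eplus \<kappa>" using \<mu> by (auto simp: VE_iff)
  have ri: "radon (\<mu> i)" using VM_radon[OF VM i] .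
  have *: "menergy \<kappa> (\<mu> i) (\<mu> i) \<le> menergy \<kappa> (rsum S \<mu>) (rsum S \<mu>)" if S: "S \<subseteq> I" "i \<in> S" for S
  proof -
    note r = rsum_VM(1)[OF VM S(1)]
    have "menergy \<kappa> (\<mu> i) (\<mu> i) \<le> menergy \<kappa> (rsum S \<mu>) (\<mu> i)"
      by (rule menergy_mono_left[OF ri r ri rsum_integral_ge[OF VM S]])
    also have "\<dots> = menergy \<kappa> (\<mu> i) (rsum S \<mu>)" by (rule menergy_sym[OF r ri])
    also have "\<dots> \<le> menergy \<kappa> (rsum S \<mu>) (rsum S \<mu>)"
      by (rule menergy_mono_left[OF ri r r rsum_integral_ge[OF VM S]])
    finally show ?thesis .
  qed
  have "menergy \<kappa> (\<mu> i) (\<mu> i) \<le> ennreal (Q \<mu>)"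
  proof (cases "i \<in> Ipos")
    case True
    then have "menergy \<kappa> (\<mu> i) (\<mu> i) \<le> ennreal (bil (Rp \<mu>) (Rp \<mu>))"
      using *[of Ipos] menergy_bil[OF E(1) E(1)] by (simp add: Rp_def)
    also have "\<dots> \<le> ennreal (Q \<mu>)" by (intro ennreal_leI) (simp add: Q_def)
    finally show ?thesis .
  next
    case False
    then have "menergy \<kappa> (\<mu> i) (\<mu> i) \<le> ennreal (bil (Rn \<mu>) (Rn \<mu>))"
      using *[of Ineg] i menergy_bil[OF E(2) E(2)] by (simp add: Rn_def)
    also have "\<dots> \<le> ennreal (Q \<mu>)" by (intro ennreal_leI) (simp add: Q_def)
    finally show ?thesis .
  qed
  then show "\<mu> i \<in> Eplus \<kappa>" using ri by (auto simp: Eplus_def intro: le_less_trans)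
  have "Q \<mu> \<ge> 0" by (simp add: Q_def)
  then show "bil (\<mu> i) (\<mu> i) \<le> Q \<mu>" unfolding bil_def
    using \<open>menergy \<kappa> (\<mu> i) (\<mu> i) \<le> ennreal (Q \<mu>)\<close> by (intro enn2real_leI) auto
qed

section \<open>Passing to the limit in the normalization\<close>

lemma component_finite:
  assumes \<mu>: "\<mu> \<in> ADM" and i: "i \<in> J"
  shows "emeasure (\<mu> i) UNIV < \<top>"
  using component_mass[OF \<mu> i] g_inf by (metis ennreal_less_top le_less_trans)

lemma AE_component:
  assumes \<mu>: "\<mu> \<in> VM" and i: "i \<in> I"
  shows "AE x in \<mu> i. x \<in> A i"
proof (rule AE_I')
  show "- A i \<in> null_sets (\<mu> i)"
    using VM_null[OF \<mu> i] VM_radon[OF \<mu> i] A_closed[OF i] by (auto simp: null_sets_def radon_sets)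
qed auto

text \<open>For \<open>y > L\<close> the factor \<open>y powr (1 - r)\<close> is below
  \<open>L powr (1 - r)\<close>, the exponent being negative.\<close>

lemma growth_pointwise:
  fixes L y r :: real
  assumes "L > 0" "y > 0" "r > 1"
  shows "y \<le> L + L powr (1 - r) * y powr r"
proof (cases "y \<le> L")
  case True
  then show ?thesis by (simp add: add_increasing2)
next
  case False
  have "y = y powr (1 - r) * y powr r" using assms by (simp add: powr_add[symmetric])
  also have "\<dots> \<le> L powr (1 - r) * y powr r"
    using False assms by (intro mult_right_mono powr_mono2') auto
  finally show ?thesis using assms by simp
qed

text \<open>Unbounded weights are handled by Young's inequality in the form of \<open>growth_pointwise\<close>,
  the power of the weight being dominated by a potential of finite energy.\<close>
lemma weight_split:
  assumes i: "i \<in> J" and e: "e > 0" and C0: "C0 \<ge> 0"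
  shows "\<exists>L\<ge>0. \<forall>\<mu>\<in>ADM. Q \<mu> \<le> C0 \<longrightarrow> (\<forall>B\<in>sets borel.
      (\<integral>\<^sup>+x. gl i x * indicator B x \<partial>\<mu> i) \<le> ennreal L * emeasure (\<mu> i) B + ennreal e)"
proof -
  have iI: "i \<in> I" using i J_sub by auto
  obtain c where c: "c > 0" "\<And>x. x \<in> A i \<Longrightarrow> c \<le> g x" using g_inf iI by blast
  from g_growth[OF iI] show ?thesis
  proof
    assume "bounded (g ` A i)"
    then obtain L where L: "L > 0" "\<And>x. x \<in> A i \<Longrightarrow> \<bar>g x\<bar> \<le> L" unfolding bounded_pos by auto
    show ?thesis
    proof (intro exI[of _ L] conjI ballI impI)
      show "0 \<le> L" using L by simp
      fix \<mu> and B :: "'a set" assume \<mu>: "\<mu> \<in> ADM" and B: "B \<in> sets borel"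
      have VM: "\<mu> \<in> VM" using \<mu> by (auto simp: adm_iff VE_iff)
      have "(\<integral>\<^sup>+x. gl i x * indicator B x \<partial>\<mu> i) \<le> (\<integral>\<^sup>+x. ennreal L * indicator B x \<partial>\<mu> i)"
      proof (rule nn_integral_mono_AE)
        show "AE x in \<mu> i. gl i x * indicator B x \<le> ennreal L * indicator B x"
          using AE_component[OF VM iI]
        proof eventually_elim
          case (elim x)
          then have "g x \<le> L" using L(2)[of x] by auto
          then show ?case using elim by (intro mult_right_mono) (auto simp: gl_def intro: ennreal_leI)
        qed
      qed
      also have "\<dots> = ennreal L * emeasure (\<mu> i) B"
        using B VM_radon[OF VM iI] by (intro nn_integral_cmult_indicator) (simp add: radon_sets)
      also have "\<dots> \<le> ennreal L * emeasure (\<mu> i) B + ennreal e" by simp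
      finally show "(\<integral>\<^sup>+x. gl i x * indicator B x \<partial>\<mu> i) \<le> ennreal L * emeasure (\<mu> i) B + ennreal e" .
    qed
  next
    assume "\<exists>r \<nu>. r > 1 \<and> \<nu> \<in> Esigned \<kappa> \<and>
           (\<exists>N. capacity \<kappa> N = 0 \<and>
              (\<forall>x\<in>A i - N. pot \<kappa> x (snd \<nu>) < \<top> \<and>
                   ennreal (g x powr r) + pot \<kappa> x (snd \<nu>) \<le> pot \<kappa> x (fst \<nu>)))"
    then obtain r \<nu> N where r: "r > 1" and \<nu>: "\<nu> \<in> Esigned \<kappa>" and N: "capacity \<kappa> N = 0"
      "\<And>x. x \<in> A i - N \<Longrightarrow> ennreal (g x powr r) + pot \<kappa> x (snd \<nu>) \<le> pot \<kappa> x (fst \<nu>)" by blast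
    \<comment> \<open>The potential of the negative part is nonnegative and stands on the smaller
      side, so the potential of the positive part alone dominates the power of the weight.\<close>
    define f where "f = fst \<nu>"
    have fE: "f \<in> Eplus \<kappa>" using \<nu> by (auto simp: f_def Esigned_def Eplus_def signed_radon_def)
    have le: "ennreal (g x powr r) \<le> pot \<kappa> x f" if "x \<in> A i - N" for x
      using N(2)[OF that] unfolding f_def by (meson le_iff_add order_trans)
    define W where "W = sqrt C0 * sqrt (bil f f)"
    have W: "W \<ge> 0" using C0 by (simp add: W_def)
    \<comment> \<open>\<open>W\<close> bounds the mutual energy of \<open>\<mu> i\<close> and
      \<open>f\<close> by the Cauchy-Schwarz inequality. The choice makes
      \<open>L powr (1 - r)\<close> equal to \<open>e / (2 * (W + 1))\<close>, so that the potential
      term contributes at most \<open>e\<close>.\<close>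
    define L where "L = (2 * (W + 1) / e) powr (1 / (r - 1))"
    have L: "L > 0" using W e by (simp add: L_def)
    have "L powr (r - 1) = 2 * (W + 1) / e" using r W e by (simp add: L_def powr_powr)
    moreover have "L powr (1 - r) = inverse (L powr (r - 1))" by (simp add: powr_minus[symmetric])
    ultimately have Lr: "L powr (1 - r) = e / (2 * (W + 1))" by simp
    have LW: "L powr (1 - r) * W \<le> e" unfolding Lr using W e by (simp add: field_simps)
    define g' where "g' x = indicator (A i) x *\<^sub>R g x" for x
    have g'm: "g' \<in> borel_measurable borel" unfolding g'_def[abs_def]
      using A_closed[OF iI] by (intro borel_measurable_continuous_on_indicator g_cont_A[OF iI]) auto
    have pm: "(\<lambda>x. pot \<kappa> x f) \<in> borel_measurable borel" using lsc_pot[OF Eplus_radon[OF fE]] by (rule lsc_measurable)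
    \<comment> \<open>The exceptional set \<open>N\<close> may be nonmeasurable. The set where the
      growth estimate actually fails is Borel and contained in \<open>N\<close>, hence null for the
      component; \<open>g'\<close> extends \<open>g\<close> by 0 so that measurability makes sense
      on the whole space.\<close>
    define Bad where "Bad = A i \<inter> {x. pot \<kappa> x f < ennreal (g' x powr r)}"
    have "{x. pot \<kappa> x f < ennreal (g' x powr r)} \<in> sets borel" using g'm pm by measurable
    then have Badb: "Bad \<in> sets borel" unfolding Bad_def using A_closed[OF iI] by auto
    have BadN: "Bad \<subseteq> N"
    proof (rule subsetI, rule ccontr)
      fix x assume x: "x \<in> Bad" "x \<notin> N"
      then have "pot \<kappa> x f < ennreal (g x powr r)" "x \<in> A i" by (auto simp: Bad_def g'_def)
      then show False using le[of x] x(2) by (meson DiffI leD)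
    qed
    show ?thesis
    proof (intro exI[of _ L] conjI ballI impI)
      show "0 \<le> L" using L by simp
      fix \<mu> and B :: "'a set" assume \<mu>: "\<mu> \<in> ADM" and Q: "Q \<mu> \<le> C0" and B: "B \<in> sets borel"
      have VE: "\<mu> \<in> VE" and VM: "\<mu> \<in> VM" using \<mu> by (auto simp: adm_iff VE_iff)
      note ri = VM_radon[OF VM iI]
      have sm: "sets (\<mu> i) = sets borel" using ri by (rule radon_sets)
      have "emeasure (\<mu> i) Bad = 0"
        by (rule capacity_zero_null[OF N(1) component_Eplus(1)[OF VE iI] component_finite[OF \<mu> i] Badb BadN])
      then have "Bad \<in> null_sets (\<mu> i)" using Badb sm by (auto simp: null_sets_def)
      then have AEb: "AE x in \<mu> i. x \<notin> Bad" by (rule AE_not_in)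
      have "(\<integral>\<^sup>+x. gl i x * indicator B x \<partial>\<mu> i) \<le> (\<integral>\<^sup>+x. ennreal L * indicator B x + ennreal (L powr (1 - r)) * pot \<kappa> x f \<partial>\<mu> i)"
      proof (rule nn_integral_mono_AE)
        show "AE x in \<mu> i. gl i x * indicator B x \<le> ennreal L * indicator B x + ennreal (L powr (1 - r)) * pot \<kappa> x f"
          using AE_component[OF VM iI] AEb
        proof eventually_elim
          case (elim x)
          have gx: "g x > 0" using c elim by force
          have "ennreal (g x) \<le> ennreal (L + L powr (1 - r) * g x powr r)"
            by (intro ennreal_leI growth_pointwise L gx r)
          also have "\<dots> = ennreal L + ennreal (L powr (1 - r)) * ennreal (g x powr r)"
            using L by (simp add: ennreal_plus ennreal_mult)
          also have "\<dots> \<le> ennreal L + ennreal (L powr (1 - r)) * pot \<kappa> x f"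
            using elim by (intro add_mono mult_left_mono) (auto simp: Bad_def g'_def not_less)
          finally show ?case using elim by (auto simp: gl_def indicator_def)
        qed
      qed
      also have "\<dots> = ennreal L * emeasure (\<mu> i) B + ennreal (L powr (1 - r)) * menergy \<kappa> (\<mu> i) f"
        unfolding menergy_def using B pm sm
        by (subst nn_integral_add) (auto simp: nn_integral_cmult_indicator nn_integral_cmult measurable_cong_sets[OF sm refl])
      also have "\<dots> \<le> ennreal L * emeasure (\<mu> i) B + ennreal e"
      proof (rule add_left_mono)
        have "bil (\<mu> i) f \<le> sqrt (bil (\<mu> i) (\<mu> i)) * sqrt (bil f f)"
          by (rule bil_Cauchy_Schwarz[OF component_Eplus(1)[OF VE iI] fE])
        also have "\<dots> \<le> W" unfolding W_def
          using component_Eplus(2)[OF VE iI] Q by (intro mult_right_mono) auto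
        finally have "L powr (1 - r) * bil (\<mu> i) f \<le> e"
          using LW mult_left_mono[of "bil (\<mu> i) f" W "L powr (1 - r)"] by simp
        then show "ennreal (L powr (1 - r)) * menergy \<kappa> (\<mu> i) f \<le> ennreal e"
          unfolding menergy_bil[OF component_Eplus(1)[OF VE iI] fE] by (simp add: ennreal_mult[symmetric] ennreal_leI)
      qed
      finally show "(\<integral>\<^sup>+x. gl i x * indicator B x \<partial>\<mu> i) \<le> ennreal L * emeasure (\<mu> i) B + ennreal e" .
    qed
  qed
qed

text \<open>The weighted tail is at most \<open>L\<close> times the plain tail mass plus
  \<open>e/2\<close>; finite capacity of the plate makes the tail mass uniformly small for bounded
  energy.\<close>

lemma tail_weight:
  assumes i: "i \<in> J" and e: "e > 0" and C0: "C0 \<ge> 0"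
  shows "\<exists>K. compact K \<and> (\<forall>\<mu>\<in>ADM. Q \<mu> \<le> C0 \<longrightarrow> (\<integral>\<^sup>+x. gl i x * indicator (-K) x \<partial>\<mu> i) \<le> ennreal e)"
proof -
  have iI: "i \<in> I" using i J_sub by auto
  obtain L where L: "L \<ge> 0" "\<And>\<mu> B. \<mu> \<in> ADM \<Longrightarrow> Q \<mu> \<le> C0 \<Longrightarrow> B \<in> sets borel \<Longrightarrow>
      (\<integral>\<^sup>+x. gl i x * indicator B x \<partial>\<mu> i) \<le> ennreal L * emeasure (\<mu> i) B + ennreal (e/2)"
    using weight_split[OF i, of "e/2" C0] e C0 by auto
  \<comment> \<open>Chosen so that \<open>L * (d * sqrt C0) \<le> e / 2\<close>.\<close>
  define d where "d = e / (2 * (L * sqrt C0 + 1))"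
  have LC: "L * sqrt C0 \<ge> 0" using L C0 by simp
  then have d: "d > 0" using e by (simp add: d_def)
  obtain K where K: "compact K" "\<And>\<nu>. \<nu> \<in> Eplus \<kappa> \<Longrightarrow> emeasure \<nu> UNIV < \<top> \<Longrightarrow> emeasure \<nu> (- A i) = 0 \<Longrightarrow>
      measure \<nu> (-K) \<le> d * sqrt (bil \<nu> \<nu>)"
    using tail_mass_bound[OF A_closed[OF iI] cap_fin[OF i] d] by blast
  have Kb: "-K \<in> sets borel" using K by (simp add: compact_imp_closed)
  show ?thesis
  proof (intro exI[of _ K] conjI ballI impI K(1))
    fix \<mu> assume \<mu>: "\<mu> \<in> ADM" and Q: "Q \<mu> \<le> C0"
    have VE: "\<mu> \<in> VE" and VM: "\<mu> \<in> VM" using \<mu> by (auto simp: adm_iff VE_iff)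
    note fin = component_finite[OF \<mu> i]
    have "measure (\<mu> i) (-K) \<le> d * sqrt (bil (\<mu> i) (\<mu> i))"
      by (rule K(2)[OF component_Eplus(1)[OF VE iI] fin VM_null[OF VM iI]])
    also have "\<dots> \<le> d * sqrt C0" using component_Eplus(2)[OF VE iI] Q d by (intro mult_left_mono) auto
    finally have m: "measure (\<mu> i) (-K) \<le> d * sqrt C0" .
    have "emeasure (\<mu> i) (-K) < \<top>"
      using emeasure_space[of "\<mu> i" "-K"] fin radon_space[OF VM_radon[OF VM iI]] by (auto intro: le_less_trans)
    then have em: "emeasure (\<mu> i) (-K) \<le> ennreal (d * sqrt C0)"
      using m by (simp add: emeasure_eq_ennreal_measure ennreal_leI)
    have "(\<integral>\<^sup>+x. gl i x * indicator (-K) x \<partial>\<mu> i) \<le> ennreal L * emeasure (\<mu> i) (-K) + ennreal (e/2)"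
      by (rule L(2)[OF \<mu> Q Kb])
    also have "\<dots> \<le> ennreal L * ennreal (d * sqrt C0) + ennreal (e/2)" by (intro add_mono mult_left_mono em) auto
    also have "\<dots> = ennreal (L * (d * sqrt C0) + e/2)" using L d C0 e by (simp add: ennreal_mult[symmetric] ennreal_plus[symmetric] del: ennreal_plus)
    also have "\<dots> \<le> ennreal e"
    proof (rule ennreal_leI)
      have "L * (d * sqrt C0) = (L * sqrt C0) * d" by simp
      also have "\<dots> \<le> e / 2" unfolding d_def using LC e by (simp add: field_simps)
      finally show "L * (d * sqrt C0) + e/2 \<le> e" by simp
    qed
    finally show "(\<integral>\<^sup>+x. gl i x * indicator (-K) x \<partial>\<mu> i) \<le> ennreal e" .
  qed
qed

text \<open>Lower semicontinuity of \<open>gl i\<close> gives one inequality. For the other, lower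
  semicontinuity is applied to the complementary function \<open>f\<close>: the integrals of
  \<open>f + u\<close>, a multiple of a test function on the plate, converge, so the integral of
  \<open>u\<close> cannot drop in the limit beyond the error from the tail.\<close>

lemma constraint_limit:
  assumes i: "i \<in> J" and U: "U \<noteq> bot" and ev: "eventually (\<lambda>\<mu>. \<mu> \<in> ADM) U"
    and evQ: "eventually (\<lambda>\<mu>. Q \<mu> \<le> C0) U" and C0: "C0 \<ge> 0"
    and v: "vlim U (\<lambda>\<mu>. \<mu> i) \<nu>" and \<nu>: "radon \<nu>" "emeasure \<nu> (- A i) = 0"
  shows "(\<integral>\<^sup>+x. gl i x \<partial>\<nu>) = ennreal (a i)"
proof (rule antisym)
  have iI: "i \<in> I" using i J_sub by auto
  have evr: "eventually (\<lambda>\<mu>. radon (\<mu> i)) U"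
    using ev by eventually_elim (auto simp: adm_iff VE_iff intro: VM_radon[OF _ iI])
  show "(\<integral>\<^sup>+x. gl i x \<partial>\<nu>) \<le> ennreal (a i)"
  proof (rule vlim_lsc_le[OF lc U v \<nu>(1) evr gl_lsc[OF iI]])
    show "eventually (\<lambda>\<mu>. (\<integral>\<^sup>+x. gl i x \<partial>\<mu> i) \<le> ennreal (a i)) U"
      using ev by eventually_elim (use i in \<open>auto simp: adm_iff\<close>)
  qed
  show "ennreal (a i) \<le> (\<integral>\<^sup>+x. gl i x \<partial>\<nu>)"
  proof (rule ennreal_le_epsilon)
    fix e :: real assume e: "e > 0"
    obtain K where K: "compact K" "\<And>\<mu>. \<mu> \<in> ADM \<Longrightarrow> Q \<mu> \<le> C0 \<Longrightarrow> (\<integral>\<^sup>+x. gl i x * indicator (-K) x \<partial>\<mu> i) \<le> ennreal (e/2)"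
      using tail_weight[OF i, of "e/2" C0] e C0 by auto
    obtain \<eta> L where \<eta>: "\<eta> \<in> Ccp" "\<And>x. \<eta> x \<le> 1" "\<And>x. x \<in> K \<Longrightarrow> \<eta> x = 1" "compact L" "\<And>x. x \<notin> L \<Longrightarrow> \<eta> x = 0"
      using Urysohn_Cc[OF lc K(1) open_UNIV subset_UNIV] by metis
    have \<eta>0: "\<eta> x \<ge> 0" for x using \<eta>(1) by (rule Ccp_nonneg)
    have gpos: "g x > 0" if "x \<in> A i" for x using g_inf that iI by force
    have "compact (g ` (L \<inter> A i))"
      using \<eta>(4) A_closed[OF iI] g_cont_A[OF iI] by (intro compact_continuous_image compact_Int_closed) (auto intro: continuous_on_subset)
    then have "bounded (g ` (L \<inter> A i))" by (rule compact_imp_bounded)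
    then obtain D where D: "D > 0" "\<And>x. x \<in> L \<Longrightarrow> x \<in> A i \<Longrightarrow> \<bar>g x\<bar> \<le> D"
      unfolding bounded_pos by auto
    \<comment> \<open>On the plate \<open>f = D * \<eta> - u\<close>, nonnegative because
      \<open>D\<close> bounds \<open>g\<close> on the support of \<open>\<eta>\<close>. Off the
      plate it jumps up to \<open>\<eta> x * D\<close>, which keeps it lower semicontinuous although
      \<open>g\<close> is only given on the plate.\<close>
    define f where "f x = (if x \<in> A i then \<eta> x * (D - g x) else \<eta> x * D)" for x
    define u where "u x = \<eta> x * (indicator (A i) x *\<^sub>R g x)" for x
    have f0: "f x \<ge> 0" for x
      using \<eta>0[of x] \<eta>(5)[of x] D(1) D(2)[of x] by (cases "x \<in> L") (auto simp: f_def intro!: mult_nonneg_nonneg)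
    have u0: "u x \<ge> 0" for x using \<eta>0[of x] gpos[of x] by (auto simp: u_def indicator_def)
    have fu: "f x + u x = D * \<eta> x" if "x \<in> A i" for x using that by (simp add: f_def u_def algebra_simps)
    have \<eta>c: "continuous_on UNIV \<eta>" using \<eta>(1) by (rule Ccp_cont)
    have lscf: "lsc (\<lambda>x. ennreal (f x))"
      unfolding lsc_def
    proof
      fix t :: ennreal
      have c0: "closed {y::real. ennreal y \<le> t}" by (intro closed_Collect_le continuous_on_ennreal continuous_intros)
      have "continuous_on (A i) (\<lambda>x. \<eta> x * (D - g x))"
        by (intro continuous_intros g_cont_A[OF iI] continuous_on_subset[OF \<eta>c]) auto
      then have c1: "closed ((\<lambda>x. \<eta> x * (D - g x)) -` {y. ennreal y \<le> t} \<inter> A i)"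
        using c0 continuous_on_closed_vimage[OF A_closed[OF iI]] by blast
      have "continuous_on UNIV (\<lambda>x. \<eta> x * D)" by (intro continuous_intros \<eta>c)
      then have c2: "closed ((\<lambda>x. \<eta> x * D) -` {y. ennreal y \<le> t})" using c0 closed_vimage by blast
      have "{x. ennreal (f x) \<le> t} = ((\<lambda>x. \<eta> x * (D - g x)) -` {y. ennreal y \<le> t} \<inter> A i) \<union> ((\<lambda>x. \<eta> x * D) -` {y. ennreal y \<le> t})"
      proof -
        have "ennreal (\<eta> x * (D - g x)) \<le> t" if "x \<in> A i" "ennreal (\<eta> x * D) \<le> t" for x
        proof -
          have "\<eta> x * (D - g x) \<le> \<eta> x * D" using \<eta>0[of x] gpos[OF that(1)] by (intro mult_left_mono) auto
          then show ?thesis using that(2) by (meson ennreal_leI order_trans)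
        qed
        then show ?thesis by (auto simp: f_def)
      qed
      then have "closed {x. ennreal (f x) \<le> t}" using c1 c2 by auto
      moreover have "{x. t < ennreal (f x)} = - {x. ennreal (f x) \<le> t}" by auto
      ultimately show "open {x. t < ennreal (f x)}" by (simp add: open_Compl)
    qed
    have um: "(\<lambda>x. ennreal (u x)) \<in> borel_measurable borel"
    proof -
      have "(\<lambda>x. indicator (A i) x *\<^sub>R g x) \<in> borel_measurable borel"
        using A_closed[OF iI] by (intro borel_measurable_continuous_on_indicator g_cont_A[OF iI]) auto
      then show ?thesis unfolding u_def using Ccp_measurable[OF \<eta>(1)] by measurable
    qed
    have sum_eq: "(\<integral>\<^sup>+x. ennreal (f x) \<partial>M) + (\<integral>\<^sup>+x. ennreal (u x) \<partial>M) = ennreal (D * integral\<^sup>L M \<eta>)"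
      if M: "radon M" "emeasure M (- A i) = 0" for M
    proof -
      have sM: "sets M = sets borel" using M by (simp add: radon_sets)
      have "- A i \<in> null_sets M" using M A_closed[OF iI] by (auto simp: null_sets_def radon_sets)
      then have AE: "AE x in M. x \<in> A i" by (rule AE_I') auto
      have "(\<integral>\<^sup>+x. ennreal (f x) \<partial>M) + (\<integral>\<^sup>+x. ennreal (u x) \<partial>M) = (\<integral>\<^sup>+x. ennreal (f x) + ennreal (u x) \<partial>M)"
        using lsc_measurable[OF lscf] um by (intro nn_integral_add[symmetric]) (auto simp: measurable_cong_sets[OF sM refl])
      also have "\<dots> = (\<integral>\<^sup>+x. ennreal (D * \<eta> x) \<partial>M)"
        using AE by (intro nn_integral_cong_AE, eventually_elim) (simp add: fu[symmetric] f0 u0 ennreal_plus)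
      also have "\<dots> = ennreal (integral\<^sup>L M (\<lambda>x. D * \<eta> x))"
        using D by (intro radon_nn_integral M Ccp_scale \<eta>) auto
      finally show ?thesis by simp
    qed
    define I0 where "I0 = integral\<^sup>L \<nu> \<eta>"
    have "((\<lambda>\<mu>. D * integral\<^sup>L (\<mu> i) \<eta>) \<longlongrightarrow> D * I0) U" unfolding I0_def by (intro tendsto_intros vlimD[OF v] \<eta>)
    then have evI: "eventually (\<lambda>\<mu>. D * integral\<^sup>L (\<mu> i) \<eta> < D * I0 + e/2) U" using e by (intro order_tendstoD) auto
    have I00: "D * I0 \<ge> 0" unfolding I0_def using D integral_nonneg_Ccp[OF \<eta>(1), of \<nu>] by simp
    \<comment> \<open>\<open>u\<close> coincides with the weight on \<open>K\<close>, so the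
      constraint loses at most \<open>e/2\<close> to the tail; the other \<open>e/2\<close> comes
      from the convergence of the integrals of \<open>\<eta>\<close>.\<close>
    have key: "eventually (\<lambda>\<mu>. (\<integral>\<^sup>+x. ennreal (f x) \<partial>\<mu> i) + ennreal (a i) \<le> ennreal (D * I0 + e)) U"
      using ev evQ evI
    proof eventually_elim
      case (elim \<mu>)
      have VM: "\<mu> \<in> VM" using elim by (auto simp: adm_iff VE_iff)
      note ri = VM_radon[OF VM iI]
      have sm: "sets (\<mu> i) = sets borel" using ri by (rule radon_sets)
      have "ennreal (a i) = (\<integral>\<^sup>+x. gl i x \<partial>\<mu> i)" using elim i by (auto simp: adm_iff)
      also have "\<dots> = (\<integral>\<^sup>+x. gl i x * indicator K x + gl i x * indicator (-K) x \<partial>\<mu> i)"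
        by (intro nn_integral_cong) (auto simp: indicator_def)
      also have "\<dots> = (\<integral>\<^sup>+x. gl i x * indicator K x \<partial>\<mu> i) + (\<integral>\<^sup>+x. gl i x * indicator (-K) x \<partial>\<mu> i)"
        using lsc_measurable[OF gl_lsc[OF iI]] K(1) by (intro nn_integral_add) (auto simp: measurable_cong_sets[OF sm refl] compact_imp_closed)
      also have "\<dots> \<le> (\<integral>\<^sup>+x. ennreal (u x) \<partial>\<mu> i) + ennreal (e/2)"
      proof (intro add_mono K(2) elim)
        show "(\<integral>\<^sup>+x. gl i x * indicator K x \<partial>\<mu> i) \<le> (\<integral>\<^sup>+x. ennreal (u x) \<partial>\<mu> i)"
        proof (rule nn_integral_mono_AE)
          show "AE x in \<mu> i. gl i x * indicator K x \<le> ennreal (u x)"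
            using AE_component[OF VM iI] by eventually_elim (auto simp: gl_def u_def indicator_def \<eta>(3))
        qed
      qed
      finally have "(\<integral>\<^sup>+x. ennreal (f x) \<partial>\<mu> i) + ennreal (a i) \<le> (\<integral>\<^sup>+x. ennreal (f x) \<partial>\<mu> i) + ((\<integral>\<^sup>+x. ennreal (u x) \<partial>\<mu> i) + ennreal (e/2))"
        by (rule add_left_mono)
      also have "\<dots> = ennreal (D * integral\<^sup>L (\<mu> i) \<eta>) + ennreal (e/2)"
        using sum_eq[OF ri VM_null[OF VM iI]] by (simp add: add.assoc[symmetric])
      also have "\<dots> \<le> ennreal (D * I0 + e/2) + ennreal (e/2)" using elim by (intro add_mono ennreal_leI) auto
      also have "\<dots> = ennreal (D * I0 + e)" using I00 e by (simp flip: ennreal_plus)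
      finally show ?case .
    qed
    \<comment> \<open>A single measure of the filter shows \<open>a i \<le> D * I0 + e\<close>, so
      that the subtraction below is one of nonnegative reals.\<close>
    obtain \<mu>0 where "(\<integral>\<^sup>+x. ennreal (f x) \<partial>\<mu>0 i) + ennreal (a i) \<le> ennreal (D * I0 + e)"
      using eventually_happens[OF key] U by blast
    then have "ennreal (a i) \<le> ennreal (D * I0 + e)" by (meson add_increasing order_trans zero_le order_refl le_add2)
    then have age: "a i \<le> D * I0 + e" using I00 e by (subst (asm) ennreal_le_iff) auto
    have "(\<integral>\<^sup>+x. ennreal (f x) \<partial>\<nu>) \<le> ennreal (D * I0 + e - a i)"
    proof (rule vlim_lsc_le[OF lc U v \<nu>(1) evr lscf])
      show "eventually (\<lambda>\<mu>. (\<integral>\<^sup>+x. ennreal (f x) \<partial>\<mu> i) \<le> ennreal (D * I0 + e - a i)) U"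
        using key
      proof eventually_elim
        case (elim \<mu>)
        then have "ennreal (a i) + (\<integral>\<^sup>+x. ennreal (f x) \<partial>\<mu> i) \<le> ennreal (a i) + ennreal (D * I0 + e - a i)"
          using age a_pos[OF iI] by (simp add: add.commute flip: ennreal_plus)
        then show ?case by (subst (asm) ennreal_add_left_cancel_le) auto
      qed
    qed
    then obtain y where y: "(\<integral>\<^sup>+x. ennreal (f x) \<partial>\<nu>) = ennreal y" "y \<ge> 0" "y \<le> D * I0 + e - a i"
      using age by (cases "\<integral>\<^sup>+x. ennreal (f x) \<partial>\<nu>") (auto simp: ennreal_le_iff top_unique)
    have "ennreal y + ennreal (a i) \<le> ennreal (D * I0 + e)"
      using y a_pos[OF iI] by (simp add: ennreal_leI flip: ennreal_plus)
    also have "\<dots> = ennreal y + ((\<integral>\<^sup>+x. ennreal (u x) \<partial>\<nu>) + ennreal e)"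
      using sum_eq[OF \<nu>] I00 e unfolding y I0_def[symmetric] by (simp add: add.assoc[symmetric] ennreal_plus)
    finally have "ennreal (a i) \<le> (\<integral>\<^sup>+x. ennreal (u x) \<partial>\<nu>) + ennreal e"
      by (subst (asm) ennreal_add_left_cancel_le) auto
    also have "\<dots> \<le> (\<integral>\<^sup>+x. gl i x \<partial>\<nu>) + ennreal e"
    proof (intro add_mono nn_integral_mono order_refl)
      fix x
      show "ennreal (u x) \<le> gl i x"
        using \<eta>0[of x] \<eta>(2)[of x] gpos[of x] by (auto simp: u_def gl_def indicator_def intro!: ennreal_leI mult_left_le_one_le)
    qed
    finally show "ennreal (a i) \<le> (\<integral>\<^sup>+x. gl i x \<partial>\<nu>) + ennreal e" .
  qed
qed

text \<open>The common core of existence and compactness. Both parts are required to be Cauchy,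
  since \<open>consistent\<close> concerns positive measures; then \<open>G\<close>, being a
  polynomial in mutual energies of the parts with each other and with \<open>\<chi>\<close>,
  converges as well.\<close>

lemma admissible_limit:
  assumes U: "ultra U" and ev: "eventually (\<lambda>\<mu>. \<mu> \<in> ADM) U" and evQ: "eventually (\<lambda>\<mu>. Q \<mu> \<le> C0) U"
    and cP: "\<And>e. e > 0 \<Longrightarrow> \<exists>T. eventually T U \<and> (\<forall>\<mu> \<nu>. T \<mu> \<longrightarrow> T \<nu> \<longrightarrow> sdist \<kappa> (Rp \<mu>) (Rp \<nu>) < e)"
    and cN: "\<And>e. e > 0 \<Longrightarrow> \<exists>T. eventually T U \<and> (\<forall>\<mu> \<nu>. T \<mu> \<longrightarrow> T \<nu> \<longrightarrow> sdist \<kappa> (Rn \<mu>) (Rn \<nu>) < e)"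
  obtains lam where "lam \<in> ADM" "\<And>i. i \<in> I \<Longrightarrow> vlim U (\<lambda>\<mu>. \<mu> i) (lam i)" "(G \<longlongrightarrow> G lam) U"
proof -
  have Unb: "U \<noteq> bot" using U by (rule ultra_not_bot)
  have evVE: "eventually (\<lambda>\<mu>. \<mu> \<in> VE) U" using ev by eventually_elim (simp add: adm_iff)
  have evVM: "eventually (\<lambda>\<mu>. \<mu> \<in> VM) U" using evVE by eventually_elim (simp add: VE_iff)
  obtain \<mu>0 where "Q \<mu>0 \<le> C0" using eventually_happens[OF evQ] Unb by blast
  moreover have "Q \<mu>0 \<ge> 0" by (simp add: Q_def)
  ultimately have C0: "C0 \<ge> 0" by linarith
  have "\<exists>\<nu>. radon \<nu> \<and> vlim U (\<lambda>\<mu>. \<mu> i) \<nu>" if i: "i \<in> I" for i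
  proof -
    have r: "eventually (\<lambda>\<mu>. radon (\<mu> i)) U" using evVM by eventually_elim (rule VM_radon[OF _ i])
    have b: "\<exists>C. eventually (\<lambda>\<mu>. measure (\<mu> i) K \<le> C) U" if K: "compact K" for K
    proof -
      obtain C where C: "\<And>\<nu>. \<nu> \<in> Eplus \<kappa> \<Longrightarrow> measure \<nu> K \<le> C * sqrt (bil \<nu> \<nu>)" using compact_mass_bound[OF K] by blast
      have "eventually (\<lambda>\<mu>. measure (\<mu> i) K \<le> \<bar>C\<bar> * sqrt C0) U"
        using evVE evQ
      proof eventually_elim
        case (elim \<mu>)
        have "measure (\<mu> i) K \<le> C * sqrt (bil (\<mu> i) (\<mu> i))" by (rule C[OF component_Eplus(1)[OF elim(1) i]])
        also have "\<dots> \<le> \<bar>C\<bar> * sqrt (bil (\<mu> i) (\<mu> i))" by (intro mult_right_mono) auto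
        also have "\<dots> \<le> \<bar>C\<bar> * sqrt C0" using component_Eplus(2)[OF elim(1) i] elim(2) by (intro mult_left_mono) auto
        finally show ?case .
      qed
      then show ?thesis by blast
    qed
    show ?thesis using vlim_exists[OF lc U r b] by metis
  qed
  then obtain l where l: "\<And>i. i \<in> I \<Longrightarrow> radon (l i)" "\<And>i. i \<in> I \<Longrightarrow> vlim U (\<lambda>\<mu>. \<mu> i) (l i)" by metis
  \<comment> \<open>\<open>vec_measures\<close> prescribes the zero measure off the index
    set.\<close>
  define lam where "lam i = (if i \<in> I then l i else null_measure borel)" for i
  have lr: "radon (lam i)" and lv: "vlim U (\<lambda>\<mu>. \<mu> i) (lam i)" if "i \<in> I" for i
    using l[OF that] that by (auto simp: lam_def)
  have lnull: "emeasure (lam i) (- A i) = 0" if i: "i \<in> I" for i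
  proof -
    have o: "open (- A i)" using A_closed[OF i] by auto
    have r: "eventually (\<lambda>\<mu>. radon (\<mu> i)) U" using evVM by eventually_elim (rule VM_radon[OF _ i])
    \<comment> \<open>The complement of a closed plate is open, so vanishing on it survives vague
      limits.\<close>
    have "(\<integral>\<^sup>+x. indicator (- A i) x \<partial>lam i) \<le> 0"
    proof (rule vlim_lsc_le[OF lc Unb lv[OF i] lr[OF i] r lsc_indicator[OF o]])
      show "eventually (\<lambda>\<mu>. (\<integral>\<^sup>+x. indicator (- A i) x \<partial>\<mu> i) \<le> 0) U"
        using evVM by eventually_elim (use o VM_null[OF _ i] VM_radon[OF _ i] in \<open>simp add: radon_sets\<close>)
    qed
    then show ?thesis using o lr[OF i] by (simp add: radon_sets)
  qed
  have lVM: "lam \<in> VM" using lr lnull by (intro VM_I) (auto simp: lam_def)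
  have vP: "vlim U Rp (Rp lam)" and vN: "vlim U Rn (Rn lam)"
    unfolding Rp_def[abs_def] Rn_def[abs_def] by (auto intro!: vlim_rsum[OF evVM lVM _ lv])
  have eP: "eventually (\<lambda>\<mu>. Rp \<mu> \<in> Eplus \<kappa>) U" and eN: "eventually (\<lambda>\<mu>. Rn \<mu> \<in> Eplus \<kappa>) U"
    using evVE by (eventually_elim, simp add: VE_iff)+
  note P = consistentD[OF Unb eP cP Rp_radon[OF lVM] vP]
  note N = consistentD[OF Unb eN cN Rn_radon[OF lVM] vN]
  have lVE: "lam \<in> VE" using lVM P(1) N(1) by (simp add: VE_iff)
  have "(\<integral>\<^sup>+x. gl i x \<partial>lam i) = ennreal (a i)" if i: "i \<in> J" for i
  proof -
    have iI: "i \<in> I" using i J_sub by auto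
    show ?thesis by (rule constraint_limit[OF i Unb ev evQ C0 lv[OF iI] lr[OF iI] lnull[OF iI]])
  qed
  then have lADM: "lam \<in> ADM" using lVE by (simp add: adm_iff)
  have "((\<lambda>\<mu>. Gform (Rp \<mu>) (Rn \<mu>)) \<longlongrightarrow> Gform (Rp lam) (Rn lam)) U"
    unfolding Gform_def
    by (intro tendsto_intros energy_tendsto[OF eP P] energy_tendsto[OF eN N] bil_tendsto2[OF eP P eN N]
        bil_tendsto[OF eP P(1) chi_Eplus(1) P(2)] bil_tendsto[OF eP P(1) chi_Eplus(2) P(2)]
        bil_tendsto[OF eN N(1) chi_Eplus(1) N(2)] bil_tendsto[OF eN N(1) chi_Eplus(2) N(2)])
  then have "((\<lambda>\<mu>. Gform (Rp \<mu>) (Rn \<mu>)) \<longlongrightarrow> G lam) U" by (simp add: Gchi_eq[OF lVE])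
  moreover have "eventually (\<lambda>\<mu>. Gform (Rp \<mu>) (Rn \<mu>) = G \<mu>) U"
    using evVE by eventually_elim (simp add: Gchi_eq)
  ultimately have "(G \<longlongrightarrow> G lam) U" by (rule Lim_transform_eventually)
  then show ?thesis using that lADM lv by blast
qed

section \<open>Existence and vague compactness of the solutions\<close>

lemma sdist_less_of_sq:
  assumes "\<mu> \<in> Eplus \<kappa>" "\<nu> \<in> Eplus \<kappa>" "(sdist \<kappa> \<mu> \<nu>)\<^sup>2 < e\<^sup>2" "e > 0"
  shows "sdist \<kappa> \<mu> \<nu> < e"
  using assms by (intro power_less_imp_less_base[of "sdist \<kappa> \<mu> \<nu>" 2 e]) auto

definition Gmin :: real where "Gmin = Inf (G ` ADM)"

lemma Gmin_le: "\<mu> \<in> ADM \<Longrightarrow> Gmin \<le> G \<mu>"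
  unfolding Gmin_def
proof (rule cInf_lower)
  show "bdd_below (G ` ADM)"
    using G_lower by (intro bdd_belowI[of _ "- (sdist \<kappa> chip chin)\<^sup>2"]) (auto simp: adm_iff)
qed auto

lemma Ginf_eq:
  assumes ne: "ADM \<noteq> {}"
  shows "Ginf \<kappa> Ipos Ineg A a g chi J = ereal Gmin"
proof (rule antisym)
  show "ereal Gmin \<le> Ginf \<kappa> Ipos Ineg A a g chi J"
    unfolding Ginf_def by (rule INF_greatest) (simp add: Gmin_le)
  show "Ginf \<kappa> Ipos Ineg A a g chi J \<le> ereal Gmin"
  proof (rule ereal_le_epsilon2)
    fix e :: real assume "e > 0"
    then have "Inf (G ` ADM) < Gmin + e" by (simp add: Gmin_def)
    then obtain \<mu> where \<mu>: "\<mu> \<in> ADM" "G \<mu> < Gmin + e" using cInf_lessD[of "G ` ADM"] ne by auto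
    have "Ginf \<kappa> Ipos Ineg A a g chi J \<le> ereal (G \<mu>)" unfolding Ginf_def using \<mu>(1) by (rule INF_lower)
    also have "\<dots> \<le> ereal Gmin + ereal e" using \<mu>(2) by simp
    finally show "Ginf \<kappa> Ipos Ineg A a g chi J \<le> ereal Gmin + ereal e" .
  qed
qed

lemma minimizer_exists:
  assumes ne: "ADM \<noteq> {}"
  shows "\<exists>lam\<in>ADM. G lam = Gmin"
proof -
  obtain D where D: "\<And>\<mu>. \<mu> \<in> ADM \<Longrightarrow> Q \<mu> \<le> 4 * G \<mu> + D" using Q_bound by blast
  \<comment> \<open>These sets are nested and, by convexity of \<open>G\<close>, closed under
    midpoints; minimizing \<open>Q\<close> over them yields a filter that is minimizing for
    \<open>G\<close> and Cauchy in both parts.\<close>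
  define S where "S n = {\<mu>\<in>ADM. G \<mu> \<le> Gmin + 1 / real (Suc n)}" for n
  define C where "C = 4 * (Gmin + 1) + D"
  have SQ: "Q \<mu> \<le> C" if "\<mu> \<in> S n" for \<mu> n
  proof -
    have "1 / real (Suc n) \<le> 1" by simp
    then have "G \<mu> \<le> Gmin + 1" using that unfolding S_def by (smt (verit) mem_Collect_eq)
    then show ?thesis using D[of \<mu>] that by (auto simp: S_def C_def)
  qed
  have Sne: "\<exists>\<mu>. \<mu> \<in> S n" for n
  proof -
    have "Inf (G ` ADM) < Gmin + 1 / real (Suc n)" by (simp add: Gmin_def)
    then obtain \<mu> where "\<mu> \<in> ADM" "G \<mu> < Gmin + 1 / real (Suc n)" using cInf_lessD[of "G ` ADM"] ne by auto
    then show ?thesis by (auto simp: S_def)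
  qed
  define Df where "Df \<mu> \<nu> = (sdist \<kappa> (Rp \<mu>) (Rp \<nu>))\<^sup>2 + (sdist \<kappa> (Rn \<mu>) (Rn \<nu>))\<^sup>2" for \<mu> \<nu>
  obtain F where F: "F \<noteq> bot" "\<And>n. eventually (\<lambda>\<mu>. \<mu> \<in> S n) F"
    "\<And>e. e > 0 \<Longrightarrow> \<exists>T. eventually T F \<and> (\<forall>\<mu> \<nu>. T \<mu> \<longrightarrow> T \<nu> \<longrightarrow> Df \<mu> \<nu> < e)"
  proof (rule minimizing_filter[of S vmid Df Q C])
    show "\<exists>m. S m \<subseteq> S k \<inter> S l" for k l
    proof -
      have "1 / real (Suc (max k l)) \<le> 1 / real (Suc k)" "1 / real (Suc (max k l)) \<le> 1 / real (Suc l)"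
        by (auto intro!: divide_left_mono)
      then show ?thesis by (intro exI[of _ "max k l"]) (force simp: S_def)
    qed
    show "vmid x y \<in> S k" if "x \<in> S k" "y \<in> S k" for k x y
    proof -
      have xy: "x \<in> ADM" "y \<in> ADM" "x \<in> VE" "y \<in> VE" using that by (auto simp: S_def adm_iff)
      have "G (vmid x y) \<le> (G x + G y) / 2" 
      proof -
        have "0 \<le> (sdist \<kappa> (radd (Rp x) (Rn y)) (radd (Rp y) (Rn x)))\<^sup>2 / 4" by simp
        then show ?thesis unfolding G_vmid[OF xy(3,4)] by linarith
      qed
      then show ?thesis using that vmid_ADM[OF xy(1,2)] by (auto simp: S_def)
    qed
    show "Df x y \<le> 2 * Q x + 2 * Q y - 4 * Q (vmid x y)" if "x \<in> S k" "y \<in> S k" for k x y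
    proof -
      have VM: "x \<in> VM" "y \<in> VM" and E: "Rp x \<in> Eplus \<kappa>" "Rp y \<in> Eplus \<kappa>" "Rn x \<in> Eplus \<kappa>" "Rn y \<in> Eplus \<kappa>"
        using that by (auto simp: S_def adm_iff VE_iff)
      show ?thesis unfolding Df_def Q_def Rp_vmid[OF VM] Rn_vmid[OF VM] sdist_sq_rmid[OF E(1,2)] sdist_sq_rmid[OF E(3,4)] by simp
    qed
    show "\<exists>x\<in>S k. Q x \<le> C" for k using Sne[of k] SQ by blast
    show "0 \<le> Q x" for x by (simp add: Q_def)
  qed blast
  obtain U where U: "ultra U" "U \<le> F" using ultra_exists[OF F(1)] by blast
  have evS: "eventually (\<lambda>\<mu>. \<mu> \<in> S n) U" for n using filter_leD[OF U(2) F(2)] .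
  have ev: "eventually (\<lambda>\<mu>. \<mu> \<in> ADM) U" using evS[of 0] by eventually_elim (simp add: S_def)
  have evQ: "eventually (\<lambda>\<mu>. Q \<mu> \<le> C) U" using evS[of 0] by eventually_elim (rule SQ)
  have cauchy: "\<exists>T. eventually T U \<and> (\<forall>\<mu> \<nu>. T \<mu> \<longrightarrow> T \<nu> \<longrightarrow> sdist \<kappa> (Rp \<mu>) (Rp \<nu>) < e \<and> sdist \<kappa> (Rn \<mu>) (Rn \<nu>) < e)"
    if e: "e > 0" for e
  proof -
    obtain T where T: "eventually T F" "\<And>\<mu> \<nu>. T \<mu> \<Longrightarrow> T \<nu> \<Longrightarrow> Df \<mu> \<nu> < e\<^sup>2" using F(3)[of "e\<^sup>2"] e by auto
    show ?thesis
    proof (intro exI[of _ "\<lambda>\<mu>. T \<mu> \<and> \<mu> \<in> ADM"] conjI allI impI)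
      show "eventually (\<lambda>\<mu>. T \<mu> \<and> \<mu> \<in> ADM) U" using filter_leD[OF U(2) T(1)] ev by (rule eventually_conj)
      fix \<mu> \<nu> assume "T \<mu> \<and> \<mu> \<in> ADM" "T \<nu> \<and> \<nu> \<in> ADM"
      then have d: "Df \<mu> \<nu> < e\<^sup>2" and E: "Rp \<mu> \<in> Eplus \<kappa>" "Rp \<nu> \<in> Eplus \<kappa>" "Rn \<mu> \<in> Eplus \<kappa>" "Rn \<nu> \<in> Eplus \<kappa>"
        using T(2) by (auto simp: adm_iff VE_iff)
      have "(sdist \<kappa> (Rp \<mu>) (Rp \<nu>))\<^sup>2 < e\<^sup>2" "(sdist \<kappa> (Rn \<mu>) (Rn \<nu>))\<^sup>2 < e\<^sup>2"
        using d unfolding Df_def by (smt (verit) zero_le_power2)+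
      then show "sdist \<kappa> (Rp \<mu>) (Rp \<nu>) < e" "sdist \<kappa> (Rn \<mu>) (Rn \<nu>) < e"
        using sdist_less_of_sq E e by blast+
    qed
  qed
  obtain lam where lam: "lam \<in> ADM" "(G \<longlongrightarrow> G lam) U"
  proof (rule admissible_limit[OF U(1) ev evQ])
    show "\<exists>T. eventually T U \<and> (\<forall>\<mu> \<nu>. T \<mu> \<longrightarrow> T \<nu> \<longrightarrow> sdist \<kappa> (Rp \<mu>) (Rp \<nu>) < e)" if "e > 0" for e
      using cauchy[OF that] by blast
    show "\<exists>T. eventually T U \<and> (\<forall>\<mu> \<nu>. T \<mu> \<longrightarrow> T \<nu> \<longrightarrow> sdist \<kappa> (Rn \<mu>) (Rn \<nu>) < e)" if "e > 0" for e
      using cauchy[OF that] by blast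
  qed blast
  have "G lam \<le> Gmin + 1 / real (Suc n)" for n
    using lam(2) by (rule tendsto_upperbound) (use evS[of n] ultra_not_bot[OF U(1)] in \<open>auto simp: S_def elim: eventually_mono\<close>)
  then have "G lam - Gmin \<le> 1 / real (Suc n)" for n by (simp add: algebra_simps)
  then have "G lam - Gmin \<le> 0" using nat_approx_posE[of "G lam - Gmin"] by (metis not_le)
  then show ?thesis using lam(1) Gmin_le[OF lam(1)] by (intro bexI[of _ lam]) auto
qed

text \<open>By strict convexity of the Gauss functional in the signed measure \<open>R\<mu>\<close>, and since the plates of
  opposite sign are disjoint, all solutions share the same positive and negative parts.\<close>
lemma minimizers_same_parts:
  assumes \<mu>: "\<mu> \<in> ADM" "G \<mu> = Gmin" and \<nu>: "\<nu> \<in> ADM" "G \<nu> = Gmin"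
  shows "Rp \<mu> = Rp \<nu>" "Rn \<mu> = Rn \<nu>"
proof -
  have VE: "\<mu> \<in> VE" "\<nu> \<in> VE" using \<mu> \<nu> by (auto simp: adm_iff)
  have VM: "\<mu> \<in> VM" "\<nu> \<in> VM" and E: "Rp \<mu> \<in> Eplus \<kappa>" "Rn \<mu> \<in> Eplus \<kappa>" "Rp \<nu> \<in> Eplus \<kappa>" "Rn \<nu> \<in> Eplus \<kappa>"
    using VE by (auto simp: VE_iff)
  note r = Rp_radon[OF VM(1)] Rn_radon[OF VM(1)] Rp_radon[OF VM(2)] Rn_radon[OF VM(2)]
  \<comment> \<open>The midpoint is admissible and cannot beat the minimum, so the quadratic defect
    in \<open>G_vmid\<close> vanishes.\<close>
  have "Gmin \<le> G (vmid \<mu> \<nu>)" by (rule Gmin_le[OF vmid_ADM[OF \<mu>(1) \<nu>(1)]])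
  then have "(sdist \<kappa> (radd (Rp \<mu>) (Rn \<nu>)) (radd (Rp \<nu>) (Rn \<mu>)))\<^sup>2 \<le> 0" unfolding G_vmid[OF VE] \<mu>(2) \<nu>(2) by simp
  then have eq: "radd (Rp \<mu>) (Rn \<nu>) = radd (Rp \<nu>) (Rn \<mu>)"
    by (intro sdist_eq_0 radd_Eplus E) simp
  have em: "emeasure (Rp \<mu>) B + emeasure (Rn \<nu>) B = emeasure (Rp \<nu>) B + emeasure (Rn \<mu>) B" if "B \<in> sets borel" for B
    using radd_emeasure[OF lc r(1) r(4) that] radd_emeasure[OF lc r(3) r(2) that] eq by simp
  have disj: "Apos \<inter> Aneg = {}" using A_sep by blast
  have z: "emeasure M B = 0" if "radon M" "emeasure M (- S) = 0" "B \<subseteq> - S" "closed S" for M B and S :: "'a set"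
  proof -
    have "emeasure M B \<le> emeasure M (- S)" using that by (intro emeasure_mono) (auto simp: radon_sets)
    then show ?thesis using that by simp
  qed
  have dec: "emeasure M V = emeasure M (V - T)" if M: "radon M" "emeasure M (- S) = 0" and S: "S \<inter> T = {}" "closed S" "closed T"
      and V: "open V" for M V and S T :: "'a set"
  proof -
    have "emeasure M (V \<inter> T) = 0" using S by (intro z[OF M _ S(2)]) auto
    moreover have "emeasure M V \<le> emeasure M (V \<inter> T) + emeasure M (V - T)"
      using emeasure_subadditive[of "V \<inter> T" M "V - T"] S V M(1) by (simp add: Int_Diff_Un radon_sets)
    moreover have "emeasure M (V - T) \<le> emeasure M V" using V M(1) by (intro emeasure_mono) (auto simp: radon_sets)
    ultimately show ?thesis by simp
  qed
  show "Rp \<mu> = Rp \<nu>"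
  proof (rule radon_eq_openI[OF r(1) r(3)])
    fix V :: "'a set" assume V: "open V"
    \<comment> \<open>Off \<open>Aneg\<close> both negative parts vanish, so \<open>em\<close>
      compares the positive parts without subtracting possibly infinite masses; \<open>dec\<close>
      then restores \<open>V\<close>.\<close>
    have Vb: "V - Aneg \<in> sets borel" using V closed_Aneg by auto
    have "emeasure (Rn \<mu>) (V - Aneg) = 0" "emeasure (Rn \<nu>) (V - Aneg) = 0"
      by (auto intro!: z[OF r(2) Rn_null[OF VM(1)] _ closed_Aneg] z[OF r(4) Rn_null[OF VM(2)] _ closed_Aneg])
    then have "emeasure (Rp \<mu>) (V - Aneg) = emeasure (Rp \<nu>) (V - Aneg)" using em[OF Vb] by simp
    then show "emeasure (Rp \<mu>) V = emeasure (Rp \<nu>) V"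
      using dec[OF r(1) Rp_null[OF VM(1)] disj closed_Apos closed_Aneg V]
        dec[OF r(3) Rp_null[OF VM(2)] disj closed_Apos closed_Aneg V] by simp
  qed
  show "Rn \<mu> = Rn \<nu>"
  proof (rule radon_eq_openI[OF r(2) r(4)])
    fix V :: "'a set" assume V: "open V"
    have Vb: "V - Apos \<in> sets borel" using V closed_Apos by auto
    have disj': "Aneg \<inter> Apos = {}" using disj by blast
    have "emeasure (Rp \<mu>) (V - Apos) = 0" "emeasure (Rp \<nu>) (V - Apos) = 0"
      by (auto intro!: z[OF r(1) Rp_null[OF VM(1)] _ closed_Apos] z[OF r(3) Rp_null[OF VM(2)] _ closed_Apos])
    then have "emeasure (Rn \<mu>) (V - Apos) = emeasure (Rn \<nu>) (V - Apos)" using em[OF Vb] by simp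
    then show "emeasure (Rn \<mu>) V = emeasure (Rn \<nu>) V"
      using dec[OF r(2) Rn_null[OF VM(1)] disj' closed_Aneg closed_Apos V]
        dec[OF r(4) Rn_null[OF VM(2)] disj' closed_Aneg closed_Apos V] by simp
  qed
qed

lemma vec_vague_eventually:
  fixes lam :: "'i \<Rightarrow> 'a measure"
  assumes v: "\<And>i. i \<in> I \<Longrightarrow> vlim F (\<lambda>\<mu>. \<mu> i) (lam i)" and W: "openin (vec_vague I) W" "lam \<in> W"
  shows "eventually (\<lambda>\<mu>. \<mu> \<in> W) F"
proof -
  have "generate_topology_on (insert UNIV {{\<mu>::'i \<Rightarrow> 'a measure. integral\<^sup>L (\<mu> i) \<phi> \<in> V} | i \<phi> V. i \<in> I \<and> \<phi> \<in> Cc \<and> open (V::real set)}) W"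
    using W(1) unfolding vec_vague_def by (rule openin_topology_generated_by)
  then show ?thesis using W(2)
  proof (induction rule: generate_topology_on.induct)
    case (Int a b)
    then show ?case by (auto intro: eventually_conj)
  next
    case (UN K)
    then obtain k where "k \<in> K" "lam \<in> k" by blast
    then have "eventually (\<lambda>\<mu>. \<mu> \<in> k) F" using UN by blast
    then show ?case by (rule eventually_mono) (use \<open>k \<in> K\<close> in blast)
  next
    case (Basis s)
    then consider "s = UNIV" | i \<phi> V where "s = {\<mu>. integral\<^sup>L (\<mu> i) \<phi> \<in> V}" "i \<in> I" "\<phi> \<in> Cc" "open V" by auto
    then show ?case
    proof cases
      case (2 i \<phi> V)
      have "((\<lambda>\<mu>. integral\<^sup>L (\<mu> i) \<phi>) \<longlongrightarrow> integral\<^sup>L (lam i) \<phi>) F" using v[OF 2(2)] 2(3) by (simp add: vlim_def)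
      from topological_tendstoD[OF this 2(4)] show ?thesis using Basis 2(1) by simp
    qed auto
  qed auto
qed

text \<open>If no finite subfamily covered the set of solutions, the complements of the cover would
  generate with it a proper filter. An ultrafilter below it converges to a solution, which lies in
  some member of the cover, although the ultrafilter avoids that member.\<close>

lemma minimizers_compact: "compactin (vec_vague I) {lam\<in>ADM. G lam = Gmin}"
  unfolding compactin_def
proof (intro conjI allI impI)
  let ?S = "{lam\<in>ADM. G lam = Gmin}"
  have "topspace (vec_vague I :: ('i \<Rightarrow> 'a measure) topology) = UNIV"
    unfolding vec_vague_def topology_generated_by_topspace by auto
  then show "?S \<subseteq> topspace (vec_vague I)" by simp
  fix \<W> assume W: "Ball \<W> (openin (vec_vague I)) \<and> ?S \<subseteq> \<Union>\<W>"
  show "\<exists>\<F>. finite \<F> \<and> \<F> \<subseteq> \<W> \<and> ?S \<subseteq> \<Union>\<F>"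
  proof (rule ccontr)
    assume neg: "\<not> ?thesis"
    define F where "F = inf (principal ?S) (INF w\<in>\<W>. principal (- w))"
    have "F \<noteq> bot"
    proof
      assume "F = bot"
      then have "eventually (\<lambda>x. x \<notin> ?S) (INF w\<in>\<W>. principal (- w))"
        unfolding F_def trivial_limit_def by (simp add: eventually_inf_principal inf_commute)
      from eventually_INF[THEN iffD1, OF this]
      obtain X where X: "X \<subseteq> \<W>" "finite X" "eventually (\<lambda>x. x \<notin> ?S) (INF w\<in>X. principal (- w))"
        by (elim exE conjE)
      have "(INF w\<in>X. principal (- w)) = principal (\<Inter>w\<in>X. - w)" using X(2) by (rule INF_principal_finite)
      then have "\<forall>x\<in>(\<Inter>w\<in>X. - w). x \<notin> ?S" using X(3) by (simp add: eventually_principal)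
      then have "?S \<subseteq> \<Union>X" by blast
      then show False using neg X by blast
    qed
    then obtain U where U: "ultra U" "U \<le> F" using ultra_exists by blast
    have evS: "eventually (\<lambda>\<mu>. \<mu> \<in> ?S) U"
      using U(2) unfolding F_def by (simp add: le_principal)
    obtain D where D: "\<And>\<mu>. \<mu> \<in> ADM \<Longrightarrow> Q \<mu> \<le> 4 * G \<mu> + D" using Q_bound by blast
    have ev: "eventually (\<lambda>\<mu>. \<mu> \<in> ADM) U" using evS by eventually_elim simp
    have evQ: "eventually (\<lambda>\<mu>. Q \<mu> \<le> 4 * Gmin + D) U" using evS by eventually_elim (use D in force)
    \<comment> \<open>Since all solutions have the same two parts, both Cauchy conditions hold with
      distance 0.\<close>
    have self: "sdist \<kappa> M M = 0" if "M \<in> Eplus \<kappa>" for M using sdist_sq[OF that that] by simp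
    have cauchy: "sdist \<kappa> (Rp \<mu>) (Rp \<nu>) = 0 \<and> sdist \<kappa> (Rn \<mu>) (Rn \<nu>) = 0" if "\<mu> \<in> ?S" "\<nu> \<in> ?S" for \<mu> \<nu>
    proof -
      have "Rp \<mu> = Rp \<nu>" "Rn \<mu> = Rn \<nu>" using minimizers_same_parts that by blast+
      moreover have "Rp \<nu> \<in> Eplus \<kappa>" "Rn \<nu> \<in> Eplus \<kappa>" using that by (auto simp: adm_iff VE_iff)
      ultimately show ?thesis using self by simp
    qed
    obtain lam where lam: "lam \<in> ADM" "\<And>i. i \<in> I \<Longrightarrow> vlim U (\<lambda>\<mu>. \<mu> i) (lam i)" "(G \<longlongrightarrow> G lam) U"
    proof (rule admissible_limit[OF U(1) ev evQ])
      show "\<exists>T. eventually T U \<and> (\<forall>\<mu> \<nu>. T \<mu> \<longrightarrow> T \<nu> \<longrightarrow> sdist \<kappa> (Rp \<mu>) (Rp \<nu>) < e)" if "e > 0" for e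
        using evS cauchy that by (intro exI[of _ "\<lambda>\<mu>. \<mu> \<in> ?S"]) simp
      show "\<exists>T. eventually T U \<and> (\<forall>\<mu> \<nu>. T \<mu> \<longrightarrow> T \<nu> \<longrightarrow> sdist \<kappa> (Rn \<mu>) (Rn \<nu>) < e)" if "e > 0" for e
        using evS cauchy that by (intro exI[of _ "\<lambda>\<mu>. \<mu> \<in> ?S"]) simp
    qed blast
    have "eventually (\<lambda>\<mu>. G \<mu> = Gmin) U" using evS by eventually_elim simp
    then have "(G \<longlongrightarrow> Gmin) U" by (rule tendsto_eventually)
    then have "G lam = Gmin" using tendsto_unique[OF ultra_not_bot[OF U(1)] lam(3)] by blast
    then obtain w where w: "w \<in> \<W>" "lam \<in> w" using W lam(1) by blast
    have "eventually (\<lambda>\<mu>. \<mu> \<in> w) U" using W w by (intro vec_vague_eventually[OF lam(2)]) blast+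
    moreover have "U \<le> principal (- w)"
      using U(2) INF_lower[OF w(1), of "\<lambda>w. principal (- w)"] unfolding F_def by (meson inf.boundedE order_trans)
    then have "eventually (\<lambda>\<mu>. \<mu> \<in> - w) U" by (simp add: le_principal)
    ultimately have "eventually (\<lambda>\<mu>. False) U" by eventually_elim simp
    then show False using ultra_not_bot[OF U(1)] by (simp add: trivial_limit_def)
  qed
qed

end

theorem theorem7p1:
  fixes \<kappa> :: "'a::t2_space \<Rightarrow> 'a \<Rightarrow> ennreal"
    and h :: real
    and Ipos Ineg J :: "'i set"
    and A :: "'i \<Rightarrow> 'a set"
    and chi :: "'a measure \<times> 'a measure"
    and g :: "'a \<Rightarrow> real"
    and a :: "'i \<Rightarrow> real"
  assumes X_lc: "locally_compact_space (euclidean :: 'a topology)"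
    and X_noncompact: "\<not> compact (UNIV :: 'a set)"
    \<comment> \<open>kernel\<close>
    and k_lsc: "lsc_kernel \<kappa>"
    and k_sym: "\<And>x y. \<kappa> x y = \<kappa> y x"
    and k_a: "strictly_pos_def \<kappa>"
    and k_b: "consistent \<kappa>"
    and k_c_fin: "\<And>x y. x \<noteq> y \<Longrightarrow> \<kappa> x y < \<top>"
    and k_c_cont: "continuous_on {z::'a\<times>'a. fst z \<noteq> snd z} (\<lambda>z. \<kappa> (fst z) (snd z))"
    and k_d: "\<And>\<epsilon> K. \<epsilon> > 0 \<Longrightarrow> compact K \<Longrightarrow>
                \<exists>K'. compact K' \<and> (\<forall>x\<in>K. \<forall>y. y \<notin> K' \<longrightarrow> \<kappa> x y < ennreal \<epsilon>)"
    and h_ge: "h \<ge> 1"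
    and k_e: "gen_max_principle \<kappa> h"
    \<comment> \<open>condenser\<close>
    and I_disj: "Ipos \<inter> Ineg = {}"
    and I_count: "countable (Ipos \<union> Ineg)"
    and A_ne: "\<And>i. i \<in> Ipos \<union> Ineg \<Longrightarrow> A i \<noteq> {}"
    and A_closed: "\<And>i. i \<in> Ipos \<union> Ineg \<Longrightarrow> closed (A i)"
    and A_locfin: "\<And>K. compact K \<Longrightarrow> finite {i \<in> Ipos \<union> Ineg. A i \<inter> K \<noteq> {}}"
    and A_sep: "\<And>i j. i \<in> Ipos \<Longrightarrow> j \<in> Ineg \<Longrightarrow> A i \<inter> A j = {}"
    and A_kbd: "(SUP z\<in>(\<Union>i\<in>Ipos. A i) \<times> (\<Union>j\<in>Ineg. A j). \<kappa> (fst z) (snd z)) < \<top>"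
    \<comment> \<open>external field\<close>
    and chi_E: "chi \<in> Esigned \<kappa>"
    and chi_bdd: "emeasure (fst chi) UNIV < \<top>" "emeasure (snd chi) UNIV < \<top>"
    and chi_supp: "msupport (fst chi) \<inter> (\<Union>j\<in>Ineg. A j) = {}"
                  "msupport (snd chi) \<inter> (\<Union>i\<in>Ipos. A i) = {}"
    \<comment> \<open>normalization\<close>
    and g_cont: "continuous_on (\<Union>i\<in>Ipos \<union> Ineg. A i) g"
    and g_inf: "\<exists>c>0. \<forall>x\<in>(\<Union>i\<in>Ipos \<union> Ineg. A i). c \<le> g x"
    and g_growth: "\<And>i. i \<in> Ipos \<union> Ineg \<Longrightarrow>
        bounded (g ` A i) \<or>
        (\<exists>r \<nu>. r > 1 \<and> \<nu> \<in> Esigned \<kappa> \<and>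
           (\<exists>N. capacity \<kappa> N = 0 \<and>
              (\<forall>x\<in>A i - N. pot \<kappa> x (snd \<nu>) < \<top> \<and>
                   ennreal (g x powr r) + pot \<kappa> x (snd \<nu>) \<le> pot \<kappa> x (fst \<nu>))))"
    and a_pos: "\<And>i. i \<in> Ipos \<union> Ineg \<Longrightarrow> a i > 0"
    and a_sum: "a summable_on (Ipos \<union> Ineg)"
    and G_fin: "Ginf \<kappa> Ipos Ineg A a g chi (Ipos \<union> Ineg) < \<infinity>"
    \<comment> \<open>the theorem's hypotheses\<close>
    and J_sub: "Ipos \<subseteq> J" "J \<subseteq> Ipos \<union> Ineg"
    and cap_fin: "\<And>j. j \<in> J \<Longrightarrow> capacity \<kappa> (A j) < \<top>"
  shows "(\<exists>lam\<in>adm \<kappa> Ipos Ineg A a g J. ereal (Gchi \<kappa> Ipos Ineg chi lam) = Ginf \<kappa> Ipos Ineg A a g chi J)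
         \<and> compactin (vec_vague (Ipos \<union> Ineg)) (solutions \<kappa> Ipos Ineg A a g chi J)"
proof -
  interpret condenser \<kappa> h Ipos Ineg J A chi g a
  proof unfold_locales
    show "locally_compact_space (euclidean :: 'a topology)" by (rule X_lc)
    show "lsc_kernel \<kappa>" by (rule k_lsc)
    show "\<kappa> x y = \<kappa> y x" for x y by (rule k_sym)
    show "strictly_pos_def \<kappa>" by (rule k_a)
    show "consistent \<kappa>" by (rule k_b)
    show "finite {i \<in> Ipos \<union> Ineg. A i \<inter> K \<noteq> {}}" if "compact K" for K using that by (rule A_locfin)
  qed (fact h_ge k_e I_disj A_closed A_sep A_kbd chi_E g_cont g_inf g_growth a_pos a_sum J_sub cap_fin)+
  \<comment> \<open>Finiteness of the infimum for the full index set makes that class nonempty, and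
    imposing the constraints only on \<open>J\<close> enlarges the class.\<close>
  have "adm \<kappa> Ipos Ineg A a g (Ipos \<union> Ineg) \<noteq> {}"
    using G_fin by (auto simp: Ginf_def top_ereal_def)
  moreover have "adm \<kappa> Ipos Ineg A a g (Ipos \<union> Ineg) \<subseteq> ADM"
    using J_sub(2) by (auto simp: adm_def)
  ultimately have ne: "ADM \<noteq> {}" by blast
  have "solutions \<kappa> Ipos Ineg A a g chi J = {lam\<in>ADM. G lam = Gmin}"
    unfolding solutions_def Ginf_eq[OF ne] by simp
  then show ?thesis
    using minimizer_exists[OF ne] minimizers_compact by (simp add: Ginf_eq[OF ne])
qed

end
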